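(* Let $n\in\{2,3\}$, let $\mathbf z=(\mathbf u,\mathbf w)$ be a Leray solution of the $n$-dimensional micropolar system with data $\mathbf z_0$, and assume that for some $\alpha>0$ and constants $c_0,C_0>0$, $t_0,T_0\ge0$, $$\|\mathbf u(\cdot,t)\|_{L^2}\le C_0\|\mathbf z_0\|_{L^2}t^{-\alpha}\ \ \forall t>T_0,\qquad \|\mathbf u(\cdot,t)\|_{L^2}\ge c_0\|\mathbf z_0\|_{L^2}t^{-\alpha}\ \ \forall t>t_0.$$ Then for each $m\ge1$, $$\|D^m\mathbf u(\cdot,t)\|_{L^2(\mathbb R^n)}\ge\Gamma_m(\alpha,c_0,C_0)\,c_0\,\mu^{-m/2}\|\mathbf z_0\|_{L^2(\mathbb R^n)}\,t^{-\alpha-m/2}\qquad\forall\,t>t_m,$$ where $\Gamma_m(\alpha,c_0,C_0)>0$ depends only on $(m,\alpha,c_0,C_0)$ and $t_m$ depends only on $(m,\alpha,\mu,\nu,\chi,c_0,C_0,t_0,T_0,\|\mathbf z_0\|_{L^2})$.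
   Context: Constants $\mu,\nu,\chi>0$, $\kappa\ge0$. For $n=3$ the micropolar system for $\mathbf u,\mathbf w:\mathbb R^3\times(0,\infty)\to\mathbb R^3$ is $\mathbf u_t+(\mathbf u\cdot\nabla)\mathbf u+\nabla p=(\mu+\chi)\Delta\mathbf u+2\chi\nabla\times\mathbf w$, $\nabla\cdot\mathbf u=0$, $\mathbf w_t+(\mathbf u\cdot\nabla)\mathbf w=\nu\Delta\mathbf w+\kappa\nabla(\nabla\cdot\mathbf w)-4\chi\mathbf w+2\chi\nabla\times\mathbf u$, $\mathbf u(\cdot,0)=\mathbf u_0\in L^2_\sigma$ (divergence-free $L^2$), $\mathbf w(\cdot,0)=\mathbf w_0\in L^2$. For $n=2$, $\mathbf u=(u_1,u_2)$, $\mathrm w$ scalar, same system without the $\kappa$-term, $\nabla\times\mathrm w=(\partial_2\mathrm w,-\partial_1\mathrm w)$, $\nabla\times\mathbf u=\partial_1u_2-\partial_2u_1$. Leray solutions: weakly continuous $L^2_\sigma\times L^2$-valued, $D\mathbf u,D\mathbf w\in L^2(\mathbb R^n\times(0,\infty))$, weak solutions attaining data $\mathbf z_0=(\mathbf u_0,\mathbf w_0)$, with energy inequality $\|\mathbf z(t)\|_{L^2}^2+2\int_s^t(\mu\|D\mathbf u\|^2+\nu\|D\mathbf w\|^2)\le\|\mathbf z(s)\|_{L^2}^2$ ($t>s$, $s=0$ and a.e. $s>0$); they are smooth for large $t$. Norms on $\mathbb R^n$: $\|D^m\mathbf v\|_{L^2}^2=\sum_i\sum_{j_1,\dots,j_m}\int|\partial_{j_1}\cdots\partial_{j_m}v_i|^2$.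 *)

theory Defs
  imports "HOL-Analysis.Analysis"
begin

fun pd :: "'n::finite list \<Rightarrow> (real^'n \<Rightarrow> real) \<Rightarrow> real^'n \<Rightarrow> real" where
  "pd [] f = f"
| "pd (j # js) f = (\<lambda>x. deriv (\<lambda>h. pd js f (x + h *\<^sub>R axis j 1)) 0)"

definition smooth_fn :: "(real^'n::finite \<Rightarrow> real) \<Rightarrow> bool" where
  "smooth_fn f \<longleftrightarrow> (\<forall>js. continuous_on UNIV (pd js f) \<and>
      (\<forall>j x. (\<lambda>h. pd js f (x + h *\<^sub>R axis j 1)) differentiable (at 0)))"

definition test_fun :: "(real^'n::finite \<Rightarrow> real) \<Rightarrow> bool" where
  "test_fun \<phi> \<longleftrightarrow> smooth_fn \<phi> \<and> (\<exists>R. \<forall>x. R < norm x \<longrightarrow> \<phi> x = 0)"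

definition vtest_fun :: "(real^'n::finite \<Rightarrow> real^'k::finite) \<Rightarrow> bool" where
  "vtest_fun \<phi> \<longleftrightarrow> (\<forall>i. test_fun (\<lambda>x. \<phi> x $ i))"

definition sgrad :: "(real^'n::finite \<Rightarrow> real) \<Rightarrow> real^'n \<Rightarrow> real^'n" where
  "sgrad \<psi> x = (\<chi> j. pd [j] \<psi> x)"

definition vgrad :: "(real^'n::finite \<Rightarrow> real^'k::finite) \<Rightarrow> real^'n \<Rightarrow> real^'n^'k" where
  "vgrad \<phi> x = (\<chi> i. \<chi> j. pd [j] (\<lambda>y. \<phi> y $ i) x)"

definition vdiv :: "(real^'n::finite \<Rightarrow> real^'n) \<Rightarrow> real^'n \<Rightarrow> real" where
  "vdiv \<phi> x = (\<Sum>j\<in>UNIV. pd [j] (\<lambda>y. \<phi> y $ j) x)"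

definition L2 :: "('a::euclidean_space \<Rightarrow> 'b::euclidean_space) \<Rightarrow> bool" where
  "L2 f \<longleftrightarrow> f \<in> borel_measurable lebesgue \<and> integrable lebesgue (\<lambda>x. (norm (f x))\<^sup>2)"

definition L2norm :: "('a::euclidean_space \<Rightarrow> 'b::euclidean_space) \<Rightarrow> real" where
  "L2norm f = sqrt (\<integral>x. (norm (f x))\<^sup>2 \<partial>lebesgue)"

definition loc_int :: "(real^'n::finite \<Rightarrow> real) \<Rightarrow> bool" where
  "loc_int f \<longleftrightarrow> f \<in> borel_measurable lebesgue \<and>
     (\<forall>K. compact K \<longrightarrow> set_integrable lebesgue K f)"

definition weak_deriv :: "'n::finite list \<Rightarrow> (real^'n \<Rightarrow> real) \<Rightarrow> (real^'n \<Rightarrow> real) \<Rightarrow> bool" where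
  "weak_deriv js f g \<longleftrightarrow> loc_int f \<and> loc_int g \<and>
     (\<forall>\<phi>. test_fun \<phi> \<longrightarrow>
        (\<integral>x. f x * pd js \<phi> x \<partial>lebesgue) = (-1) ^ length js * (\<integral>x. g x * \<phi> x \<partial>lebesgue))"

definition weak_grad :: "(real^'n::finite \<Rightarrow> real^'k::finite) \<Rightarrow> (real^'n \<Rightarrow> real^'n^'k) \<Rightarrow> bool" where
  "weak_grad v G \<longleftrightarrow> (\<forall>i j. weak_deriv [j] (\<lambda>x. v x $ i) (\<lambda>x. G x $ i $ j))"

definition weak_grad_s :: "(real^'n::finite \<Rightarrow> real) \<Rightarrow> (real^'n \<Rightarrow> real^'n) \<Rightarrow> bool" where
  "weak_grad_s v G \<longleftrightarrow> (\<forall>j. weak_deriv [j] v (\<lambda>x. G x $ j))"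

definition div_free :: "(real^'n::finite \<Rightarrow> real^'n) \<Rightarrow> bool" where
  "div_free v \<longleftrightarrow> (\<forall>\<psi>. test_fun \<psi> \<longrightarrow> (\<integral>x. v x \<bullet> sgrad \<psi> x \<partial>lebesgue) = 0)"

definition Dm_sq :: "nat \<Rightarrow> (real^'n::finite \<Rightarrow> real^'k::finite) \<Rightarrow> ennreal" where
  "Dm_sq m v = (if (\<forall>i (js::'n list). length js = m \<longrightarrow> (\<exists>g. weak_deriv js (\<lambda>x. v x $ i) g))
     then (\<Sum>i\<in>UNIV. \<Sum>js\<in>{js::'n list. length js = m}.
             \<integral>\<^sup>+x. ennreal (((SOME g. weak_deriv js (\<lambda>x. v x $ i) g) x)\<^sup>2) \<partial>lebesgue)
     else \<infinity>)"

definition Dm_norm :: "nat \<Rightarrow> (real^'n::finite \<Rightarrow> real^'k::finite) \<Rightarrow> ereal" where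
  "Dm_norm m v = (if Dm_sq m v = \<infinity> then \<infinity> else ereal (sqrt (enn2real (Dm_sq m v))))"

definition znorm :: "('a::euclidean_space \<Rightarrow> 'b::euclidean_space) \<Rightarrow> ('a \<Rightarrow> 'c::euclidean_space) \<Rightarrow> real" where
  "znorm u0 w0 = sqrt ((L2norm u0)\<^sup>2 + (L2norm w0)\<^sup>2)"

definition sol_data :: "(real^'n::finite \<Rightarrow> real^'n) \<Rightarrow> (real^'n \<Rightarrow> 'w::euclidean_space)
     \<Rightarrow> (real^'n \<Rightarrow> real \<Rightarrow> real^'n) \<Rightarrow> (real^'n \<Rightarrow> real \<Rightarrow> 'w) \<Rightarrow> bool" where
  "sol_data u0 w0 u w \<longleftrightarrow>
     L2 u0 \<and> div_free u0 \<and> L2 w0 \<and>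
     (\<lambda>(x,t). u x t) \<in> borel_measurable lebesgue \<and>
     (\<lambda>(x,t). w x t) \<in> borel_measurable lebesgue \<and>
     (\<forall>t\<ge>0. L2 (\<lambda>x. u x t) \<and> div_free (\<lambda>x. u x t) \<and> L2 (\<lambda>x. w x t)) \<and>
     (\<forall>\<phi>::real^'n \<Rightarrow> real^'n. L2 \<phi> \<longrightarrow>
         continuous_on {0..} (\<lambda>t. \<integral>x. u x t \<bullet> \<phi> x \<partial>lebesgue)) \<and>
     (\<forall>\<phi>::real^'n \<Rightarrow> 'w. L2 \<phi> \<longrightarrow>
         continuous_on {0..} (\<lambda>t. \<integral>x. w x t \<bullet> \<phi> x \<partial>lebesgue)) \<and>
     (AE x in lebesgue. u x 0 = u0 x) \<and> (AE x in lebesgue. w x 0 = w0 x)"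

definition energy_ineq :: "real \<Rightarrow> real \<Rightarrow> (real^'n::finite \<Rightarrow> real \<Rightarrow> real^'n) \<Rightarrow> (real^'n \<Rightarrow> real \<Rightarrow> 'w::euclidean_space)
     \<Rightarrow> (real^'n \<Rightarrow> real \<Rightarrow> real^'n^'n) \<Rightarrow> (real^'n \<Rightarrow> real \<Rightarrow> 'g::euclidean_space) \<Rightarrow> bool" where
  "energy_ineq \<mu> \<nu> u w Gu Gw \<longleftrightarrow>
    (let E = (\<lambda>s t. (L2norm (\<lambda>x. u x t))\<^sup>2 + (L2norm (\<lambda>x. w x t))\<^sup>2
        + 2 * set_lebesgue_integral lebesgue {s..t}
             (\<lambda>\<tau>. \<mu> * (\<integral>x. (norm (Gu x \<tau>))\<^sup>2 \<partial>lebesgue) + \<nu> * (\<integral>x. (norm (Gw x \<tau>))\<^sup>2 \<partial>lebesgue))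
        \<le> (L2norm (\<lambda>x. u x s))\<^sup>2 + (L2norm (\<lambda>x. w x s))\<^sup>2)
     in (\<forall>t>0. E 0 t) \<and> (AE s in lebesgue. s > 0 \<longrightarrow> (\<forall>t>s. E s t)))"

definition grads_ok :: "(real^'n::finite \<Rightarrow> real \<Rightarrow> real^'n) \<Rightarrow> (real^'n \<Rightarrow> real \<Rightarrow> real^'n^'n)
     \<Rightarrow> (real^'n \<Rightarrow> real \<Rightarrow> 'g::euclidean_space) \<Rightarrow> bool" where
  "grads_ok u Gu Gw \<longleftrightarrow>
     (AE s in lebesgue. s > 0 \<longrightarrow> weak_grad (\<lambda>x. u x s) (\<lambda>x. Gu x s)) \<and>
     (\<lambda>(x,s). Gu x s) \<in> borel_measurable lebesgue \<and>
     (\<lambda>(x,s). Gw x s) \<in> borel_measurable lebesgue \<and>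
     set_integrable lebesgue {p :: (real^'n) \<times> real. snd p > 0} (\<lambda>(x,s). (norm (Gu x s))\<^sup>2) \<and>
     set_integrable lebesgue {p :: (real^'n) \<times> real. snd p > 0} (\<lambda>(x,s). (norm (Gw x s))\<^sup>2)"

text \<open>curl from the Jacobian G (G $ i $ j = d_j w_i)\<close>
definition curl3 :: "real^3^3 \<Rightarrow> real^3" where
  "curl3 G = vector [G$3$2 - G$2$3, G$1$3 - G$3$1, G$2$1 - G$1$2]"

definition leray3 :: "real \<Rightarrow> real \<Rightarrow> real \<Rightarrow> real \<Rightarrow> (real^3 \<Rightarrow> real^3) \<Rightarrow> (real^3 \<Rightarrow> real^3)
     \<Rightarrow> (real^3 \<Rightarrow> real \<Rightarrow> real^3) \<Rightarrow> (real^3 \<Rightarrow> real \<Rightarrow> real^3) \<Rightarrow> bool" where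
  "leray3 \<mu> \<nu> chi \<kappa> u0 w0 u w \<longleftrightarrow> sol_data u0 w0 u w \<and>
    (\<exists>Gu Gw. grads_ok u Gu Gw \<and>
       (AE s in lebesgue. s > 0 \<longrightarrow> weak_grad (\<lambda>x. w x s) (\<lambda>x. Gw x s)) \<and>
       (\<forall>\<phi> t. vtest_fun \<phi> \<and> (\<forall>x. vdiv \<phi> x = 0) \<and> t \<ge> 0 \<longrightarrow>
          (\<integral>x. u x t \<bullet> \<phi> x \<partial>lebesgue) - (\<integral>x. u0 x \<bullet> \<phi> x \<partial>lebesgue)
          + set_lebesgue_integral lebesgue {0..t} (\<lambda>s. \<integral>x.
               (\<mu> + chi) * (Gu x s \<bullet> vgrad \<phi> x) + (Gu x s *v u x s) \<bullet> \<phi> x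
               - 2 * chi * (curl3 (Gw x s) \<bullet> \<phi> x) \<partial>lebesgue) = 0) \<and>
       (\<forall>\<psi> t. vtest_fun \<psi> \<and> t \<ge> 0 \<longrightarrow>
          (\<integral>x. w x t \<bullet> \<psi> x \<partial>lebesgue) - (\<integral>x. w0 x \<bullet> \<psi> x \<partial>lebesgue)
          + set_lebesgue_integral lebesgue {0..t} (\<lambda>s. \<integral>x.
               \<nu> * (Gw x s \<bullet> vgrad \<psi> x) + \<kappa> * (\<Sum>i\<in>UNIV. Gw x s $ i $ i) * vdiv \<psi> x
               + (Gw x s *v u x s) \<bullet> \<psi> x + 4 * chi * (w x s \<bullet> \<psi> x)
               - 2 * chi * (curl3 (Gu x s) \<bullet> \<psi> x) \<partial>lebesgue) = 0) \<and>
       energy_ineq \<mu> \<nu> u w Gu Gw)"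

text \<open>curl of scalar w from its gradient g: (d_2 w, - d_1 w); curl of u: d_1 u_2 - d_2 u_1\<close>
definition curl2s :: "real^2 \<Rightarrow> real^2" where
  "curl2s g = vector [g$2, - (g$1)]"

definition curl2v :: "real^2^2 \<Rightarrow> real" where
  "curl2v G = G$2$1 - G$1$2"

definition leray2 :: "real \<Rightarrow> real \<Rightarrow> real \<Rightarrow> (real^2 \<Rightarrow> real^2) \<Rightarrow> (real^2 \<Rightarrow> real)
     \<Rightarrow> (real^2 \<Rightarrow> real \<Rightarrow> real^2) \<Rightarrow> (real^2 \<Rightarrow> real \<Rightarrow> real) \<Rightarrow> bool" where
  "leray2 \<mu> \<nu> chi u0 w0 u w \<longleftrightarrow> sol_data u0 w0 u w \<and>
    (\<exists>Gu Gw. grads_ok u Gu Gw \<and>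
       (AE s in lebesgue. s > 0 \<longrightarrow> weak_grad_s (\<lambda>x. w x s) (\<lambda>x. Gw x s)) \<and>
       (\<forall>\<phi> t. vtest_fun \<phi> \<and> (\<forall>x. vdiv \<phi> x = 0) \<and> t \<ge> 0 \<longrightarrow>
          (\<integral>x. u x t \<bullet> \<phi> x \<partial>lebesgue) - (\<integral>x. u0 x \<bullet> \<phi> x \<partial>lebesgue)
          + set_lebesgue_integral lebesgue {0..t} (\<lambda>s. \<integral>x.
               (\<mu> + chi) * (Gu x s \<bullet> vgrad \<phi> x) + (Gu x s *v u x s) \<bullet> \<phi> x
               - 2 * chi * (curl2s (Gw x s) \<bullet> \<phi> x) \<partial>lebesgue) = 0) \<and>
       (\<forall>\<psi> t. test_fun \<psi> \<and> t \<ge> 0 \<longrightarrow>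
          (\<integral>x. w x t * \<psi> x \<partial>lebesgue) - (\<integral>x. w0 x * \<psi> x \<partial>lebesgue)
          + set_lebesgue_integral lebesgue {0..t} (\<lambda>s. \<integral>x.
               \<nu> * (Gw x s \<bullet> sgrad \<psi> x)
               + (Gw x s \<bullet> u x s) * \<psi> x + 4 * chi * (w x s * \<psi> x)
               - 2 * chi * (curl2v (Gu x s) * \<psi> x) \<partial>lebesgue) = 0) \<and>
       energy_ineq \<mu> \<nu> u w Gu Gw)"

end

(*
Suppose that at a large time t the norm of D^m u(t) is much smaller than |u(t)| (mu t)^(-m/2).
Then u(t) lives essentially at wave numbers below (mu t)^(-1/2), so that replacing u(t) by its
convolution with a kernel of width l = A sqrt(mu t) changes it little, and the pairing of u(t) with a
smooth, compactly supported, divergence-free approximation phi of this convolution is at least a fixed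
fraction of |u(t)|^2.  Follow the pairing of u(s) with phi from s = t to s = M t.  Adding half of the
pairing of w with curl phi cancels the coupling terms: the drift chi <u, Lap phi> + 2 chi <w, curl phi>
of the first equation is compensated by -2 chi <w, curl phi> - chi <u, Lap phi> from the second.
What remains is mu <u, Lap phi> together with quadratic terms, of lower order in t because phi has
scale l, and pairings of w with curls of iterated Laplacians of phi.  The term -4 chi w makes each
such pairing inherit the decay of the next one and of u, so finitely many iterations show that they
decay faster than u.  Hence |u(M t)| is at least a fixed fraction of |u(t)| for A large, which
contradicts |u(M t)| <= C0 |z0| (M t)^(-alpha) once M is large.
*)

theory Submission
  imports Defs "HOL-Computational_Algebra.Polynomial" "HOL-Real_Asymp.Real_Asymp"
begin

section \<open>Square integrable functions\<close>

text \<open>Everything happens in physical space and by duality: D^m u(t) enters only through its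
  pairings with test functions, that is, through the integrals of u(t) against D^m \<theta>. The
  obstacle is the test field. The momentum equation may be tested only with compactly supported
  solenoidal fields; a mollification of u(t) is solenoidal but not compactly supported, and a
  cut-off destroys the divergence constraint. The order in which the constants are fixed yields the
  claimed dependence: the kernel is determined by m, the number of Laplacians by \<alpha>, and then
  M, A and \<Gamma> follow in this order. Relative to the size of u, the viscous term is of order M
  t \<mu> / l^2 = M / A^2 for the length scale l, so \<mu> cancels; besides the end point M t it is
  the only term that does not vanish as t grows. The parameters \<nu> and \<xi>, and the norm of the
  data beyond a common factor, occur only in terms of lower order and hence affect the threshold
  alone. The iteration over Laplacians stops after about \<alpha> + 1 steps, because then even the
  crude bound for the last pairing decays faster than required.\<close>

definition sqint :: "('a::euclidean_space \<Rightarrow> real) \<Rightarrow> bool" where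
  "sqint f \<longleftrightarrow> f \<in> borel_measurable borel \<and> integrable lborel (\<lambda>x. (f x)\<^sup>2)"

definition n2 :: "('a::euclidean_space \<Rightarrow> real) \<Rightarrow> real" where
  "n2 f = sqrt (\<integral>x. (f x)\<^sup>2 \<partial>lborel)"

lemma sqint_meas[measurable_dest]: "sqint f \<Longrightarrow> f \<in> borel_measurable borel"
  by (simp add: sqint_def)

lemma n2_nonneg[simp]: "0 \<le> n2 f"
  by (simp add: n2_def)

lemma n2_sq: "(n2 f)\<^sup>2 = (\<integral>x. (f x)\<^sup>2 \<partial>lborel)"
  by (simp add: n2_def)

lemma sqint_mult_integrable:
  assumes "sqint f" "sqint g" shows "integrable lborel (\<lambda>x. f x * g x)"
proof (rule Bochner_Integration.integrable_bound)
  show "integrable lborel (\<lambda>x. (f x)\<^sup>2 + (g x)\<^sup>2)" using assms by (auto simp: sqint_def)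
  show "(\<lambda>x. f x * g x) \<in> borel_measurable lborel" using assms by (auto simp: sqint_def)
  have "\<bar>a * b\<bar> \<le> a\<^sup>2 + b\<^sup>2" for a b :: real
  proof -
    have "0 \<le> \<bar>a\<bar> * \<bar>b\<bar>" by simp
    moreover have "2 * \<bar>a\<bar> * \<bar>b\<bar> \<le> a\<^sup>2 + b\<^sup>2" using sum_squares_bound[of "\<bar>a\<bar>" "\<bar>b\<bar>"] by simp
    ultimately show ?thesis unfolding abs_mult by linarith
  qed
  then show "AE x in lborel. norm (f x * g x) \<le> norm ((f x)\<^sup>2 + (g x)\<^sup>2)" by auto
qed

text \<open>The integral of (s f + r g)^2 is a nonnegative quadratic form in (s, r); its value at s
  = c, r = -b is c (a c - b^2).\<close>

lemma sqint_cauchy_schwarz: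
  assumes "sqint f" "sqint g" shows "\<bar>\<integral>x. f x * g x \<partial>lborel\<bar> \<le> n2 f * n2 g"
proof -
  define a b c where "a = (\<integral>x. (f x)\<^sup>2 \<partial>lborel)" and "b = (\<integral>x. f x * g x \<partial>lborel)" and "c = (\<integral>x. (g x)\<^sup>2 \<partial>lborel)"
  note i = sqint_mult_integrable[OF assms]
  have f: "integrable lborel (\<lambda>x. (f x)\<^sup>2)" and g: "integrable lborel (\<lambda>x. (g x)\<^sup>2)"
    using assms by (auto simp: sqint_def)
  have q: "0 \<le> s\<^sup>2 * a + 2 * s * r * b + r\<^sup>2 * c" for s r
  proof -
    have "0 \<le> (\<integral>x. (s * f x + r * g x)\<^sup>2 \<partial>lborel)" by simp
    also have "(\<lambda>x. (s * f x + r * g x)\<^sup>2) = (\<lambda>x. s\<^sup>2 * (f x)\<^sup>2 + 2 * s * r * (f x * g x) + r\<^sup>2 * (g x)\<^sup>2)"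
      by (auto simp: power2_eq_square algebra_simps)
    also have "(\<integral>x. s\<^sup>2 * (f x)\<^sup>2 + 2 * s * r * (f x * g x) + r\<^sup>2 * (g x)\<^sup>2 \<partial>lborel) = s\<^sup>2 * a + 2 * s * r * b + r\<^sup>2 * c"
      unfolding a_def b_def c_def using i f g by simp
    finally show ?thesis .
  qed
  have c0: "c \<ge> 0" by (auto simp: c_def)
  have "b\<^sup>2 \<le> a * c"
  proof (cases "c = 0")
    case True
    \<comment> \<open>For c = 0 and s = 1 the form is affine in r, so b \<noteq> 0 would make it
      negative somewhere; the r chosen here gives the value -1.\<close>
    have "b = 0"
    proof (rule ccontr)
      assume "b \<noteq> 0"
      have "0 \<le> a + 2 * (- (a+1) / (2*b)) * b" using q[of 1 "- (a+1) / (2*b)"] True by simp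
      moreover have "2 * (- (a+1) / (2*b)) * b = - (a+1)" using \<open>b \<noteq> 0\<close> by simp
      ultimately show False by linarith
    qed
    with True show ?thesis by simp
  next
    case False
    have "0 \<le> c * (c * a - b\<^sup>2)" using q[of c "-b"] by (simp add: power2_eq_square algebra_simps)
    with False c0 show ?thesis by (simp add: zero_le_mult_iff mult.commute)
  qed
  then have "sqrt (b\<^sup>2) \<le> sqrt (a * c)" by (rule real_sqrt_le_mono)
  then show ?thesis by (simp add: a_def b_def c_def n2_def real_sqrt_mult)
qed

lemma sqint_add: assumes "sqint f" "sqint g" shows "sqint (\<lambda>x. f x + g x)"
proof -
  have "(\<lambda>x. (f x + g x)\<^sup>2) = (\<lambda>x. (f x)\<^sup>2 + 2 * (f x * g x) + (g x)\<^sup>2)"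
    by (auto simp: power2_eq_square algebra_simps)
  then show ?thesis using assms sqint_mult_integrable[OF assms] by (auto simp: sqint_def)
qed

lemma sqint_cmult: assumes "sqint f" shows "sqint (\<lambda>x. c * f x)"
  using assms by (auto simp: sqint_def power_mult_distrib)

lemma sqint_diff: assumes "sqint f" "sqint g" shows "sqint (\<lambda>x. f x - g x)"
  using sqint_add[OF assms(1) sqint_cmult[OF assms(2), of "-1"]] by simp

lemma sqint_zero[simp]: "sqint (\<lambda>x. 0)" by (simp add: sqint_def)

lemma sqint_sum: "(\<And>i. i \<in> I \<Longrightarrow> sqint (f i)) \<Longrightarrow> sqint (\<lambda>x. \<Sum>i\<in>I. f i x)"
  by (induction I rule: infinite_finite_induct) (auto intro: sqint_add)

lemma n2_cmult: "n2 (\<lambda>x. c * f x) = \<bar>c\<bar> * n2 f"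
  by (simp add: n2_def power_mult_distrib real_sqrt_mult)

lemma n2_zero[simp]: "n2 (\<lambda>x. 0) = 0" by (simp add: n2_def)

lemma n2_add: assumes "sqint f" "sqint g" shows "n2 (\<lambda>x. f x + g x) \<le> n2 f + n2 g"
proof -
  have e: "(\<lambda>x. (f x + g x)\<^sup>2) = (\<lambda>x. (f x)\<^sup>2 + 2 * (f x * g x) + (g x)\<^sup>2)"
    by (auto simp: power2_eq_square algebra_simps)
  have "(n2 (\<lambda>x. f x + g x))\<^sup>2 = (n2 f)\<^sup>2 + 2 * (\<integral>x. f x * g x \<partial>lborel) + (n2 g)\<^sup>2"
    unfolding n2_sq e using assms sqint_mult_integrable[OF assms] by (simp add: sqint_def)
  also have "\<dots> \<le> (n2 f + n2 g)\<^sup>2"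
    using sqint_cauchy_schwarz[OF assms] by (simp add: power2_sum)
  finally show ?thesis by (rule power2_le_imp_le) simp
qed

lemma n2_diff: assumes "sqint f" "sqint g" shows "n2 (\<lambda>x. f x - g x) \<le> n2 f + n2 g"
  using n2_add[OF assms(1) sqint_cmult[OF assms(2), of "-1"]] n2_cmult[of "-1" g] by simp

lemma n2_sum: "(\<And>i. i \<in> I \<Longrightarrow> sqint (f i)) \<Longrightarrow> n2 (\<lambda>x. \<Sum>i\<in>I. f i x) \<le> (\<Sum>i\<in>I. n2 (f i))"
proof (induction I rule: infinite_finite_induct)
  case (insert i I)
  then have "n2 (\<lambda>x. f i x + (\<Sum>i\<in>I. f i x)) \<le> n2 (f i) + n2 (\<lambda>x. \<Sum>i\<in>I. f i x)"
    by (intro n2_add sqint_sum) auto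
  with insert show ?case by (auto intro: order_trans)
qed auto

lemma n2_mono:
  assumes "sqint g" "\<And>x. \<bar>f x\<bar> \<le> \<bar>g x\<bar>" shows "n2 f \<le> n2 g"
  unfolding n2_def
proof (rule real_sqrt_le_mono, rule integral_mono')
  show "integrable lborel (\<lambda>x. (g x)\<^sup>2)" using assms by (simp add: sqint_def)
  show "(f x)\<^sup>2 \<le> (g x)\<^sup>2" for x using assms(2)[of x] by (simp add: abs_le_square_iff)
qed auto

lemma sqint_bound:
  assumes "sqint g" "f \<in> borel_measurable borel" "\<And>x. \<bar>f x\<bar> \<le> \<bar>g x\<bar>" shows "sqint f"
  unfolding sqint_def
proof (intro conjI)
  show "integrable lborel (\<lambda>x. (f x)\<^sup>2)"
  proof (rule Bochner_Integration.integrable_bound)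
    show "integrable lborel (\<lambda>x. (g x)\<^sup>2)" using assms by (simp add: sqint_def)
    show "AE x in lborel. norm ((f x)\<^sup>2) \<le> norm ((g x)\<^sup>2)" using assms(3) by (auto simp: abs_le_square_iff)
  qed (use assms in auto)
qed (use assms in auto)

section \<open>Translations, reflections and truncations\<close>

lemma lborel_integral_shift:
  fixes f :: "'a::euclidean_space \<Rightarrow> real"
  assumes [measurable]: "f \<in> borel_measurable borel"
  shows "(\<integral>x. f (x + a) \<partial>lborel) = (\<integral>x. f x \<partial>lborel)"
proof -
  have "(\<integral>x. f x \<partial>lborel) = (\<integral>x. f x \<partial>(distr lborel borel (\<lambda>x. a + x)))"
    by (simp add: lborel_distr_plus)
  also have "\<dots> = (\<integral>x. f (a + x) \<partial>lborel)" by (rule integral_distr) auto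
  finally show ?thesis by (simp add: add.commute)
qed

lemma lborel_integrable_shift:
  fixes f :: "'a::euclidean_space \<Rightarrow> real"
  assumes [measurable]: "f \<in> borel_measurable borel" and "integrable lborel f"
  shows "integrable lborel (\<lambda>x. f (x + a))"
proof -
  have "integrable (distr lborel borel (\<lambda>x. a + x)) f" using assms(2) by (simp add: lborel_distr_plus)
  then have "integrable lborel (\<lambda>x. f (a + x))" by (subst (asm) integrable_distr_eq) auto
  then show ?thesis by (simp add: add.commute)
qed

lemma sqint_shift: assumes "sqint f" shows "sqint (\<lambda>x. f (x + a))"
  using assms lborel_integrable_shift[of "\<lambda>x. (f x)\<^sup>2" a] by (auto simp: sqint_def)

lemma n2_shift: assumes "f \<in> borel_measurable borel" shows "n2 (\<lambda>x. f (x + a)) = n2 f"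
  using assms lborel_integral_shift[of "\<lambda>x. (f x)\<^sup>2" a] by (auto simp: n2_def)

lemma lborel_integral_reflect:
  fixes f :: "'a::euclidean_space \<Rightarrow> real"
  assumes [measurable]: "f \<in> borel_measurable borel"
  shows "(\<integral>x. f (a - x) \<partial>lborel) = (\<integral>x. f x \<partial>lborel)"
proof -
  have e: "(lborel :: 'a measure) = distr lborel borel (\<lambda>x. a + (-1) *\<^sub>R x)"
    using lborel_affine[of "-1" a] by (simp add: density_1)
  have "(\<integral>x. f x \<partial>lborel) = (\<integral>x. f x \<partial>(distr lborel borel (\<lambda>x. a + (-1) *\<^sub>R x)))"
    using e by simp
  also have "\<dots> = (\<integral>x. f (a + (-1) *\<^sub>R x) \<partial>lborel)" by (rule integral_distr) auto
  finally show ?thesis by simp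
qed

lemma lborel_integrable_reflect:
  fixes f :: "'a::euclidean_space \<Rightarrow> real"
  assumes [measurable]: "f \<in> borel_measurable borel" and "integrable lborel f"
  shows "integrable lborel (\<lambda>x. f (a - x))"
proof -
  have e: "(lborel :: 'a measure) = distr lborel borel (\<lambda>x. a + (-1) *\<^sub>R x)"
    using lborel_affine[of "-1" a] by (simp add: density_1)
  have "integrable (distr lborel borel (\<lambda>x. a + (-1) *\<^sub>R x)) f" using assms(2) e by simp
  then have "integrable lborel (\<lambda>x. f (a + (-1) *\<^sub>R x))" by (subst (asm) integrable_distr_eq) auto
  then show ?thesis by simp
qed

lemma bounded_support_sqint:
  fixes f :: "'a::euclidean_space \<Rightarrow> real"
  assumes [measurable]: "f \<in> borel_measurable borel" and b: "\<And>x. \<bar>f x\<bar> \<le> B" and s: "\<And>x. R < norm x \<Longrightarrow> f x = 0"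
  shows "sqint f" "integrable lborel f"
proof -
  have i: "integrable lborel (\<lambda>x::'a. c * indicator (cball 0 R) x :: real)" for c :: real
    using emeasure_lborel_cball_finite[of "0::'a" R] by (intro integrable_mult_right integrable_real_indicator) auto
  show "integrable lborel f"
  proof (rule Bochner_Integration.integrable_bound[OF i[of "\<bar>B\<bar>"]])
    show "AE x in lborel. norm (f x) \<le> norm (\<bar>B\<bar> * indicator (cball 0 R) x :: real)"
    proof (rule AE_I2)
      fix x
      have "\<bar>f x\<bar> \<le> \<bar>B\<bar>" using b[of x] by linarith
      then show "norm (f x) \<le> norm (\<bar>B\<bar> * indicator (cball 0 R) x :: real)"
        using s[of x] by (cases "norm x \<le> R") auto
    qed
  qed simp
  show "sqint f" unfolding sqint_def
  proof (intro conjI Bochner_Integration.integrable_bound[OF i[of "B\<^sup>2"]])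
    show "AE x in lborel. norm ((f x)\<^sup>2) \<le> norm (B\<^sup>2 * indicator (cball 0 R) x :: real)"
    proof (rule AE_I2)
      fix x
      have "\<bar>f x\<bar> \<le> \<bar>B\<bar>" using b[of x] by linarith
      then have "(f x)\<^sup>2 \<le> B\<^sup>2" by (simp add: abs_le_square_iff)
      then show "norm ((f x)\<^sup>2) \<le> norm (B\<^sup>2 * indicator (cball 0 R) x :: real)"
        using s[of x] by (cases "norm x \<le> R") auto
    qed
  qed simp_all
qed

lemma sqint_indicator_ball:
  fixes f :: "'a::euclidean_space \<Rightarrow> real"
  assumes "sqint f"
  shows "sqint (\<lambda>x. indicator (cball 0 R) x * f x)" "integrable lborel (\<lambda>x. indicator (cball 0 R) x * f x)"
proof -
  have b: "sqint (\<lambda>x::'a. indicator (cball 0 R) x :: real)"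
    by (rule bounded_support_sqint[where B=1 and R=R]) (auto simp: indicator_def)
  have [measurable]: "f \<in> borel_measurable borel" using assms by (simp add: sqint_def)
  show "sqint (\<lambda>x. indicator (cball 0 R) x * f x)"
    by (rule sqint_bound[OF assms]) (auto simp: indicator_def)
  show "integrable lborel (\<lambda>x. indicator (cball 0 R) x * f x)"
    by (rule sqint_mult_integrable[OF b assms])
qed

text \<open>At each point the truncation agrees with f from some radius on, and f^2 dominates the
  squared difference.\<close>

lemma sqint_tail:
  fixes f :: "'a::euclidean_space \<Rightarrow> real"
  assumes "sqint f"
  shows "((\<lambda>n. n2 (\<lambda>x. f x - indicator (cball 0 (real n)) x * f x)) \<longlongrightarrow> 0) sequentially"
proof -
  have [measurable]: "f \<in> borel_measurable borel" using assms by (simp add: sqint_def)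
  have "(\<lambda>n. \<integral>x. (f x - indicator (cball 0 (real n)) x * f x)\<^sup>2 \<partial>lborel) \<longlonglongrightarrow> (\<integral>x. 0 \<partial>(lborel::'a measure))"
  proof (rule integral_dominated_convergence[where w="\<lambda>x. (f x)\<^sup>2"])
    show "integrable lborel (\<lambda>x. (f x)\<^sup>2)" using assms by (simp add: sqint_def)
    show "AE x in lborel. (\<lambda>n. (f x - indicator (cball 0 (real n)) x * f x)\<^sup>2) \<longlonglongrightarrow> 0"
    proof (intro AE_I2 tendsto_eventually)
      fix x :: 'a
      obtain k where "norm x \<le> real k" using real_arch_simple by blast
      then show "\<forall>\<^sub>F n in sequentially. (f x - indicator (cball 0 (real n)) x * f x)\<^sup>2 = 0"
        by (intro eventually_sequentiallyI[of k]) (auto simp: indicator_def)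
    qed
    show "AE x in lborel. norm ((f x - indicator (cball 0 (real n)) x * f x)\<^sup>2) \<le> (f x)\<^sup>2" for n
      by (auto simp: indicator_def)
    show "(\<lambda>x. (f x - indicator (cball 0 (real n)) x * f x)\<^sup>2) \<in> borel_measurable lborel" for n
      by (auto intro!: borel_measurable_power borel_measurable_diff borel_measurable_times borel_measurable_indicator)
  qed simp
  then have "(\<lambda>n. sqrt (\<integral>x. (f x - indicator (cball 0 (real n)) x * f x)\<^sup>2 \<partial>lborel)) \<longlonglongrightarrow> sqrt 0"
    by (intro tendsto_real_sqrt) simp
  then show ?thesis by (simp add: n2_def)
qed

text \<open>Up to small errors in L2 both functions live in a common ball, and a translation by more
  than its diameter makes the truncated supports disjoint. This is what later makes the far copy of
  a test field invisible to u.\<close>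

lemma pairing_shift_tendsto_0:
  fixes p q :: "'a::euclidean_space \<Rightarrow> real"
  assumes p: "sqint p" and q: "sqint q" and e: "norm e = 1" and d: "\<delta> > 0"
  shows "\<exists>L\<^sub>0. \<forall>L\<ge>L\<^sub>0. \<bar>\<integral>x. p x * q (x - L *\<^sub>R e) \<partial>lborel\<bar> \<le> \<delta>"
proof -
  \<comment> \<open>The summand 1 keeps \<open>B\<close> positive; with \<open>\<epsilon>\<close> as
    below each of the two truncation errors costs at most \<open>\<delta> / 2\<close>.\<close>
  define B where "B = n2 p + n2 q + 1"
  have B: "B > 0" by (simp add: B_def add_nonneg_pos)
  define \<epsilon> where "\<epsilon> = \<delta> / (2 * B)"
  have e0: "\<epsilon> > 0" using d B by (simp add: \<epsilon>_def)
  have "\<forall>\<^sub>F n in sequentially. n2 (\<lambda>x. p x - indicator (cball 0 (real n)) x * p x) < \<epsilon>"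
       "\<forall>\<^sub>F n in sequentially. n2 (\<lambda>x. q x - indicator (cball 0 (real n)) x * q x) < \<epsilon>"
    using order_tendstoD(2)[OF sqint_tail[OF p] e0] order_tendstoD(2)[OF sqint_tail[OF q] e0] by auto
  then have "\<forall>\<^sub>F n in sequentially. n2 (\<lambda>x. p x - indicator (cball 0 (real n)) x * p x) < \<epsilon> \<and>
       n2 (\<lambda>x. q x - indicator (cball 0 (real n)) x * q x) < \<epsilon>" by eventually_elim auto
  then obtain n where n: "n2 (\<lambda>x. p x - indicator (cball 0 (real n)) x * p x) < \<epsilon>"
       "n2 (\<lambda>x. q x - indicator (cball 0 (real n)) x * q x) < \<epsilon>"
    by (auto simp: eventually_sequentially)
  let ?p = "\<lambda>x. indicator (cball 0 (real n)) x * p x" and ?q = "\<lambda>x. indicator (cball 0 (real n)) x * q x"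
  have "\<bar>\<integral>x. p x * q (x - L *\<^sub>R e) \<partial>lborel\<bar> \<le> \<delta>" if "L \<ge> 2 * real n + 1" for L
  proof -
    let ?s = "- (L *\<^sub>R e)"
    note sp = sqint_indicator_ball(1)[OF p, of n] and sq = sqint_indicator_ball(1)[OF q, of n]
    note sqs = sqint_shift[OF sq, of ?s] and qs = sqint_shift[OF q, of ?s]
    have qd: "sqint (\<lambda>x. q x - ?q x)" and pd: "sqint (\<lambda>x. p x - ?p x)" by (intro sqint_diff p q sp sq)+
    note qds = sqint_shift[OF qd, of ?s]
    have disj: "?p x * ?q (x + ?s) = 0" for x
    proof -
      have "\<not> (norm x \<le> n \<and> norm (x + ?s) \<le> n)"
      proof
        assume "norm x \<le> n \<and> norm (x + ?s) \<le> n"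
        moreover have "L \<le> norm (L *\<^sub>R e)" using e by simp
        moreover have "norm (L *\<^sub>R e) \<le> norm x + norm (x + ?s)" using norm_triangle_ineq4[of x "x + ?s"] by simp
        ultimately show False using that by linarith
      qed
      then show ?thesis by (auto simp: indicator_def)
    qed
    have "(\<lambda>x. p x * q (x + ?s)) = (\<lambda>x. (p x - ?p x) * q (x + ?s) + ?p x * (q (x + ?s) - ?q (x + ?s)))"
    proof
      fix x show "p x * q (x + ?s) = (p x - ?p x) * q (x + ?s) + ?p x * (q (x + ?s) - ?q (x + ?s))"
        using disj[of x] by (simp add: algebra_simps)
    qed
    then have "(\<integral>x. p x * q (x + ?s) \<partial>lborel) = (\<integral>x. (p x - ?p x) * q (x + ?s) \<partial>lborel) + (\<integral>x. ?p x * (q (x + ?s) - ?q (x + ?s)) \<partial>lborel)"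
      by (simp only:) (intro Bochner_Integration.integral_add sqint_mult_integrable pd qs sp qds)
    moreover have "\<bar>\<integral>x. (p x - ?p x) * q (x + ?s) \<partial>lborel\<bar> \<le> n2 (\<lambda>x. p x - ?p x) * n2 (\<lambda>x. q (x + ?s))"
      by (rule sqint_cauchy_schwarz[OF pd qs])
    moreover have "n2 (\<lambda>x. p x - ?p x) * n2 (\<lambda>x. q (x + ?s)) \<le> \<epsilon> * B"
      using n(1) n2_shift[OF sqint_meas[OF q], of ?s] e0 by (intro mult_mono) (auto simp: B_def intro: add_nonneg_nonneg)
    moreover have "\<bar>\<integral>x. ?p x * (q (x + ?s) - ?q (x + ?s)) \<partial>lborel\<bar> \<le> n2 ?p * n2 (\<lambda>x. q (x + ?s) - ?q (x + ?s))"
      by (rule sqint_cauchy_schwarz[OF sp qds])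
    moreover have "n2 ?p * n2 (\<lambda>x. q (x + ?s) - ?q (x + ?s)) \<le> B * \<epsilon>"
    proof (rule mult_mono)
      have "n2 ?p \<le> n2 p" by (rule n2_mono[OF p]) (auto simp: indicator_def)
      then show "n2 ?p \<le> B" by (simp add: B_def add_increasing2)
      show "n2 (\<lambda>x. q (x + ?s) - ?q (x + ?s)) \<le> \<epsilon>"
        using n2_shift[OF sqint_meas[OF qd], of ?s] n(2) by simp
    qed (use B in auto)
    moreover have "\<epsilon> * B + B * \<epsilon> = \<delta>" using B by (simp add: \<epsilon>_def)
    ultimately have "\<bar>\<integral>x. p x * q (x + ?s) \<partial>lborel\<bar> \<le> \<delta>" by linarith
    then show ?thesis by simp
  qed
  then show ?thesis by blast
qed

section \<open>Iterated partial derivatives and test functions\<close>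

lemma pd_append: "pd js (pd ks f) = pd (js @ ks) f"
  by (induction js) auto

lemma smooth_fn_continuous: "smooth_fn f \<Longrightarrow> continuous_on UNIV (pd js f)"
  by (simp add: smooth_fn_def)

lemma smooth_fn_deriv0:
  assumes "smooth_fn f"
  shows "((\<lambda>h. pd js f (x + h *\<^sub>R axis j 1)) has_real_derivative pd (j # js) f x) (at 0)"
proof -
  have "(\<lambda>h. pd js f (x + h *\<^sub>R axis j 1)) differentiable (at 0)" using assms by (auto simp: smooth_fn_def)
  then have "DERIV (\<lambda>h. pd js f (x + h *\<^sub>R axis j 1)) 0 :> deriv (\<lambda>h. pd js f (x + h *\<^sub>R axis j 1)) 0"
    by (simp add: real_differentiable_def DERIV_deriv_iff_real_differentiable)
  then show ?thesis by simp
qed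

lemma smooth_fn_deriv:
  assumes "smooth_fn f"
  shows "((\<lambda>h. pd js f (x + h *\<^sub>R axis j 1)) has_real_derivative pd (j # js) f (x + s *\<^sub>R axis j 1)) (at s)"
proof -
  have "((\<lambda>h. pd js f ((x + s *\<^sub>R axis j 1) + (h - s) *\<^sub>R axis j 1)) has_real_derivative
      pd (j # js) f (x + s *\<^sub>R axis j 1) * 1) (at s)"
    by (rule DERIV_chain2[where f="\<lambda>h. pd js f ((x + s *\<^sub>R axis j 1) + h *\<^sub>R axis j 1)" and g="\<lambda>h. h - s"])
       (use smooth_fn_deriv0[OF assms, of js "x + s *\<^sub>R axis j 1" j] in \<open>auto intro!: derivative_eq_intros\<close>)
  moreover have "(x + s *\<^sub>R axis j 1) + (h - s) *\<^sub>R axis j 1 = x + h *\<^sub>R axis j 1" for h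
    by (simp add: algebra_simps)
  ultimately show ?thesis by simp
qed

lemma smooth_fn_pd: "smooth_fn f \<Longrightarrow> smooth_fn (pd ks f)"
  unfolding smooth_fn_def pd_append by blast

text \<open>Smoothness is always established through this criterion: all iterated derivatives are
  guessed at once as a family indexed by lists, and it remains to check one further derivative at
  each list.\<close>

lemma smooth_fn_family:
  assumes F0: "F [] = f" and c: "\<And>js. continuous_on UNIV (F js)"
    and d: "\<And>js j x. ((\<lambda>h. F js (x + h *\<^sub>R axis j 1)) has_real_derivative F (j # js) x) (at 0)"
  shows "smooth_fn f" "pd js f = F js"
proof -
  have p: "pd js f = F js" for js
  proof (induction js)
    case (Cons j js)
    show ?case
    proof
      fix x show "pd (j # js) f x = F (j # js) x"
        using d[of js x j] Cons by (simp add: DERIV_imp_deriv)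
    qed
  qed (simp add: F0)
  then show "pd js f = F js" .
  show "smooth_fn f" unfolding smooth_fn_def p
    using c d real_differentiable_def by blast
qed

lemma
  assumes "smooth_fn f"
  shows smooth_fn_affine: "smooth_fn (\<lambda>x. c * f (a + r *\<^sub>R x))"
    and pd_affine: "pd js (\<lambda>x. c * f (a + r *\<^sub>R x)) = (\<lambda>x. c * r ^ length js * pd js f (a + r *\<^sub>R x))"
proof -
  define F where "F = (\<lambda>js x. c * r ^ length js * pd js f (a + r *\<^sub>R x))"
  have c: "continuous_on UNIV (F js)" for js
    unfolding F_def
    by (intro continuous_intros continuous_on_compose2[OF smooth_fn_continuous[OF assms]]) auto
  have d: "((\<lambda>h. F js (x + h *\<^sub>R axis j 1)) has_real_derivative F (j # js) x) (at 0)" for js j x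
  proof -
    have "((\<lambda>h. pd js f ((a + r *\<^sub>R x) + (r * h) *\<^sub>R axis j 1)) has_real_derivative pd (j # js) f ((a + r *\<^sub>R x)) * r) (at 0)"
      by (rule DERIV_chain2[where f="\<lambda>h. pd js f ((a + r *\<^sub>R x) + h *\<^sub>R axis j 1)" and g="\<lambda>h. r * h"])
         (use smooth_fn_deriv0[OF assms, of js "a + r *\<^sub>R x" j] in \<open>auto intro!: derivative_eq_intros\<close>)
    then have "((\<lambda>h. pd js f (a + r *\<^sub>R (x + h *\<^sub>R axis j 1))) has_real_derivative pd (j # js) f ((a + r *\<^sub>R x)) * r) (at 0)"
      by (simp add: algebra_simps)
    from DERIV_cmult[OF this, of "c * r ^ length js"] show ?thesis unfolding F_def by (simp add: mult_ac)
  qed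
  show "smooth_fn (\<lambda>x. c * f (a + r *\<^sub>R x))" by (rule smooth_fn_family(1)[of F, OF _ c d]) (simp add: F_def)
  show "pd js (\<lambda>x. c * f (a + r *\<^sub>R x)) = (\<lambda>x. c * r ^ length js * pd js f (a + r *\<^sub>R x))"
    using smooth_fn_family(2)[of F, OF _ c d, where js=js and f="\<lambda>x. c * f (a + r *\<^sub>R x)"] by (simp add: F_def)
qed

lemma
  assumes "\<And>i. i \<in> I \<Longrightarrow> smooth_fn (f i)"
  shows smooth_fn_sum: "smooth_fn (\<lambda>x. \<Sum>i\<in>I. f i x)"
    and pd_sum: "pd js (\<lambda>x. \<Sum>i\<in>I. f i x) = (\<lambda>x. \<Sum>i\<in>I. pd js (f i) x)"
proof -
  define F where "F = (\<lambda>js x. \<Sum>i\<in>I. pd js (f i) x)"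
  have c: "continuous_on UNIV (F js)" for js
    unfolding F_def by (intro continuous_intros smooth_fn_continuous assms)
  have d: "((\<lambda>h. F js (x + h *\<^sub>R axis j 1)) has_real_derivative F (j # js) x) (at 0)" for js j x
    unfolding F_def by (intro DERIV_sum smooth_fn_deriv0 assms)
  show "smooth_fn (\<lambda>x. \<Sum>i\<in>I. f i x)" by (rule smooth_fn_family(1)[of F, OF _ c d]) (simp add: F_def)
  show "pd js (\<lambda>x. \<Sum>i\<in>I. f i x) = (\<lambda>x. \<Sum>i\<in>I. pd js (f i) x)"
    using smooth_fn_family(2)[of F, OF _ c d, where js=js and f="\<lambda>x. \<Sum>i\<in>I. f i x"] by (simp add: F_def)
qed

lemma
  assumes "smooth_fn f" "smooth_fn g"
  shows smooth_fn_add: "smooth_fn (\<lambda>x. f x + g x)"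
    and pd_add: "pd js (\<lambda>x. f x + g x) = (\<lambda>x. pd js f x + pd js g x)"
  using smooth_fn_sum[of "UNIV :: bool set" "\<lambda>b. if b then f else g"] pd_sum[of "UNIV :: bool set" "\<lambda>b. if b then f else g" js] assms
  by (auto simp: UNIV_bool add.commute split: if_splits)

lemma
  assumes "smooth_fn f"
  shows smooth_fn_cmult: "smooth_fn (\<lambda>x. c * f x)"
    and pd_cmult: "pd js (\<lambda>x. c * f x) = (\<lambda>x. c * pd js f x)"
  using smooth_fn_affine[OF assms, of c 0 1] pd_affine[OF assms, of js c 0 1] by auto

lemma
  assumes "smooth_fn f" "smooth_fn g"
  shows smooth_fn_diff: "smooth_fn (\<lambda>x. f x - g x)"
    and pd_diff: "pd js (\<lambda>x. f x - g x) = (\<lambda>x. pd js f x - pd js g x)"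
  using smooth_fn_add[OF assms(1) smooth_fn_cmult[OF assms(2), of "-1"]]
    pd_add[OF assms(1) smooth_fn_cmult[OF assms(2), of "-1"], of js] pd_cmult[OF assms(2), of js "-1"] by auto

lemma
  assumes "smooth_fn f"
  shows smooth_fn_shift: "smooth_fn (\<lambda>x. f (x + a))"
    and pd_shift: "pd js (\<lambda>x. f (x + a)) = (\<lambda>x. pd js f (x + a))"
  using smooth_fn_affine[OF assms, of 1 a 1] pd_affine[OF assms, of js 1 a 1] by (auto simp: add.commute)

lemma
  assumes "smooth_fn f"
  shows smooth_fn_reflect: "smooth_fn (\<lambda>x. f (a - x))"
    and pd_reflect: "pd js (\<lambda>x. f (a - x)) = (\<lambda>x. (-1) ^ length js * pd js f (a - x))"
  using smooth_fn_affine[OF assms, of 1 a "-1"] pd_affine[OF assms, of js 1 a "-1"] by auto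

text \<open>The terms of the Leibniz rule for \<open>pd\<close>: every way, with multiplicity and in
  the given order, of letting each derivative fall on the first or on the second factor.\<close>

fun splits :: "'a list \<Rightarrow> ('a list \<times> 'a list) list" where
  "splits [] = [([], [])]"
| "splits (j # js) = map (\<lambda>(a, b). (j # a, b)) (splits js) @ map (\<lambda>(a, b). (a, j # b)) (splits js)"

text \<open>The sums over \<open>splits\<close> are closed under one more derivative, since the new
  derivative extends either component of each pair. Symmetry of mixed derivatives does not enter,
  which is why pairs of lists are used instead of binomial coefficients.\<close>

lemma
  assumes "smooth_fn f" "smooth_fn g"
  shows smooth_fn_mult: "smooth_fn (\<lambda>x. f x * g x)"
    and pd_mult: "pd [j] (\<lambda>x. f x * g x) = (\<lambda>x. pd [j] f x * g x + f x * pd [j] g x)"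
proof -
  define F where "F = (\<lambda>js x. \<Sum>(a, b)\<leftarrow>splits js. pd a f x * pd b g x)"
  have c: "continuous_on UNIV (F js)" for js
  proof -
    have "continuous_on UNIV (\<lambda>x. \<Sum>(a, b)\<leftarrow>xs. pd a f x * pd b g x)" for xs
      by (induction xs) (auto intro!: continuous_intros smooth_fn_continuous assms)
    then show ?thesis by (simp add: F_def)
  qed
  have d: "((\<lambda>h. F js (x + h *\<^sub>R axis j 1)) has_real_derivative F (j # js) x) (at 0)" for js j x
  proof -
    have "((\<lambda>h. \<Sum>(a, b)\<leftarrow>xs. pd a f (x + h *\<^sub>R axis j 1) * pd b g (x + h *\<^sub>R axis j 1)) has_real_derivative
       (\<Sum>(a, b)\<leftarrow>map (\<lambda>(a, b). (j # a, b)) xs. pd a f x * pd b g x)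
      + (\<Sum>(a, b)\<leftarrow>map (\<lambda>(a, b). (a, j # b)) xs. pd a f x * pd b g x)) (at 0)" for xs
    proof (induction xs)
      case (Cons p xs)
      obtain a b where p: "p = (a, b)" by (cases p)
      have "((\<lambda>h. pd a f (x + h *\<^sub>R axis j 1) * pd b g (x + h *\<^sub>R axis j 1)) has_real_derivative
         pd (j # a) f x * pd b g (x + 0 *\<^sub>R axis j 1) + pd (j # b) g x * pd a f (x + 0 *\<^sub>R axis j 1)) (at 0)"
        by (intro DERIV_mult smooth_fn_deriv0 assms)
      from DERIV_add[OF this Cons] show ?case
        by (simp only: p list.map sum_list.Cons prod.case) (simp add: algebra_simps del: pd.simps)
    qed simp
    from this[of "splits js"] show ?thesis by (simp add: F_def del: pd.simps)
  qed
  show "smooth_fn (\<lambda>x. f x * g x)" by (rule smooth_fn_family(1)[of F, OF _ c d]) (simp add: F_def)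
  show "pd [j] (\<lambda>x. f x * g x) = (\<lambda>x. pd [j] f x * g x + f x * pd [j] g x)"
    using smooth_fn_family(2)[of F, OF _ c d, where js="[j]" and f="\<lambda>x. f x * g x"] by (simp add: F_def del: pd.simps(2))
qed

lemma smooth_fn_measurable: "smooth_fn f \<Longrightarrow> pd js f \<in> borel_measurable borel"
  by (intro borel_measurable_continuous_onI smooth_fn_continuous)

section \<open>Supports and the algebra of test functions\<close>

lemma pd_support:
  assumes "\<And>x. R < norm x \<Longrightarrow> f x = 0"
  shows "R < norm x \<Longrightarrow> pd js f x = 0"
proof (induction js arbitrary: x)
  case (Cons j js)
  have "open {y::real^'a. R < norm y}" by (intro open_Collect_less continuous_intros)
  moreover have "continuous (at 0) (\<lambda>h::real. x + h *\<^sub>R axis j 1)" by (intro continuous_intros)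
  ultimately have "\<forall>\<^sub>F h in nhds 0. R < norm (x + h *\<^sub>R axis j 1)"
  proof -
    have "((\<lambda>h::real. norm (x + h *\<^sub>R axis j 1)) \<longlongrightarrow> norm (x + 0 *\<^sub>R axis j 1)) (nhds 0)"
      by (intro tendsto_intros filterlim_ident)
    then show ?thesis using Cons.prems by (intro order_tendstoD(1)) auto
  qed
  then have "\<forall>\<^sub>F h in nhds 0. pd js f (x + h *\<^sub>R axis j 1) = 0" by eventually_elim (rule Cons.IH)
  then have "deriv (\<lambda>h. pd js f (x + h *\<^sub>R axis j 1)) 0 = deriv (\<lambda>h. 0) (0::real)"
    by (intro deriv_cong_ev) auto
  then show ?case by simp
qed (use assms in auto)

lemma test_fun_smooth: "test_fun f \<Longrightarrow> smooth_fn f" by (simp add: test_fun_def)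

lemma test_fun_pd: "test_fun f \<Longrightarrow> test_fun (pd js f)"
  unfolding test_fun_def using smooth_fn_pd pd_support by metis

lemma test_fun_bounded:
  assumes "test_fun f" shows "\<exists>B>0. \<forall>x. \<bar>f x\<bar> \<le> B"
proof -
  from assms obtain R where R: "\<And>x. R < norm x \<Longrightarrow> f x = 0" by (auto simp: test_fun_def)
  have "continuous_on (cball 0 R) f"
    using smooth_fn_continuous[OF test_fun_smooth[OF assms], of "[]"] continuous_on_subset by auto
  then have "bounded (f ` cball 0 R)" by (intro compact_imp_bounded compact_continuous_image) auto
  then obtain B where B: "\<forall>x\<in>cball 0 R. \<bar>f x\<bar> \<le> B" by (auto simp: bounded_iff)
  have "\<bar>f x\<bar> \<le> \<bar>B\<bar> + 1" for x using bspec[OF B, of x] R[of x] by (cases "norm x \<le> R") auto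
  then show ?thesis by (intro exI[of _ "\<bar>B\<bar> + 1"]) auto
qed

lemma test_fun_measurable: "test_fun f \<Longrightarrow> f \<in> borel_measurable borel"
  using smooth_fn_measurable[OF test_fun_smooth, of f "[]"] by simp

lemma test_fun_sqint: assumes "test_fun f" shows "sqint f" "integrable lborel f"
proof -
  obtain B where B: "\<And>x. \<bar>f x\<bar> \<le> B" using test_fun_bounded[OF assms] by auto
  obtain R where R: "\<And>x. R < norm x \<Longrightarrow> f x = 0" using assms by (auto simp: test_fun_def)
  show "sqint f" "integrable lborel f"
    using bounded_support_sqint[OF test_fun_measurable[OF assms] B R] by auto
qed

lemma test_fun_add: "test_fun f \<Longrightarrow> test_fun g \<Longrightarrow> test_fun (\<lambda>x. f x + g x)"
  unfolding test_fun_def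
proof (elim conjE exE, intro conjI)
  fix R1 R2 assume "smooth_fn f" "smooth_fn g" and R: "\<forall>x. R1 < norm x \<longrightarrow> f x = 0" "\<forall>x. R2 < norm x \<longrightarrow> g x = 0"
  then show "smooth_fn (\<lambda>x. f x + g x)" by (intro smooth_fn_add)
  show "\<exists>R. \<forall>x. R < norm x \<longrightarrow> f x + g x = 0" using R by (intro exI[of _ "max R1 R2"]) auto
qed

lemma test_fun_zero[simp]: "test_fun (\<lambda>x. 0)"
  using smooth_fn_sum[of "{}"] by (auto simp: test_fun_def)

lemma test_fun_cmult: "test_fun f \<Longrightarrow> test_fun (\<lambda>x. c * f x)"
  unfolding test_fun_def using smooth_fn_cmult[of f c] by (metis mult_zero_right)

lemma test_fun_diff: "test_fun f \<Longrightarrow> test_fun g \<Longrightarrow> test_fun (\<lambda>x. f x - g x)"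
  using test_fun_add[of f "\<lambda>x. - 1 * g x"] test_fun_cmult[of g "-1"] by simp

lemma test_fun_sum: "(\<And>i. i \<in> I \<Longrightarrow> test_fun (f i)) \<Longrightarrow> test_fun (\<lambda>x. \<Sum>i\<in>I. f i x)"
  by (induction I rule: infinite_finite_induct) (auto intro: test_fun_add)

lemma test_fun_mult: "smooth_fn f \<Longrightarrow> test_fun g \<Longrightarrow> test_fun (\<lambda>x. f x * g x)"
  unfolding test_fun_def using smooth_fn_mult[of f g] by (metis mult_zero_right)

lemma test_fun_affine:
  assumes "test_fun f" "r \<noteq> 0" shows "test_fun (\<lambda>x. c * f (a + r *\<^sub>R x))"
proof -
  obtain R where R: "\<And>x. R < norm x \<Longrightarrow> f x = 0" using assms by (auto simp: test_fun_def)
  have "c * f (a + r *\<^sub>R x) = 0" if "(R + norm a) / \<bar>r\<bar> < norm x" for x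
  proof -
    have "R + norm a < \<bar>r\<bar> * norm x" using that assms(2) by (simp add: divide_less_eq mult.commute)
    moreover have "\<bar>r\<bar> * norm x \<le> norm (a + r *\<^sub>R x) + norm a"
      using norm_triangle_ineq4[of "a + r *\<^sub>R x" a] by simp
    ultimately show ?thesis using R[of "a + r *\<^sub>R x"] by simp
  qed
  then show ?thesis using smooth_fn_affine[OF test_fun_smooth[OF assms(1)], of c a r] by (auto simp: test_fun_def)
qed

lemma test_fun_shift: "test_fun f \<Longrightarrow> test_fun (\<lambda>x. f (x + a))"
  using test_fun_affine[of f 1 1 a] by (simp add: add.commute)

lemma test_fun_reflect: "test_fun f \<Longrightarrow> test_fun (\<lambda>x. f (a - x))"
  using test_fun_affine[of f "-1" 1 a] by simp

lemma smooth_fn_increment: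
  assumes "smooth_fn f" and B: "\<And>y. \<bar>pd [j] f y\<bar> \<le> B"
  shows "\<bar>f (x + h *\<^sub>R axis j 1) - f x\<bar> \<le> B * \<bar>h\<bar>"
proof -
  have "norm (f (x + h *\<^sub>R axis j 1) - f (x + 0 *\<^sub>R axis j 1)) \<le> B * norm (h - 0)"
  proof (rule field_differentiable_bound[where S=UNIV and f'="\<lambda>h. pd [j] f (x + h *\<^sub>R axis j 1)"])
    show "((\<lambda>h. f (x + h *\<^sub>R axis j 1)) has_field_derivative pd [j] f (x + z *\<^sub>R axis j 1)) (at z within UNIV)" for z
      using smooth_fn_deriv[OF assms(1), of "[]" x j z] by (simp del: pd.simps(2))
  qed (use B in auto)
  then show ?thesis by simp
qed

text \<open>\<open>pd\<close> is an iterated derivative in a prescribed order, and the definition of \<open>test_fun\<close> does not make the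
  order irrelevant; the symmetry of second derivatives is therefore carried along for the test fields.\<close>
definition comm_pd :: "(real^'n::finite \<Rightarrow> real) \<Rightarrow> bool" where
  "comm_pd f \<longleftrightarrow> (\<forall>js ks. mset js = mset ks \<longrightarrow> pd js f = pd ks f)"

definition ctest :: "(real^'n::finite \<Rightarrow> real) \<Rightarrow> bool" where
  "ctest f \<longleftrightarrow> test_fun f \<and> comm_pd f"

lemma ctest_test: "ctest f \<Longrightarrow> test_fun f" by (simp add: ctest_def)
lemma ctest_smooth: "ctest f \<Longrightarrow> smooth_fn f" by (simp add: ctest_def test_fun_def)

lemma ctest_comm: "ctest f \<Longrightarrow> mset js = mset ks \<Longrightarrow> pd js f = pd ks f"
  unfolding ctest_def comm_pd_def by blast

lemma pd_zero: "pd js (\<lambda>x. 0) = (\<lambda>x. 0)"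
  by (induction js) auto

lemma ctestI:
  assumes "test_fun f" "\<And>js ks. mset js = mset ks \<Longrightarrow> pd js f = pd ks f"
  shows "ctest f"
  using assms unfolding ctest_def comm_pd_def by blast

lemma ctest_pd: assumes "ctest f" shows "ctest (pd ks f)"
proof (rule ctestI)
  show "test_fun (pd ks f)" by (rule test_fun_pd[OF ctest_test[OF assms]])
  show "pd js (pd ks f) = pd ls (pd ks f)" if "mset js = mset ls" for js ls
    unfolding pd_append by (rule ctest_comm[OF assms]) (simp add: that)
qed

lemma ctest_add: assumes "ctest f" "ctest g" shows "ctest (\<lambda>x. f x + g x)"
proof (rule ctestI)
  show "test_fun (\<lambda>x. f x + g x)" by (intro test_fun_add ctest_test assms)
  show "pd js (\<lambda>x. f x + g x) = pd ls (\<lambda>x. f x + g x)" if "mset js = mset ls" for js ls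
    unfolding pd_add[OF ctest_smooth[OF assms(1)] ctest_smooth[OF assms(2)]]
      ctest_comm[OF assms(1) that] ctest_comm[OF assms(2) that] ..
qed

lemma ctest_affine: assumes "ctest f" "r \<noteq> 0" shows "ctest (\<lambda>x. c * f (a + r *\<^sub>R x))"
proof (rule ctestI)
  show "test_fun (\<lambda>x. c * f (a + r *\<^sub>R x))" by (intro test_fun_affine ctest_test assms)
  show "pd js (\<lambda>x. c * f (a + r *\<^sub>R x)) = pd ls (\<lambda>x. c * f (a + r *\<^sub>R x))" if "mset js = mset ls" for js ls
    unfolding pd_affine[OF ctest_smooth[OF assms(1)]] ctest_comm[OF assms(1) that] mset_eq_length[OF that] ..
qed

lemma ctest_cmult: assumes "ctest f" shows "ctest (\<lambda>x. c * f x)"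
  using ctest_affine[OF assms, of 1 c 0] by simp

lemma ctest_zero[simp]: "ctest (\<lambda>x. 0)"
  by (rule ctestI) (simp_all add: pd_zero)

lemma ctest_sum: "(\<And>i. i \<in> I \<Longrightarrow> ctest (f i)) \<Longrightarrow> ctest (\<lambda>x. \<Sum>i\<in>I. f i x)"
  by (induction I rule: infinite_finite_induct) (auto intro: ctest_add)

section \<open>Mollifiers\<close>

text \<open>The functions p(1/x) exp(-1/x), continued by 0, with a polynomial p. Differentiation
  acts on p alone, so one derivative rule gives smoothness of exp(-1/x) to all orders.\<close>

definition flat_exp :: "real poly \<Rightarrow> real \<Rightarrow> real" where
  "flat_exp p x = (if x \<le> 0 then 0 else poly p (1 / x) * exp (- 1 / x))"

lemma flat_exp_tendsto: "((\<lambda>x. poly (p :: real poly) (1 / x) * exp (- 1 / x)) \<longlongrightarrow> 0) (at_right 0)"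
proof -
  have "((\<lambda>y::real. \<Sum>i\<le>degree p. coeff p i * (y ^ i / exp y)) \<longlongrightarrow> (\<Sum>i\<le>degree p. coeff p i * 0)) at_top"
    by (intro tendsto_intros tendsto_power_div_exp_0)
  moreover have "(\<Sum>i\<le>degree p. coeff p i * (y ^ i / exp y)) = poly p y * exp (- y)" for y
    by (simp add: poly_altdef sum_distrib_right exp_minus divide_inverse mult.assoc)
  ultimately have "((\<lambda>y::real. poly p y * exp (- y)) \<longlongrightarrow> 0) at_top" by simp
  from filterlim_compose[OF this filterlim_inverse_at_top_right] show ?thesis
    by (simp add: divide_inverse)
qed

text \<open>For x > 0 the derivative of p(1/x) exp(-1/x) is (1/x)^2 (p - p')(1/x) exp(-1/x). At the
  origin the difference quotient from the right has the same form with p multiplied by the variable,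
  hence tends to 0.\<close>

lemma flat_exp_deriv:
  "(flat_exp p has_real_derivative flat_exp (monom 1 2 * (p - pderiv p)) x) (at x)"
proof -
  consider "x < 0" | "x > 0" | "x = 0" by linarith
  then show ?thesis
  proof cases
    case 1
    have "((\<lambda>x. 0) has_real_derivative 0) (at x)" by simp
    moreover have "\<forall>\<^sub>F y in nhds x. flat_exp p y = 0"
      using eventually_nhds_in_open[of "{..<0}" x] 1 by (auto simp: flat_exp_def elim!: eventually_mono)
    ultimately show ?thesis using 1 by (subst DERIV_cong_ev[OF refl _ refl]) (auto simp: flat_exp_def)
  next
    case 2
    have "((\<lambda>x. poly p (1 / x) * exp (- 1 / x)) has_real_derivative
       (poly (pderiv p) (1 / x) * (- 1 / x\<^sup>2)) * exp (- 1 / x) + exp (- 1 / x) * (1 / x\<^sup>2) * poly p (1 / x)) (at x)"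
      using 2 by (auto intro!: derivative_eq_intros DERIV_chain2[of "poly p"] poly_DERIV simp: power2_eq_square)
    also have "(poly (pderiv p) (1 / x) * (- 1 / x\<^sup>2)) * exp (- 1 / x) + exp (- 1 / x) * (1 / x\<^sup>2) * poly p (1 / x)
      = flat_exp (monom 1 2 * (p - pderiv p)) x"
      using 2 by (simp add: flat_exp_def poly_monom field_simps)
    finally have d: "((\<lambda>x. poly p (1 / x) * exp (- 1 / x)) has_real_derivative flat_exp (monom 1 2 * (p - pderiv p)) x) (at x)" .
    have "\<forall>\<^sub>F y in nhds x. flat_exp p y = poly p (1 / y) * exp (- 1 / y)"
      using eventually_nhds_in_open[of "{0<..}" x] 2 by (auto simp: flat_exp_def elim!: eventually_mono)
    with d show ?thesis by (subst DERIV_cong_ev[OF refl _ refl])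
  next
    case 3
    have "((\<lambda>y. flat_exp p y / y) \<longlongrightarrow> 0) (at 0)"
      unfolding at_eq_sup_left_right
    proof (rule filterlim_sup)
      show "((\<lambda>y. flat_exp p y / y) \<longlongrightarrow> 0) (at_left 0)"
        by (intro tendsto_eventually) (auto simp: flat_exp_def eventually_at_filter)
      have "((\<lambda>x. poly (monom 1 1 * p) (1 / x) * exp (- 1 / x)) \<longlongrightarrow> 0) (at_right 0)" by (rule flat_exp_tendsto)
      moreover have "\<forall>\<^sub>F x in at_right 0. poly (monom 1 1 * p) (1 / x) * exp (- 1 / x) = flat_exp p x / x"
        by (auto simp: flat_exp_def eventually_at_filter poly_monom)
      ultimately show "((\<lambda>y. flat_exp p y / y) \<longlongrightarrow> 0) (at_right 0)" by (rule Lim_transform_eventually)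
    qed
    then show ?thesis using 3 by (simp add: DERIV_def flat_exp_def)
  qed
qed

text \<open>A smooth function of one variable, represented by the sequence of all its derivatives;
  \<open>D 0\<close> is the function itself.\<close>

definition smooth_seq :: "(nat \<Rightarrow> real \<Rightarrow> real) \<Rightarrow> bool" where
  "smooth_seq D \<longleftrightarrow> (\<forall>k x. (D k has_real_derivative D (Suc k) x) (at x))"

lemma smooth_seq_mult:
  assumes "smooth_seq D" "smooth_seq E"
  shows "\<exists>F. smooth_seq F \<and> F 0 = (\<lambda>x. D 0 x * E 0 x)"
proof -
  define G where "G = (\<lambda>k x. \<Sum>i\<le>k. real (k choose i) * (D i x * E (k - i) x))"
  have "(G k has_real_derivative G (Suc k) x) (at x)" for k x
  proof -
    have "(G k has_real_derivative (\<Sum>i\<le>k. real (k choose i) * (D (Suc i) x * E (k - i) x + E (Suc (k - i)) x * D i x))) (at x)"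
      unfolding G_def using assms
      by (intro DERIV_sum DERIV_cmult DERIV_mult) (auto simp: smooth_seq_def)
    \<comment> \<open>Pascal's rule: the sum in which \<open>D\<close> is differentiated is shifted
      by one index, and the coefficients k over i-1 and k over i add up.\<close>
    also have "(\<Sum>i\<le>k. real (k choose i) * (D (Suc i) x * E (k - i) x + E (Suc (k - i)) x * D i x)) = G (Suc k) x"
    proof -
      have 1: "(\<Sum>i\<le>k. real (k choose i) * (D (Suc i) x * E (k - i) x)) = (\<Sum>i\<le>Suc k. real (if i = 0 then 0 else k choose (i - 1)) * (D i x * E (Suc k - i) x))"
        by (subst sum.atMost_Suc_shift) simp
      have 2: "(\<Sum>i\<le>k. real (k choose i) * (E (Suc (k - i)) x * D i x)) = (\<Sum>i\<le>Suc k. real (k choose i) * (D i x * E (Suc k - i) x))"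
        by (simp add: mult_ac Suc_diff_le)
      have "(\<Sum>i\<le>k. real (k choose i) * (D (Suc i) x * E (k - i) x + E (Suc (k - i)) x * D i x)) =
        (\<Sum>i\<le>Suc k. (real (if i = 0 then 0 else k choose (i - 1)) + real (k choose i)) * (D i x * E (Suc k - i) x))"
        unfolding distrib_left distrib_right sum.distrib 1 2 ..
      also have "\<dots> = G (Suc k) x" unfolding G_def
      proof (intro sum.cong refl)
        fix i show "(real (if i = 0 then 0 else k choose (i - 1)) + real (k choose i)) * (D i x * E (Suc k - i) x) = real (Suc k choose i) * (D i x * E (Suc k - i) x)"
          by (cases i) auto
      qed
      finally show ?thesis .
    qed
    finally show ?thesis .
  qed
  then show ?thesis by (intro exI[of _ G]) (auto simp: smooth_seq_def G_def)
qed

text \<open>The bump is exp(-1/(1+x)) exp(-1/(1-x)) inside (-1, 1). The polynomials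
  \<open>P k\<close> iterate the derivative rule of \<open>flat_exp\<close>; the signs in
  \<open>B\<close> come from the inner derivative of 1 - x.\<close>

lemma smooth_bump_1d:
  obtains D :: "nat \<Rightarrow> real \<Rightarrow> real" where "smooth_seq D" "\<And>x. 0 \<le> D 0 x" "0 < D 0 0" "\<And>x. 1 \<le> \<bar>x\<bar> \<Longrightarrow> D 0 x = 0"
proof -
  define P where "P = rec_nat (1 :: real poly) (\<lambda>_ p. monom 1 2 * (p - pderiv p))"
  define A where "A = (\<lambda>k x. flat_exp (P k) (1 + x))"
  define B where "B = (\<lambda>k x. (-1) ^ k * flat_exp (P k) (1 - x))"
  have "smooth_seq A" unfolding smooth_seq_def A_def
  proof safe
    fix k x
    show "((\<lambda>x. flat_exp (P k) (1 + x)) has_real_derivative flat_exp (P (Suc k)) (1 + x)) (at x)"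
      by (rule DERIV_cong[OF DERIV_chain2[OF flat_exp_deriv]]) (auto intro!: derivative_eq_intros simp: P_def)
  qed
  moreover have "smooth_seq B" unfolding smooth_seq_def B_def
  proof safe
    fix k x
    show "((\<lambda>x. (-1) ^ k * flat_exp (P k) (1 - x)) has_real_derivative (-1) ^ Suc k * flat_exp (P (Suc k)) (1 - x)) (at x)"
      by (rule DERIV_cong[OF DERIV_cmult[OF DERIV_chain2[OF flat_exp_deriv]]]) (auto intro!: derivative_eq_intros simp: P_def)
  qed
  ultimately obtain D where D: "smooth_seq D" "D 0 = (\<lambda>x. A 0 x * B 0 x)" using smooth_seq_mult by metis
  show ?thesis
    by (rule that[OF D(1)]) (auto simp: D(2) A_def B_def P_def flat_exp_def)
qed

text \<open>For a tensor product an iterated derivative depends only on how often each coordinate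
  occurs in the list. Taking the family in terms of \<open>count (mset js)\<close> therefore gives
  smoothness and the symmetry of derivatives together.\<close>

lemma product_ctest:
  fixes D :: "nat \<Rightarrow> real \<Rightarrow> real"
  assumes D: "smooth_seq D" and s: "\<And>x. 1 \<le> \<bar>x\<bar> \<Longrightarrow> D 0 x = 0"
  shows "ctest (\<lambda>x::real^'n::finite. \<Prod>i\<in>UNIV. D 0 (x $ i))"
proof -
  define F where "F = (\<lambda>(js::'n list) (x::real^'n). \<Prod>i\<in>UNIV. D (count (mset js) i) (x $ i))"
  have cD: "continuous_on S (D k)" for k S using D unfolding smooth_seq_def
    by (meson DERIV_isCont continuous_at_imp_continuous_on)
  have c: "continuous_on UNIV (F js)" for js
    unfolding F_def by (intro continuous_intros continuous_on_compose2[OF cD[of UNIV]]) auto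
  have d: "((\<lambda>h. F js (x + h *\<^sub>R axis j 1)) has_real_derivative F (j # js) x) (at 0)" for js j x
  proof -
    let ?c = "\<Prod>i\<in>UNIV-{j}. D (count (mset js) i) (x $ i)"
    have e: "F js (x + h *\<^sub>R axis j 1) = D (count (mset js) j) (x $ j + h) * ?c" for h
      unfolding F_def by (subst prod.remove[of _ j]) (auto simp: axis_def intro!: prod.cong)
    have e2: "F (j # js) x = D (Suc (count (mset js) j)) (x $ j) * ?c"
      unfolding F_def by (subst prod.remove[of _ j]) (auto intro!: prod.cong)
    have "((\<lambda>h. D (count (mset js) j) (x $ j + h) * ?c) has_real_derivative D (Suc (count (mset js) j)) (x $ j + 0) * 1 * ?c) (at 0)"
      by (intro DERIV_cmult_right DERIV_chain2[of "D (count (mset js) j)"])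
         (use D in \<open>auto simp: smooth_seq_def intro!: derivative_eq_intros\<close>)
    then show ?thesis by (simp add: e e2)
  qed
  have F0: "F [] = (\<lambda>x. \<Prod>i\<in>UNIV. D 0 (x $ i))" by (simp add: F_def)
  note sm = smooth_fn_family[of F, OF F0 c d]
  \<comment> \<open>If all coordinates were below 1 in modulus, the norm would be at most the square
    root of the dimension.\<close>
  have z: "(\<Prod>i\<in>UNIV. D 0 (x $ i)) = 0" if "sqrt (real CARD('n)) < norm x" for x :: "real^'n"
  proof -
    have "\<exists>i. 1 \<le> \<bar>x $ i\<bar>"
    proof (rule ccontr)
      assume "\<not> ?thesis"
      then have "(x $ i)\<^sup>2 \<le> 1" for i using abs_square_le_1[of "x $ i"] by (meson linear)
      then have "(\<Sum>i\<in>UNIV. (x $ i)\<^sup>2) \<le> real CARD('n)" using sum_bounded_above[of UNIV "\<lambda>i. (x $ i)\<^sup>2" 1] by simp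
      then have "norm x \<le> sqrt (real CARD('n))" by (simp add: norm_vec_def L2_set_def)
      with that show False by simp
    qed
    then show ?thesis using s by (auto intro!: prod_zero)
  qed
  show ?thesis
  proof (rule ctestI)
    show "test_fun (\<lambda>x::real^'n. \<Prod>i\<in>UNIV. D 0 (x $ i))"
      unfolding test_fun_def using sm(1) z by blast
    show "pd js (\<lambda>x::real^'n. \<Prod>i\<in>UNIV. D 0 (x $ i)) = pd ks (\<lambda>x. \<Prod>i\<in>UNIV. D 0 (x $ i))" if "mset js = mset ks" for js ks
      unfolding sm(2) by (simp add: F_def that)
  qed
qed

text \<open>Normalization requires a positive integral: a nonnegative function with integral 0
  vanishes almost everywhere, while this one is positive on a nonempty open set, which is not a null
  set.\<close>

lemma mollifier_exists:
  obtains \<rho> :: "real^'n::finite \<Rightarrow> real" where "ctest \<rho>" "\<And>x. 0 \<le> \<rho> x" "(\<integral>x. \<rho> x \<partial>lborel) = 1"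
proof -
  obtain D :: "nat \<Rightarrow> real \<Rightarrow> real" where D: "smooth_seq D" "\<And>x. 0 \<le> D 0 x" "0 < D 0 0" "\<And>x. 1 \<le> \<bar>x\<bar> \<Longrightarrow> D 0 x = 0"
    using smooth_bump_1d by blast
  define g where "g = (\<lambda>x::real^'n. \<Prod>i\<in>UNIV. D 0 (x $ i))"
  have g: "ctest g" unfolding g_def by (rule product_ctest[OF D(1,4)])
  have g0: "0 \<le> g x" for x unfolding g_def by (intro prod_nonneg) (auto intro: D(2))
  have gp: "0 < g 0" unfolding g_def by (intro prod_pos) (auto intro: D(3))
  note gi = test_fun_sqint(2)[OF ctest_test[OF g]]
  have cont: "continuous_on UNIV g" using smooth_fn_continuous[OF ctest_smooth[OF g], of "[]"] by simp
  have "(\<integral>x. g x \<partial>lborel) \<noteq> 0"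
  proof
    assume "(\<integral>x. g x \<partial>lborel) = 0"
    then have ae: "AE x in lborel. g x = 0" using integral_nonneg_eq_0_iff_AE[OF gi] g0 by simp
    have "open {x. 0 < g x}" by (intro open_Collect_less cont continuous_intros)
    moreover have "(0::real^'n) \<in> {x. 0 < g x}" using gp by simp
    ultimately have "{x. 0 < g x} \<notin> null_sets lborel"
      using open_not_negligible[of "{x. 0 < g x}"] null_sets_completionI[of _ lborel] by (auto simp: negligible_iff_null_sets)
    moreover have "{x. 0 < g x} \<in> null_sets lborel"
    proof -
      have "{x. 0 < g x} = {x \<in> space lborel. \<not> g x = 0}" using g0 by (auto simp: less_le)
      moreover have "{x \<in> space lborel. \<not> g x = 0} \<in> sets lborel" using test_fun_measurable[OF ctest_test[OF g]] by measurable
      ultimately show ?thesis using ae by (simp add: AE_iff_null_sets)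
    qed
    ultimately show False by simp
  qed
  moreover have "(\<integral>x. g x \<partial>lborel) \<ge> 0" using g0 by simp
  ultimately have c: "(\<integral>x. g x \<partial>lborel) > 0" by simp
  show ?thesis
  proof (rule that[of "\<lambda>x. (1 / (\<integral>x. g x \<partial>lborel)) * g x"])
    show "ctest (\<lambda>x. (1 / (\<integral>x. g x \<partial>lborel)) * g x)" by (rule ctest_cmult[OF g])
    show "0 \<le> (1 / (\<integral>x. g x \<partial>lborel)) * g x" for x using c g0 by simp
    show "(\<integral>x. (1 / (\<integral>x. g x \<partial>lborel)) * g x \<partial>lborel) = 1" using c gi by simp
  qed
qed

section \<open>Convolution\<close>

text \<open>The kernel carries all derivatives, so \<open>f\<close> need only be integrable, and the
  symmetry of derivatives passes from the kernel to the convolution.\<close>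

definition conv :: "('a::euclidean_space \<Rightarrow> real) \<Rightarrow> ('a \<Rightarrow> real) \<Rightarrow> 'a \<Rightarrow> real" where
  "conv k f x = (\<integral>y. k (x - y) * f y \<partial>lborel)"

lemma conv_flip:
  assumes [measurable]: "k \<in> borel_measurable borel" "f \<in> borel_measurable borel"
  shows "conv k f x = (\<integral>y. k y * f (x - y) \<partial>lborel)"
  using lborel_integral_reflect[of "\<lambda>y. k y * f (x - y)" x] by (simp add: conv_def)

lemma test_fun_L1_mult:
  assumes k: "test_fun k" and f: "integrable lborel f"
  shows "integrable lborel (\<lambda>y. k (x - y) * f y)"
proof -
  obtain B where B: "\<And>x. \<bar>k x\<bar> \<le> B" using test_fun_bounded[OF k] by auto
  have [measurable]: "k \<in> borel_measurable borel" by (rule test_fun_measurable[OF k])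
  have [measurable]: "f \<in> borel_measurable borel" using borel_measurable_integrable[OF f] by simp
  show ?thesis
  proof (rule Bochner_Integration.integrable_bound)
    show "integrable lborel (\<lambda>y. B * f y)" using f by simp
    show "AE y in lborel. norm (k (x - y) * f y) \<le> norm (B * f y)"
      using B by (intro AE_I2) (auto simp: abs_mult intro!: mult_right_mono intro: order_trans[OF _ abs_ge_self])
  qed simp
qed

lemma conv_continuous:
  assumes k: "test_fun k" and f: "integrable lborel f"
  shows "continuous_on UNIV (conv k f)"
proof -
  obtain B where B: "\<And>x. \<bar>k x\<bar> \<le> B" using test_fun_bounded[OF k] by auto
  have [measurable]: "k \<in> borel_measurable borel" by (rule test_fun_measurable[OF k])
  have [measurable]: "f \<in> borel_measurable borel" using borel_measurable_integrable[OF f] by simp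
  have ck: "continuous_on UNIV k" using smooth_fn_continuous[OF test_fun_smooth[OF k], of "[]"] by simp
  have "(\<lambda>n. conv k f (X n)) \<longlonglongrightarrow> conv k f x" if X: "X \<longlonglongrightarrow> x" for X x
    unfolding conv_def
  proof (rule integral_dominated_convergence[where w="\<lambda>y. B * \<bar>f y\<bar>"])
    show "AE y in lborel. (\<lambda>n. k (X n - y) * f y) \<longlonglongrightarrow> k (x - y) * f y"
      using X ck by (intro AE_I2 tendsto_intros continuous_on_tendsto_compose[OF ck]) auto
    show "AE y in lborel. norm (k (X n - y) * f y) \<le> B * \<bar>f y\<bar>" for n
      using B by (intro AE_I2) (auto simp: abs_mult intro!: mult_right_mono)
    show "integrable lborel (\<lambda>y. B * \<bar>f y\<bar>)" using f by simp
  qed simp_all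
  then show ?thesis by (auto simp: continuous_on_sequentially o_def)
qed

text \<open>Differentiation under the integral along an arbitrary null sequence: the difference
  quotients of the kernel are bounded by the supremum of its derivative, which gives an integrable
  majorant.\<close>

lemma conv_deriv:
  assumes k: "test_fun k" and f: "integrable lborel f"
  shows "((\<lambda>h. conv k f (x + h *\<^sub>R axis j 1)) has_real_derivative conv (pd [j] k) f x) (at 0)"
proof -
  have k': "test_fun (pd [j] k)" by (rule test_fun_pd[OF k])
  obtain B where B: "\<And>x. \<bar>pd [j] k x\<bar> \<le> B" using test_fun_bounded[OF k'] by auto
  have [measurable]: "k \<in> borel_measurable borel" "pd [j] k \<in> borel_measurable borel"
    using test_fun_measurable[OF k] test_fun_measurable[OF k'] by auto
  have [measurable]: "f \<in> borel_measurable borel" using borel_measurable_integrable[OF f] by simp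
  have lim: "(\<lambda>n. (conv k f (x + H n *\<^sub>R axis j 1) - conv k f x) / H n) \<longlonglongrightarrow> conv (pd [j] k) f x"
    if H: "H \<longlonglongrightarrow> 0" "\<And>n. H n \<noteq> 0" for H :: "nat \<Rightarrow> real"
  proof -
    have e: "(conv k f (x + H n *\<^sub>R axis j 1) - conv k f x) / H n = (\<integral>y. (k (x - y + H n *\<^sub>R axis j 1) - k (x - y)) / H n * f y \<partial>lborel)" for n
    proof -
      have "conv k f (x + H n *\<^sub>R axis j 1) - conv k f x = (\<integral>y. k (x + H n *\<^sub>R axis j 1 - y) * f y - k (x - y) * f y \<partial>lborel)"
        unfolding conv_def by (intro Bochner_Integration.integral_diff[symmetric] test_fun_L1_mult k f)
      also have "(\<lambda>y. k (x + H n *\<^sub>R axis j 1 - y) * f y - k (x - y) * f y) = (\<lambda>y. H n * ((k (x - y + H n *\<^sub>R axis j 1) - k (x - y)) / H n * f y))"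
        using H(2)[of n] by (auto simp: field_simps)
      finally show ?thesis using H(2)[of n] by simp
    qed
    show ?thesis unfolding e unfolding conv_def
    proof (rule integral_dominated_convergence[where w="\<lambda>y. B * \<bar>f y\<bar>"])
      show "AE y in lborel. (\<lambda>n. (k (x - y + H n *\<^sub>R axis j 1) - k (x - y)) / H n * f y) \<longlonglongrightarrow> pd [j] k (x - y) * f y"
      proof (intro AE_I2 tendsto_mult tendsto_const)
        fix y
        have "((\<lambda>h. (k (x - y + h *\<^sub>R axis j 1) - k (x - y)) / h) \<longlongrightarrow> pd [j] k (x - y)) (at 0)"
          using smooth_fn_deriv0[OF test_fun_smooth[OF k], of "[]" "x - y" j] by (simp add: DERIV_def del: pd.simps(2))
        moreover have "filterlim H (at 0) sequentially" using H by (auto simp: filterlim_at)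
        ultimately show "(\<lambda>n. (k (x - y + H n *\<^sub>R axis j 1) - k (x - y)) / H n) \<longlonglongrightarrow> pd [j] k (x - y)"
          by (rule filterlim_compose)
      qed
      show "AE y in lborel. norm ((k (x - y + H n *\<^sub>R axis j 1) - k (x - y)) / H n * f y) \<le> B * \<bar>f y\<bar>" for n
      proof (intro AE_I2)
        fix y
        have "\<bar>k (x - y + H n *\<^sub>R axis j 1) - k (x - y)\<bar> \<le> B * \<bar>H n\<bar>"
          by (rule smooth_fn_increment[OF test_fun_smooth[OF k] B])
        then have "\<bar>(k (x - y + H n *\<^sub>R axis j 1) - k (x - y)) / H n\<bar> \<le> B"
          using H(2)[of n] by (simp add: abs_divide divide_le_eq)
        then show "norm ((k (x - y + H n *\<^sub>R axis j 1) - k (x - y)) / H n * f y) \<le> B * \<bar>f y\<bar>"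
          unfolding real_norm_def abs_mult by (intro mult_right_mono) auto
      qed
      show "integrable lborel (\<lambda>y. B * \<bar>f y\<bar>)" using f by simp
    qed (simp_all del: pd.simps(2))
  qed
  show ?thesis unfolding DERIV_def
    using lim by (auto simp: tendsto_at_iff_sequentially o_def)
qed

lemma
  assumes k: "test_fun k" and f: "integrable lborel f"
  shows conv_smooth: "smooth_fn (conv k f)" and pd_conv: "pd js (conv k f) = conv (pd js k) f"
proof -
  have d: "((\<lambda>h. conv (pd js k) f (x + h *\<^sub>R axis j 1)) has_real_derivative conv (pd (j # js) k) f x) (at 0)" for js j x
    using conv_deriv[OF test_fun_pd[OF k] f, of js x j] by (simp only: pd_append append.simps)
  have c: "continuous_on UNIV (conv (pd js k) f)" for js by (rule conv_continuous[OF test_fun_pd[OF k] f])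
  show "smooth_fn (conv k f)" by (rule smooth_fn_family(1)[of "\<lambda>js. conv (pd js k) f", OF _ c d]) simp
  show "pd js (conv k f) = conv (pd js k) f" by (rule smooth_fn_family(2)[of "\<lambda>js. conv (pd js k) f", OF _ c d]) simp
qed

lemma conv_test_fun:
  fixes f :: "real^'n::finite \<Rightarrow> real"
  assumes k: "test_fun k" and f: "integrable lborel f" and s: "\<And>x. R < norm x \<Longrightarrow> f x = 0"
  shows "test_fun (conv k f)"
  unfolding test_fun_def
proof
  show "smooth_fn (conv k f)" by (rule conv_smooth[OF k f])
  obtain R' where R': "\<And>x. R' < norm x \<Longrightarrow> k x = 0" using k by (auto simp: test_fun_def)
  have "conv k f x = 0" if "R + R' < norm x" for x
  proof -
    have "k (x - y) * f y = 0" for y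
      using norm_triangle_sub[of x y] R'[of "x - y"] s[of y] that by (cases "R < norm y") auto
    then have "(\<lambda>y. k (x - y) * f y) = (\<lambda>y. 0)" by (rule ext)
    then show ?thesis by (simp only: conv_def) simp
  qed
  then show "\<exists>R. \<forall>x. R < norm x \<longrightarrow> conv k f x = 0" by blast
qed

lemma conv_ctest:
  fixes f :: "real^'n::finite \<Rightarrow> real"
  assumes k: "ctest k" and f: "integrable lborel f" and s: "\<And>x. R < norm x \<Longrightarrow> f x = 0"
  shows "ctest (conv k f)"
proof (rule ctestI)
  show "test_fun (conv k f)" by (rule conv_test_fun[OF ctest_test[OF k] f s])
  show "pd js (conv k f) = pd ks (conv k f)" if "mset js = mset ks" for js ks
    unfolding pd_conv[OF ctest_test[OF k] f] ctest_comm[OF k that] ..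
qed

lemma test_fun_conv_integrable:
  assumes k: "test_fun k" and f: "sqint f"
  shows "integrable lborel (\<lambda>y. k (x - y) * f y)"
  by (rule sqint_mult_integrable[OF test_fun_sqint(1)[OF test_fun_reflect[OF k]] f])

lemma conv_measurable[measurable]:
  assumes [measurable]: "k \<in> borel_measurable borel" "f \<in> borel_measurable borel"
  shows "conv k f \<in> borel_measurable borel"
  unfolding conv_def by measurable

lemma conv_diff:
  assumes k: "test_fun k" and f: "sqint f" "sqint g"
  shows "conv k (\<lambda>x. f x - g x) = (\<lambda>x. conv k f x - conv k g x)"
  using test_fun_conv_integrable[OF k f(1)] test_fun_conv_integrable[OF k f(2)]
  by (auto simp: conv_def right_diff_distrib)

lemma conv_sup:
  assumes k: "test_fun k" and f: "sqint f"
  shows "\<bar>conv k f x\<bar> \<le> n2 k * n2 f"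
proof -
  have "n2 (\<lambda>y. k (x - y)) = n2 k"
    using lborel_integral_reflect[of "\<lambda>y. (k y)\<^sup>2" x] test_fun_measurable[OF k] by (simp add: n2_def)
  then show ?thesis
    using sqint_cauchy_schwarz[OF test_fun_sqint(1)[OF test_fun_reflect[OF k]] f, of x] by (simp add: conv_def)
qed

text \<open>Young's inequality for L1 and L2. Splitting |k| into two square roots and applying
  Cauchy-Schwarz bounds the square of the convolution at x by the L1 norm of k times the integral of
  |k(x - y)| f(y)^2; Tonelli then integrates this in x.\<close>

lemma conv_young:
  fixes f :: "real^'n::finite \<Rightarrow> real"
  assumes k: "test_fun k" and f: "sqint f"
  shows "sqint (conv k f)" "n2 (conv k f) \<le> (\<integral>x. \<bar>k x\<bar> \<partial>lborel) * n2 f"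
proof -
  define A where "A = (\<integral>x. \<bar>k x\<bar> \<partial>lborel)"
  obtain B where B: "\<And>x. \<bar>k x\<bar> \<le> B" using test_fun_bounded[OF k] by auto
  have [measurable]: "k \<in> borel_measurable borel" by (rule test_fun_measurable[OF k])
  have [measurable]: "f \<in> borel_measurable borel" using f by (simp add: sqint_def)
  have fi: "integrable lborel (\<lambda>x. (f x)\<^sup>2)" using f by (simp add: sqint_def)
  have ki: "integrable lborel (\<lambda>x. \<bar>k x\<bar>)" using test_fun_sqint(2)[OF k] by simp
  have A0: "A \<ge> 0" by (simp add: A_def)
  have kfi: "integrable lborel (\<lambda>y. \<bar>k (x - y)\<bar> * (f y)\<^sup>2)" for x
  proof (rule Bochner_Integration.integrable_bound)
    show "integrable lborel (\<lambda>y. B * (f y)\<^sup>2)" using fi by simp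
    show "AE y in lborel. norm (\<bar>k (x - y)\<bar> * (f y)\<^sup>2) \<le> norm (B * (f y)\<^sup>2)"
      using B by (intro AE_I2) (auto simp: abs_mult intro!: mult_right_mono intro: order_trans[OF _ abs_ge_self])
  qed simp
  have pt: "(conv k f x)\<^sup>2 \<le> A * (\<integral>y. \<bar>k (x - y)\<bar> * (f y)\<^sup>2 \<partial>lborel)" for x
  proof -
    have s1: "sqint (\<lambda>y. sqrt \<bar>k (x - y)\<bar>)" unfolding sqint_def
      using lborel_integrable_reflect[OF _ ki, of x] by simp
    have s2: "sqint (\<lambda>y. sqrt \<bar>k (x - y)\<bar> * \<bar>f y\<bar>)" unfolding sqint_def
      using kfi[of x] by (simp add: power_mult_distrib)
    have "\<bar>conv k f x\<bar> \<le> (\<integral>y. \<bar>k (x - y) * f y\<bar> \<partial>lborel)" unfolding conv_def by (rule integral_abs_bound)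
    also have "\<dots> = (\<integral>y. sqrt \<bar>k (x - y)\<bar> * (sqrt \<bar>k (x - y)\<bar> * \<bar>f y\<bar>) \<partial>lborel)"
      by (simp add: abs_mult mult.assoc[symmetric])
    also have "\<dots> \<le> n2 (\<lambda>y. sqrt \<bar>k (x - y)\<bar>) * n2 (\<lambda>y. sqrt \<bar>k (x - y)\<bar> * \<bar>f y\<bar>)"
      using sqint_cauchy_schwarz[OF s1 s2] by linarith
    finally have "\<bar>conv k f x\<bar>\<^sup>2 \<le> (n2 (\<lambda>y. sqrt \<bar>k (x - y)\<bar>) * n2 (\<lambda>y. sqrt \<bar>k (x - y)\<bar> * \<bar>f y\<bar>))\<^sup>2"
      by (intro power_mono) auto
    then have "(conv k f x)\<^sup>2 \<le> (n2 (\<lambda>y. sqrt \<bar>k (x - y)\<bar>) * n2 (\<lambda>y. sqrt \<bar>k (x - y)\<bar> * \<bar>f y\<bar>))\<^sup>2"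
      by simp
    also have "\<dots> = (\<integral>y. \<bar>k (x - y)\<bar> \<partial>lborel) * (\<integral>y. \<bar>k (x - y)\<bar> * (f y)\<^sup>2 \<partial>lborel)"
      by (simp add: power_mult_distrib n2_sq)
    also have "(\<integral>y. \<bar>k (x - y)\<bar> \<partial>lborel) = A" unfolding A_def
      by (rule lborel_integral_reflect) simp
    finally show ?thesis .
  qed
  have nn: "(\<integral>\<^sup>+x. ennreal ((conv k f x)\<^sup>2) \<partial>lborel) \<le> ennreal (A * A * (\<integral>x. (f x)\<^sup>2 \<partial>lborel))"
  proof -
    have kx: "(\<integral>\<^sup>+x. ennreal \<bar>k (x - y)\<bar> \<partial>lborel) = ennreal A" for y
    proof -
      have "integrable lborel (\<lambda>x. \<bar>k (x - y)\<bar>)" using lborel_integrable_shift[OF _ ki, of "-y"] by simp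
      then have "(\<integral>\<^sup>+x. ennreal \<bar>k (x - y)\<bar> \<partial>lborel) = ennreal (\<integral>x. \<bar>k (x - y)\<bar> \<partial>lborel)"
        by (intro nn_integral_eq_integral) auto
      also have "(\<integral>x. \<bar>k (x - y)\<bar> \<partial>lborel) = A"
        using lborel_integral_shift[of "\<lambda>x. \<bar>k x\<bar>" "-y"] by (simp add: A_def)
      finally show ?thesis .
    qed
    have "(\<integral>\<^sup>+x. ennreal ((conv k f x)\<^sup>2) \<partial>lborel) \<le> (\<integral>\<^sup>+x. ennreal A * (\<integral>\<^sup>+y. ennreal (\<bar>k (x - y)\<bar> * (f y)\<^sup>2) \<partial>lborel) \<partial>lborel)"
    proof (rule nn_integral_mono)
      fix x
      have "ennreal ((conv k f x)\<^sup>2) \<le> ennreal (A * (\<integral>y. \<bar>k (x - y)\<bar> * (f y)\<^sup>2 \<partial>lborel))"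
        using pt by (rule ennreal_leI)
      also have "\<dots> = ennreal A * (\<integral>\<^sup>+y. ennreal (\<bar>k (x - y)\<bar> * (f y)\<^sup>2) \<partial>lborel)"
        using kfi[of x] A0 by (subst nn_integral_eq_integral) (auto simp: ennreal_mult)
      finally show "ennreal ((conv k f x)\<^sup>2) \<le> ennreal A * (\<integral>\<^sup>+y. ennreal (\<bar>k (x - y)\<bar> * (f y)\<^sup>2) \<partial>lborel)" .
    qed
    also have "\<dots> = ennreal A * (\<integral>\<^sup>+x. (\<integral>\<^sup>+y. ennreal (\<bar>k (x - y)\<bar> * (f y)\<^sup>2) \<partial>lborel) \<partial>lborel)"
      by (rule nn_integral_cmult) measurable
    also have "(\<integral>\<^sup>+x. (\<integral>\<^sup>+y. ennreal (\<bar>k (x - y)\<bar> * (f y)\<^sup>2) \<partial>lborel) \<partial>lborel) = (\<integral>\<^sup>+y. (\<integral>\<^sup>+x. ennreal (\<bar>k (x - y)\<bar> * (f y)\<^sup>2) \<partial>lborel) \<partial>lborel)"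
      by (rule lborel_pair.Fubini'[symmetric]) measurable
    also have "\<dots> = (\<integral>\<^sup>+y. ennreal A * ennreal ((f y)\<^sup>2) \<partial>lborel)"
    proof (rule nn_integral_cong)
      fix y
      have "(\<integral>\<^sup>+x. ennreal (\<bar>k (x - y)\<bar> * (f y)\<^sup>2) \<partial>lborel) = (\<integral>\<^sup>+x. ennreal \<bar>k (x - y)\<bar> * ennreal ((f y)\<^sup>2) \<partial>lborel)"
        by (simp add: ennreal_mult)
      also have "\<dots> = (\<integral>\<^sup>+x. ennreal \<bar>k (x - y)\<bar> \<partial>lborel) * ennreal ((f y)\<^sup>2)"
        by (rule nn_integral_multc) measurable
      finally show "(\<integral>\<^sup>+x. ennreal (\<bar>k (x - y)\<bar> * (f y)\<^sup>2) \<partial>lborel) = ennreal A * ennreal ((f y)\<^sup>2)"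
        unfolding kx .
    qed
    also have "\<dots> = ennreal A * ennreal (\<integral>x. (f x)\<^sup>2 \<partial>lborel)"
      using fi by (simp add: nn_integral_cmult nn_integral_eq_integral)
    finally show ?thesis using A0 by (simp add: ennreal_mult mult.assoc)
  qed
  have ci: "integrable lborel (\<lambda>x. (conv k f x)\<^sup>2)"
    unfolding integrable_iff_bounded using nn by (auto intro: order.strict_trans1)
  then show "sqint (conv k f)" by (simp add: sqint_def)
  have "ennreal (\<integral>x. (conv k f x)\<^sup>2 \<partial>lborel) \<le> ennreal (A * A * (\<integral>x. (f x)\<^sup>2 \<partial>lborel))"
    using nn ci by (simp add: nn_integral_eq_integral)
  then have "(\<integral>x. (conv k f x)\<^sup>2 \<partial>lborel) \<le> A * A * (\<integral>x. (f x)\<^sup>2 \<partial>lborel)"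
    using A0 by simp
  then have "(n2 (conv k f))\<^sup>2 \<le> (A * n2 f)\<^sup>2" by (simp add: n2_sq power_mult_distrib) (simp add: power2_eq_square)
  then show "n2 (conv k f) \<le> (\<integral>x. \<bar>k x\<bar> \<partial>lborel) * n2 f"
    unfolding A_def[symmetric] by (rule power2_le_imp_le) (use A0 in simp)
qed

text \<open>Fubini turns the pairing with a convolution into an average of pairings with translates.
  The inner integral is bounded by \<open>n2 g * n2 f\<close> uniformly in the translation, hence
  absolute integrability. This form is what links smoothing errors to finite differences.\<close>

lemma conv_pairing:
  fixes f g :: "real^'n::finite \<Rightarrow> real"
  assumes k: "test_fun k" and f: "sqint f" and g: "sqint g"
  shows "(\<integral>x. g x * conv k f x \<partial>lborel) = (\<integral>y. k y * (\<integral>x. g x * f (x - y) \<partial>lborel) \<partial>lborel)"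
    and "integrable lborel (\<lambda>y. k y * (\<integral>x. g x * f (x - y) \<partial>lborel))"
proof -
  have [measurable]: "k \<in> borel_measurable borel" by (rule test_fun_measurable[OF k])
  have [measurable]: "f \<in> borel_measurable borel" "g \<in> borel_measurable borel" using f g by (auto simp: sqint_def)
  have ki: "integrable lborel (\<lambda>x. \<bar>k x\<bar>)" using test_fun_sqint(2)[OF k] by simp
  let ?F = "\<lambda>(y, x). k y * (g x * f (x - y))"
  have in1: "integrable lborel (\<lambda>x. g x * f (x - y))" for y
    using sqint_mult_integrable[OF g sqint_shift[OF f, of "-y"]] by simp
  have b: "(\<integral>x. \<bar>g x * f (x - y)\<bar> \<partial>lborel) \<le> n2 g * n2 f" for y
  proof -
    have "sqint (\<lambda>x. \<bar>g x\<bar>)" "sqint (\<lambda>x. \<bar>f (x - y)\<bar>)" using g sqint_shift[OF f, of "-y"] by (auto simp: sqint_def)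
    from sqint_cauchy_schwarz[OF this] have "(\<integral>x. \<bar>g x\<bar> * \<bar>f (x - y)\<bar> \<partial>lborel) \<le> n2 (\<lambda>x. \<bar>g x\<bar>) * n2 (\<lambda>x. \<bar>f (x - y)\<bar>)" by linarith
    moreover have "n2 (\<lambda>x. \<bar>g x\<bar>) = n2 g" "n2 (\<lambda>x. \<bar>f (x - y)\<bar>) = n2 f"
      using n2_shift[of f "-y"] by (auto simp: n2_def)
    ultimately show ?thesis by (simp add: abs_mult)
  qed
  have int: "integrable (lborel \<Otimes>\<^sub>M lborel) ?F"
  proof (rule lborel_pair.Fubini_integrable)
    show "?F \<in> borel_measurable (lborel \<Otimes>\<^sub>M lborel)" by measurable
    show "AE y in lborel. integrable lborel (\<lambda>x. ?F (y, x))" using in1 by simp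
    show "integrable lborel (\<lambda>y. \<integral>x. norm (?F (y, x)) \<partial>lborel)"
    proof (rule Bochner_Integration.integrable_bound)
      show "integrable lborel (\<lambda>y. n2 g * n2 f * \<bar>k y\<bar>)" using ki by simp
      show "AE y in lborel. norm (\<integral>x. norm (?F (y, x)) \<partial>lborel) \<le> norm (n2 g * n2 f * \<bar>k y\<bar>)"
      proof (rule AE_I2)
        fix y
        have "(\<integral>x. norm (?F (y, x)) \<partial>lborel) = \<bar>k y\<bar> * (\<integral>x. \<bar>g x * f (x - y)\<bar> \<partial>lborel)"
          by (simp add: abs_mult)
        also have "\<dots> \<le> \<bar>k y\<bar> * (n2 g * n2 f)" by (intro mult_left_mono b) simp
        finally show "norm (\<integral>x. norm (?F (y, x)) \<partial>lborel) \<le> norm (n2 g * n2 f * \<bar>k y\<bar>)" by (simp add: mult_ac abs_mult)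
      qed
    qed measurable
  qed
  have "(\<integral>x. (\<integral>y. ?F (y, x) \<partial>lborel) \<partial>lborel) = (\<integral>y. (\<integral>x. ?F (y, x) \<partial>lborel) \<partial>lborel)"
    by (rule lborel_pair.Fubini_integral[of "\<lambda>y x. ?F (y, x)"]) (use int in simp)
  moreover have "(\<integral>y. ?F (y, x) \<partial>lborel) = g x * conv k f x" for x
  proof -
    have "(\<lambda>y. ?F (y, x)) = (\<lambda>y. g x * (k y * f (x - y)))" by (auto simp: mult_ac)
    then show ?thesis unfolding conv_flip[OF test_fun_measurable[OF k] sqint_meas[OF f]] by simp
  qed
  ultimately show "(\<integral>x. g x * conv k f x \<partial>lborel) = (\<integral>y. k y * (\<integral>x. g x * f (x - y) \<partial>lborel) \<partial>lborel)" by simp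
  show "integrable lborel (\<lambda>y. k y * (\<integral>x. g x * f (x - y) \<partial>lborel))"
    using lborel_pair.integrable_fst'[OF int] by simp
qed

section \<open>Dilation and density of test functions\<close>

lemma lborel_integral_scale:
  fixes f :: "'a::euclidean_space \<Rightarrow> real"
  assumes [measurable]: "f \<in> borel_measurable borel" and c: "c > 0"
  shows "(\<integral>x. f (c *\<^sub>R x) \<partial>lborel) = (1 / c ^ DIM('a)) * (\<integral>x. f x \<partial>lborel)"
proof -
  have "(\<integral>x. f x \<partial>lborel) = (\<integral>x. f x \<partial>(density (distr lborel borel (\<lambda>x. 0 + c *\<^sub>R x)) (\<lambda>_. \<bar>c\<bar> ^ DIM('a))))"
    using lborel_affine[of c "0::'a"] c by simp
  also have "\<dots> = c ^ DIM('a) * (\<integral>x. f (c *\<^sub>R x) \<partial>lborel)"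
    using c by (subst integral_density) (auto simp: integral_distr ennreal_power[symmetric])
  finally show ?thesis using c by simp
qed

text \<open>Fixed once and for all, so that every constant computed from it depends on the dimension
  only.\<close>

definition molli :: "real^'n::finite \<Rightarrow> real" where
  "molli = (SOME \<rho>. ctest \<rho> \<and> (\<forall>x. 0 \<le> \<rho> x) \<and> (\<integral>x. \<rho> x \<partial>lborel) = 1)"

lemma molli: "ctest (molli :: real^'n::finite \<Rightarrow> real)" "0 \<le> molli (x :: real^'n)" "(\<integral>x. molli (x :: real^'n) \<partial>lborel) = 1"
proof -
  have "\<exists>\<rho> :: real^'n \<Rightarrow> real. ctest \<rho> \<and> (\<forall>x. 0 \<le> \<rho> x) \<and> (\<integral>x. \<rho> x \<partial>lborel) = 1"
    using mollifier_exists by metis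
  from someI_ex[OF this] show "ctest (molli :: real^'n \<Rightarrow> real)" "0 \<le> molli (x :: real^'n)" "(\<integral>x. molli (x :: real^'n) \<partial>lborel) = 1"
    unfolding molli_def by blast+
qed

text \<open>The prefactor preserves the integral and the L1 norm, hence also the convolution bound
  on L2, at every length scale h.\<close>

definition dil :: "real \<Rightarrow> (real^'n::finite \<Rightarrow> real) \<Rightarrow> real^'n \<Rightarrow> real" where
  "dil h k x = (1 / h ^ CARD('n)) * k ((1 / h) *\<^sub>R x)"

lemma dil_ctest: "h > 0 \<Longrightarrow> ctest k \<Longrightarrow> ctest (dil h k)"
  unfolding dil_def using ctest_affine[of k "1 / h" "1 / h ^ CARD('n)" 0] by simp

lemma dil_test: "h > 0 \<Longrightarrow> test_fun k \<Longrightarrow> test_fun (dil h k)"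
  unfolding dil_def using test_fun_affine[of k "1 / h" "1 / h ^ CARD('n)" 0] by simp

lemma dil_integral:
  fixes k :: "real^'n::finite \<Rightarrow> real"
  assumes "h > 0" and [measurable]: "k \<in> borel_measurable borel" "g \<in> borel_measurable borel"
  shows "(\<integral>x. dil h k x * g x \<partial>lborel) = (\<integral>x. k x * g (h *\<^sub>R x) \<partial>lborel)"
proof -
  have "dil h k (h *\<^sub>R x) * g (h *\<^sub>R x) = (1 / h ^ CARD('n)) * (k x * g (h *\<^sub>R x))" for x
    using assms(1) by (simp add: dil_def)
  then have "(1 / h ^ CARD('n)) * (\<integral>x. k x * g (h *\<^sub>R x) \<partial>lborel) = (\<integral>x. dil h k (h *\<^sub>R x) * g (h *\<^sub>R x) \<partial>lborel)"
    by simp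
  also have "\<dots> = (1 / h ^ CARD('n)) * (\<integral>x. dil h k x * g x \<partial>lborel)"
    using lborel_integral_scale[of "\<lambda>x. dil h k x * g x" h] assms(1) by (simp add: dil_def[abs_def])
  finally show ?thesis using assms(1) by simp
qed

lemma molli_measurable: "(molli :: real^'n::finite \<Rightarrow> real) \<in> borel_measurable borel"
  by (rule test_fun_measurable[OF ctest_test[OF molli(1)]])

lemma dil_molli_integral: "h > 0 \<Longrightarrow> (\<integral>x. dil h molli x \<partial>(lborel :: (real^'n::finite) measure)) = 1"
  using dil_integral[of h "molli :: real^'n \<Rightarrow> real" "\<lambda>_. 1"] molli(3)[where 'n='n] molli_measurable[where 'n='n] by simp

lemma dil_molli_nonneg: "h > 0 \<Longrightarrow> 0 \<le> dil h molli (x :: real^'n::finite)"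
  by (simp add: dil_def molli(2))

section \<open>Density of continuous functions and mollification\<close>

lemma closed_open_approx:
  fixes A :: "'a::euclidean_space set"
  assumes A: "A \<in> sets borel" and e: "e > 0"
  obtains C U where "closed C" "open U" "C \<subseteq> A" "A \<subseteq> U" "emeasure lborel (U - C) < ennreal e"
proof -
  obtain U where U: "open U" "A \<subseteq> U" "emeasure lborel (U - A) < ennreal (e / 2)"
    using outer_regular_lborel[OF A, of "e / 2"] e by auto
  obtain V where V: "open V" "- A \<subseteq> V" "emeasure lborel (V - (- A)) < ennreal (e / 2)"
    using outer_regular_lborel[of "- A" "e / 2"] A e by (auto simp: sets.compl_sets)
  have "U - (- V) \<subseteq> (U - A) \<union> (V - (- A))" by auto
  then have "emeasure lborel (U - (- V)) \<le> emeasure lborel ((U - A) \<union> (V - (- A)))"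
    using U V A by (intro emeasure_mono) auto
  also have "\<dots> \<le> emeasure lborel (U - A) + emeasure lborel (V - (- A))"
    using U V A by (intro emeasure_subadditive) auto
  also have "\<dots> < ennreal (e / 2) + ennreal (e / 2)" using U V by (intro add_strict_mono)
  also have "\<dots> = ennreal e" using e by (simp flip: ennreal_plus)
  finally show ?thesis using U V by (intro that[of "- V" U]) auto
qed

text \<open>Induction over integrable functions. For an indicator function, Urysohn's lemma
  interpolates between a closed subset and an open superset whose difference has small measure; sums
  and dominated limits follow by the triangle inequality.\<close>

lemma continuous_dense_L1:
  fixes f :: "'a::euclidean_space \<Rightarrow> real"
  assumes "integrable lborel f"
  shows "\<forall>e>0. \<exists>g. continuous_on UNIV g \<and> integrable lborel g \<and> (\<integral>x. \<bar>f x - g x\<bar> \<partial>lborel) < e"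
  using assms
proof (induction f rule: integrable_induct)
  case (base A c)
  show ?case
  proof safe
    fix e :: real assume e: "e > 0"
    define d where "d = e / (\<bar>c\<bar> + 1)"
    have d: "d > 0" using e by (simp add: d_def add_nonneg_pos)
    have Ab: "A \<in> sets borel" using base by simp
    obtain C U where CU: "closed C" "open U" "C \<subseteq> A" "A \<subseteq> U" "emeasure lborel (U - C) < ennreal d"
      using closed_open_approx[OF Ab d] by blast
    obtain \<phi> :: "'a \<Rightarrow> real" where \<phi>: "continuous_on UNIV \<phi>" "\<And>x. \<phi> x \<in> closed_segment 1 0" "\<And>x. x \<in> C \<Longrightarrow> \<phi> x = 1" "\<And>x. x \<in> - U \<Longrightarrow> \<phi> x = 0"
      using Urysohn[of C "- U" "1::real" 0] CU by (metis Compl_disjoint closed_Compl compl_le_compl_iff disjoint_eq_subset_Compl double_compl order_trans)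
    have r: "0 \<le> \<phi> x" "\<phi> x \<le> 1" for x using \<phi>(2)[of x] by (auto simp: closed_segment_eq_real_ivl)
    have [measurable]: "\<phi> \<in> borel_measurable borel" using \<phi>(1) by (rule borel_measurable_continuous_onI)
    have [measurable]: "A \<in> sets borel" "U \<in> sets borel" "C \<in> sets borel" using Ab CU by auto
    have UC: "emeasure lborel (U - C) < \<infinity>" using CU(5) by (rule less_trans) simp
    have iUC: "integrable lborel (indicator (U - C) :: 'a \<Rightarrow> real)"
      using UC by (intro integrable_real_indicator) auto
    have iA: "integrable lborel (indicator A :: 'a \<Rightarrow> real)"
      using base by (intro integrable_real_indicator) auto
    have dif: "\<bar>indicator A x - \<phi> x\<bar> \<le> indicator (U - C) x" for x
      using r[of x] \<phi>(3)[of x] \<phi>(4)[of x] CU(3,4) by (auto simp: indicator_def)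
    have i1: "integrable lborel (\<lambda>x. indicator A x - \<phi> x)"
      by (rule Bochner_Integration.integrable_bound[OF iUC]) (use dif in auto)
    have "integrable lborel (\<lambda>x. indicator A x - (indicator A x - \<phi> x))" by (intro Bochner_Integration.integrable_diff iA i1)
    then have i\<phi>: "integrable lborel \<phi>" by simp
    have "(\<integral>x. \<bar>indicator A x - \<phi> x\<bar> \<partial>lborel) \<le> (\<integral>x. indicator (U - C) x \<partial>lborel)"
      using i1 iUC dif by (intro integral_mono) auto
    also have "\<dots> = measure lborel (U - C)" by simp
    also have "\<dots> < d" using CU(5) UC d by (simp add: emeasure_eq_ennreal_measure ennreal_less_iff)
    finally have *: "(\<integral>x. \<bar>indicator A x - \<phi> x\<bar> \<partial>lborel) < d" .
    show "\<exists>g. continuous_on UNIV g \<and> integrable lborel g \<and> (\<integral>x. \<bar>indicator A x *\<^sub>R c - g x\<bar> \<partial>lborel) < e"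
    proof (intro exI[of _ "\<lambda>x. c * \<phi> x"] conjI)
      show "continuous_on UNIV (\<lambda>x. c * \<phi> x)" using \<phi>(1) by (intro continuous_intros)
      show "integrable lborel (\<lambda>x. c * \<phi> x)" using i\<phi> by simp
      have "(\<lambda>x. \<bar>indicator A x *\<^sub>R c - c * \<phi> x\<bar>) = (\<lambda>x. \<bar>c\<bar> * \<bar>indicator A x - \<phi> x\<bar>)"
        by (auto simp: abs_mult[symmetric] algebra_simps)
      then have "(\<integral>x. \<bar>indicator A x *\<^sub>R c - c * \<phi> x\<bar> \<partial>lborel) = \<bar>c\<bar> * (\<integral>x. \<bar>indicator A x - \<phi> x\<bar> \<partial>lborel)"
        by simp
      also have "\<dots> \<le> \<bar>c\<bar> * d" using * by (intro mult_left_mono) auto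
      also have "\<dots> < (\<bar>c\<bar> + 1) * d" using d by (simp add: distrib_right)
      also have "\<dots> = e" by (simp add: d_def add_nonneg_eq_0_iff)
      finally show "(\<integral>x. \<bar>indicator A x *\<^sub>R c - c * \<phi> x\<bar> \<partial>lborel) < e" .
    qed
  qed
next
  case (add f g)
  show ?case
  proof safe
    fix e :: real assume "e > 0"
    then have e2: "e / 2 > 0" by simp
    obtain p where p: "continuous_on UNIV p" "integrable lborel p" "(\<integral>x. \<bar>f x - p x\<bar> \<partial>lborel) < e / 2"
      using add(3)[rule_format, OF e2] by blast
    obtain q where q: "continuous_on UNIV q" "integrable lborel q" "(\<integral>x. \<bar>g x - q x\<bar> \<partial>lborel) < e / 2"
      using add(4)[rule_format, OF e2] by blast
    have "(\<integral>x. \<bar>f x + g x - (p x + q x)\<bar> \<partial>lborel) \<le> (\<integral>x. \<bar>f x - p x\<bar> + \<bar>g x - q x\<bar> \<partial>lborel)"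
      using p q add by (intro integral_mono) auto
    also have "\<dots> = (\<integral>x. \<bar>f x - p x\<bar> \<partial>lborel) + (\<integral>x. \<bar>g x - q x\<bar> \<partial>lborel)"
      using p q add by (intro Bochner_Integration.integral_add) auto
    also have "\<dots> < e" using p q by simp
    finally show "\<exists>h. continuous_on UNIV h \<and> integrable lborel h \<and> (\<integral>x. \<bar>f x + g x - h x\<bar> \<partial>lborel) < e"
      using p q by (intro exI[of _ "\<lambda>x. p x + q x"]) (auto intro!: continuous_intros)
  qed
next
  case (lim f s)
  show ?case
  proof safe
    fix e :: real assume e: "e > 0"
    have [measurable]: "f \<in> borel_measurable borel" using borel_measurable_integrable[OF lim(4)] by simp
    have [measurable]: "s i \<in> borel_measurable borel" for i using borel_measurable_integrable[OF lim(1)] by simp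
    have "(\<lambda>i. \<integral>x. \<bar>f x - s i x\<bar> \<partial>lborel) \<longlonglongrightarrow> (\<integral>x. 0 \<partial>(lborel :: 'a measure))"
    \<comment> \<open>The induction rule provides approximations bounded by 2 |f|, whence the
      majorant 3 |f|.\<close>
    proof (rule integral_dominated_convergence[where w="\<lambda>x. 3 * \<bar>f x\<bar>"])
      show "integrable lborel (\<lambda>x. 3 * \<bar>f x\<bar>)" using lim by simp
      show "AE x in lborel. (\<lambda>i. \<bar>f x - s i x\<bar>) \<longlonglongrightarrow> 0"
      proof (intro AE_I2)
        fix x
        have "(\<lambda>i. \<bar>f x - s i x\<bar>) \<longlonglongrightarrow> \<bar>f x - f x\<bar>" using lim(2)[of x] by (intro tendsto_intros) auto
        then show "(\<lambda>i. \<bar>f x - s i x\<bar>) \<longlonglongrightarrow> 0" by simp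
      qed
      show "AE x in lborel. norm \<bar>f x - s i x\<bar> \<le> 3 * \<bar>f x\<bar>" for i
      proof (intro AE_I2)
        fix x
        have "\<bar>s i x\<bar> \<le> 2 * \<bar>f x\<bar>" using lim(3)[of x i] by simp
        then show "norm \<bar>f x - s i x\<bar> \<le> 3 * \<bar>f x\<bar>" by simp
      qed
    qed simp_all
    then have "(\<lambda>i. \<integral>x. \<bar>f x - s i x\<bar> \<partial>lborel) \<longlonglongrightarrow> 0" by simp
    then have "\<forall>\<^sub>F i in sequentially. (\<integral>x. \<bar>f x - s i x\<bar> \<partial>lborel) < e / 2" using e by (intro order_tendstoD) auto
    then obtain i where i: "(\<integral>x. \<bar>f x - s i x\<bar> \<partial>lborel) < e / 2" by (auto simp: eventually_sequentially)
    obtain p where p: "continuous_on UNIV p" "integrable lborel p" "(\<integral>x. \<bar>s i x - p x\<bar> \<partial>lborel) < e / 2"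
      using lim(5)[of i, rule_format, of "e / 2"] e by auto
    have "(\<integral>x. \<bar>f x - p x\<bar> \<partial>lborel) \<le> (\<integral>x. \<bar>f x - s i x\<bar> + \<bar>s i x - p x\<bar> \<partial>lborel)"
      using p lim by (intro integral_mono) auto
    also have "\<dots> = (\<integral>x. \<bar>f x - s i x\<bar> \<partial>lborel) + (\<integral>x. \<bar>s i x - p x\<bar> \<partial>lborel)"
      using p lim by (intro Bochner_Integration.integral_add) auto
    also have "\<dots> < e" using p i by simp
    finally show "\<exists>h. continuous_on UNIV h \<and> integrable lborel h \<and> (\<integral>x. \<bar>f x - h x\<bar> \<partial>lborel) < e"
      using p by blast
  qed
qed

text \<open>Reduction to L1: after truncating f in space and in size at level n, and cutting and
  clamping the L1 approximation in the same way, the squared difference is at most 2 n times the L1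
  error density.\<close>

lemma cc_dense_L2:
  fixes f :: "'a::euclidean_space \<Rightarrow> real"
  assumes f: "sqint f" and e: "e > 0"
  obtains g R where "continuous_on UNIV g" "\<And>x. R < norm x \<Longrightarrow> g x = 0" "sqint g" "n2 (\<lambda>x. f x - g x) < e"
proof -
  have [measurable]: "f \<in> borel_measurable borel" using f by (simp add: sqint_def)
  define F where "F = (\<lambda>n x. if norm x \<le> real n \<and> \<bar>f x\<bar> \<le> real n then f x else 0)"
  have [measurable]: "F n \<in> borel_measurable borel" for n unfolding F_def by measurable
  have Fb: "\<bar>F n x\<bar> \<le> real n" "real n < norm x \<Longrightarrow> F n x = 0" for n x by (auto simp: F_def)
  have sF: "sqint (F n)" for n
    by (rule bounded_support_sqint(1)[where B="real n" and R="real n"]) (simp_all add: Fb)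
  have iF: "integrable lborel (F n)" for n
    by (rule bounded_support_sqint(2)[where B="real n" and R="real n"]) (simp_all add: Fb)
  have "(\<lambda>n. \<integral>x. (f x - F n x)\<^sup>2 \<partial>lborel) \<longlonglongrightarrow> (\<integral>x. 0 \<partial>(lborel::'a measure))"
  proof (rule integral_dominated_convergence[where w="\<lambda>x. (f x)\<^sup>2"])
    show "integrable lborel (\<lambda>x. (f x)\<^sup>2)" using f by (simp add: sqint_def)
    show "AE x in lborel. (\<lambda>n. (f x - F n x)\<^sup>2) \<longlonglongrightarrow> 0"
    proof (intro AE_I2 tendsto_eventually)
      fix x
      obtain k where "max (norm x) \<bar>f x\<bar> \<le> real k" using real_arch_simple by blast
      then show "\<forall>\<^sub>F n in sequentially. (f x - F n x)\<^sup>2 = 0"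
        by (intro eventually_sequentiallyI[of k]) (auto simp: F_def)
    qed
    show "AE x in lborel. norm ((f x - F n x)\<^sup>2) \<le> (f x)\<^sup>2" for n by (auto simp: F_def)
  qed simp_all
  then have "(\<lambda>n. sqrt (\<integral>x. (f x - F n x)\<^sup>2 \<partial>lborel)) \<longlonglongrightarrow> sqrt 0" by (intro tendsto_real_sqrt) simp
  then have "(\<lambda>n. n2 (\<lambda>x. f x - F n x)) \<longlonglongrightarrow> 0" by (simp add: n2_def)
  then have "\<forall>\<^sub>F n in sequentially. n2 (\<lambda>x. f x - F n x) < e / 2" using e by (intro order_tendstoD) auto
  then obtain n where n: "n2 (\<lambda>x. f x - F n x) < e / 2" by (auto simp: eventually_sequentially)
  \<comment> \<open>Makes 2 n d at most (e / 2)^2; the summand 1 covers n = 0.\<close>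
  define d where "d = (e / 2)\<^sup>2 / (2 * real n + 1)"
  have d: "d > 0" using e by (simp add: d_def add_nonneg_pos)
  obtain p where p: "continuous_on UNIV p" "integrable lborel p" "(\<integral>x. \<bar>F n x - p x\<bar> \<partial>lborel) < d"
    using continuous_dense_L1[OF iF[of n]] d by blast
  have [measurable]: "p \<in> borel_measurable borel" using p(1) by (rule borel_measurable_continuous_onI)
  \<comment> \<open>A continuous cut-off, equal to 1 on the ball of radius n and to 0 outside the
    ball of radius n + 1.\<close>
  define ct where "ct = (\<lambda>x::'a. max 0 (min 1 (real n + 1 - norm x)))"
  define g where "g = (\<lambda>x. ct x * max (- real n) (min (real n) (p x)))"
  have cg: "continuous_on UNIV g" unfolding g_def ct_def by (intro continuous_intros p(1))
  have [measurable]: "g \<in> borel_measurable borel" using cg by (rule borel_measurable_continuous_onI)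
  have clampb: "\<bar>max (- real n) (min (real n) y)\<bar> \<le> real n" for y by auto
  have ct01: "0 \<le> ct x" "ct x \<le> 1" for x by (auto simp: ct_def)
  have gb: "\<bar>g x\<bar> \<le> real n" for x
    unfolding g_def abs_mult using mult_mono[OF _ clampb[of "p x"], of "\<bar>ct x\<bar>" 1] ct01[of x] by simp
  have gs: "real n + 1 < norm x \<Longrightarrow> g x = 0" for x by (simp add: g_def ct_def)
  have sg: "sqint g" by (rule bounded_support_sqint(1)[OF _ gb gs]) simp_all
  have pt: "(F n x - g x)\<^sup>2 \<le> 2 * real n * \<bar>F n x - p x\<bar>" for x
  proof -
    have 1: "\<bar>F n x - g x\<bar> \<le> \<bar>F n x - p x\<bar>"
    proof (cases "norm x \<le> real n")
      case True
      then have "ct x = 1" by (simp add: ct_def)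
      then show ?thesis using Fb(1)[of n x] by (auto simp: g_def)
    next
      case False
      then have "F n x = 0" by (simp add: F_def)
      moreover have "\<bar>g x\<bar> \<le> \<bar>p x\<bar>"
      proof -
        have "\<bar>g x\<bar> \<le> 1 * \<bar>max (- real n) (min (real n) (p x))\<bar>"
          unfolding g_def abs_mult using ct01[of x] by (intro mult_right_mono) auto
        also have "\<dots> \<le> \<bar>p x\<bar>" by auto
        finally show ?thesis .
      qed
      ultimately show ?thesis by simp
    qed
    have 2: "\<bar>F n x - g x\<bar> \<le> 2 * real n" using Fb(1)[of n x] gb[of x] by linarith
    have "(F n x - g x)\<^sup>2 = \<bar>F n x - g x\<bar> * \<bar>F n x - g x\<bar>" by (simp add: power2_eq_square)
    also have "\<dots> \<le> 2 * real n * \<bar>F n x - p x\<bar>" using 1 2 by (intro mult_mono) auto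
    finally show ?thesis .
  qed
  have "(n2 (\<lambda>x. F n x - g x))\<^sup>2 \<le> (\<integral>x. 2 * real n * \<bar>F n x - p x\<bar> \<partial>lborel)"
    unfolding n2_sq using sqint_diff[OF sF[of n] sg] iF[of n] p(2) pt by (intro integral_mono) (auto simp: sqint_def)
  also have "\<dots> = 2 * real n * (\<integral>x. \<bar>F n x - p x\<bar> \<partial>lborel)" by simp
  also have "\<dots> \<le> 2 * real n * d" using p(3) by (intro mult_left_mono) auto
  also have "\<dots> \<le> (2 * real n + 1) * d" using d by (intro mult_right_mono) auto
  also have "\<dots> = (e / 2)\<^sup>2" unfolding d_def by (simp add: add_nonneg_eq_0_iff)
  finally have "n2 (\<lambda>x. F n x - g x) \<le> e / 2" by (rule power2_le_imp_le) (use e in simp)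
  moreover have "n2 (\<lambda>x. (f x - F n x) + (F n x - g x)) \<le> n2 (\<lambda>x. f x - F n x) + n2 (\<lambda>x. F n x - g x)"
    by (intro n2_add sqint_diff f sF sg)
  ultimately have "n2 (\<lambda>x. f x - g x) < e" using n by simp
  then show ?thesis using that[OF cg gs sg] by blast
qed

lemma n2_bounded_support:
  fixes f :: "'a::euclidean_space \<Rightarrow> real"
  assumes "\<And>x. \<bar>f x\<bar> \<le> B" "\<And>x. R < norm x \<Longrightarrow> f x = 0" "B \<ge> 0"
  shows "n2 f \<le> B * sqrt (measure lborel (cball (0::'a) R))"
proof -
  have fin: "emeasure lborel (cball (0::'a) R) < \<infinity>" by (rule emeasure_lborel_cball_finite)
  have "(\<integral>x. (f x)\<^sup>2 \<partial>lborel) \<le> (\<integral>x. B\<^sup>2 * indicator (cball (0::'a) R) x \<partial>lborel)"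
  proof (rule integral_mono')
    show "integrable lborel (\<lambda>x::'a. B\<^sup>2 * indicator (cball 0 R) x)"
      using fin by (intro integrable_mult_right integrable_real_indicator) auto
    show "(f x)\<^sup>2 \<le> B\<^sup>2 * indicator (cball 0 R) x" for x
    proof (cases "norm x \<le> R")
      case True
      have "\<bar>f x\<bar> \<le> \<bar>B\<bar>" using assms(1)[of x] by linarith
      then show ?thesis using True by (simp add: abs_le_square_iff)
    qed (use assms(2)[of x] in auto)
  qed simp
  also have "\<dots> = B\<^sup>2 * measure lborel (cball (0::'a) R)" by simp
  finally have "n2 f \<le> sqrt (B\<^sup>2 * measure lborel (cball (0::'a) R))" unfolding n2_def by (rule real_sqrt_le_mono)
  then show ?thesis using assms(3) by (simp add: real_sqrt_mult)
qed

text \<open>Uniform continuity bounds the error pointwise, and the error lives in a fixed ball, so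
  the supremum bound gives an L2 bound.\<close>

lemma mollify_cc:
  fixes g :: "real^'n::finite \<Rightarrow> real"
  assumes c: "continuous_on UNIV g" and s: "\<And>x. R < norm x \<Longrightarrow> g x = 0" and e: "e > 0"
  shows "\<exists>h0>0. \<forall>h. 0 < h \<and> h < h0 \<longrightarrow> n2 (\<lambda>x. conv (dil h molli) g x - g x) < e"
proof -
  have [measurable]: "g \<in> borel_measurable borel" using c by (rule borel_measurable_continuous_onI)
  obtain S0 where S0: "\<And>x::real^'n. S0 < norm x \<Longrightarrow> molli x = 0"
    using ctest_test[OF molli(1)[where 'n='n]] unfolding test_fun_def by blast
  define S where "S = max S0 1"
  have S: "molli x = 0" if "S < norm x" for x :: "real^'n" using S0[of x] that by (simp add: S_def)
  have S1: "S \<ge> 1" by (simp add: S_def)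
  define R1 where "R1 = max R 0 + 1"
  define V where "V = sqrt (measure lborel (cball (0::real^'n) R1))"
  define e' where "e' = e / (2 * (V + 1))"
  have V0: "V \<ge> 0" by (simp add: V_def)
  have e': "e' > 0" using e V0 by (simp add: e'_def)
  have "uniformly_continuous_on (cball (0::real^'n) (R1 + 1)) g"
    by (intro compact_uniformly_continuous continuous_on_subset[OF c]) auto
  then obtain d where d: "d > 0" "\<And>x y. x \<in> cball 0 (R1 + 1) \<Longrightarrow> y \<in> cball 0 (R1 + 1) \<Longrightarrow> dist y x < d \<Longrightarrow> dist (g y) (g x) < e'"
    unfolding uniformly_continuous_on_def using e' by metis
  \<comment> \<open>Below this value the support radius h S of the kernel is less than 1, so
    supports grow by at most 1, and less than the modulus of continuity d.\<close>
  define h0 where "h0 = min 1 d / S"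
  have h0: "h0 > 0" using d S1 by (simp add: h0_def)
  have "n2 (\<lambda>x. conv (dil h molli) g x - g x) < e" if h: "0 < h" "h < h0" for h
  proof -
    have hS: "h * S < 1" "h * S < d" using h S1 by (auto simp: h0_def less_divide_eq)
    let ?k = "dil h molli :: real^'n \<Rightarrow> real"
    have kt: "test_fun ?k" by (rule dil_test[OF h(1) ctest_test[OF molli(1)]])
    have [measurable]: "?k \<in> borel_measurable borel" by (rule test_fun_measurable[OF kt])
    have ks: "?k y = 0" if "h * S < norm y" for y
      using S[of "(1/h) *\<^sub>R y"] that h by (simp add: dil_def less_divide_eq mult.commute)
    have near: "\<bar>g (x - y) - g x\<bar> \<le> e'" if y: "norm y \<le> h * S" for x y
    proof (cases "norm x \<le> R1")
      case True
      then have "norm (x - y) \<le> R1 + 1" using norm_triangle_ineq4[of x y] y hS by linarith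
      then show ?thesis using d(2)[of x "x - y"] True y hS by (auto simp: dist_norm norm_minus_commute)
    next
      case False
      then have "R < norm x" "R < norm (x - y)" using norm_triangle_ineq2[of x y] y hS by (auto simp: R1_def)
      then show ?thesis using s e' by simp
    qed
    have ki: "integrable lborel ?k" by (rule test_fun_sqint(2)[OF kt])
    obtain B where B: "\<And>x. \<bar>g x\<bar> \<le> B"
    proof -
      have "compact (g ` cball 0 R)" by (intro compact_continuous_image continuous_on_subset[OF c]) auto
      from compact_imp_bounded[OF this] obtain B where "\<forall>x\<in>cball 0 R. \<bar>g x\<bar> \<le> B" by (auto simp: bounded_iff)
      then have "\<bar>g x\<bar> \<le> max B 0" for x using s[of x] by (cases "norm x \<le> R") (force simp: max_def)+
      then show ?thesis by (rule that)
    qed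
    have kgi: "integrable lborel (\<lambda>y. ?k y * g (x - y))" for x
    proof (rule Bochner_Integration.integrable_bound)
      show "integrable lborel (\<lambda>y. B * ?k y)" using ki by simp
      show "AE y in lborel. norm (?k y * g (x - y)) \<le> norm (B * ?k y)"
      proof (intro AE_I2)
        fix y
        have "\<bar>?k y\<bar> * \<bar>g (x - y)\<bar> \<le> \<bar>?k y\<bar> * \<bar>B\<bar>" using B[of "x-y"] by (intro mult_left_mono) auto
        then show "norm (?k y * g (x - y)) \<le> norm (B * ?k y)" by (simp add: abs_mult mult.commute)
      qed
    qed simp
    have b: "\<bar>conv ?k g x - g x\<bar> \<le> e'" for x
    proof -
      have "g x = (\<integral>y. ?k y * g x \<partial>lborel)" using dil_molli_integral[OF h(1), where 'n='n] by simp
      then have "conv ?k g x - g x = (\<integral>y. ?k y * g (x - y) - ?k y * g x \<partial>lborel)"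
        using kgi ki by (subst conv_flip) auto
      then have "\<bar>conv ?k g x - g x\<bar> \<le> (\<integral>y. \<bar>?k y * g (x - y) - ?k y * g x\<bar> \<partial>lborel)"
        by (simp only: integral_abs_bound)
      also have "\<dots> \<le> (\<integral>y. e' * ?k y \<partial>lborel)"
      proof (rule integral_mono)
        show "integrable lborel (\<lambda>y. \<bar>?k y * g (x - y) - ?k y * g x\<bar>)" using kgi ki by auto
        show "integrable lborel (\<lambda>y. e' * ?k y)" using ki by simp
        show "\<bar>?k y * g (x - y) - ?k y * g x\<bar> \<le> e' * ?k y" for y
        proof (cases "norm y \<le> h * S")
          case True
          have "\<bar>?k y * g (x - y) - ?k y * g x\<bar> = ?k y * \<bar>g (x - y) - g x\<bar>"
            using dil_molli_nonneg[OF h(1), of y] by (simp add: right_diff_distrib[symmetric] abs_mult)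
          also have "\<dots> \<le> ?k y * e'" using near[OF True] dil_molli_nonneg[OF h(1), of y] by (intro mult_left_mono)
          finally show ?thesis by (simp add: mult.commute)
        qed (use ks[of y] in simp)
      qed
      also have "\<dots> = e'" using dil_molli_integral[OF h(1), where 'n='n] by simp
      finally show ?thesis .
    qed
    have z: "conv ?k g x - g x = 0" if x: "R1 < norm x" for x
    proof -
      have "(\<lambda>y. ?k y * g (x - y)) = (\<lambda>y. 0)"
      proof
        fix y show "?k y * g (x - y) = 0"
        proof (cases "norm y \<le> h * S")
          case True
          then have "R < norm (x - y)" using norm_triangle_ineq2[of x y] x hS by (auto simp: R1_def)
          then show ?thesis using s by simp
        qed (use ks[of y] in simp)
      qed
      moreover have "g x = 0" using s[of x] x by (simp add: R1_def)
      moreover have "conv ?k g x = (\<integral>y. ?k y * g (x - y) \<partial>lborel)" by (rule conv_flip) auto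
      ultimately show ?thesis by simp
    qed
    have "n2 (\<lambda>x. conv ?k g x - g x) \<le> e' * V"
      unfolding V_def by (rule n2_bounded_support[OF b z less_imp_le[OF e']])
    also have "\<dots> < e" using e V0 by (simp add: e'_def field_simps add_nonneg_pos)
    finally show ?thesis .
  qed
  then show ?thesis using h0 by blast
qed

lemma dil_molli_L1: "h > 0 \<Longrightarrow> (\<integral>x. \<bar>dil h molli x\<bar> \<partial>(lborel :: (real^'n::finite) measure)) = 1"
  using dil_molli_integral[of h, where 'n='n] dil_molli_nonneg[where 'n='n and h=h] by simp

text \<open>Approximation by a continuous, compactly supported g: the mollifier has L1 norm 1, so it
  does not enlarge the error f - g.\<close>

lemma mollify_L2:
  fixes f :: "real^'n::finite \<Rightarrow> real"
  assumes f: "sqint f" and e: "e > 0"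
  shows "\<exists>h0>0. \<forall>h. 0 < h \<and> h < h0 \<longrightarrow> n2 (\<lambda>x. conv (dil h molli) f x - f x) < e"
proof -
  obtain g R where g: "continuous_on UNIV g" "\<And>x. R < norm x \<Longrightarrow> g x = 0" "sqint g" "n2 (\<lambda>x. f x - g x) < e / 3"
    using cc_dense_L2[OF f, of "e / 3"] e by auto
  obtain h0 where h0: "h0 > 0" "\<And>h. 0 < h \<Longrightarrow> h < h0 \<Longrightarrow> n2 (\<lambda>x. conv (dil h molli) g x - g x) < e / 3"
    using mollify_cc[of g R "e / 3"] g(1,2) e by (metis divide_pos_pos zero_less_numeral)
  have "n2 (\<lambda>x. conv (dil h molli) f x - f x) < e" if h: "0 < h" "h < h0" for h
  proof -
    let ?k = "dil h molli :: real^'n \<Rightarrow> real"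
    have kt: "test_fun ?k" by (rule dil_test[OF h(1) ctest_test[OF molli(1)]])
    note fg = sqint_diff[OF f g(3)]
    have "n2 (conv ?k (\<lambda>x. f x - g x)) \<le> n2 (\<lambda>x. f x - g x)"
      using conv_young(2)[OF kt fg] dil_molli_L1[OF h(1), where 'n='n] by simp
    then have 1: "n2 (\<lambda>x. conv ?k f x - conv ?k g x) < e / 3" using g(4) by (simp add: conv_diff[OF kt f g(3)])
    have s1: "sqint (\<lambda>x. conv ?k f x - conv ?k g x)" and s2: "sqint (\<lambda>x. conv ?k g x - g x)"
      by (intro sqint_diff conv_young(1)[OF kt] f g(3))+
    have "n2 (\<lambda>x. (conv ?k f x - conv ?k g x) + (conv ?k g x - g x) - (f x - g x)) \<le>
      n2 (\<lambda>x. (conv ?k f x - conv ?k g x) + (conv ?k g x - g x)) + n2 (\<lambda>x. f x - g x)"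
      by (intro n2_diff sqint_add s1 s2 fg)
    also have "\<dots> \<le> n2 (\<lambda>x. conv ?k f x - conv ?k g x) + n2 (\<lambda>x. conv ?k g x - g x) + n2 (\<lambda>x. f x - g x)"
      using n2_add[OF s1 s2] by simp
    also have "\<dots> < e" using 1 h0(2)[OF h] g(4) by simp
    finally show ?thesis by (simp add: algebra_simps)
  qed
  then show ?thesis using h0(1) by blast
qed

lemma test_dense_L2:
  fixes f :: "real^'n::finite \<Rightarrow> real"
  assumes f: "sqint f" and e: "e > 0"
  obtains \<theta> where "test_fun \<theta>" "n2 (\<lambda>x. f x - \<theta> x) < e"
proof -
  obtain g R where g: "continuous_on UNIV g" "\<And>x. R < norm x \<Longrightarrow> g x = 0" "sqint g" "n2 (\<lambda>x. f x - g x) < e / 2"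
    using cc_dense_L2[OF f, of "e / 2"] e by auto
  obtain h0 where h0: "h0 > 0" "\<And>h. 0 < h \<Longrightarrow> h < h0 \<Longrightarrow> n2 (\<lambda>x. conv (dil h molli) g x - g x) < e / 2"
    using mollify_cc[of g R "e / 2"] g(1,2) e by (metis divide_pos_pos zero_less_numeral)
  define h where "h = h0 / 2"
  have h: "0 < h" "h < h0" using h0 by (auto simp: h_def)
  let ?k = "dil h molli :: real^'n \<Rightarrow> real"
  have kt: "test_fun ?k" by (rule dil_test[OF h(1) ctest_test[OF molli(1)]])
  have gi: "integrable lborel g"
  proof -
    have "(\<lambda>x. indicator (cball 0 R) x * g x) = g" using g(2) by (auto simp: indicator_def fun_eq_iff not_le)
    then show ?thesis using sqint_indicator_ball(2)[OF g(3), of R] by simp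
  qed
  have "test_fun (conv ?k g)" by (rule conv_test_fun[OF kt gi g(2)])
  moreover have "n2 (\<lambda>x. f x - conv ?k g x) < e"
  proof -
    have "n2 (\<lambda>x. (f x - g x) - (conv ?k g x - g x)) \<le> n2 (\<lambda>x. f x - g x) + n2 (\<lambda>x. conv ?k g x - g x)"
      by (intro n2_diff sqint_diff f g(3) conv_young(1)[OF kt])
    then show ?thesis using h0(2)[OF h] g(4) by simp
  qed
  ultimately show ?thesis by (rule that)
qed

section \<open>Smoothing error in terms of higher derivatives\<close>

text \<open>The pairing of an L2 function with a translate of \<open>\<xi>\<close> is differentiable
  in the translation: for bounded shifts only the values of u in a fixed ball matter, so the pairing
  is a convolution with an integrable function. The mean value inequality then applies.\<close>

lemma pairing_step_axis:
  fixes u \<xi> :: "real^'n::finite \<Rightarrow> real"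
  assumes u: "sqint u" and \<xi>: "test_fun \<xi>"
    and B: "\<And>a. \<bar>\<integral>x. u x * pd [i] \<xi> (x + a) \<partial>lborel\<bar> \<le> B"
  shows "\<bar>(\<integral>x. u x * \<xi> (x + (c + r *\<^sub>R axis i 1)) \<partial>lborel) - (\<integral>x. u x * \<xi> (x + c) \<partial>lborel)\<bar> \<le> B * \<bar>r\<bar>"
proof -
  obtain R where R: "\<And>x. R < norm x \<Longrightarrow> \<xi> x = 0" using \<xi> by (auto simp: test_fun_def)
  \<comment> \<open>This ball contains the support of every translate that occurs between c and c +
    r e_i.\<close>
  define Q where "Q = \<bar>R\<bar> + norm c + \<bar>r\<bar>"
  define f where "f = (\<lambda>x. indicator (cball 0 Q) x * u x)"
  have f: "integrable lborel f" unfolding f_def by (rule sqint_indicator_ball(2)[OF u])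
  have fm[measurable]: "f \<in> borel_measurable borel" using borel_measurable_integrable[OF f] by simp
  have um[measurable]: "u \<in> borel_measurable borel" using u by (simp add: sqint_def)
  have f': "integrable lborel (\<lambda>y. f (- y))" using lborel_integrable_reflect[OF fm f, of 0] by simp
  have eq: "(\<integral>x. u x * pd js \<xi> (x + (c + s *\<^sub>R axis i 1)) \<partial>lborel) = conv (pd js \<xi>) (\<lambda>y. f (- y)) (c + s *\<^sub>R axis i 1)"
    if s: "\<bar>s\<bar> \<le> \<bar>r\<bar>" for s js
  proof -
    have [measurable]: "pd js \<xi> \<in> borel_measurable borel" by (rule test_fun_measurable[OF test_fun_pd[OF \<xi>]])
    have "u x * pd js \<xi> (x + (c + s *\<^sub>R axis i 1)) = pd js \<xi> (c + s *\<^sub>R axis i 1 + x) * f x" for x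
    proof (cases "norm x \<le> Q")
      case False
      have "norm x \<le> norm (x + (c + s *\<^sub>R axis i 1)) + norm (c + s *\<^sub>R axis i (1::real))"
        using norm_triangle_ineq4[of "x + (c + s *\<^sub>R axis i 1)" "c + s *\<^sub>R axis i 1"] by simp
      also have "norm (c + s *\<^sub>R axis i (1::real)) \<le> norm c + \<bar>s\<bar>"
        using norm_triangle_ineq[of c "s *\<^sub>R axis i (1::real)"] by simp
      finally have "R < norm (x + (c + s *\<^sub>R axis i 1))" using False s by (simp add: Q_def)
      then show ?thesis using pd_support[of R \<xi> "x + (c + s *\<^sub>R axis i 1)" js] R by (simp add: add.commute)
    qed (simp add: f_def add.commute mult.commute)
    then have "(\<integral>x. u x * pd js \<xi> (x + (c + s *\<^sub>R axis i 1)) \<partial>lborel) = (\<integral>x. pd js \<xi> (c + s *\<^sub>R axis i 1 + x) * f x \<partial>lborel)"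
      by simp
    also have "\<dots> = (\<integral>x. pd js \<xi> (c + s *\<^sub>R axis i 1 + (0 - x)) * f (0 - x) \<partial>lborel)"
      by (rule lborel_integral_reflect[symmetric]) measurable
    finally show ?thesis by (simp add: conv_def)
  qed
  let ?F = "\<lambda>s. conv \<xi> (\<lambda>y. f (- y)) (c + s *\<^sub>R axis i 1)"
  have "norm (?F r - ?F 0) \<le> B * norm (r - 0)"
  proof (rule field_differentiable_bound[where S="{-\<bar>r\<bar>..\<bar>r\<bar>}" and f'="\<lambda>s. conv (pd [i] \<xi>) (\<lambda>y. f (- y)) (c + s *\<^sub>R axis i 1)"])
    fix s assume s: "s \<in> {-\<bar>r\<bar>..\<bar>r\<bar>}"
    show "((\<lambda>s. conv \<xi> (\<lambda>y. f (- y)) (c + s *\<^sub>R axis i 1)) has_field_derivative conv (pd [i] \<xi>) (\<lambda>y. f (- y)) (c + s *\<^sub>R axis i 1)) (at s within {-\<bar>r\<bar>..\<bar>r\<bar>})"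
      using smooth_fn_deriv[OF conv_smooth[OF \<xi> f'], of "[]" c i s]
      unfolding pd_conv[OF \<xi> f'] pd.simps(1) by (rule has_field_derivative_at_within)
    show "norm (conv (pd [i] \<xi>) (\<lambda>y. f (- y)) (c + s *\<^sub>R axis i 1)) \<le> B"
      using B[of "c + s *\<^sub>R axis i 1"] eq[of s "[i]"] s by (auto simp del: pd.simps)
  qed auto
  moreover have "?F r = (\<integral>x. u x * \<xi> (x + (c + r *\<^sub>R axis i 1)) \<partial>lborel)" using eq[of r "[]"] by simp
  moreover have "?F 0 = (\<integral>x. u x * \<xi> (x + c) \<partial>lborel)" using eq[of 0 "[]"] by simp
  ultimately show ?thesis by simp
qed

lemma pairing_shift_integrable:
  assumes "sqint u" "test_fun \<xi>" shows "integrable lborel (\<lambda>x. u x * \<xi> (x + a))"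
  by (rule sqint_mult_integrable[OF assms(1) sqint_shift[OF test_fun_sqint(1)[OF assms(2)]]])

text \<open>One coordinate of the translation is changed at a time, which is why the l1 norm of y
  appears.\<close>

lemma pairing_difference:
  fixes u \<xi> :: "real^'n::finite \<Rightarrow> real"
  assumes u: "sqint u" and \<xi>: "test_fun \<xi>"
    and B: "\<And>i a. \<bar>\<integral>x. u x * pd [i] \<xi> (x + a) \<partial>lborel\<bar> \<le> B"
  shows "\<bar>\<integral>x. u x * (\<xi> x - \<xi> (x - y)) \<partial>lborel\<bar> \<le> B * (\<Sum>i\<in>UNIV. \<bar>y $ i\<bar>)"
proof -
  define P where "P = (\<lambda>a. \<integral>x. u x * \<xi> (x + a) \<partial>lborel)"
  have *: "\<bar>P (\<Sum>i\<in>I. (- y $ i) *\<^sub>R axis i 1) - P 0\<bar> \<le> B * (\<Sum>i\<in>I. \<bar>y $ i\<bar>)" for I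
  proof (induction I rule: infinite_finite_induct)
    case (insert i I)
    have "\<bar>P ((\<Sum>i\<in>I. (- y $ i) *\<^sub>R axis i 1) + (- y $ i) *\<^sub>R axis i 1) - P (\<Sum>i\<in>I. (- y $ i) *\<^sub>R axis i 1)\<bar> \<le> B * \<bar>- y $ i\<bar>"
      unfolding P_def by (rule pairing_step_axis[OF u \<xi> B])
    moreover have "(\<Sum>i\<in>insert i I. (- y $ i) *\<^sub>R axis i 1) = (\<Sum>i\<in>I. (- y $ i) *\<^sub>R axis i 1) + (- y $ i) *\<^sub>R axis i (1::real)"
      using insert by (simp add: add.commute)
    moreover have "(\<Sum>i\<in>insert i I. \<bar>y $ i\<bar>) = (\<Sum>i\<in>I. \<bar>y $ i\<bar>) + \<bar>y $ i\<bar>" using insert by simp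
    ultimately show ?case using insert.IH by (simp add: distrib_left)
  qed auto
  have "(\<Sum>i\<in>UNIV. (- y $ i) *\<^sub>R axis i 1) = - y"
    using basis_expansion[of "-y"] by (simp add: scalar_mult_eq_scaleR)
  with *[of UNIV] have "\<bar>P (- y) - P 0\<bar> \<le> B * (\<Sum>i\<in>UNIV. \<bar>y $ i\<bar>)" by simp
  moreover have "(\<integral>x. u x * (\<xi> x - \<xi> (x - y)) \<partial>lborel) = P 0 - P (- y)"
    using pairing_shift_integrable[OF u \<xi>, of 0] pairing_shift_integrable[OF u \<xi>, of "- y"]
    by (simp add: P_def right_diff_distrib)
  ultimately show ?thesis by simp
qed

section \<open>Finite differences and the smoothing kernel\<close>

primrec dif :: "nat \<Rightarrow> 'a::real_normed_vector \<Rightarrow> ('a \<Rightarrow> real) \<Rightarrow> 'a \<Rightarrow> real" where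
  "dif 0 y \<theta> = \<theta>"
| "dif (Suc k) y \<theta> = (\<lambda>x. dif k y \<theta> x - dif k y \<theta> (x - y))"

lemma dif_shift: "dif k y (\<lambda>x. \<theta> (x + a)) = (\<lambda>x. dif k y \<theta> (x + a))"
  by (induction k) (auto simp: algebra_simps)

lemma dif_test: "test_fun \<theta> \<Longrightarrow> test_fun (dif k y \<theta>)"
  by (induction k) (auto intro: test_fun_diff test_fun_shift[of _ "-y", simplified])

lemma dif_expand: "dif k y \<theta> x = (\<Sum>j\<le>k. (-1) ^ j * real (k choose j) * \<theta> (x - real j *\<^sub>R y))"
proof (induction k arbitrary: x)
  case (Suc k)
  let ?t = "\<lambda>j. \<theta> (x - real j *\<^sub>R y)"
  have 1: "dif k y \<theta> (x - y) = (\<Sum>j\<le>k. (-1) ^ j * real (k choose j) * ?t (Suc j))"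
    unfolding Suc.IH by (intro sum.cong refl) (simp add: algebra_simps)
  have "(\<Sum>j\<le>Suc k. (-1) ^ j * real (Suc k choose j) * ?t j) = ?t 0 + (\<Sum>j\<le>k. (-1) ^ Suc j * real (Suc k choose Suc j) * ?t (Suc j))"
    by (subst sum.atMost_Suc_shift) simp
  also have "(\<Sum>j\<le>k. (-1) ^ Suc j * real (Suc k choose Suc j) * ?t (Suc j)) =
    (\<Sum>j\<le>k. (-1) ^ Suc j * real (k choose Suc j) * ?t (Suc j)) - (\<Sum>j\<le>k. (-1) ^ j * real (k choose j) * ?t (Suc j))"
    unfolding sum_subtractf[symmetric] by (intro sum.cong refl) (simp add: algebra_simps)
  also have "?t 0 + ((\<Sum>j\<le>k. (-1) ^ Suc j * real (k choose Suc j) * ?t (Suc j)) - (\<Sum>j\<le>k. (-1) ^ j * real (k choose j) * ?t (Suc j)))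
    = (?t 0 + (\<Sum>j\<le>k. (-1) ^ Suc j * real (k choose Suc j) * ?t (Suc j))) - (\<Sum>j\<le>k. (-1) ^ j * real (k choose j) * ?t (Suc j))" by simp
  also have "?t 0 + (\<Sum>j\<le>k. (-1) ^ Suc j * real (k choose Suc j) * ?t (Suc j)) = (\<Sum>j\<le>Suc k. (-1) ^ j * real (k choose j) * ?t j)"
    by (subst sum.atMost_Suc_shift) simp
  also have "\<dots> = dif k y \<theta> x" unfolding Suc.IH by simp
  finally show ?case using 1 by simp
qed simp

text \<open>Every difference is traded for one derivative and a factor given by the l1 norm of y,
  until m derivatives are reached and the hypothesis applies. The list \<open>js\<close> collects
  the derivatives already gained; bounds for all translates come for free by translating
  \<open>\<theta>\<close>, which leaves its norm unchanged.\<close>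

lemma dif_pairing_bound:
  fixes u :: "real^'n::finite \<Rightarrow> real"
  assumes u: "sqint u"
    and D: "\<And>js \<theta>. length js = m \<Longrightarrow> test_fun \<theta> \<Longrightarrow> \<bar>\<integral>x. u x * pd js \<theta> x \<partial>lborel\<bar> \<le> D * n2 \<theta>"
  shows "length js + k = m \<Longrightarrow> test_fun \<theta> \<Longrightarrow> \<bar>\<integral>x. u x * pd js (dif k y \<theta>) x \<partial>lborel\<bar> \<le> D * (\<Sum>i\<in>UNIV. \<bar>y $ i\<bar>) ^ k * n2 \<theta>"
proof (induction k arbitrary: js \<theta>)
  case 0
  then show ?case using D by simp
next
  case (Suc k)
  let ?\<xi> = "pd js (dif k y \<theta>)"
  note dt = dif_test[OF Suc.prems(2), of k y]
  have t: "test_fun ?\<xi>" by (intro test_fun_pd dt)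
  have e: "pd js (dif (Suc k) y \<theta>) = (\<lambda>x. ?\<xi> x - ?\<xi> (x - y))"
    using pd_diff[OF test_fun_smooth[OF dt] smooth_fn_shift[OF test_fun_smooth[OF dt], of "-y"], of js]
      pd_shift[OF test_fun_smooth[OF dt], of js "-y"] by simp
  have "\<bar>\<integral>x. u x * (?\<xi> x - ?\<xi> (x - y)) \<partial>lborel\<bar> \<le> (D * (\<Sum>i\<in>UNIV. \<bar>y $ i\<bar>) ^ k * n2 \<theta>) * (\<Sum>i\<in>UNIV. \<bar>y $ i\<bar>)"
  proof (rule pairing_difference[OF u t])
    fix i a
    have "\<bar>\<integral>x. u x * pd (i # js) (dif k y (\<lambda>x. \<theta> (x + a))) x \<partial>lborel\<bar> \<le> D * (\<Sum>i\<in>UNIV. \<bar>y $ i\<bar>) ^ k * n2 (\<lambda>x. \<theta> (x + a))"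
      using Suc.prems by (intro Suc.IH test_fun_shift) auto
    moreover have "pd (i # js) (dif k y (\<lambda>x. \<theta> (x + a))) = (\<lambda>x. pd [i] ?\<xi> (x + a))"
      unfolding dif_shift pd_shift[OF test_fun_smooth[OF dt]] pd_append by simp
    moreover have "n2 (\<lambda>x. \<theta> (x + a)) = n2 \<theta>" by (rule n2_shift[OF test_fun_measurable[OF Suc.prems(2)]])
    ultimately show "\<bar>\<integral>x. u x * pd [i] ?\<xi> (x + a) \<partial>lborel\<bar> \<le> D * (\<Sum>i\<in>UNIV. \<bar>y $ i\<bar>) ^ k * n2 \<theta>"
      by (simp del: pd.simps)
  qed
  then show ?case unfolding e by (simp add: mult_ac)
qed

text \<open>Convolution with this kernel averages \<open>1 - (1 - S)\<^sup>m\<close> over \<open>y\<close>, where \<open>S\<close> is the translation by \<open>y\<close>;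
  the smoothing error is thus an average of \<open>m\<close>-th order differences.\<close>
definition kerK :: "nat \<Rightarrow> real^'n::finite \<Rightarrow> real" where
  "kerK m x = (\<Sum>j=1..m. (-1) ^ (j + 1) * real (m choose j) * dil (real j) molli x)"

lemma kerK_ctest: "ctest (kerK m)"
  unfolding kerK_def by (intro ctest_sum ctest_cmult dil_ctest molli(1)) auto

lemma dil_dil: "dil a (dil b k) = dil (a * b) k"
  by (auto simp: dil_def fun_eq_iff power_mult_distrib mult.commute[of b a])

lemma dil_kerK: "dil l (kerK m) = (\<lambda>x. \<Sum>j=1..m. (-1) ^ (j + 1) * real (m choose j) * dil (real j) (dil l molli) x)"
  unfolding dil_dil by (auto simp: dil_def kerK_def sum_distrib_left fun_eq_iff power_mult_distrib mult_ac intro!: sum.cong)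

text \<open>Expanding the m-th difference binomially, the term j pairs u with the translate by j y,
  and averaging this over y with the mollifier is convolution with the mollifier dilated by j. The
  term j = 0 reproduces \<open>\<theta>\<close> itself because the mollifier has integral 1.\<close>

lemma pairing_kernel:
  fixes u \<theta> :: "real^'n::finite \<Rightarrow> real"
  assumes u: "sqint u" and \<theta>: "sqint \<theta>" and l: "l > 0"
  shows "(\<integral>x. u x * (\<theta> x - conv (dil l (kerK m)) \<theta> x) \<partial>lborel) =
     (\<integral>y. dil l molli y * (\<integral>x. u x * dif m y \<theta> x \<partial>lborel) \<partial>lborel)"
proof -
  define P where "P = (\<lambda>y. \<integral>x. u x * \<theta> (x - y) \<partial>lborel)"
  let ?k = "dil l molli :: real^'n \<Rightarrow> real"
  have [measurable]: "u \<in> borel_measurable borel" "\<theta> \<in> borel_measurable borel" using u \<theta> by (auto simp: sqint_def)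
  have Pm[measurable]: "P \<in> borel_measurable borel" unfolding P_def by measurable
  have kt: "test_fun ?k" by (rule dil_test[OF l ctest_test[OF molli(1)]])
  have km[measurable]: "?k \<in> borel_measurable borel" by (rule test_fun_measurable[OF kt])
  have jt: "test_fun (dil (real j) ?k)" if "j \<ge> 1" for j using that by (intro dil_test kt) auto
  have Pi: "integrable lborel (\<lambda>y. dil (real j) ?k y * P y)" "(\<integral>x. u x * conv (dil (real j) ?k) \<theta> x \<partial>lborel) = (\<integral>y. ?k y * P (real j *\<^sub>R y) \<partial>lborel)"
    if j: "j \<ge> 1" for j
  proof -
    show "integrable lborel (\<lambda>y. dil (real j) ?k y * P y)" unfolding P_def by (rule conv_pairing(2)[OF jt[OF j] \<theta> u])
    have "(\<integral>x. u x * conv (dil (real j) ?k) \<theta> x \<partial>lborel) = (\<integral>y. dil (real j) ?k y * P y \<partial>lborel)"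
      unfolding P_def by (rule conv_pairing(1)[OF jt[OF j] \<theta> u])
    also have "\<dots> = (\<integral>y. ?k y * P (real j *\<^sub>R y) \<partial>lborel)" using j by (intro dil_integral) auto
    finally show "(\<integral>x. u x * conv (dil (real j) ?k) \<theta> x \<partial>lborel) = (\<integral>y. ?k y * P (real j *\<^sub>R y) \<partial>lborel)" .
  qed
  have Pb: "\<bar>P y\<bar> \<le> n2 u * n2 \<theta>" for y
    unfolding P_def using sqint_cauchy_schwarz[OF u sqint_shift[OF \<theta>, of "-y"]] n2_shift[of \<theta> "-y"] by simp
  have kPi: "integrable lborel (\<lambda>y. ?k y * P (real j *\<^sub>R y))" for j
  proof (rule Bochner_Integration.integrable_bound)
    show "integrable lborel (\<lambda>y. (n2 u * n2 \<theta>) * ?k y)" using test_fun_sqint(2)[OF kt] by simp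
    show "AE y in lborel. norm (?k y * P (real j *\<^sub>R y)) \<le> norm ((n2 u * n2 \<theta>) * ?k y)"
    proof (rule AE_I2)
      fix y
      have "\<bar>?k y\<bar> * \<bar>P (real j *\<^sub>R y)\<bar> \<le> \<bar>?k y\<bar> * (n2 u * n2 \<theta>)" by (intro mult_left_mono Pb) simp
      then show "norm (?k y * P (real j *\<^sub>R y)) \<le> norm ((n2 u * n2 \<theta>) * ?k y)" by (simp add: abs_mult mult_ac)
    qed
  qed measurable
  have conv_eq: "conv (dil l (kerK m)) \<theta> x = (\<Sum>j=1..m. (-1) ^ (j + 1) * real (m choose j) * conv (dil (real j) ?k) \<theta> x)" for x
    unfolding dil_kerK conv_def sum_distrib_right
    by (subst Bochner_Integration.integral_sum)
       (auto simp: mult.assoc intro!: integrable_mult_right test_fun_conv_integrable[OF jt \<theta>, unfolded conv_def])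
  have cs: "sqint (conv (dil (real j) ?k) \<theta>)" if "j \<ge> 1" for j by (rule conv_young(1)[OF jt[OF that] \<theta>])
  have "(\<integral>x. u x * (\<theta> x - conv (dil l (kerK m)) \<theta> x) \<partial>lborel) =
     (\<integral>x. u x * \<theta> x - (\<Sum>j=1..m. (-1) ^ (j + 1) * real (m choose j) * (u x * conv (dil (real j) ?k) \<theta> x)) \<partial>lborel)"
    unfolding conv_eq by (simp add: right_diff_distrib sum_distrib_left mult_ac)
  also have "\<dots> = (\<integral>x. u x * \<theta> x \<partial>lborel) - (\<Sum>j=1..m. (-1) ^ (j + 1) * real (m choose j) * (\<integral>x. u x * conv (dil (real j) ?k) \<theta> x \<partial>lborel))"
    using sqint_mult_integrable[OF u \<theta>] sqint_mult_integrable[OF u cs]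
    by (subst Bochner_Integration.integral_diff) (auto intro!: Bochner_Integration.integrable_sum simp: Bochner_Integration.integral_sum)
  also have "\<dots> = (\<Sum>j\<le>m. (-1) ^ j * real (m choose j) * (\<integral>y. ?k y * P (real j *\<^sub>R y) \<partial>lborel))"
  proof -
    have "(\<integral>y. ?k y * P (real 0 *\<^sub>R y) \<partial>lborel) = (\<integral>x. u x * \<theta> x \<partial>lborel)"
      using dil_molli_integral[OF l, where 'n='n] by (simp add: P_def)
    moreover have "{..m} = insert 0 {1..m}" by auto
    ultimately show ?thesis by (simp add: Pi(2) sum_negf)
  qed
  also have "\<dots> = (\<integral>y. (\<Sum>j\<le>m. (-1) ^ j * real (m choose j) * (?k y * P (real j *\<^sub>R y))) \<partial>lborel)"
    using kPi by (subst Bochner_Integration.integral_sum) auto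
  also have "\<dots> = (\<integral>y. ?k y * (\<integral>x. u x * dif m y \<theta> x \<partial>lborel) \<partial>lborel)"
  proof (intro Bochner_Integration.integral_cong refl)
    fix y
    have "(\<integral>x. u x * dif m y \<theta> x \<partial>lborel) = (\<integral>x. (\<Sum>j\<le>m. (-1) ^ j * real (m choose j) * (u x * \<theta> (x - real j *\<^sub>R y))) \<partial>lborel)"
      unfolding dif_expand by (simp add: sum_distrib_left mult_ac)
    also have "\<dots> = (\<Sum>j\<le>m. (-1) ^ j * real (m choose j) * P (real j *\<^sub>R y))"
      unfolding P_def using sqint_mult_integrable[OF u sqint_shift[OF \<theta>, of "- (real j *\<^sub>R y)" for j]]
      by (subst Bochner_Integration.integral_sum) auto
    finally show "(\<Sum>j\<le>m. (-1) ^ j * real (m choose j) * (?k y * P (real j *\<^sub>R y))) = ?k y * (\<integral>x. u x * dif m y \<theta> x \<partial>lborel)"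
      by (simp add: sum_distrib_left mult_ac)
  qed
  finally show ?thesis .
qed

definition molli_radius :: "'n::finite itself \<Rightarrow> real" where
  "molli_radius _ = (SOME S. S > 0 \<and> (\<forall>x::real^'n. S < norm x \<longrightarrow> molli x = 0))"

lemma molli_radius: "molli_radius TYPE('n::finite) > 0" "molli_radius TYPE('n) < norm x \<Longrightarrow> molli (x::real^'n) = 0"
proof -
  obtain S where S: "\<forall>x::real^'n. S < norm x \<longrightarrow> molli x = 0"
    using ctest_test[OF molli(1)[where 'n='n]] unfolding test_fun_def by blast
  have "\<exists>S. S > 0 \<and> (\<forall>x::real^'n. S < norm x \<longrightarrow> molli x = 0)"
    by (rule exI[of _ "max S 1"]) (use S in auto)
  from someI_ex[OF this] show "molli_radius TYPE('n::finite) > 0" "molli_radius TYPE('n) < norm x \<Longrightarrow> molli (x::real^'n) = 0"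
    unfolding molli_radius_def by blast+
qed

text \<open>Only y with norm at most the support radius times l contribute, and their l1 norm is at
  most the dimension times that; the difference bound is then averaged against a probability
  density.\<close>

lemma kernel_error_test:
  fixes u \<theta> :: "real^'n::finite \<Rightarrow> real"
  assumes u: "sqint u" and \<theta>: "test_fun \<theta>" and l: "l > 0" and D0: "D \<ge> 0"
    and D: "\<And>js \<theta>. length js = m \<Longrightarrow> test_fun \<theta> \<Longrightarrow> \<bar>\<integral>x. u x * pd js \<theta> x \<partial>lborel\<bar> \<le> D * n2 \<theta>"
  shows "\<bar>\<integral>x. u x * (\<theta> x - conv (dil l (kerK m)) \<theta> x) \<partial>lborel\<bar> \<le> (real CARD('n) * molli_radius TYPE('n) * l) ^ m * D * n2 \<theta>"
proof -
  let ?k = "dil l molli :: real^'n \<Rightarrow> real"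
  define C where "C = (real CARD('n) * molli_radius TYPE('n) * l) ^ m * D * n2 \<theta>"
  have kt: "test_fun ?k" by (rule dil_test[OF l ctest_test[OF molli(1)]])
  have ki: "integrable lborel ?k" by (rule test_fun_sqint(2)[OF kt])
  have b: "\<bar>?k y * (\<integral>x. u x * dif m y \<theta> x \<partial>lborel)\<bar> \<le> C * ?k y" for y
  proof (cases "norm y \<le> molli_radius TYPE('n) * l")
    case True
    have "\<bar>\<integral>x. u x * dif m y \<theta> x \<partial>lborel\<bar> \<le> D * (\<Sum>i\<in>UNIV. \<bar>y $ i\<bar>) ^ m * n2 \<theta>"
      using dif_pairing_bound[OF u D, where js="[]" and k=m and \<theta>=\<theta> and y=y] \<theta> by simp
    also have "(\<Sum>i\<in>UNIV. \<bar>y $ i\<bar>) \<le> real CARD('n) * (molli_radius TYPE('n) * l)"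
      using sum_bounded_above[of UNIV "\<lambda>i. \<bar>y $ i\<bar>" "molli_radius TYPE('n) * l"] component_le_norm_cart[of y] True
      by (meson order_trans)
    then have "D * (\<Sum>i\<in>UNIV. \<bar>y $ i\<bar>) ^ m * n2 \<theta> \<le> D * (real CARD('n) * (molli_radius TYPE('n) * l)) ^ m * n2 \<theta>"
      using D0 by (intro mult_right_mono mult_left_mono power_mono) (auto intro: sum_nonneg)
    finally have "\<bar>\<integral>x. u x * dif m y \<theta> x \<partial>lborel\<bar> \<le> C" by (simp add: C_def mult_ac)
    then show ?thesis using dil_molli_nonneg[OF l, of y]
      by (simp add: abs_mult mult.commute[of C] mult_left_mono)
  next
    case False
    then have "molli_radius TYPE('n) < norm ((1/l) *\<^sub>R y)" using l by (simp add: less_divide_eq)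
    from molli_radius(2)[OF this] show ?thesis by (simp add: dil_def)
  qed
  have "\<bar>\<integral>y. ?k y * (\<integral>x. u x * dif m y \<theta> x \<partial>lborel) \<partial>lborel\<bar> \<le> (\<integral>y. C * ?k y \<partial>lborel)"
  proof (rule order_trans[OF integral_abs_bound integral_mono'])
    show "integrable lborel (\<lambda>y. C * ?k y)" using ki by simp
    show "\<bar>?k y * (\<integral>x. u x * dif m y \<theta> x \<partial>lborel)\<bar> \<le> C * ?k y" for y by (rule b)
    show "0 \<le> C * ?k y" for y by (rule order_trans[OF abs_ge_zero b])
  qed
  also have "\<dots> = C" using dil_molli_integral[OF l, where 'n='n] by simp
  finally show ?thesis unfolding pairing_kernel[OF u test_fun_sqint(1)[OF \<theta>] l] C_def .
qed

text \<open>The preceding bound should be applied with \<open>\<theta>\<close> equal to u, which is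
  not a test function; u is approximated in L2, and all errors are linear in the distance. Here the
  smallness of the m-th derivatives, in the form of D, enters the argument.\<close>

lemma kernel_error:
  fixes u :: "real^'n::finite \<Rightarrow> real"
  assumes u: "sqint u" and l: "l > 0" and D0: "D \<ge> 0"
    and D: "\<And>js \<theta>. length js = m \<Longrightarrow> test_fun \<theta> \<Longrightarrow> \<bar>\<integral>x. u x * pd js \<theta> x \<partial>lborel\<bar> \<le> D * n2 \<theta>"
  shows "(\<integral>x. u x * conv (dil l (kerK m)) u x \<partial>lborel) \<ge> (n2 u)\<^sup>2 - (real CARD('n) * molli_radius TYPE('n) * l) ^ m * D * n2 u"
proof -
  let ?K = "dil l (kerK m) :: real^'n \<Rightarrow> real"
  define C where "C = (real CARD('n) * molli_radius TYPE('n) * l) ^ m * D"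
  define A where "A = (\<integral>x. \<bar>?K x\<bar> \<partial>lborel)"
  have C0: "C \<ge> 0" using l D0 molli_radius(1)[where 'n='n] by (simp add: C_def)
  have A0: "A \<ge> 0" by (simp add: A_def)
  have Kt: "test_fun ?K" by (rule dil_test[OF l ctest_test[OF kerK_ctest]])
  note Ku = conv_young(1)[OF Kt u]
  \<comment> \<open>Collects the factor by which the distance between u and the test function is
    multiplied.\<close>
  define E where "E = n2 u * (1 + A) + C"
  have E0: "E \<ge> 0" using C0 A0 by (simp add: E_def)
  have "(\<integral>x. u x * (u x - conv ?K u x) \<partial>lborel) \<le> C * n2 u + e" if e: "e > 0" for e
  proof -
    define d where "d = e / (E + 1)"
    have d: "d > 0" using e E0 by (simp add: d_def add_nonneg_pos)
    obtain \<theta> where \<theta>: "test_fun \<theta>" "n2 (\<lambda>x. u x - \<theta> x) < d" using test_dense_L2[OF u d] by blast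
    note s\<theta> = test_fun_sqint(1)[OF \<theta>(1)]
    note ut = sqint_diff[OF u s\<theta>]
    note K\<theta> = conv_young(1)[OF Kt s\<theta>]
    let ?w = "\<lambda>x. (u x - \<theta> x) - (conv ?K u x - conv ?K \<theta> x)"
    have w: "sqint ?w" by (intro sqint_diff u s\<theta> Ku K\<theta>)
    have "n2 ?w \<le> n2 (\<lambda>x. u x - \<theta> x) + n2 (\<lambda>x. conv ?K u x - conv ?K \<theta> x)" by (intro n2_diff sqint_diff u s\<theta> Ku K\<theta>)
    moreover have "n2 (\<lambda>x. conv ?K u x - conv ?K \<theta> x) \<le> A * n2 (\<lambda>x. u x - \<theta> x)"
      using conv_young(2)[OF Kt ut] unfolding A_def conv_diff[OF Kt u s\<theta>] .
    moreover have "A * n2 (\<lambda>x. u x - \<theta> x) \<le> A * d" using \<theta>(2) A0 by (intro mult_left_mono) auto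
    ultimately have nw: "n2 ?w \<le> (1 + A) * d" using \<theta>(2) by (simp add: distrib_right)
    have "(\<integral>x. u x * (u x - conv ?K u x) \<partial>lborel) = (\<integral>x. u x * ?w x + u x * (\<theta> x - conv ?K \<theta> x) \<partial>lborel)"
      by (simp add: algebra_simps)
    also have "\<dots> = (\<integral>x. u x * ?w x \<partial>lborel) + (\<integral>x. u x * (\<theta> x - conv ?K \<theta> x) \<partial>lborel)"
      by (intro Bochner_Integration.integral_add sqint_mult_integrable u w sqint_diff s\<theta> K\<theta>)
    also have "(\<integral>x. u x * ?w x \<partial>lborel) \<le> n2 u * ((1 + A) * d)"
      using sqint_cauchy_schwarz[OF u w] mult_left_mono[OF nw n2_nonneg[of u]] by linarith
    also have "(\<integral>x. u x * (\<theta> x - conv ?K \<theta> x) \<partial>lborel) \<le> C * n2 \<theta>"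
    proof -
      have "\<bar>\<integral>x. u x * (\<theta> x - conv ?K \<theta> x) \<partial>lborel\<bar> \<le> C * n2 \<theta>"
        unfolding C_def by (rule kernel_error_test[OF u \<theta>(1) l D0]) (rule D)
      then show ?thesis by linarith
    qed
    also have "C * n2 \<theta> \<le> C * (n2 u + d)"
    proof (rule mult_left_mono[OF _ C0])
      have "n2 (\<lambda>x. u x - (u x - \<theta> x)) \<le> n2 u + n2 (\<lambda>x. u x - \<theta> x)" by (intro n2_diff u ut)
      then show "n2 \<theta> \<le> n2 u + d" using \<theta>(2) by simp
    qed
    also have "n2 u * ((1 + A) * d) + C * (n2 u + d) = C * n2 u + E * d" by (simp add: E_def algebra_simps)
    also have "E * d \<le> (E + 1) * d" using d by (simp add: distrib_right)
    also have "(E + 1) * d = e" using E0 by (simp add: d_def)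
    finally show ?thesis by simp
  qed
  then have "(\<integral>x. u x * (u x - conv ?K u x) \<partial>lborel) \<le> C * n2 u" by (rule field_le_epsilon)
  moreover have "(\<integral>x. u x * (u x - conv ?K u x) \<partial>lborel) = (n2 u)\<^sup>2 - (\<integral>x. u x * conv ?K u x \<partial>lborel)"
    using sqint_mult_integrable[OF u Ku] sqint_mult_integrable[OF u u] by (simp add: right_diff_distrib n2_sq) (simp add: power2_eq_square)
  ultimately show ?thesis unfolding C_def by simp
qed

section \<open>Solenoidal test fields\<close>

lemma molli_pairing_tendsto:
  fixes p v :: "real^'n::finite \<Rightarrow> real"
  assumes p: "sqint p" and v: "sqint v"
  shows "(\<lambda>k. \<integral>x. p x * conv (dil (1 / real (Suc k)) molli) v x \<partial>lborel) \<longlonglongrightarrow> (\<integral>x. p x * v x \<partial>lborel)"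
proof (rule LIMSEQ_I)
  fix r :: real assume r: "r > 0"
  define e where "e = r / (n2 p + 1)"
  have e: "e > 0" using r by (simp add: e_def add_nonneg_pos)
  obtain h0 where h0: "h0 > 0" "\<And>h. 0 < h \<Longrightarrow> h < h0 \<Longrightarrow> n2 (\<lambda>x. conv (dil h molli) v x - v x) < e"
    using mollify_L2[OF v e] by auto
  obtain N where N: "1 / real (Suc N) < h0" using h0(1) by (meson nat_approx_posE)
  show "\<exists>no. \<forall>n\<ge>no. norm ((\<integral>x. p x * conv (dil (1 / real (Suc n)) molli) v x \<partial>lborel) - (\<integral>x. p x * v x \<partial>lborel)) < r"
  proof (intro exI[of _ N] allI impI)
    fix n assume n: "N \<le> n"
    let ?h = "1 / real (Suc n)"
    have "?h \<le> 1 / real (Suc N)" using n by (intro divide_left_mono) auto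
    then have h: "0 < ?h" "?h < h0" using N by (auto simp: less_le_trans)
    have kt: "test_fun (dil ?h molli :: real^'n \<Rightarrow> real)" by (rule dil_test[OF h(1) ctest_test[OF molli(1)]])
    note cv = conv_young(1)[OF kt v]
    have "(\<integral>x. p x * conv (dil ?h molli) v x \<partial>lborel) - (\<integral>x. p x * v x \<partial>lborel) = (\<integral>x. p x * (conv (dil ?h molli) v x - v x) \<partial>lborel)"
      using sqint_mult_integrable[OF p cv] sqint_mult_integrable[OF p v] by (simp add: right_diff_distrib)
    also have "\<bar>\<dots>\<bar> \<le> n2 p * n2 (\<lambda>x. conv (dil ?h molli) v x - v x)"
      by (rule sqint_cauchy_schwarz[OF p sqint_diff[OF cv v]])
    also have "\<dots> \<le> n2 p * e" using h0(2)[OF h] by (intro mult_left_mono) auto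
    also have "\<dots> < (n2 p + 1) * e" using e by (simp add: distrib_right)
    also have "\<dots> = r" unfolding e_def by (simp add: add_nonneg_eq_0_iff)
    finally show "norm ((\<integral>x. p x * conv (dil ?h molli) v x \<partial>lborel) - (\<integral>x. p x * v x \<partial>lborel)) < r" by simp
  qed
qed

lemma sqint_mult_bounded:
  assumes f: "sqint f" and [measurable]: "g \<in> borel_measurable borel" and B: "\<And>x. \<bar>g x\<bar> \<le> B"
  shows "sqint (\<lambda>x. f x * g x)" "n2 (\<lambda>x. f x * g x) \<le> B * n2 f"
proof -
  have [measurable]: "f \<in> borel_measurable borel" using f by (simp add: sqint_def)
  have B0: "B \<ge> 0" using B[of undefined] by linarith
  have le: "\<bar>f x * g x\<bar> \<le> \<bar>B * f x\<bar>" for x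
    using mult_left_mono[OF B[of x] abs_ge_zero[of "f x"]] B0 by (simp add: abs_mult mult.commute)
  show "sqint (\<lambda>x. f x * g x)" by (rule sqint_bound[OF sqint_cmult[OF f, of B]]) (use le in auto)
  have "n2 (\<lambda>x. f x * g x) \<le> n2 (\<lambda>x. B * f x)" by (rule n2_mono[OF sqint_cmult[OF f]]) (rule le)
  then show "n2 (\<lambda>x. f x * g x) \<le> B * n2 f" using B0 by (simp add: n2_cmult)
qed

lemma sqint_mult_test:
  assumes "sqint f" "test_fun \<phi>" shows "sqint (\<lambda>x. f x * \<phi> x)" "integrable lborel (\<lambda>x. f x * \<phi> x)"
proof -
  obtain B where "\<And>x. \<bar>\<phi> x\<bar> \<le> B" using test_fun_bounded[OF assms(2)] by auto
  then show "sqint (\<lambda>x. f x * \<phi> x)" by (rule sqint_mult_bounded(1)[OF assms(1) test_fun_measurable[OF assms(2)]])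
  show "integrable lborel (\<lambda>x. f x * \<phi> x)" by (rule sqint_mult_integrable[OF assms(1) test_fun_sqint(1)[OF assms(2)]])
qed

text \<open>Integration by parts in the convective term, with u and f only in L2. The product of u
  with \<open>\<phi>\<close> is not an admissible test function, so it is mollified before the weak
  derivative of f is used, and the mollification is removed in the limit.\<close>

lemma transport_by_parts:
  fixes u :: "'n::finite \<Rightarrow> real^'n \<Rightarrow> real"
  assumes u: "\<And>j. sqint (u j)" and f: "sqint f" and g: "\<And>j. sqint (g j)"
    and dv: "\<And>\<psi>. test_fun \<psi> \<Longrightarrow> (\<Sum>j\<in>UNIV. \<integral>x. u j x * pd [j] \<psi> x \<partial>lborel) = 0"
    and wd: "\<And>j \<psi>. test_fun \<psi> \<Longrightarrow> (\<integral>x. f x * pd [j] \<psi> x \<partial>lborel) = - (\<integral>x. g j x * \<psi> x \<partial>lborel)"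
    and \<phi>: "test_fun \<phi>"
  shows "(\<Sum>j\<in>UNIV. \<integral>x. g j x * (u j x * \<phi> x) \<partial>lborel) = - (\<Sum>j\<in>UNIV. \<integral>x. f x * (u j x * pd [j] \<phi> x) \<partial>lborel)"
proof -
  obtain R where R: "\<And>x. R < norm x \<Longrightarrow> \<phi> x = 0" using \<phi> by (auto simp: test_fun_def)
  let ?k = "\<lambda>n. dil (1 / real (Suc n)) molli :: real^'n \<Rightarrow> real"
  have kt: "test_fun (?k n)" for n by (rule dil_test[OF _ ctest_test[OF molli(1)]]) simp
  note p\<phi> = test_fun_pd[OF \<phi>]
  have eq: "(\<Sum>j\<in>UNIV. \<integral>x. f x * conv (?k n) (\<lambda>x. u j x * pd [j] \<phi> x) x \<partial>lborel)
      = - (\<Sum>j\<in>UNIV. \<integral>x. g j x * conv (?k n) (\<lambda>x. u j x * \<phi> x) x \<partial>lborel)" for n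
  proof -
    have L1: "integrable lborel (\<lambda>x. u j x * \<phi> x)" for j by (rule sqint_mult_test(2)[OF u \<phi>])
    have ct: "test_fun (conv (?k n) (\<lambda>x. u j x * \<phi> x))" for j
      by (rule conv_test_fun[OF kt L1, of R]) (simp add: R)
    have pc: "pd [j] (conv (?k n) (\<lambda>x. u j x * \<phi> x)) = conv (pd [j] (?k n)) (\<lambda>x. u j x * \<phi> x)" for j
      by (rule pd_conv[OF kt L1])
    \<comment> \<open>The divergence constraint, tested with the product of the reflected kernel and
      \<open>\<phi>\<close>, moves the derivatives from the kernel to \<open>\<phi>\<close>.\<close>
    have key: "(\<Sum>j\<in>UNIV. conv (pd [j] (?k n)) (\<lambda>x. u j x * \<phi> x) x) = (\<Sum>j\<in>UNIV. conv (?k n) (\<lambda>x. u j x * pd [j] \<phi> x) x)" for x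
    proof -
      let ?\<psi> = "\<lambda>y. ?k n (x - y) * \<phi> y"
      have sk: "smooth_fn (\<lambda>y. ?k n (x - y))" by (rule smooth_fn_reflect[OF test_fun_smooth[OF kt]])
      have \<psi>t: "test_fun ?\<psi>" by (rule test_fun_mult[OF sk \<phi>])
      have pd\<psi>: "pd [j] ?\<psi> = (\<lambda>y. - (pd [j] (?k n) (x - y) * \<phi> y) + ?k n (x - y) * pd [j] \<phi> y)" for j
        unfolding pd_mult[OF sk test_fun_smooth[OF \<phi>]] pd_reflect[OF test_fun_smooth[OF kt]] by (simp del: pd.simps(2))
      have i1: "integrable lborel (\<lambda>y. pd [j] (?k n) (x - y) * (u j y * \<phi> y))" for j
        by (rule test_fun_conv_integrable[OF test_fun_pd[OF kt] sqint_mult_test(1)[OF u \<phi>]])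
      have i2: "integrable lborel (\<lambda>y. ?k n (x - y) * (u j y * pd [j] \<phi> y))" for j
        by (rule test_fun_conv_integrable[OF kt sqint_mult_test(1)[OF u p\<phi>]])
      have "0 = (\<Sum>j\<in>UNIV. \<integral>y. u j y * pd [j] ?\<psi> y \<partial>lborel)" using dv[OF \<psi>t] by simp
      also have "\<dots> = (\<Sum>j\<in>UNIV. \<integral>y. - (pd [j] (?k n) (x - y) * (u j y * \<phi> y)) + ?k n (x - y) * (u j y * pd [j] \<phi> y) \<partial>lborel)"
        unfolding pd\<psi> by (intro sum.cong Bochner_Integration.integral_cong refl) (simp add: algebra_simps del: pd.simps)
      also have "\<dots> = (\<Sum>j\<in>UNIV. - conv (pd [j] (?k n)) (\<lambda>x. u j x * \<phi> x) x + conv (?k n) (\<lambda>x. u j x * pd [j] \<phi> x) x)"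
        unfolding conv_def using i1 i2 by (simp del: pd.simps)
      also have "\<dots> = - (\<Sum>j\<in>UNIV. conv (pd [j] (?k n)) (\<lambda>x. u j x * \<phi> x) x) + (\<Sum>j\<in>UNIV. conv (?k n) (\<lambda>x. u j x * pd [j] \<phi> x) x)"
        by (simp add: sum.distrib sum_negf sum_subtractf del: pd.simps)
      finally show ?thesis by simp
    qed
    have s1: "sqint (conv (pd [j] (?k n)) (\<lambda>x. u j x * \<phi> x))" for j
      by (rule conv_young(1)[OF test_fun_pd[OF kt] sqint_mult_test(1)[OF u \<phi>]])
    have s2: "sqint (conv (?k n) (\<lambda>x. u j x * pd [j] \<phi> x))" for j
      by (rule conv_young(1)[OF kt sqint_mult_test(1)[OF u p\<phi>]])
    have "(\<Sum>j\<in>UNIV. \<integral>x. f x * conv (?k n) (\<lambda>x. u j x * pd [j] \<phi> x) x \<partial>lborel) = (\<integral>x. (\<Sum>j\<in>UNIV. f x * conv (?k n) (\<lambda>x. u j x * pd [j] \<phi> x) x) \<partial>lborel)"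
      by (rule Bochner_Integration.integral_sum[symmetric]) (rule sqint_mult_integrable[OF f s2])
    also have "\<dots> = (\<integral>x. (\<Sum>j\<in>UNIV. f x * conv (pd [j] (?k n)) (\<lambda>x. u j x * \<phi> x) x) \<partial>lborel)"
      unfolding sum_distrib_left[symmetric] key ..
    also have "\<dots> = (\<Sum>j\<in>UNIV. \<integral>x. f x * conv (pd [j] (?k n)) (\<lambda>x. u j x * \<phi> x) x \<partial>lborel)"
      by (rule Bochner_Integration.integral_sum) (rule sqint_mult_integrable[OF f s1])
    also have "\<dots> = (\<Sum>j\<in>UNIV. - (\<integral>x. g j x * conv (?k n) (\<lambda>x. u j x * \<phi> x) x \<partial>lborel))"
      unfolding pc[symmetric] by (intro sum.cong refl wd ct)
    finally show ?thesis by (simp add: sum_negf)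
  qed
  have t1: "(\<lambda>n. \<Sum>j\<in>UNIV. \<integral>x. f x * conv (?k n) (\<lambda>x. u j x * pd [j] \<phi> x) x \<partial>lborel) \<longlonglongrightarrow> (\<Sum>j\<in>UNIV. \<integral>x. f x * (u j x * pd [j] \<phi> x) \<partial>lborel)"
    by (intro tendsto_sum molli_pairing_tendsto f sqint_mult_test(1)[OF u p\<phi>])
  have t2: "(\<lambda>n. - (\<Sum>j\<in>UNIV. \<integral>x. g j x * conv (?k n) (\<lambda>x. u j x * \<phi> x) x \<partial>lborel)) \<longlonglongrightarrow> - (\<Sum>j\<in>UNIV. \<integral>x. g j x * (u j x * \<phi> x) \<partial>lborel)"
    by (intro tendsto_minus tendsto_sum molli_pairing_tendsto g sqint_mult_test(1)[OF u \<phi>])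
  from LIMSEQ_unique[OF t1[unfolded eq] t2] show ?thesis by simp
qed

section \<open>Compactly supported divergence-free fields\<close>

lemma shift_primitive_exists:
  fixes K :: "real^'n::finite \<Rightarrow> real"
  assumes K: "ctest K" and L: "L > 0"
  obtains F where "ctest F" "pd [e] F = (\<lambda>x. K x - K (x - L *\<^sub>R axis e 1))"
proof -
  \<comment> \<open>The primitive is the integral of K over the segment from x back to x - L e. Its
    derivative along e telescopes, and the finite length of the segment keeps the support
    bounded.\<close>
  define G where "G = (\<lambda>js x. integral (cbox 0 L) (\<lambda>s. pd js K (x - s *\<^sub>R axis e 1)))"
  note sK = ctest_smooth[OF K]
  have ck: "continuous_on UNIV (pd js K)" for js by (rule smooth_fn_continuous[OF sK])
  have c: "continuous_on UNIV (G js)" for js unfolding G_def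
    by (rule integral_continuous_on_param) (auto simp: split_def intro!: continuous_on_compose2[OF ck] continuous_intros)
  have d: "((\<lambda>h. G js (x + h *\<^sub>R axis j 1)) has_real_derivative G (j # js) x) (at 0)" for js j x
  proof -
    have "((\<lambda>h. integral (cbox 0 L) (\<lambda>s. pd js K ((x - s *\<^sub>R axis e 1) + h *\<^sub>R axis j 1))) has_real_derivative
       integral (cbox 0 L) (\<lambda>s. pd (j # js) K ((x - s *\<^sub>R axis e 1) + 0 *\<^sub>R axis j 1))) (at 0 within UNIV)"
    proof (rule leibniz_rule_field_derivative)
      show "((\<lambda>h. pd js K ((x - t *\<^sub>R axis e 1) + h *\<^sub>R axis j 1)) has_field_derivative pd (j # js) K ((x - t *\<^sub>R axis e 1) + h *\<^sub>R axis j 1)) (at h within UNIV)" for h t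
        by (rule smooth_fn_deriv[OF sK])
      show "(\<lambda>s. pd js K ((x - s *\<^sub>R axis e 1) + h *\<^sub>R axis j 1)) integrable_on cbox 0 L" for h
        by (intro integrable_continuous continuous_on_compose2[OF ck] continuous_intros) auto
      show "continuous_on (UNIV \<times> cbox 0 L) (\<lambda>(h, s). pd (j # js) K ((x - s *\<^sub>R axis e 1) + h *\<^sub>R axis j 1))"
        unfolding split_def by (intro continuous_on_compose2[OF ck] continuous_intros) auto
    qed auto
    then show ?thesis by (simp add: G_def algebra_simps del: pd.simps)
  qed
  note sm = smooth_fn_family[of G, OF refl c d]
  have "ctest (G [])"
  proof (rule ctestI)
    obtain R where R: "\<And>x. R < norm x \<Longrightarrow> K x = 0" using ctest_test[OF K] by (auto simp: test_fun_def)
    have "G [] x = 0" if x: "R + L < norm x" for x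
    proof -
      have "integral (cbox 0 L) (\<lambda>s. pd [] K (x - s *\<^sub>R axis e 1)) = integral (cbox 0 L) (\<lambda>s. 0)"
      proof (rule integral_cong)
        fix s assume s: "s \<in> cbox 0 L"
        have "norm x - norm (s *\<^sub>R axis e (1::real)) \<le> norm (x - s *\<^sub>R axis e 1)" by (rule norm_triangle_ineq2)
        then have "R < norm (x - s *\<^sub>R axis e 1)" using s x by auto
        then show "pd [] K (x - s *\<^sub>R axis e 1) = 0" by (simp add: R)
      qed
      then show ?thesis by (simp add: G_def)
    qed
    then show "test_fun (G [])" unfolding test_fun_def using sm(1) by blast
    show "pd js (G []) = pd ks (G [])" if "mset js = mset ks" for js ks
      unfolding sm(2) unfolding G_def ctest_comm[OF K that] ..
  qed
  moreover have "pd [e] (G []) = (\<lambda>x. K x - K (x - L *\<^sub>R axis e 1))"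
  proof
    fix x
    have "((\<lambda>s. pd [e] K (x - s *\<^sub>R axis e 1)) has_integral (- K (x - L *\<^sub>R axis e 1)) - (- K (x - 0 *\<^sub>R axis e 1))) {0..L}"
    proof (rule fundamental_theorem_of_calculus)
      fix s
      have "((\<lambda>s. pd [] K (x + (- s) *\<^sub>R axis e 1)) has_real_derivative pd [e] K (x + (- s) *\<^sub>R axis e 1) * (-1)) (at s)"
        by (rule DERIV_chain2[where f="\<lambda>s. pd [] K (x + s *\<^sub>R axis e 1)" and g="\<lambda>s. - s"])
           (use smooth_fn_deriv[OF sK, of "[]" x e "- s"] in \<open>auto intro!: derivative_eq_intros\<close>)
      from DERIV_minus[OF this] have "((\<lambda>s. - K (x - s *\<^sub>R axis e 1)) has_real_derivative pd [e] K (x - s *\<^sub>R axis e 1)) (at s)"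
        by (simp del: pd.simps(2))
      then show "((\<lambda>s. - K (x - s *\<^sub>R axis e 1)) has_vector_derivative pd [e] K (x - s *\<^sub>R axis e 1)) (at s within {0..L})"
        using has_field_derivative_at_within has_real_derivative_iff_has_vector_derivative by blast
    qed (use L in auto)
    then show "pd [e] (G []) x = K x - K (x - L *\<^sub>R axis e 1)"
      unfolding sm(2) unfolding G_def by (simp add: integral_unique del: pd.simps)
  qed
  ultimately show ?thesis by (rule that)
qed

lemma conv_shift_kernel:
  assumes "k \<in> borel_measurable borel"
  shows "conv (\<lambda>x. k (x - a)) f x = conv k f (x - a)"
  by (simp add: conv_def algebra_simps)

lemma conv_kernel_diff:
  assumes "test_fun k" "test_fun k'" "sqint f"
  shows "conv (\<lambda>x. k x - k' x) f = (\<lambda>x. conv k f x - conv k' f x)"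
  using test_fun_conv_integrable[OF assms(1,3)] test_fun_conv_integrable[OF assms(2,3)]
  by (auto simp: conv_def left_diff_distrib)

text \<open>The field below is a truncation of the convolution of \<open>u\<close> with a kernel minus its translate by
  \<open>L\<close>: such a difference is a derivative of a compactly supported kernel, so that the truncation can be
  performed inside a curl and preserves the divergence constraint; the translate escapes to infinity.\<close>

lemma solenoidal_test_field:
  fixes u :: "'n::finite \<Rightarrow> real^'n \<Rightarrow> real" and K :: "real^'n \<Rightarrow> real"
  assumes u: "\<And>j. sqint (u j)" and K: "ctest K" and d: "\<delta> > 0"
    and dv: "\<And>\<psi>. test_fun \<psi> \<Longrightarrow> (\<Sum>j\<in>UNIV. \<integral>x. u j x * pd [j] \<psi> x \<partial>lborel) = 0"
  obtains \<phi> :: "'n \<Rightarrow> real^'n \<Rightarrow> real" where "\<And>b. ctest (\<phi> b)" "\<And>x. (\<Sum>b\<in>UNIV. pd [b] (\<phi> b) x) = 0"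
    "\<And>b js. length js \<le> J \<Longrightarrow> n2 (pd js (\<phi> b)) \<le> 2 * (\<integral>x. \<bar>pd js K x\<bar> \<partial>lborel) * n2 (u b) + \<delta>"
    "\<And>b js x. length js \<le> J \<Longrightarrow> \<bar>pd js (\<phi> b) x\<bar> \<le> 2 * n2 (pd js K) * n2 (u b) + \<delta>"
    "\<bar>(\<Sum>b\<in>UNIV. \<integral>x. u b x * \<phi> b x \<partial>lborel) - (\<Sum>b\<in>UNIV. \<integral>x. u b x * conv K (u b) x \<partial>lborel)\<bar> \<le> \<delta>"
proof -
  \<comment> \<open>Any coordinate direction serves for pushing the second copy to infinity.\<close>
  obtain e :: 'n where True by simp
  have Kt: "test_fun K" by (rule ctest_test[OF K])
  \<comment> \<open>Half of the admissible error in the pairing is reserved for the far copy, shared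
    equally by the components; the other half goes to the truncation.\<close>
  define \<eta> where "\<eta> = \<delta> / (2 * real CARD('n))"
  have \<eta>: "\<eta> > 0" using d by (simp add: \<eta>_def)
  have "\<forall>b. \<exists>L0. \<forall>L\<ge>L0. \<bar>\<integral>x. u b x * conv K (u b) (x - L *\<^sub>R axis e 1) \<partial>lborel\<bar> \<le> \<eta>"
    using pairing_shift_tendsto_0[OF u conv_young(1)[OF Kt u] _ \<eta>] by simp
  then obtain L0 where L0: "\<And>b L. L \<ge> L0 b \<Longrightarrow> \<bar>\<integral>x. u b x * conv K (u b) (x - L *\<^sub>R axis e 1) \<partial>lborel\<bar> \<le> \<eta>" by metis
  define L where "L = (\<Sum>b\<in>UNIV. \<bar>L0 b\<bar>) + 1"
  have L: "L > 0" unfolding L_def by (intro add_nonneg_pos sum_nonneg) auto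
  have LL0: "L \<ge> L0 b" for b
    using member_le_sum[of b UNIV "\<lambda>b. \<bar>L0 b\<bar>"] unfolding L_def by simp
  obtain F where F: "ctest F" "pd [e] F = (\<lambda>x. K x - K (x - L *\<^sub>R axis e 1))"
    by (rule shift_primitive_exists[OF K L])
  define K' where "K' = (\<lambda>x. K x - K (x - L *\<^sub>R axis e 1))"
  note Ft = ctest_test[OF F(1)] and sK = test_fun_smooth[OF Kt]
  have sKs: "smooth_fn (\<lambda>x. K (x - L *\<^sub>R axis e 1))" using smooth_fn_shift[OF sK, of "- (L *\<^sub>R axis e 1)"] by simp
  have pdK': "pd js K' = (\<lambda>x. pd js K x - pd js K (x - L *\<^sub>R axis e 1))" for js
    unfolding K'_def pd_diff[OF sK sKs] using pd_shift[OF sK, of js "- (L *\<^sub>R axis e 1)"] by simp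
  have pdF: "pd (js @ [e]) F = pd js K'" for js
    unfolding pd_append[symmetric] F(2) K'_def ..
  have K't: "test_fun (pd js K')" for js unfolding pdF[symmetric] by (rule test_fun_pd[OF Ft])
  have pKs: "test_fun (\<lambda>x. pd js K (x - L *\<^sub>R axis e 1))" for js
    using test_fun_shift[OF test_fun_pd[OF Kt], of js "- (L *\<^sub>R axis e 1)"] by simp
  define U where "U = (\<lambda>n j x. indicator (cball 0 (real n)) x * u j x)"
  have U: "sqint (U n j)" "integrable lborel (U n j)" for n j unfolding U_def by (intro sqint_indicator_ball u)+
  have Uz: "real n < norm x \<Longrightarrow> U n j x = 0" for n j x by (simp add: U_def indicator_def)
  have Ud: "sqint (\<lambda>x. u j x - U n j x)" for n j by (intro sqint_diff u U)
  have Ulim: "(\<lambda>n. n2 (\<lambda>x. u j x - U n j x)) \<longlonglongrightarrow> 0" for j unfolding U_def by (rule sqint_tail[OF u])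
  \<comment> \<open>For b other than e the component is d_e F * U_b, and the e-component is minus
    the sum of the d_c F * U_c. Symmetry of second derivatives makes the divergence vanish for
    arbitrary U. With u in place of U all components would be d_e F * u_b, because F * u is
    solenoidal.\<close>
  define \<Phi> where "\<Phi> = (\<lambda>n b x. if b = e then \<Sum>c\<in>UNIV-{e}. (-1) * conv (pd [c] F) (U n c) x else conv (pd [e] F) (U n b) x)"
  have cU: "ctest (conv (pd [c] F) (U n j))" for c n j by (rule conv_ctest[OF ctest_pd[OF F(1)] U(2) Uz])
  have \<Phi>e: "\<Phi> n e = (\<lambda>x. \<Sum>c\<in>UNIV-{e}. (-1) * conv (pd [c] F) (U n c) x)" for n by (simp add: \<Phi>_def)
  have \<Phi>o: "b \<noteq> e \<Longrightarrow> \<Phi> n b = conv (pd [e] F) (U n b)" for n b by (simp add: \<Phi>_def)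
  have c\<Phi>: "ctest (\<Phi> n b)" for n b
  proof (cases "b = e")
    case True
    show ?thesis unfolding True \<Phi>e by (rule ctest_sum) (rule ctest_cmult[OF cU])
  qed (simp only: \<Phi>o cU not_False_eq_True)
  have pdc: "pd js (conv (pd [c] F) (U n j)) = conv (pd (js @ [c]) F) (U n j)" for js c n j
    unfolding pd_conv[OF test_fun_pd[OF Ft] U(2)] pd_append ..
  have pd\<Phi>e: "pd js (\<Phi> n e) = (\<lambda>x. - (\<Sum>c\<in>UNIV-{e}. conv (pd (js @ [c]) F) (U n c) x))" for js n
  proof -
    have "pd js (\<Phi> n e) = (\<lambda>x. \<Sum>c\<in>UNIV-{e}. pd js (\<lambda>x. (-1) * conv (pd [c] F) (U n c) x) x)"
      unfolding \<Phi>e by (rule pd_sum) (rule smooth_fn_cmult[OF ctest_smooth[OF cU]])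
    then show ?thesis unfolding pd_cmult[OF ctest_smooth[OF cU]] pdc by (simp add: sum_negf del: pd.simps)
  qed
  have pd\<Phi>o: "b \<noteq> e \<Longrightarrow> pd js (\<Phi> n b) = conv (pd (js @ [e]) F) (U n b)" for js n b
    unfolding \<Phi>o pdc ..
  have div: "(\<Sum>b\<in>UNIV. pd [b] (\<Phi> n b) x) = 0" for n x
  proof -
    have "(\<Sum>b\<in>UNIV. pd [b] (\<Phi> n b) x) = pd [e] (\<Phi> n e) x + (\<Sum>b\<in>UNIV-{e}. pd [b] (\<Phi> n b) x)"
      by (rule sum.remove) auto
    also have "pd [e] (\<Phi> n e) x = - (\<Sum>b\<in>UNIV-{e}. conv (pd ([e] @ [b]) F) (U n b) x)" by (simp only: pd\<Phi>e)
    also have "(\<Sum>b\<in>UNIV-{e}. pd [b] (\<Phi> n b) x) = (\<Sum>b\<in>UNIV-{e}. conv (pd ([e] @ [b]) F) (U n b) x)"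
    proof (rule sum.cong[OF refl])
      fix b assume "b \<in> UNIV - {e}"
      then have "b \<noteq> e" by simp
      then have "pd [b] (\<Phi> n b) = conv (pd ([b] @ [e]) F) (U n b)" by (rule pd\<Phi>o)
      moreover have "pd ([b] @ [e]) F = pd ([e] @ [b]) F" by (rule ctest_comm[OF F(1)]) simp
      ultimately show "pd [b] (\<Phi> n b) x = conv (pd ([e] @ [b]) F) (U n b) x" by (simp only:)
    qed
    finally show ?thesis by simp
  qed
  \<comment> \<open>The divergence constraint on u, tested with the reflected kernel; it identifies
    the e-component of the field before truncation.\<close>
  have sum0: "(\<Sum>c\<in>UNIV. conv (pd (js @ [c]) F) (u c) x) = 0" for js x
  proof -
    let ?\<psi> = "\<lambda>y. pd js F (x - y)"
    have pt: "test_fun (pd js F)" by (rule test_fun_pd[OF Ft])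
    have "pd (js @ [c]) F = pd [c] (pd js F)" for c
      unfolding pd_append by (rule ctest_comm[OF F(1)]) simp
    then have e1: "pd [c] ?\<psi> y = - pd (js @ [c]) F (x - y)" for c y
      unfolding pd_reflect[OF test_fun_smooth[OF pt]] by (simp del: pd.simps)
    have "0 = (\<Sum>c\<in>UNIV. \<integral>y. u c y * pd [c] ?\<psi> y \<partial>lborel)" using dv[OF test_fun_reflect[OF pt], of x] by simp
    also have "\<dots> = - (\<Sum>c\<in>UNIV. conv (pd (js @ [c]) F) (u c) x)"
      unfolding e1 conv_def by (simp add: sum_negf mult.commute del: pd.simps)
    finally show ?thesis by simp
  qed
  \<comment> \<open>The effect of the truncation alone; it is controlled in L2 and in supremum norm
    by the tails \<open>T n\<close> of u, with constants that depend on F and hence on L, so L is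
    fixed before n.\<close>
  define E where "E = (\<lambda>n b js x. pd js (\<Phi> n b) x - conv (pd js K') (u b) x)"
  have cF: "test_fun (pd (js @ [c]) F)" for js c by (rule test_fun_pd[OF Ft])
  have Ee: "E n e js = (\<lambda>x. \<Sum>c\<in>UNIV-{e}. conv (pd (js @ [c]) F) (\<lambda>x. u c x - U n c x) x)" for n js
  proof
    fix x
    have "conv (pd (js @ [e]) F) (u e) x = - (\<Sum>c\<in>UNIV-{e}. conv (pd (js @ [c]) F) (u c) x)"
      using sum0[of js x] sum.remove[where A=UNIV and x=e and g="\<lambda>c. conv (pd (js @ [c]) F) (u c) x"] by simp
    then show "E n e js x = (\<Sum>c\<in>UNIV-{e}. conv (pd (js @ [c]) F) (\<lambda>x. u c x - U n c x) x)"
      unfolding E_def pd\<Phi>e pdF[symmetric] conv_diff[OF cF u U(1)] by (simp add: sum_subtractf)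
  qed
  have Eo: "b \<noteq> e \<Longrightarrow> E n b js = (\<lambda>x. (-1) * conv (pd (js @ [e]) F) (\<lambda>x. u b x - U n b x) x)" for n b js
    unfolding E_def pd\<Phi>o pdF[symmetric] conv_diff[OF cF u U(1)] by simp
  have sE: "sqint (E n b js)" for n b js
  proof (cases "b = e")
    case True
    show ?thesis unfolding True Ee by (rule sqint_sum) (rule conv_young(1)[OF cF Ud])
  next
    case False
    show ?thesis unfolding Eo[OF False] by (rule sqint_cmult) (rule conv_young(1)[OF cF Ud])
  qed
  define A where "A = (\<lambda>js. \<Sum>c\<in>UNIV. (\<integral>x. \<bar>pd (js @ [c]) F x\<bar> \<partial>lborel) + n2 (pd (js @ [c]) F))"
  define T where "T = (\<lambda>n. \<Sum>c\<in>UNIV. n2 (\<lambda>x. u c x - U n c x))"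
  have Tlim: "T \<longlonglongrightarrow> 0" unfolding T_def using tendsto_sum[OF Ulim, where I=UNIV] by simp
  have Ai: "(\<integral>x. \<bar>pd (js @ [c]) F x\<bar> \<partial>lborel) \<le> A js" "n2 (pd (js @ [c]) F) \<le> A js" for js c
    unfolding A_def
    by (intro order_trans[OF _ member_le_sum[of c UNIV "\<lambda>c. (\<integral>x. \<bar>pd (js @ [c]) F x\<bar> \<partial>lborel) + n2 (pd (js @ [c]) F)"]]; simp)+
  have A0: "A js \<ge> 0" for js unfolding A_def by (intro sum_nonneg add_nonneg_nonneg) auto
  have e1: "n2 (conv (pd (js @ [c]) F) (\<lambda>x. u j x - U n j x)) \<le> A js * n2 (\<lambda>x. u j x - U n j x)" for js c j n
    by (rule order_trans[OF conv_young(2)[OF cF Ud]]) (intro mult_right_mono Ai n2_nonneg)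
  have e2: "\<bar>conv (pd (js @ [c]) F) (\<lambda>x. u j x - U n j x) x\<bar> \<le> A js * n2 (\<lambda>x. u j x - U n j x)" for js c j n x
    by (rule order_trans[OF conv_sup[OF cF Ud]]) (intro mult_right_mono Ai n2_nonneg)
  have Tle: "A js * n2 (\<lambda>x. u j x - U n j x) \<le> A js * T n" for js j n
    unfolding T_def by (intro mult_left_mono member_le_sum A0) auto
  have Tsum: "(\<Sum>c\<in>UNIV-{e}. A js * n2 (\<lambda>x. u c x - U n c x)) \<le> A js * T n" for js n
    unfolding T_def sum_distrib_left by (intro sum_mono2 mult_nonneg_nonneg A0) auto
  have En2: "n2 (E n b js) \<le> A js * T n" for n b js
  proof (cases "b = e")
    case True
    have "n2 (E n e js) \<le> (\<Sum>c\<in>UNIV-{e}. n2 (conv (pd (js @ [c]) F) (\<lambda>x. u c x - U n c x)))"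
      unfolding Ee by (intro n2_sum conv_young(1)[OF cF Ud])
    also have "\<dots> \<le> (\<Sum>c\<in>UNIV-{e}. A js * n2 (\<lambda>x. u c x - U n c x))" by (intro sum_mono e1)
    finally show ?thesis using Tsum[of js n] True by simp
  next
    case False
    then show ?thesis unfolding Eo[OF False] n2_cmult using e1[of js e b n] Tle[of js b n] by simp
  qed
  have Esup: "\<bar>E n b js x\<bar> \<le> A js * T n" for n b js x
  proof (cases "b = e")
    case True
    have "\<bar>E n e js x\<bar> \<le> (\<Sum>c\<in>UNIV-{e}. \<bar>conv (pd (js @ [c]) F) (\<lambda>x. u c x - U n c x) x\<bar>)"
      unfolding Ee by (rule sum_abs)
    also have "\<dots> \<le> (\<Sum>c\<in>UNIV-{e}. A js * n2 (\<lambda>x. u c x - U n c x))" by (intro sum_mono e2)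
    finally show ?thesis using Tsum[of js n] True by simp
  next
    case False
    then show ?thesis unfolding Eo[OF False] using e2[of js e b n x] Tle[of js b n] by simp
  qed
  define S where "S = {js::'n list. length js \<le> J}"
  have finS: "finite S" unfolding S_def using finite_lists_length_le[of "UNIV::'n set" J] by simp
  have "\<forall>\<^sub>F n in sequentially. A js * T n < \<delta>" for js
    using tendsto_mult_right_zero[OF Tlim, of "A js"] d by (intro order_tendstoD)
  then have ev1: "\<forall>\<^sub>F n in sequentially. \<forall>js\<in>S. A js * T n < \<delta>" by (intro eventually_ball_finite finS ballI)
  have "(\<lambda>n. (\<Sum>b\<in>UNIV. n2 (u b)) * (A [] * T n)) \<longlonglongrightarrow> 0"
    by (intro tendsto_mult_right_zero Tlim)
  then have ev2: "\<forall>\<^sub>F n in sequentially. (\<Sum>b\<in>UNIV. n2 (u b)) * (A [] * T n) < \<delta> / 2"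
    using d by (intro order_tendstoD) auto
  obtain n where n: "\<And>js. js \<in> S \<Longrightarrow> A js * T n < \<delta>" "(\<Sum>b\<in>UNIV. n2 (u b)) * (A [] * T n) < \<delta> / 2"
    using eventually_conj[OF ev1 ev2] by (auto simp: eventually_sequentially)
  have pd_split: "pd js (\<Phi> n b) = (\<lambda>x. E n b js x + (conv (pd js K) (u b) x - conv (pd js K) (u b) (x - L *\<^sub>R axis e 1)))" for js b
    unfolding E_def pdK' conv_kernel_diff[OF test_fun_pd[OF Kt] pKs u] conv_shift_kernel[OF test_fun_measurable[OF test_fun_pd[OF Kt]]] by auto
  show ?thesis
  proof (rule that[of "\<Phi> n"])
    show "ctest (\<Phi> n b)" for b by (rule c\<Phi>)
    show "(\<Sum>b\<in>UNIV. pd [b] (\<Phi> n b) x) = 0" for x by (rule div)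
    fix b :: 'n and js :: "'n list" assume js: "length js \<le> J"
    let ?c = "conv (pd js K) (u b)"
    have sc: "sqint ?c" by (rule conv_young(1)[OF test_fun_pd[OF Kt] u])
    have scs: "sqint (\<lambda>x. ?c (x - L *\<^sub>R axis e 1))" "n2 (\<lambda>x. ?c (x - L *\<^sub>R axis e 1)) = n2 ?c"
      using sqint_shift[OF sc, of "- (L *\<^sub>R axis e 1)"] n2_shift[OF sqint_meas[OF sc], of "- (L *\<^sub>R axis e 1)"] by auto
    have s\<delta>: "A js * T n < \<delta>" using n(1) js by (simp add: S_def)
    have "n2 (pd js (\<Phi> n b)) \<le> n2 (E n b js) + (n2 ?c + n2 ?c)"
      unfolding pd_split using n2_add[OF sE[of n b js] sqint_diff[OF sc scs(1)]] n2_diff[OF sc scs(1)] scs(2) by linarith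
    then show "n2 (pd js (\<Phi> n b)) \<le> 2 * (\<integral>x. \<bar>pd js K x\<bar> \<partial>lborel) * n2 (u b) + \<delta>"
      using En2[of n b js] s\<delta> conv_young(2)[OF test_fun_pd[OF Kt] u, of js b] by simp
    fix x
    have "\<bar>pd js (\<Phi> n b) x\<bar> \<le> \<bar>E n b js x\<bar> + (\<bar>?c x\<bar> + \<bar>?c (x - L *\<^sub>R axis e 1)\<bar>)"
      unfolding pd_split by linarith
    then show "\<bar>pd js (\<Phi> n b) x\<bar> \<le> 2 * n2 (pd js K) * n2 (u b) + \<delta>"
      using Esup[of n b js x] s\<delta> conv_sup[OF test_fun_pd[OF Kt] u, of js b x]
        conv_sup[OF test_fun_pd[OF Kt] u, of js b "x - L *\<^sub>R axis e 1"] by simp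
  next
    have i: "(\<integral>x. u b x * \<Phi> n b x \<partial>lborel) = (\<integral>x. u b x * E n b [] x \<partial>lborel) + ((\<integral>x. u b x * conv K (u b) x \<partial>lborel) - (\<integral>x. u b x * conv K (u b) (x - L *\<^sub>R axis e 1) \<partial>lborel))" for b
    proof -
      have sc: "sqint (conv K (u b))" by (rule conv_young(1)[OF Kt u])
      have scs: "sqint (\<lambda>x. conv K (u b) (x - L *\<^sub>R axis e 1))" using sqint_shift[OF sc, of "- (L *\<^sub>R axis e 1)"] by simp
      have "(\<lambda>x. u b x * \<Phi> n b x) = (\<lambda>x. u b x * E n b [] x + (u b x * conv K (u b) x - u b x * conv K (u b) (x - L *\<^sub>R axis e 1)))"
      proof
        fix x
        have "\<Phi> n b x = E n b [] x + (conv K (u b) x - conv K (u b) (x - L *\<^sub>R axis e 1))"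
          using fun_cong[OF pd_split[of "[]" b], of x] by simp
        then show "u b x * \<Phi> n b x = u b x * E n b [] x + (u b x * conv K (u b) x - u b x * conv K (u b) (x - L *\<^sub>R axis e 1))"
          by (simp only: distrib_left right_diff_distrib)
      qed
      then show ?thesis
        using sqint_mult_integrable[OF u sE] sqint_mult_integrable[OF u sc] sqint_mult_integrable[OF u scs] by simp
    qed
    have "\<bar>\<integral>x. u b x * E n b [] x \<partial>lborel\<bar> \<le> n2 (u b) * (A [] * T n)" for b
      by (rule order_trans[OF sqint_cauchy_schwarz[OF u sE]]) (intro mult_left_mono En2 n2_nonneg)
    then have "\<bar>\<Sum>b\<in>UNIV. \<integral>x. u b x * E n b [] x \<partial>lborel\<bar> \<le> (\<Sum>b\<in>UNIV. n2 (u b) * (A [] * T n))"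
      by (intro order_trans[OF sum_abs] sum_mono)
    then have 1: "\<bar>\<Sum>b\<in>UNIV. \<integral>x. u b x * E n b [] x \<partial>lborel\<bar> < \<delta> / 2" using n(2) unfolding sum_distrib_right by linarith
    have "\<bar>\<Sum>b\<in>UNIV. \<integral>x. u b x * conv K (u b) (x - L *\<^sub>R axis e 1) \<partial>lborel\<bar> \<le> (\<Sum>b\<in>(UNIV::'n set). \<eta>)"
      by (intro order_trans[OF sum_abs] sum_mono L0 LL0)
    then have 2: "\<bar>\<Sum>b\<in>UNIV. \<integral>x. u b x * conv K (u b) (x - L *\<^sub>R axis e 1) \<partial>lborel\<bar> \<le> \<delta> / 2" by (simp add: \<eta>_def)
    show "\<bar>(\<Sum>b\<in>UNIV. \<integral>x. u b x * \<Phi> n b x \<partial>lborel) - (\<Sum>b\<in>UNIV. \<integral>x. u b x * conv K (u b) x \<partial>lborel)\<bar> \<le> \<delta>"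
      unfolding i sum.distrib sum_subtractf using 1 2 by linarith
  qed
qed

section \<open>Decay of the microrotation pairings\<close>

text \<open>Comparison with Y, the solution of Y' = C - l Y that starts at C / l + |b r|. The
  inequality is kept in integrated form because b is only continuous.\<close>

lemma damping_upper:
  fixes b :: "real \<Rightarrow> real"
  assumes l: "l > 0" and C: "C \<ge> 0" and rs: "r \<le> s" and cb: "continuous_on {r..s} b"
    and inc: "\<And>s1 s2. r \<le> s1 \<Longrightarrow> s1 \<le> s2 \<Longrightarrow> s2 \<le> s \<Longrightarrow> b s2 - b s1 \<le> C * (s2 - s1) - l * integral {s1..s2} b"
  shows "b s \<le> exp (- l * (s - r)) * \<bar>b r\<bar> + C / l"
proof (rule ccontr)
  define Y where "Y = (\<lambda>x. C / l + exp (- l * (x - r)) * \<bar>b r\<bar>)"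
  define d where "d = (\<lambda>x. b x - Y x)"
  assume "\<not> ?thesis"
  then have ds: "d s > 0" by (simp add: d_def Y_def)
  have dr: "d r \<le> 0" using C l by (simp add: d_def Y_def add_increasing)
  have cY: "continuous_on X Y" for X unfolding Y_def using l by (intro continuous_intros) auto
  have cd: "continuous_on {r..s} d" unfolding d_def by (intro continuous_intros cb cY)
  have Yinc: "Y s2 - Y s1 = C * (s2 - s1) - l * integral {s1..s2} Y" if "s1 \<le> s2" for s1 s2
  proof -
    have "((\<lambda>x. C - l * Y x) has_integral Y s2 - Y s1) {s1..s2}"
    proof (rule fundamental_theorem_of_calculus[OF that])
      fix x
      have "(Y has_real_derivative C - l * Y x) (at x)"
        unfolding Y_def using l by (auto intro!: derivative_eq_intros simp: algebra_simps)
      then show "(Y has_vector_derivative C - l * Y x) (at x within {s1..s2})"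
        using has_field_derivative_at_within has_real_derivative_iff_has_vector_derivative by blast
    qed
    moreover have "((\<lambda>x. C - l * Y x) has_integral (C * (s2 - s1) - l * integral {s1..s2} Y)) {s1..s2}"
      using that has_integral_const_real[of C s1 s2]
      by (intro has_integral_diff has_integral_mult_right integrable_integral integrable_continuous_real cY) (simp add: mult.commute)
    ultimately show ?thesis by (rule has_integral_unique)
  qed
  \<comment> \<open>The last time at which b does not exceed Y: there equality holds, and from then
    on b is at least Y, so b is damped at least as strongly and cannot end above Y.\<close>
  define S where "S = {x \<in> {r..s}. d x \<le> 0}"
  have "closed S" unfolding S_def by (intro continuous_closed_preimage_constant[of "{r..s}" d, unfolded vimage_def] continuous_on_closed_Collect_le cd continuous_intros closed_atLeastAtMost)
  moreover have "{r..s} \<inter> S = S" by (auto simp: S_def)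
  ultimately have "compact S" using compact_Int_closed[of "{r..s}" S] by simp
  moreover have "r \<in> S" using dr rs by (simp add: S_def)
  ultimately obtain s1 where s1: "s1 \<in> S" "\<And>x. x \<in> S \<Longrightarrow> x \<le> s1" using compact_attains_sup[of S] by blast
  have s1r: "r \<le> s1" "s1 \<le> s" "d s1 \<le> 0" using s1(1) by (auto simp: S_def)
  obtain x where x: "s1 \<le> x" "x \<le> s" "d x = 0"
    using IVT'[of d s1 0 s] s1r ds continuous_on_subset[OF cd, of "{s1..s}"] by auto
  then have "x \<in> S" using s1r by (simp add: S_def)
  then have "x = s1" using s1(2) x by force
  then have d0: "d s1 = 0" using x by simp
  have dpos: "0 \<le> d y" if "y \<in> {s1..s}" for y
  proof (cases "y = s1")
    case False
    then have "y \<notin> S" using s1(2)[of y] that by auto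
    then show ?thesis using that s1r by (auto simp: S_def)
  qed (use d0 in simp)
  have bi: "b integrable_on {s1..s}" using continuous_on_subset[OF cb] s1r by (intro integrable_continuous_real) auto
  have Yi: "Y integrable_on {s1..s}" by (intro integrable_continuous_real cY)
  have "0 \<le> integral {s1..s} d" unfolding d_def
    by (rule integral_nonneg) (use dpos in \<open>auto simp: d_def intro!: integrable_diff bi Yi\<close>)
  also have "integral {s1..s} d = integral {s1..s} b - integral {s1..s} Y"
    unfolding d_def by (rule integral_diff[OF bi Yi])
  finally have "l * integral {s1..s} Y \<le> l * integral {s1..s} b" using l by simp
  moreover have "b s - b s1 \<le> C * (s - s1) - l * integral {s1..s} b" using inc[of s1 s] s1r by simp
  ultimately have "d s \<le> d s1" using Yinc[of s1 s] s1r by (simp add: d_def)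
  then show False using ds d0 by simp
qed

text \<open>The one-sided comparison for b and for -b. The forcing h is bounded by H, while G
  measures the rate at which the integral equation may fail.\<close>

lemma damping_bound:
  fixes b h :: "real \<Rightarrow> real"
  assumes l: "l > 0" and rs: "r \<le> s" and cb: "continuous_on {r..s} b" and ch: "continuous_on {r..s} h"
    and H: "\<And>x. x \<in> {r..s} \<Longrightarrow> \<bar>h x\<bar> \<le> H" and G: "G \<ge> 0"
    and inc: "\<And>s1 s2. r \<le> s1 \<Longrightarrow> s1 \<le> s2 \<Longrightarrow> s2 \<le> s \<Longrightarrow> \<bar>b s2 - b s1 - integral {s1..s2} (\<lambda>x. h x - l * b x)\<bar> \<le> G * (s2 - s1)"
  shows "\<bar>b s\<bar> \<le> exp (- l * (s - r)) * \<bar>b r\<bar> + (H + G) / l"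
proof -
  have H0: "H \<ge> 0" using H[of r] rs by force
  have main: "\<bar>b s2 - b s1 + l * integral {s1..s2} b\<bar> \<le> (H + G) * (s2 - s1)" if s: "r \<le> s1" "s1 \<le> s2" "s2 \<le> s" for s1 s2
  proof -
    have sub: "{s1..s2} \<subseteq> {r..s}" using s by auto
    have hi: "h integrable_on {s1..s2}" and bi: "b integrable_on {s1..s2}"
      using continuous_on_subset[OF ch sub] continuous_on_subset[OF cb sub] by (auto intro: integrable_continuous_real)
    have "integral {s1..s2} (\<lambda>x. h x - l * b x) = integral {s1..s2} h - l * integral {s1..s2} b"
      using hi bi by (subst integral_diff) (auto intro: integrable_on_mult_right)
    moreover have "\<bar>integral {s1..s2} h\<bar> \<le> H * (s2 - s1)"
      using integral_bound[OF s(2) continuous_on_subset[OF ch sub], of H] H sub by auto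
    moreover note inc[OF s]
    ultimately show ?thesis by (simp add: distrib_right)
  qed
  have "b s \<le> exp (- l * (s - r)) * \<bar>b r\<bar> + (H + G) / l"
  proof (rule damping_upper[OF l _ rs cb])
    fix s1 s2 assume "r \<le> s1" "s1 \<le> s2" "s2 \<le> s"
    from main[OF this] show "b s2 - b s1 \<le> (H + G) * (s2 - s1) - l * integral {s1..s2} b" by linarith
  qed (use H0 G in simp)
  moreover have "- b s \<le> exp (- l * (s - r)) * \<bar>- b r\<bar> + (H + G) / l"
  proof (rule damping_upper[OF l _ rs])
    show "continuous_on {r..s} (\<lambda>x. - b x)" by (intro continuous_intros cb)
    fix s1 s2 assume "r \<le> s1" "s1 \<le> s2" "s2 \<le> s"
    from main[OF this] show "- b s2 - - b s1 \<le> (H + G) * (s2 - s1) - l * integral {s1..s2} (\<lambda>x. - b x)" by simp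
  qed (use H0 G in simp)
  ultimately show ?thesis by auto
qed

section \<open>Pairings, solenoidal fields and their scaling\<close>

definition pr :: "('n::finite \<Rightarrow> real^'n \<Rightarrow> real) \<Rightarrow> ('n \<Rightarrow> real^'n \<Rightarrow> real) \<Rightarrow> real" where
  "pr f \<phi> = (\<Sum>b\<in>UNIV. \<integral>x. f b x * \<phi> b x \<partial>lborel)"

definition nrm :: "('n::finite \<Rightarrow> real^'n \<Rightarrow> real) \<Rightarrow> real" where
  "nrm f = sqrt (\<Sum>b\<in>UNIV. (n2 (f b))\<^sup>2)"

text \<open>The name stands for solenoidal: these are the admissible test fields, with symmetry of
  derivatives included through \<open>ctest\<close>.\<close>

definition sol :: "('n::finite \<Rightarrow> real^'n \<Rightarrow> real) \<Rightarrow> bool" where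
  "sol \<phi> \<longleftrightarrow> (\<forall>b. ctest (\<phi> b)) \<and> (\<forall>x. (\<Sum>b\<in>UNIV. pd [b] (\<phi> b) x) = 0)"

definition lap :: "('n::finite \<Rightarrow> real^'n \<Rightarrow> real) \<Rightarrow> 'n \<Rightarrow> real^'n \<Rightarrow> real" where
  "lap \<phi> b x = (\<Sum>j\<in>UNIV. pd [j, j] (\<phi> b) x)"

text \<open>Size of a field at length scale \<open>l\<close>, for derivatives up to order \<open>J\<close>; \<open>a\<close> counts derivatives already taken.
  The sup bound needs only one extra factor \<open>1 / l\<close>, which is the correct scaling in dimension two and,
  for \<open>l \<ge> 1\<close>, a lossy but sufficient one in dimension three.\<close>
definition tb :: "nat \<Rightarrow> real \<Rightarrow> real \<Rightarrow> nat \<Rightarrow> (real^'n::finite \<Rightarrow> real) \<Rightarrow> bool" where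
  "tb J l V a f \<longleftrightarrow> (\<forall>js. a + length js \<le> J \<longrightarrow> n2 (pd js f) \<le> V * (1 / l) ^ (a + length js) \<and>
     (\<forall>x. \<bar>pd js f x\<bar> \<le> V * (1 / l) ^ Suc (a + length js)))"

lemma nrm_nonneg[simp]: "0 \<le> nrm f" by (simp add: nrm_def sum_nonneg)

lemma n2_le_nrm: "n2 (f b) \<le> nrm f"
  unfolding nrm_def by (rule real_le_rsqrt) (rule member_le_sum[of b UNIV "\<lambda>b. (n2 (f b))\<^sup>2"], auto)

lemma tb_pd: assumes "tb J l V a f" shows "tb J l V (a + length ks) (pd ks f)"
  unfolding tb_def pd_append
proof (intro allI impI)
  fix js :: "'a list" assume "a + length ks + length js \<le> J"
  then show "n2 (pd (js @ ks) f) \<le> V * (1 / l) ^ (a + length ks + length js) \<and>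
     (\<forall>x. \<bar>pd (js @ ks) f x\<bar> \<le> V * (1 / l) ^ Suc (a + length ks + length js))"
    using assms[unfolded tb_def, rule_format, of "js @ ks"] by (simp add: add_ac)
qed

lemma tb_sum:
  fixes f :: "'n::finite \<Rightarrow> real^'n \<Rightarrow> real"
  assumes "\<And>i. tb J l V a (f i)" "\<And>i. test_fun (f i)"
  shows "tb J l (real CARD('n) * V) a (\<lambda>x. \<Sum>i\<in>UNIV. f i x)"
  unfolding tb_def pd_sum[OF test_fun_smooth[OF assms(2)]]
proof (intro allI impI conjI)
  fix js :: "'n list" assume js: "a + length js \<le> J"
  have "n2 (\<lambda>x. \<Sum>i\<in>UNIV. pd js (f i) x) \<le> (\<Sum>i\<in>UNIV. n2 (pd js (f i)))"
    by (rule n2_sum) (rule test_fun_sqint(1)[OF test_fun_pd[OF assms(2)]])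
  also have "\<dots> \<le> (\<Sum>i\<in>(UNIV::'n set). V * (1 / l) ^ (a + length js))"
    using assms(1) js by (intro sum_mono) (auto simp: tb_def)
  finally show "n2 (\<lambda>x. \<Sum>i\<in>UNIV. pd js (f i) x) \<le> real CARD('n) * V * (1 / l) ^ (a + length js)" by simp
  fix x
  have "\<bar>\<Sum>i\<in>UNIV. pd js (f i) x\<bar> \<le> (\<Sum>i\<in>UNIV. \<bar>pd js (f i) x\<bar>)" by (rule sum_abs)
  also have "\<dots> \<le> (\<Sum>i\<in>(UNIV::'n set). V * (1 / l) ^ Suc (a + length js))"
    using assms(1) js by (intro sum_mono) (auto simp: tb_def simp del: power_Suc)
  finally show "\<bar>\<Sum>i\<in>UNIV. pd js (f i) x\<bar> \<le> real CARD('n) * V * (1 / l) ^ Suc (a + length js)" by simp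
qed

lemma sol_test: "sol \<phi> \<Longrightarrow> test_fun (\<phi> b)" by (simp add: sol_def ctest_test)

lemma sol_lap: assumes "sol \<phi>" shows "sol (lap \<phi>)"
proof -
  have c: "ctest (\<phi> b)" for b using assms by (simp add: sol_def)
  have s: "smooth_fn (pd [j, j] (\<phi> b))" for j b by (rule smooth_fn_pd[OF ctest_smooth[OF c]])
  have "(\<Sum>b\<in>UNIV. pd [b] (lap \<phi> b) x) = 0" for x
  proof -
    have z: "(\<lambda>x. \<Sum>b\<in>UNIV. pd [b] (\<phi> b) x) = (\<lambda>x. 0)" using assms by (auto simp: sol_def)
    have "pd [b] (lap \<phi> b) x = (\<Sum>j\<in>UNIV. pd [j, j] (pd [b] (\<phi> b)) x)" for b
    proof -
      have "pd [b] (lap \<phi> b) = (\<lambda>x. \<Sum>j\<in>UNIV. pd [b] (pd [j, j] (\<phi> b)) x)"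
        unfolding lap_def[abs_def] by (rule pd_sum[OF s])
      moreover have "pd [b] (pd [j, j] (\<phi> b)) = pd [j, j] (pd [b] (\<phi> b))" for j
        unfolding pd_append by (rule ctest_comm[OF c]) simp
      ultimately show ?thesis by (simp only:)
    qed
    then have "(\<Sum>b\<in>UNIV. pd [b] (lap \<phi> b) x) = (\<Sum>b\<in>UNIV. \<Sum>j\<in>UNIV. pd [j, j] (pd [b] (\<phi> b)) x)" by (simp only:)
    also have "\<dots> = (\<Sum>j\<in>UNIV. \<Sum>b\<in>UNIV. pd [j, j] (pd [b] (\<phi> b)) x)" by (rule sum.swap)
    also have "\<dots> = 0"
    proof (rule sum.neutral, rule ballI)
      fix j
      have "pd [j, j] (\<lambda>x. \<Sum>b\<in>UNIV. pd [b] (\<phi> b) x) = (\<lambda>x. \<Sum>b\<in>UNIV. pd [j, j] (pd [b] (\<phi> b)) x)"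
        by (rule pd_sum) (rule smooth_fn_pd[OF ctest_smooth[OF c]])
      then show "(\<Sum>b\<in>UNIV. pd [j, j] (pd [b] (\<phi> b)) x) = 0" unfolding z pd_zero by (rule fun_cong[symmetric])
    qed
    finally show ?thesis .
  qed
  moreover have "ctest (lap \<phi> b)" for b unfolding lap_def[abs_def] by (intro ctest_sum ctest_pd c)
  ultimately show ?thesis by (simp add: sol_def del: pd.simps)
qed

lemma tb_lap:
  assumes "sol \<phi>" "\<And>b. tb J l V a (\<phi> b)"
  shows "tb J l (real CARD('n::finite) * V) (a + 2) (lap \<phi> (b::'n))"
  unfolding lap_def[abs_def]
  using tb_pd[OF assms(2), of "[j, j]" for j] by (intro tb_sum test_fun_pd sol_test[OF assms(1)]) (simp del: pd.simps)

lemma sol_lap_pow: "sol \<phi> \<Longrightarrow> sol ((lap ^^ k) \<phi>)"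
  by (induction k) (auto intro: sol_lap)

lemma tb_lap_pow:
  assumes "sol \<phi>" "\<And>b. tb J l V 0 (\<phi> b)"
  shows "tb J l (real CARD('n::finite) ^ k * V) (2 * k) ((lap ^^ k) \<phi> (b::'n))"
proof (induction k arbitrary: b)
  case (Suc k)
  from tb_lap[OF sol_lap_pow[OF assms(1)] this] show ?case by (simp add: mult.assoc)
qed (use assms in simp)

lemma pr_bound:
  fixes f \<phi> :: "'n::finite \<Rightarrow> real^'n \<Rightarrow> real"
  assumes f: "\<And>b. sqint (f b)" and \<phi>: "\<And>b. sqint (\<phi> b)" and U: "nrm f \<le> U" and q: "\<And>b. n2 (\<phi> b) \<le> q"
  shows "\<bar>pr f \<phi>\<bar> \<le> real CARD('n) * (U * q)"
proof -
  have "\<bar>pr f \<phi>\<bar> \<le> (\<Sum>b\<in>UNIV. \<bar>\<integral>x. f b x * \<phi> b x \<partial>lborel\<bar>)" unfolding pr_def by (rule sum_abs)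
  also have "\<dots> \<le> (\<Sum>b\<in>(UNIV::'n set). U * q)"
  proof (intro sum_mono)
    fix b
    have "\<bar>\<integral>x. f b x * \<phi> b x \<partial>lborel\<bar> \<le> n2 (f b) * n2 (\<phi> b)" by (rule sqint_cauchy_schwarz[OF f \<phi>])
    also have "\<dots> \<le> U * q" using order_trans[OF n2_le_nrm U, of b] q[of b] by (intro mult_mono) (auto intro: order_trans[OF n2_nonneg])
    finally show "\<bar>\<integral>x. f b x * \<phi> b x \<partial>lborel\<bar> \<le> U * q" .
  qed
  finally show ?thesis by simp
qed

text \<open>All that the lower bound uses of a Leray solution: \<open>\<beta> \<phi> s\<close> stands for the pairing of \<open>w(s)\<close> with the curl of
  \<open>\<phi>\<close>, \<open>Z\<close> for the norm of the data. The \<open>\<kappa>\<close>-term is absent because curls are divergence free.\<close>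
definition damped :: "real \<Rightarrow> real \<Rightarrow> real \<Rightarrow> real \<Rightarrow> (real \<Rightarrow> 'n::finite \<Rightarrow> real^'n \<Rightarrow> real)
    \<Rightarrow> (('n \<Rightarrow> real^'n \<Rightarrow> real) \<Rightarrow> real \<Rightarrow> real) \<Rightarrow> bool" where
  "damped \<mu> \<nu> \<xi> Z u \<beta> \<longleftrightarrow>
    (\<forall>t\<ge>0. (\<forall>b. sqint (u t b)) \<and> nrm (u t) \<le> Z \<and>
       (\<forall>\<psi>. test_fun \<psi> \<longrightarrow> (\<Sum>j\<in>UNIV. \<integral>x. u t j x * pd [j] \<psi> x \<partial>lborel) = 0)) \<and>
    (\<forall>\<phi>. sol \<phi> \<longrightarrow>
       continuous_on {0..} (\<lambda>t. pr (u t) \<phi>) \<and> continuous_on {0..} (\<beta> \<phi>) \<and>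
       (\<forall>s1 s2 q U. 0 \<le> s1 \<and> s1 \<le> s2 \<and> (\<forall>j b x. \<bar>pd [j] (\<phi> b) x\<bar> \<le> q) \<and> (\<forall>s\<in>{s1..s2}. nrm (u s) \<le> U) \<longrightarrow>
          \<bar>pr (u s2) \<phi> - pr (u s1) \<phi> - integral {s1..s2} (\<lambda>s. (\<mu> + \<xi>) * pr (u s) (lap \<phi>) + 2 * \<xi> * \<beta> \<phi> s)\<bar>
            \<le> 100 * U\<^sup>2 * q * (s2 - s1)) \<and>
       (\<forall>s1 s2 q U. 0 \<le> s1 \<and> s1 \<le> s2 \<and> (\<forall>i j b x. \<bar>pd [i, j] (\<phi> b) x\<bar> \<le> q) \<and> (\<forall>s\<in>{s1..s2}. nrm (u s) \<le> U) \<longrightarrow>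
          \<bar>\<beta> \<phi> s2 - \<beta> \<phi> s1 - integral {s1..s2} (\<lambda>s. \<nu> * \<beta> (lap \<phi>) s - 4 * \<xi> * \<beta> \<phi> s - 2 * \<xi> * pr (u s) (lap \<phi>))\<bar>
            \<le> 100 * Z * U * q * (s2 - s1)) \<and>
       (\<forall>q s. s \<ge> 0 \<and> (\<forall>j b. n2 (pd [j] (\<phi> b)) \<le> q) \<longrightarrow> \<bar>\<beta> \<phi> s\<bar> \<le> 100 * Z * q))"

text \<open>Bound for the pairing of the microrotation with the curl of the \<open>(N - j)\<close>-th iterated Laplacian of the
  test field, per unit size of the test field; \<open>l\<close> is the length scale of that field and \<open>d\<close> the dimension.\<close>
primrec rot_bound :: "real \<Rightarrow> real \<Rightarrow> real \<Rightarrow> nat \<Rightarrow> real \<Rightarrow> real \<Rightarrow> real \<Rightarrow> real \<Rightarrow> nat \<Rightarrow> real" where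
  "rot_bound \<nu> \<xi> Z N d t l U 0 = 100 * Z * d ^ N * (1 / l) ^ (2 * N + 1)"
| "rot_bound \<nu> \<xi> Z N d t l U (Suc j) =
     exp (- 4 * \<xi> * (t / (2 * (real N + 1)))) * (100 * Z * d ^ (N - Suc j) * (1 / l) ^ (2 * (N - Suc j) + 1))
     + (\<nu> * rot_bound \<nu> \<xi> Z N d t l U j + 2 * \<xi> * (d * (U * (d ^ (N - j) * (1 / l) ^ (2 * (N - j)))))
        + 100 * Z * U * (d ^ (N - Suc j) * (1 / l) ^ (2 * (N - Suc j) + 3))) / (4 * \<xi>)"

text \<open>Induction from the N-th Laplacian, where only the crude bound is used, down to lower
  powers. The pairing with the k-th power obeys a damped equation forced by the (k+1)-st one, by u
  and by convection. Each stage waits for a time \<tau> = t / (2 (N + 1)) so that the exponential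
  makes the crude bound at the start of the stage negligible; all stages together stay within
  [t / 2, t'], where the bound U for u is available.\<close>

lemma rot_estimate:
  fixes u :: "real \<Rightarrow> 'n::finite \<Rightarrow> real^'n \<Rightarrow> real"
  assumes D: "damped \<mu> \<nu> \<xi> Z u \<beta>" and \<phi>: "sol \<phi>" and tb: "\<And>b. tb (2 * N + 2) l W 0 (\<phi> b)"
    and pos: "\<nu> > 0" "\<xi> > 0" "Z \<ge> 0" "l > 0" "W \<ge> 0" "t > 0" "t \<le> t'"
    and U: "\<And>s. t / 2 \<le> s \<Longrightarrow> s \<le> t' \<Longrightarrow> nrm (u s) \<le> U"
    and j: "j \<le> N" and s: "t - real (N - j) * (t / (2 * (real N + 1))) \<le> s" "s \<le> t'"
  shows "\<bar>\<beta> ((lap ^^ (N - j)) \<phi>) s\<bar> \<le> rot_bound \<nu> \<xi> Z N (real CARD('n)) t l U j * W"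
  using j s
proof (induction j arbitrary: s)
  case 0
  have tN: "real N * (t / (2 * (real N + 1))) \<le> t / 2" using pos by (simp add: field_simps)
  have sN: "sol ((lap ^^ N) \<phi>)" by (rule sol_lap_pow[OF \<phi>])
  have "s \<ge> 0" using 0 tN pos by simp
  moreover have "n2 (pd [j] ((lap ^^ N) \<phi> b)) \<le> real CARD('n) ^ N * W * (1 / l) ^ (2 * N + 1)" for j b
    using tb_lap_pow[OF \<phi> tb, of N b, unfolded tb_def, rule_format, of "[j]"] by (simp del: pd.simps)
  ultimately have "\<bar>\<beta> ((lap ^^ N) \<phi>) s\<bar> \<le> 100 * Z * (real CARD('n) ^ N * W * (1 / l) ^ (2 * N + 1))"
    using D sN unfolding damped_def by blast
  then show ?case by (simp add: mult_ac)
next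
  case (Suc j)
  let ?n = "real CARD('n)" and ?\<tau> = "t / (2 * (real N + 1))"
  define k where "k = N - Suc j"
  have kN: "N - j = Suc k" "k < N" using Suc.prems by (auto simp: k_def)
  define r where "r = s - ?\<tau>"
  have \<tau>: "?\<tau> > 0" using pos by simp
  have k1: "real (Suc k) * ?\<tau> \<le> t / 2"
  proof -
    have "real (Suc k) * ?\<tau> \<le> (real N + 1) * ?\<tau>" using kN \<tau> by (intro mult_right_mono) auto
    also have "\<dots> = t / 2" by (simp add: field_simps)
    finally show ?thesis .
  qed
  \<comment> \<open>The interval for index j reaches further back by exactly one \<tau> than that
    for its successor, so the induction hypothesis covers the whole waiting period that starts at
    \<open>r\<close>.\<close>
  have sk: "t - real k * ?\<tau> \<le> s" using Suc.prems by (simp add: k_def)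
  have r1: "t - real (Suc k) * ?\<tau> \<le> r"
  proof -
    have "real (Suc k) * ?\<tau> = real k * ?\<tau> + ?\<tau>" unfolding of_nat_Suc distrib_right by simp
    then show ?thesis using sk unfolding r_def by linarith
  qed
  have r2: "t / 2 \<le> r" using r1 k1 by linarith
  have r0: "0 \<le> r" using r2 pos by simp
  have rs: "r \<le> s" using \<tau> by (simp add: r_def)
  let ?\<phi> = "(lap ^^ k) \<phi>"
  have sk': "sol ?\<phi>" by (rule sol_lap_pow[OF \<phi>])
  have lapk: "lap ?\<phi> = (lap ^^ Suc k) \<phi>" by simp
  have sk'': "sol (lap ?\<phi>)" by (rule sol_lap[OF sk'])
  note Dk = D[unfolded damped_def, THEN conjunct2, rule_format, OF sk']
  note Dk' = D[unfolded damped_def, THEN conjunct2, rule_format, OF sk'']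
  have cb: "continuous_on {r..s} (\<beta> ?\<phi>)" using Dk r0 by (auto elim: continuous_on_subset)
  have cb': "continuous_on {r..s} (\<beta> (lap ?\<phi>))" using Dk' r0 by (auto elim: continuous_on_subset)
  have cp: "continuous_on {r..s} (\<lambda>s. pr (u s) (lap ?\<phi>))" using Dk' r0 by (auto elim: continuous_on_subset)
  let ?P = "?n * (U * (?n ^ Suc k * W * (1 / l) ^ (2 * Suc k)))"
  let ?E = "rot_bound \<nu> \<xi> Z N ?n t l U j * W"
  have U': "nrm (u x) \<le> U" if "x \<in> {r..s}" for x using that r2 Suc.prems by (intro U) auto
  have U0: "U \<ge> 0" using order_trans[OF nrm_nonneg U'[of r]] rs by simp
  have prb: "\<bar>pr (u x) (lap ?\<phi>)\<bar> \<le> ?P" if x: "x \<in> {r..s}" for x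
  proof (rule pr_bound)
    show "sqint (u x b)" for b using D x r0 by (auto simp: damped_def)
    show "sqint (lap ?\<phi> b)" for b by (rule test_fun_sqint(1)[OF sol_test[OF sk'']])
    show "nrm (u x) \<le> U" by (rule U'[OF x])
    show "n2 (lap ?\<phi> b) \<le> ?n ^ Suc k * W * (1 / l) ^ (2 * Suc k)" for b
      using tb_lap_pow[OF \<phi> tb, of "Suc k" b, unfolded tb_def, rule_format, of "[]"] kN by simp
  qed
  have bb: "\<bar>\<beta> (lap ?\<phi>) x\<bar> \<le> ?E" if x: "x \<in> {r..s}" for x
  proof -
    have "\<bar>\<beta> ((lap ^^ (N - j)) \<phi>) x\<bar> \<le> ?E"
      using x r1 Suc.prems by (intro Suc.IH) (auto simp: kN)
    then show ?thesis unfolding kN lapk .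
  qed
  have "\<bar>\<beta> ?\<phi> s\<bar> \<le> exp (- (4 * \<xi>) * (s - r)) * \<bar>\<beta> ?\<phi> r\<bar> + ((\<nu> * ?E + 2 * \<xi> * ?P) + 100 * Z * U * (?n ^ k * W * (1 / l) ^ (2 * k + 3))) / (4 * \<xi>)"
  proof (rule damping_bound[where h="\<lambda>x. \<nu> * \<beta> (lap ?\<phi>) x - 2 * \<xi> * pr (u x) (lap ?\<phi>)"])
    show "continuous_on {r..s} (\<lambda>x. \<nu> * \<beta> (lap ?\<phi>) x - 2 * \<xi> * pr (u x) (lap ?\<phi>))" by (intro continuous_intros cb' cp)
    show "\<bar>\<nu> * \<beta> (lap ?\<phi>) x - 2 * \<xi> * pr (u x) (lap ?\<phi>)\<bar> \<le> \<nu> * ?E + 2 * \<xi> * ?P" if x: "x \<in> {r..s}" for x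
    proof -
      have "\<bar>\<nu> * \<beta> (lap ?\<phi>) x - 2 * \<xi> * pr (u x) (lap ?\<phi>)\<bar> \<le> \<bar>\<nu> * \<beta> (lap ?\<phi>) x\<bar> + \<bar>2 * \<xi> * pr (u x) (lap ?\<phi>)\<bar>"
        by (rule abs_triangle_ineq4)
      also have "\<dots> = \<nu> * \<bar>\<beta> (lap ?\<phi>) x\<bar> + 2 * \<xi> * \<bar>pr (u x) (lap ?\<phi>)\<bar>" using pos by (simp add: abs_mult)
      also have "\<dots> \<le> \<nu> * ?E + 2 * \<xi> * ?P" using pos bb[OF x] prb[OF x] by (intro add_mono mult_left_mono) auto
      finally show ?thesis .
    qed
    show "0 \<le> 100 * Z * U * (?n ^ k * W * (1 / l) ^ (2 * k + 3))" using pos U0 by (intro mult_nonneg_nonneg) auto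
    fix s1 s2 assume s12: "r \<le> s1" "s1 \<le> s2" "s2 \<le> s"
    have q: "\<bar>pd [i, j] (?\<phi> b) x\<bar> \<le> ?n ^ k * W * (1 / l) ^ (2 * k + 3)" for i j b x
      using tb_lap_pow[OF \<phi> tb, of k b, unfolded tb_def, rule_format, of "[i, j]"] kN by (simp add: numeral_3_eq_3 del: pd.simps)
    have "\<bar>\<beta> ?\<phi> s2 - \<beta> ?\<phi> s1 - integral {s1..s2} (\<lambda>s. \<nu> * \<beta> (lap ?\<phi>) s - 4 * \<xi> * \<beta> ?\<phi> s - 2 * \<xi> * pr (u s) (lap ?\<phi>))\<bar>
        \<le> 100 * Z * U * (?n ^ k * W * (1 / l) ^ (2 * k + 3)) * (s2 - s1)"
      using s12 r0 q U' by (intro Dk[THEN conjunct2, THEN conjunct2, THEN conjunct2, THEN conjunct1, rule_format]) auto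
    then show "\<bar>\<beta> ?\<phi> s2 - \<beta> ?\<phi> s1 - integral {s1..s2} (\<lambda>x. (\<nu> * \<beta> (lap ?\<phi>) x - 2 * \<xi> * pr (u x) (lap ?\<phi>)) - 4 * \<xi> * \<beta> ?\<phi> x)\<bar>
        \<le> 100 * Z * U * (?n ^ k * W * (1 / l) ^ (2 * k + 3)) * (s2 - s1)"
      by (simp add: algebra_simps)
  qed (use pos rs cb in auto)
  also have "\<bar>\<beta> ?\<phi> r\<bar> \<le> 100 * Z * (?n ^ k * W * (1 / l) ^ (2 * k + 1))"
  proof (rule Dk[THEN conjunct2, THEN conjunct2, THEN conjunct2, THEN conjunct2, rule_format], intro conjI allI r0)
    show "n2 (pd [j] (?\<phi> b)) \<le> ?n ^ k * W * (1 / l) ^ (2 * k + 1)" for j b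
      using tb_lap_pow[OF \<phi> tb, of k b, unfolded tb_def, rule_format, of "[j]"] kN by (simp del: pd.simps)
  qed
  also have "s - r = ?\<tau>" by (simp add: r_def)
  finally have "\<bar>\<beta> ?\<phi> s\<bar> \<le> exp (- (4 * \<xi>) * ?\<tau>) * (100 * Z * (?n ^ k * W * (1 / l) ^ (2 * k + 1))) + ((\<nu> * ?E + 2 * \<xi> * ?P) + 100 * Z * U * (?n ^ k * W * (1 / l) ^ (2 * k + 3))) / (4 * \<xi>)"
    by (simp add: mult_left_mono)
  also have "\<dots> = rot_bound \<nu> \<xi> Z N ?n t l U (Suc j) * W"
    unfolding rot_bound.simps k_def[symmetric] kN(1) by (simp add: algebra_simps add_divide_distrib)
  finally show ?case unfolding k_def .
qed

section \<open>The lower bound for damped systems\<close>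

text \<open>The terms in the parentheses come, in order, from the end point M t, from the
  microrotation pairings at both ends with weight one half each, and from the integrals over a time
  of length (M - 1) t: the microrotation paired with the curl of the Laplacian, viscosity, and the
  convective defects of the two equations.\<close>

lemma field_pairing_estimate:
  fixes u :: "real \<Rightarrow> 'n::finite \<Rightarrow> real^'n \<Rightarrow> real"
  assumes D: "damped \<mu> \<nu> \<xi> Z u \<beta>" and \<phi>: "sol \<phi>" and tb: "\<And>b. tb (2 * N + 2) l W 0 (\<phi> b)" and N: "N \<ge> 1"
    and pos: "\<mu> > 0" "\<nu> > 0" "\<xi> > 0" "Z \<ge> 0" "l > 0" "W \<ge> 0" "t > 0" "M \<ge> 1"
    and U: "\<And>s. t / 2 \<le> s \<Longrightarrow> s \<le> M * t \<Longrightarrow> nrm (u s) \<le> U" and Ue: "nrm (u (M * t)) \<le> Ue"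
  shows "\<bar>pr (u t) \<phi>\<bar> \<le> W * (real CARD('n) * Ue + rot_bound \<nu> \<xi> Z N (real CARD('n)) t l U N
     + (M - 1) * t * (\<nu> / 2 * rot_bound \<nu> \<xi> Z N (real CARD('n)) t l U (N - 1)
        + \<mu> * (real CARD('n) * (U * (real CARD('n) * (1 / l)\<^sup>2))) + 100 * U\<^sup>2 * (1 / l)\<^sup>2 + 50 * Z * U * (1 / l) ^ 3))"
proof -
  let ?n = "real CARD('n)" and ?t' = "M * t"
  let ?E0 = "rot_bound \<nu> \<xi> Z N ?n t l U N * W" and ?E1 = "rot_bound \<nu> \<xi> Z N ?n t l U (N - 1) * W"
  have tt: "t \<le> ?t'" using pos by simp
  have t0: "0 \<le> t" using pos by simp
  note D1 = D[unfolded damped_def, THEN conjunct1, rule_format]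
  note D\<phi> = D[unfolded damped_def, THEN conjunct2, rule_format, OF \<phi>]
  have sl: "sol (lap \<phi>)" by (rule sol_lap[OF \<phi>])
  note Dl = D[unfolded damped_def, THEN conjunct2, rule_format, OF sl]
  have b0: "\<bar>\<beta> \<phi> s\<bar> \<le> ?E0" if "t \<le> s" "s \<le> ?t'" for s
    using rot_estimate[OF D \<phi> tb pos(2-7) tt U, of N s] that by simp
  have b1: "\<bar>\<beta> (lap \<phi>) s\<bar> \<le> ?E1" if "t \<le> s" "s \<le> ?t'" for s
  proof -
    have e: "N - (N - 1) = 1" using N by simp
    have "0 \<le> t / (2 * (real N + 1))" using pos by simp
    then show ?thesis using rot_estimate[OF D \<phi> tb pos(2-7) tt U, of "N - 1" s] that unfolding e by simp
  qed
  have U': "nrm (u s) \<le> U" if "s \<in> {t..?t'}" for s using that pos by (intro U) auto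
  let ?P = "?n * (U * (?n * W * (1 / l)\<^sup>2))"
  have prb: "\<bar>pr (u s) (lap \<phi>)\<bar> \<le> ?P" if s: "s \<in> {t..?t'}" for s
  proof (rule pr_bound)
    show "sqint (u s b)" for b using D1[of s] s t0 by simp
    show "sqint (lap \<phi> b)" for b by (rule test_fun_sqint(1)[OF sol_test[OF sl]])
    show "nrm (u s) \<le> U" by (rule U'[OF s])
    show "n2 (lap \<phi> b) \<le> ?n * W * (1 / l)\<^sup>2" for b
      using tb_lap_pow[OF \<phi> tb, of 1 b, unfolded tb_def, rule_format, of "[]"] N by simp
  qed
  have pe: "\<bar>pr (u ?t') \<phi>\<bar> \<le> ?n * (Ue * W)"
  proof (rule pr_bound[OF _ _ Ue])
    show "sqint (u ?t' b)" for b using D1[of ?t'] tt t0 by simp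
    show "sqint (\<phi> b)" for b by (rule test_fun_sqint(1)[OF sol_test[OF \<phi>]])
    show "n2 (\<phi> b) \<le> W" for b using tb[of b, unfolded tb_def, rule_format, of "[]"] by simp
  qed
  have cA: "continuous_on {t..?t'} (\<lambda>s. pr (u s) (lap \<phi>))" using Dl t0 by (auto elim: continuous_on_subset)
  have c0: "continuous_on {t..?t'} (\<beta> \<phi>)" using D\<phi> t0 by (auto elim: continuous_on_subset)
  have c1: "continuous_on {t..?t'} (\<beta> (lap \<phi>))" using Dl t0 by (auto elim: continuous_on_subset)
  note iA = integrable_continuous_real[OF cA] and i0 = integrable_continuous_real[OF c0] and i1 = integrable_continuous_real[OF c1]
  define IA I0 I1 where "IA = integral {t..?t'} (\<lambda>s. pr (u s) (lap \<phi>))" and "I0 = integral {t..?t'} (\<beta> \<phi>)" and "I1 = integral {t..?t'} (\<beta> (lap \<phi>))"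
  have "\<bar>pr (u ?t') \<phi> - pr (u t) \<phi> - integral {t..?t'} (\<lambda>s. (\<mu> + \<xi>) * pr (u s) (lap \<phi>) + 2 * \<xi> * \<beta> \<phi> s)\<bar> \<le> 100 * U\<^sup>2 * (W * (1 / l)\<^sup>2) * (?t' - t)"
  proof (rule D\<phi>[THEN conjunct2, THEN conjunct2, THEN conjunct1, rule_format], intro conjI allI ballI t0 tt U')
    show "\<bar>pd [j] (\<phi> b) x\<bar> \<le> W * (1 / l)\<^sup>2" for j b x
      using tb[of b, unfolded tb_def, rule_format, of "[j]"] by (simp add: power2_eq_square del: pd.simps)
  qed
  moreover have "integral {t..?t'} (\<lambda>s. (\<mu> + \<xi>) * pr (u s) (lap \<phi>) + 2 * \<xi> * \<beta> \<phi> s) = (\<mu> + \<xi>) * IA + 2 * \<xi> * I0"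
    unfolding IA_def I0_def using iA i0 by (subst integral_add) (auto intro: integrable_on_mult_right)
  ultimately have eu: "\<bar>pr (u ?t') \<phi> - pr (u t) \<phi> - ((\<mu> + \<xi>) * IA + 2 * \<xi> * I0)\<bar> \<le> 100 * U\<^sup>2 * (W * (1 / l)\<^sup>2) * (?t' - t)" by simp
  have "\<bar>\<beta> \<phi> ?t' - \<beta> \<phi> t - integral {t..?t'} (\<lambda>s. \<nu> * \<beta> (lap \<phi>) s - 4 * \<xi> * \<beta> \<phi> s - 2 * \<xi> * pr (u s) (lap \<phi>))\<bar> \<le> 100 * Z * U * (W * (1 / l) ^ 3) * (?t' - t)"
  proof (rule D\<phi>[THEN conjunct2, THEN conjunct2, THEN conjunct2, THEN conjunct1, rule_format], intro conjI allI ballI t0 tt U')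
    show "\<bar>pd [i, j] (\<phi> b) x\<bar> \<le> W * (1 / l) ^ 3" for i j b x
      using tb[of b, unfolded tb_def, rule_format, of "[i, j]"] N by (simp add: numeral_3_eq_3 del: pd.simps)
  qed
  moreover have "integral {t..?t'} (\<lambda>s. \<nu> * \<beta> (lap \<phi>) s - 4 * \<xi> * \<beta> \<phi> s - 2 * \<xi> * pr (u s) (lap \<phi>)) = \<nu> * I1 - 4 * \<xi> * I0 - 2 * \<xi> * IA"
  proof -
    have "integral {t..?t'} (\<lambda>s. \<nu> * \<beta> (lap \<phi>) s - 4 * \<xi> * \<beta> \<phi> s - 2 * \<xi> * pr (u s) (lap \<phi>)) =
      integral {t..?t'} (\<lambda>s. \<nu> * \<beta> (lap \<phi>) s - 4 * \<xi> * \<beta> \<phi> s) - integral {t..?t'} (\<lambda>s. 2 * \<xi> * pr (u s) (lap \<phi>))"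
      using iA i0 i1 by (intro integral_diff integrable_diff integrable_on_mult_right)
    also have "integral {t..?t'} (\<lambda>s. \<nu> * \<beta> (lap \<phi>) s - 4 * \<xi> * \<beta> \<phi> s) = integral {t..?t'} (\<lambda>s. \<nu> * \<beta> (lap \<phi>) s) - integral {t..?t'} (\<lambda>s. 4 * \<xi> * \<beta> \<phi> s)"
      using i0 i1 by (intro integral_diff integrable_on_mult_right)
    finally show ?thesis unfolding IA_def I0_def I1_def by simp
  qed
  ultimately have ew: "\<bar>\<beta> \<phi> ?t' - \<beta> \<phi> t - (\<nu> * I1 - 4 * \<xi> * I0 - 2 * \<xi> * IA)\<bar> \<le> 100 * Z * U * (W * (1 / l) ^ 3) * (?t' - t)" by simp
  have IAb: "\<bar>IA\<bar> \<le> ?P * (?t' - t)" unfolding IA_def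
    using integral_bound[OF tt cA, of ?P] prb by simp
  have I1b: "\<bar>I1\<bar> \<le> ?E1 * (?t' - t)" unfolding I1_def
    using integral_bound[OF tt c1, of ?E1] b1 by simp
  \<comment> \<open>The weight one half makes the two occurrences of \<open>I0\<close> cancel and
    reduces the coefficient of \<open>IA\<close> from \<mu> + \<xi> to \<mu>.\<close>
  have id: "pr (u ?t') \<phi> - pr (u t) \<phi> - ((\<mu> + \<xi>) * IA + 2 * \<xi> * I0) + (\<beta> \<phi> ?t' - \<beta> \<phi> t - (\<nu> * I1 - 4 * \<xi> * I0 - 2 * \<xi> * IA)) / 2
    = pr (u ?t') \<phi> - pr (u t) \<phi> + (\<beta> \<phi> ?t' - \<beta> \<phi> t) / 2 - (\<mu> * IA + \<nu> / 2 * I1)" by (simp add: algebra_simps add_divide_distrib diff_divide_distrib)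
  have m1: "\<bar>\<mu> * IA\<bar> \<le> \<mu> * (?P * (?t' - t))" using IAb pos by (simp add: abs_mult)
  have m2: "\<bar>\<nu> / 2 * I1\<bar> \<le> \<nu> / 2 * (?E1 * (?t' - t))" using I1b pos by (simp add: abs_mult)
  have x1: "\<bar>\<beta> \<phi> ?t'\<bar> \<le> ?E0" and x2: "\<bar>\<beta> \<phi> t\<bar> \<le> ?E0" using b0[of ?t'] b0[of t] tt by auto
  have "\<bar>pr (u t) \<phi>\<bar> \<le> ?n * (Ue * W) + ?E0 + 100 * U\<^sup>2 * (W * (1 / l)\<^sup>2) * (?t' - t) + 100 * Z * U * (W * (1 / l) ^ 3) * (?t' - t) / 2
     + \<mu> * (?P * (?t' - t)) + \<nu> / 2 * (?E1 * (?t' - t))"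
  proof -
    have gen: "\<bar>p\<bar> \<le> e + E + e1 + e2 / 2 + a1 + a2"
      if "\<bar>p' - p - v\<bar> \<le> e1" "\<bar>b' - b - w\<bar> \<le> e2" "(p' - p - v) + (b' - b - w) / 2 = p' - p + (b' - b) / 2 - (y1 + y2)"
        "\<bar>y1\<bar> \<le> a1" "\<bar>y2\<bar> \<le> a2" "\<bar>b'\<bar> \<le> E" "\<bar>b\<bar> \<le> E" "\<bar>p'\<bar> \<le> e" for p p' v b b' w y1 y2 e e1 e2 a1 a2 E :: real
    proof -
      define A B where "A = p' - p - v" and "B = b' - b - w"
      have eq: "p = p' + (b' - b) / 2 - y1 - y2 - A - B / 2" using that(3) unfolding A_def B_def by argo
      have AB: "\<bar>A\<bar> \<le> e1" "\<bar>B\<bar> \<le> e2" using that(1,2) by (simp_all only: A_def B_def)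
      have "p \<le> e + E + e1 + e2 / 2 + a1 + a2"
        using abs_le_D1[OF that(8)] abs_le_D1[OF that(6)] abs_le_D2[OF that(7)] abs_le_D2[OF that(4)] abs_le_D2[OF that(5)] abs_le_D2[OF AB(1)] abs_le_D2[OF AB(2)]
        unfolding eq by argo
      moreover have "- p \<le> e + E + e1 + e2 / 2 + a1 + a2"
        using abs_le_D2[OF that(8)] abs_le_D2[OF that(6)] abs_le_D1[OF that(7)] abs_le_D1[OF that(4)] abs_le_D1[OF that(5)] abs_le_D1[OF AB(1)] abs_le_D1[OF AB(2)]
        unfolding eq by argo
      ultimately show ?thesis by (rule abs_leI)
    qed
    show ?thesis by (rule gen[OF eu ew id m1 m2 x1 x2 pe])
  qed
  also have "\<dots> = W * (?n * Ue + rot_bound \<nu> \<xi> Z N ?n t l U N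
     + (M - 1) * t * (\<nu> / 2 * rot_bound \<nu> \<xi> Z N ?n t l U (N - 1) + \<mu> * (?n * (U * (?n * (1 / l)\<^sup>2))) + 100 * U\<^sup>2 * (1 / l)\<^sup>2 + 50 * Z * U * (1 / l) ^ 3))"
    by (simp add: algebra_simps add_divide_distrib diff_divide_distrib)
  finally show ?thesis .
qed

section \<open>Decay in time of the error terms\<close>

lemma powr_scale_tendsto:
  fixes p a :: real
  assumes a: "a > 0" and p: "p < real q / 2"
  shows "((\<lambda>t. t powr p * (1 / (a * sqrt t)) ^ q) \<longlongrightarrow> 0) at_top"
proof -
  have "((\<lambda>t::real. (1 / a) ^ q * t powr (p - real q / 2)) \<longlongrightarrow> (1 / a) ^ q * 0) at_top"
    using p by (intro tendsto_intros tendsto_neg_powr filterlim_ident) auto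
  moreover have "\<forall>\<^sub>F t in at_top. (1 / a) ^ q * t powr (p - real q / 2) = t powr p * (1 / (a * sqrt t)) ^ q"
    using eventually_gt_at_top[of 0]
  proof eventually_elim
    case (elim t)
    have "sqrt t ^ q = t powr (real q / 2)" using elim
      by (simp add: powr_half_sqrt[symmetric] powr_realpow[symmetric] powr_powr)
    then show ?case using elim by (simp add: powr_diff power_divide power_mult_distrib)
  qed
  ultimately show ?thesis by (simp add: tendsto_cong)
qed

lemma exp_scale_tendsto:
  fixes p a c :: real
  assumes a: "a > 0" and c: "c > 0"
  shows "((\<lambda>t. t powr p * (exp (- (c * t)) * (1 / (a * sqrt t)) ^ q)) \<longlongrightarrow> 0) at_top"
proof -
  have "((\<lambda>t::real. t powr (p + 1) * exp (- (c * t))) \<longlongrightarrow> 0) at_top" using c by real_asymp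
  moreover have "((\<lambda>t. t powr (-1) * (1 / (a * sqrt t)) ^ q) \<longlongrightarrow> 0) at_top" using a by (intro powr_scale_tendsto) auto
  ultimately have "((\<lambda>t. t powr (p + 1) * exp (- (c * t)) * (t powr (-1) * (1 / (a * sqrt t)) ^ q)) \<longlongrightarrow> 0 * 0) at_top" by (rule tendsto_mult)
  moreover have "\<forall>\<^sub>F t in at_top. t powr (p + 1) * exp (- (c * t)) * (t powr (-1) * (1 / (a * sqrt t)) ^ q) = t powr p * (exp (- (c * t)) * (1 / (a * sqrt t)) ^ q)"
    using eventually_gt_at_top[of 0] by eventually_elim (simp add: powr_add powr_minus field_simps)
  ultimately show ?thesis by (simp add: tendsto_cong)
qed

lemma powr_decay_scale_tendsto:
  fixes p a \<alpha> :: real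
  assumes "a > 0" "p - \<alpha> < real q / 2"
  shows "((\<lambda>t. t powr p * (t powr (- \<alpha>) * (1 / (a * sqrt t)) ^ q)) \<longlongrightarrow> 0) at_top"
proof -
  have "((\<lambda>t. t powr (p - \<alpha>) * (1 / (a * sqrt t)) ^ q) \<longlongrightarrow> 0) at_top" by (rule powr_scale_tendsto[OF assms])
  moreover have "t powr (p - \<alpha>) * (1 / (a * sqrt t)) ^ q = t powr p * (t powr (- \<alpha>) * (1 / (a * sqrt t)) ^ q)" for t
    by (simp add: powr_diff powr_minus divide_inverse)
  ultimately show ?thesis by simp
qed

text \<open>With l of order sqrt t the initial bound is of order t^(-N - 1/2), which beats
  t^(-\<alpha> - 1) as N \<ge> \<alpha> + 1. Every step adds a forcing by u of order t^(-\<alpha>)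
  l^(-2 (N - j)): it gains at least t^(-2) before the last step, but only t^(-1) in the last one.
  Hence the two weights; the larger one is what integration over a time of order t requires.\<close>

lemma rot_bound_tendsto:
  fixes a \<alpha> Z B d \<nu> \<xi> :: real
  assumes a: "a > 0" and \<xi>: "\<xi> > 0" and N: "\<alpha> + 1 \<le> real N" and \<alpha>: "\<alpha> > 0"
  defines "R \<equiv> \<lambda>j t. rot_bound \<nu> \<xi> Z N d t (a * sqrt t) (B * t powr (- \<alpha>)) j"
  shows "j < N \<Longrightarrow> ((\<lambda>t. t powr (\<alpha> + 1) * R j t) \<longlongrightarrow> 0) at_top" "((\<lambda>t. t powr \<alpha> * R N t) \<longlongrightarrow> 0) at_top"
proof -
  have step: "((\<lambda>t. t powr p * R (Suc j) t) \<longlongrightarrow> 0) at_top"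
    if jN: "Suc j \<le> N" and p: "p - \<alpha> < real (2 * (N - j)) / 2" and IH: "((\<lambda>t. t powr p * R j t) \<longlongrightarrow> 0) at_top" for p j
  proof -
    let ?k = "N - Suc j"
    let ?c = "4 * \<xi> / (2 * (real N + 1))"
    have c: "?c > 0" using \<xi> by simp
    have nk: "N - j = Suc ?k" using jN by simp
    have p2: "p - \<alpha> < real (2 * ?k + 3) / 2" using p unfolding nk by simp
    have "((\<lambda>t. (100 * Z * d ^ ?k) * (t powr p * (exp (- (?c * t)) * (1 / (a * sqrt t)) ^ (2 * ?k + 1)))
       + \<nu> / (4 * \<xi>) * (t powr p * R j t)
       + (d * B * d ^ (N - j)) / 2 * (t powr p * (t powr (- \<alpha>) * (1 / (a * sqrt t)) ^ (2 * (N - j))))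
       + (100 * Z * B * d ^ ?k) / (4 * \<xi>) * (t powr p * (t powr (- \<alpha>) * (1 / (a * sqrt t)) ^ (2 * ?k + 3)))) \<longlongrightarrow>
       (100 * Z * d ^ ?k) * 0 + \<nu> / (4 * \<xi>) * 0 + (d * B * d ^ (N - j)) / 2 * 0 + (100 * Z * B * d ^ ?k) / (4 * \<xi>) * 0) at_top"
      by (intro tendsto_add tendsto_mult tendsto_const exp_scale_tendsto powr_decay_scale_tendsto a c p p2 IH)
    moreover have "(100 * Z * d ^ ?k) * (t powr p * (exp (- (?c * t)) * (1 / (a * sqrt t)) ^ (2 * ?k + 1)))
       + \<nu> / (4 * \<xi>) * (t powr p * R j t)
       + (d * B * d ^ (N - j)) / 2 * (t powr p * (t powr (- \<alpha>) * (1 / (a * sqrt t)) ^ (2 * (N - j))))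
       + (100 * Z * B * d ^ ?k) / (4 * \<xi>) * (t powr p * (t powr (- \<alpha>) * (1 / (a * sqrt t)) ^ (2 * ?k + 3))) = t powr p * R (Suc j) t" for t
    proof -
      have "exp (- 4 * \<xi> * (t / (2 * (real N + 1)))) = exp (- (?c * t))" by simp
      moreover have "x + \<nu> / (4 * \<xi>) * y + P / 2 * w + Q / (4 * \<xi>) * v = x + (\<nu> * y + 2 * \<xi> * (P * w) + Q * v) / (4 * \<xi>)" for x y w v P Q
        using \<xi> by (simp add: field_simps)
      ultimately show ?thesis unfolding R_def rot_bound.simps by (simp only:) (simp add: algebra_simps add_divide_distrib)
    qed
    ultimately show ?thesis by simp
  qed
  have base: "((\<lambda>t. t powr p * R 0 t) \<longlongrightarrow> 0) at_top" if "p \<le> \<alpha> + 1" for p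
  proof -
    have "((\<lambda>t. (100 * Z * d ^ N) * (t powr p * (1 / (a * sqrt t)) ^ (2 * N + 1))) \<longlongrightarrow> (100 * Z * d ^ N) * 0) at_top"
      using that N by (intro tendsto_mult tendsto_const powr_scale_tendsto a) auto
    then show ?thesis by (simp add: R_def mult_ac)
  qed
  show A: "((\<lambda>t. t powr (\<alpha> + 1) * R j t) \<longlongrightarrow> 0) at_top" if "j < N" for j
    using that
  proof (induction j)
    case (Suc j)
    then have "real (N - j) \<ge> 2" by (simp add: of_nat_diff)
    then show ?case using Suc by (intro step) auto
  qed (rule base, simp)
  have N1: "N \<ge> 1" using N \<alpha> by (cases N) auto
  have "((\<lambda>t. t powr \<alpha> * R (Suc (N - 1)) t) \<longlongrightarrow> 0) at_top"
  proof (rule step)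
    show "\<alpha> - \<alpha> < real (2 * (N - (N - 1))) / 2" using N1 by simp
    have "((\<lambda>t. t powr (-1) * (t powr (\<alpha> + 1) * R (N - 1) t)) \<longlongrightarrow> 0 * 0) at_top"
      using N1 by (intro tendsto_mult A tendsto_neg_powr filterlim_ident) auto
    moreover have "\<forall>\<^sub>F t in at_top. t powr (-1) * (t powr (\<alpha> + 1) * R (N - 1) t) = t powr \<alpha> * R (N - 1) t"
      using eventually_gt_at_top[of 0] by eventually_elim (simp add: powr_add powr_minus field_simps)
    ultimately show "((\<lambda>t. t powr \<alpha> * R (N - 1) t) \<longlongrightarrow> 0) at_top" by (simp add: tendsto_cong)
  qed (use N1 in simp)
  then show "((\<lambda>t. t powr \<alpha> * R N t) \<longlongrightarrow> 0) at_top" using N1 by simp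
qed

section \<open>Scaled kernels and the choice of constants\<close>

lemma pd_dil: assumes "smooth_fn k" shows "pd js (dil l k) = (\<lambda>x. (1 / l) ^ length js * dil l (pd js k) x)"
  unfolding dil_def[abs_def] using pd_affine[OF assms, of js "1 / l ^ CARD('a)" 0 "1 / l"] by (auto simp: mult_ac)

lemma dil_L1:
  assumes "l > 0" "(k :: real^'n::finite \<Rightarrow> real) \<in> borel_measurable borel"
  shows "(\<integral>x. \<bar>dil l k x\<bar> \<partial>lborel) = (\<integral>x. \<bar>k x\<bar> \<partial>lborel)"
proof -
  have "(\<lambda>x. \<bar>dil l k x\<bar>) = (\<lambda>x. dil l (\<lambda>x. \<bar>k x\<bar>) x * 1)" using assms(1) by (auto simp: dil_def abs_mult)
  then show ?thesis using dil_integral[of l "\<lambda>x. \<bar>k x\<bar>" "\<lambda>_. 1"] assms by simp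
qed

text \<open>The exact scaling is l to the power minus half the dimension; one power of l is kept,
  which for l \<ge> 1 is weaker or equal in dimension at least two.\<close>

lemma dil_n2:
  assumes "l \<ge> 1" "(k :: real^'n::finite \<Rightarrow> real) \<in> borel_measurable borel" and n: "CARD('n) \<ge> 2"
  shows "n2 (dil l k) \<le> 1 / l * n2 k"
proof -
  have "(\<lambda>x. (dil l k x)\<^sup>2) = (\<lambda>x. dil l (\<lambda>x. (k x)\<^sup>2) x * (1 / l ^ CARD('n)))"
    by (auto simp: dil_def power_mult_distrib power2_eq_square)
  then have "(n2 (dil l k))\<^sup>2 = (1 / l ^ CARD('n)) * (n2 k)\<^sup>2"
    using dil_integral[of l "\<lambda>x. (k x)\<^sup>2" "\<lambda>_. 1 / l ^ CARD('n)"] assms by (simp add: n2_sq)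
  also have "\<dots> \<le> (1 / l ^ 2) * (n2 k)\<^sup>2"
    using assms n by (intro mult_right_mono divide_left_mono power_increasing) auto
  also have "\<dots> = (1 / l * n2 k)\<^sup>2" by (simp add: power_mult_distrib power_divide)
  finally show ?thesis by (rule power2_le_imp_le) (use assms in simp)
qed

text \<open>After multiplication by t^\<alpha> only the end point term and the viscous term have
  nonzero limits, and \<open>lim\<close> says that their sum lies below the target. In the viscous
  term \<mu> cancels against the square of the length scale.\<close>

lemma core_threshold:
  fixes \<alpha> :: real
  assumes pos: "\<alpha> > 0" "C0 > 0" "Z > 0" "\<mu> > 0" "\<xi> > 0" "M \<ge> 1" "A > 0" "N = nat \<lceil>\<alpha>\<rceil> + 1"
    and lim: "d * C0 * M powr (- \<alpha>) + (M - 1) * d\<^sup>2 * C0 * 2 powr \<alpha> / A\<^sup>2 < c"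
  shows "\<forall>\<^sub>F t in at_top. t powr \<alpha> * (d * (C0 * Z * (M * t) powr (- \<alpha>)) + rot_bound \<nu> \<xi> Z N d t (A * sqrt (\<mu> * t)) (C0 * Z * 2 powr \<alpha> * t powr (- \<alpha>)) N
     + (M - 1) * t * (\<nu> / 2 * rot_bound \<nu> \<xi> Z N d t (A * sqrt (\<mu> * t)) (C0 * Z * 2 powr \<alpha> * t powr (- \<alpha>)) (N - 1)
        + \<mu> * (d * (C0 * Z * 2 powr \<alpha> * t powr (- \<alpha>) * (d * (1 / (A * sqrt (\<mu> * t)))\<^sup>2))) + 100 * (C0 * Z * 2 powr \<alpha> * t powr (- \<alpha>))\<^sup>2 * (1 / (A * sqrt (\<mu> * t)))\<^sup>2
        + 50 * Z * (C0 * Z * 2 powr \<alpha> * t powr (- \<alpha>)) * (1 / (A * sqrt (\<mu> * t))) ^ 3)) < Z * c"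
proof -
  define a where "a = A * sqrt \<mu>"
  define B where "B = C0 * Z * 2 powr \<alpha>"
  have a: "a > 0" using pos by (simp add: a_def)
  have N: "\<alpha> + 1 \<le> real N" using pos(1,8) by (simp add: of_nat_ceiling)
  have N1: "N - 1 < N" using pos(8) by simp
  have l: "A * sqrt (\<mu> * t) = a * sqrt t" for t by (simp add: a_def real_sqrt_mult)
  let ?R = "\<lambda>j t. rot_bound \<nu> \<xi> Z N d t (a * sqrt t) (B * t powr (- \<alpha>)) j"
  let ?L = "d * C0 * Z * M powr (- \<alpha>) + 0 + (M - 1) * (\<nu> / 2) * 0 + (M - 1) * \<mu> * d\<^sup>2 * B / a\<^sup>2 + (M - 1) * 100 * B\<^sup>2 * 0 + (M - 1) * 50 * Z * B * 0"
  have q: "((\<lambda>t. t powr (1 - \<alpha>) * (1 / (a * sqrt t)) ^ 2) \<longlongrightarrow> 0) at_top" "((\<lambda>t. t powr 1 * (1 / (a * sqrt t)) ^ 3) \<longlongrightarrow> 0) at_top"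
    using pos by (intro powr_scale_tendsto a; simp)+
  have "((\<lambda>t. d * C0 * Z * M powr (- \<alpha>) + t powr \<alpha> * ?R N t + (M - 1) * (\<nu> / 2) * (t powr (\<alpha> + 1) * ?R (N - 1) t) + (M - 1) * \<mu> * d\<^sup>2 * B / a\<^sup>2
      + (M - 1) * 100 * B\<^sup>2 * (t powr (1 - \<alpha>) * (1 / (a * sqrt t)) ^ 2) + (M - 1) * 50 * Z * B * (t powr 1 * (1 / (a * sqrt t)) ^ 3)) \<longlongrightarrow> ?L) at_top"
    by (intro tendsto_add tendsto_mult tendsto_const rot_bound_tendsto q a pos N N1)
  moreover have "?L < Z * c"
  proof -
    have "?L = Z * (d * C0 * M powr (- \<alpha>) + (M - 1) * d\<^sup>2 * C0 * 2 powr \<alpha> / A\<^sup>2)"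
      using pos by (simp add: B_def a_def power_mult_distrib field_simps)
    also have "\<dots> < Z * c" using lim pos by simp
    finally show ?thesis .
  qed
  ultimately have "\<forall>\<^sub>F t in at_top. d * C0 * Z * M powr (- \<alpha>) + t powr \<alpha> * ?R N t + (M - 1) * (\<nu> / 2) * (t powr (\<alpha> + 1) * ?R (N - 1) t) + (M - 1) * \<mu> * d\<^sup>2 * B / a\<^sup>2
      + (M - 1) * 100 * B\<^sup>2 * (t powr (1 - \<alpha>) * (1 / (a * sqrt t)) ^ 2) + (M - 1) * 50 * Z * B * (t powr 1 * (1 / (a * sqrt t)) ^ 3) < Z * c"
    by (rule order_tendstoD(2))
  then show ?thesis using eventually_gt_at_top[of 0]
  proof eventually_elim
    case (elim t)
    define p where "p = t powr \<alpha>"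
    have p: "p > 0" using elim by (simp add: p_def)
    have e2: "t powr (- \<alpha>) = 1 / p" unfolding p_def powr_minus by (rule inverse_eq_divide)
    have e1: "(M * t) powr (- \<alpha>) = M powr (- \<alpha>) / p"
      using powr_mult[of M t "- \<alpha>"] elim pos unfolding e2 by simp
    have e3: "t powr (\<alpha> + 1) = p * t" "t powr (1 - \<alpha>) = t / p" "t powr 1 = t"
      using elim powr_add[of t \<alpha> 1] powr_diff[of t 1 \<alpha>] by (simp_all add: p_def)
    have e4: "(1 / (a * sqrt t)) ^ 2 = 1 / (a\<^sup>2 * t)" using elim by (simp add: power_mult_distrib power_divide)
    \<comment> \<open>Once the powers of t are abbreviated by p, the rearrangement is a rational
      identity in which the unwieldy bounds \<open>r0\<close>, \<open>r1\<close> and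
      \<open>x3\<close> are opaque variables.\<close>
    have R: "p * (d * (C0 * Z * (M powr (- \<alpha>) / p)) + r0 + (M - 1) * t * (\<nu> / 2 * r1 + \<mu> * (d * (B * (1 / p) * (d * (1 / (a\<^sup>2 * t))))) + 100 * (B * (1 / p))\<^sup>2 * (1 / (a\<^sup>2 * t)) + 50 * Z * (B * (1 / p)) * x3))
      = d * C0 * Z * M powr (- \<alpha>) + p * r0 + (M - 1) * (\<nu> / 2) * (p * t * r1) + (M - 1) * \<mu> * d\<^sup>2 * B / a\<^sup>2 + (M - 1) * 100 * B\<^sup>2 * (t / p * (1 / (a\<^sup>2 * t))) + (M - 1) * 50 * Z * B * (t * x3)" for r0 r1 x3
      using p elim a by (simp add: field_simps power2_eq_square)
    show ?case unfolding l B_def[symmetric] e1 unfolding p_def[symmetric]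
      using elim(1) unfolding e3 e4 unfolding p_def[symmetric] unfolding e2 e4 R by simp
  qed
qed

text \<open>Dilation turns the kernel norms into powers of 1 / l. In \<open>kv\<close> the factor 2
  accounts for the kernel and its translate, and the summand 1 absorbs the error \<delta> of the
  truncation.\<close>

lemma scaled_test_field:
  fixes u :: "'n::finite \<Rightarrow> real^'n \<Rightarrow> real" and K :: "real^'n \<Rightarrow> real"
  assumes n: "CARD('n) \<ge> 2" and u: "\<And>j. sqint (u j)" and K: "ctest K" and l: "l \<ge> 1" and V: "nrm u > 0"
    and dv: "\<And>\<psi>. test_fun \<psi> \<Longrightarrow> (\<Sum>j\<in>UNIV. \<integral>x. u j x * pd [j] \<psi> x \<partial>lborel) = 0"
    and kv: "kv = 1 + (\<Sum>js\<in>{js::'n list. length js \<le> J}. 2 * ((\<integral>x. \<bar>pd js K x\<bar> \<partial>lborel) + n2 (pd js K)))"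
    and pr: "(\<Sum>b\<in>UNIV. \<integral>x. u b x * conv (dil l K) (u b) x \<partial>lborel) \<ge> 3 / 4 * (nrm u)\<^sup>2"
  obtains \<phi> where "sol \<phi>" "\<And>b. tb J l (kv * nrm u) 0 (\<phi> b)" "pr u \<phi> \<ge> (nrm u)\<^sup>2 / 2"
proof -
  define V where "V = nrm u"
  have V0: "V > 0" using V by (simp add: V_def)
  have l0: "l > 0" using l by simp
  \<comment> \<open>The first bound costs a quarter of |u|^2, leaving one half of it in the pairing;
    the second is the smallest scaled bound among all derivatives up to order J, since l \<ge>
    1.\<close>
  define \<delta> where "\<delta> = min (V\<^sup>2 / 4) (V * (1 / l) ^ Suc J)"
  have \<delta>: "\<delta> > 0" using V0 l0 by (simp add: \<delta>_def)
  have Kl: "ctest (dil l K)" by (rule dil_ctest[OF l0 K])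
  obtain \<phi> where \<phi>: "\<And>b. ctest (\<phi> b)" "\<And>x. (\<Sum>b\<in>UNIV. pd [b] (\<phi> b) x) = 0"
    "\<And>b js. length js \<le> J \<Longrightarrow> n2 (pd js (\<phi> b)) \<le> 2 * (\<integral>x. \<bar>pd js (dil l K) x\<bar> \<partial>lborel) * n2 (u b) + \<delta>"
    "\<And>b js x. length js \<le> J \<Longrightarrow> \<bar>pd js (\<phi> b) x\<bar> \<le> 2 * n2 (pd js (dil l K)) * n2 (u b) + \<delta>"
    "\<bar>(\<Sum>b\<in>UNIV. \<integral>x. u b x * \<phi> b x \<partial>lborel) - (\<Sum>b\<in>UNIV. \<integral>x. u b x * conv (dil l K) (u b) x \<partial>lborel)\<bar> \<le> \<delta>"
    using solenoidal_test_field[OF u Kl \<delta> dv, of J] by blast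
  have "sol \<phi>" using \<phi>(1,2) by (simp add: sol_def)
  moreover have "tb J l (kv * V) 0 (\<phi> b)" for b
    unfolding tb_def
  proof (intro allI impI)
    fix js :: "'n list" assume "0 + length js \<le> J"
    then have js: "length js \<le> J" by simp
    let ?L = "1 / l"
    have km: "pd js K \<in> borel_measurable borel" by (rule test_fun_measurable[OF test_fun_pd[OF ctest_test[OF K]]])
    define I1 I2 where "I1 = (\<integral>x. \<bar>pd js K x\<bar> \<partial>lborel)" and "I2 = n2 (pd js K)"
    have I0: "I1 \<ge> 0" "I2 \<ge> 0" by (auto simp: I1_def I2_def)
    have fin: "finite {js::'n list. length js \<le> J}" using finite_lists_length_le[of "UNIV::'n set" J] by simp
    have kvI: "1 + 2 * (I1 + I2) \<le> kv" unfolding kv I1_def I2_def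
      using member_le_sum[OF _ _ fin, of js "\<lambda>js. 2 * ((\<integral>x. \<bar>pd js K x\<bar> \<partial>lborel) + n2 (pd js K))"] js by simp
    have pdK: "pd js (dil l K) = (\<lambda>x. ?L ^ length js * dil l (pd js K) x)" by (rule pd_dil[OF ctest_smooth[OF K]])
    have L1: "(\<integral>x. \<bar>pd js (dil l K) x\<bar> \<partial>lborel) = ?L ^ length js * I1"
      unfolding pdK I1_def using dil_L1[OF l0 km] l0 by (simp add: abs_mult)
    have L2: "n2 (pd js (dil l K)) \<le> ?L ^ Suc (length js) * I2"
    proof -
      have "n2 (pd js (dil l K)) = ?L ^ length js * n2 (dil l (pd js K))" unfolding pdK n2_cmult using l0 by simp
      also have "\<dots> \<le> ?L ^ length js * (?L * I2)" unfolding I2_def using dil_n2[OF l km n] l0 by (intro mult_left_mono) auto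
      finally show ?thesis by (simp add: mult_ac)
    qed
    have Lp: "0 \<le> ?L ^ k" "?L ^ Suc J \<le> ?L ^ Suc (length js)" "?L ^ Suc (length js) \<le> ?L ^ length js" for k
      using l js by (auto intro!: power_decreasing simp del: power_Suc)
    have ub: "n2 (u b) \<le> V" unfolding V_def by (rule n2_le_nrm)
    have d1: "\<delta> \<le> V * ?L ^ Suc (length js)"
      unfolding \<delta>_def by (rule min.coboundedI2) (intro mult_left_mono Lp(2), use V0 in simp)
    have d2: "\<delta> \<le> V * ?L ^ length js" using d1 mult_left_mono[OF Lp(3), of V] V0 by linarith
    have kv1: "1 + 2 * I1 \<le> kv" "1 + 2 * I2 \<le> kv" using kvI I0 by auto
    have "n2 (pd js (\<phi> b)) \<le> 2 * (?L ^ length js * I1) * n2 (u b) + \<delta>" using \<phi>(3)[OF js, of b] unfolding L1 .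
    also have "2 * (?L ^ length js * I1) * n2 (u b) \<le> 2 * (?L ^ length js * I1) * V" using ub I0 Lp(1) by (intro mult_left_mono) auto
    also have "2 * (?L ^ length js * I1) * V + \<delta> \<le> (1 + 2 * I1) * (V * ?L ^ length js)" using d2 by (simp add: algebra_simps)
    also have "\<dots> \<le> kv * (V * ?L ^ length js)" using V0 Lp(1) by (intro mult_right_mono kv1 mult_nonneg_nonneg) auto
    finally have r1: "n2 (pd js (\<phi> b)) \<le> kv * V * ?L ^ (0 + length js)" by (simp add: mult.assoc)
    have "\<bar>pd js (\<phi> b) x\<bar> \<le> kv * V * ?L ^ Suc (0 + length js)" for x
    proof -
      have "\<bar>pd js (\<phi> b) x\<bar> \<le> 2 * n2 (pd js (dil l K)) * n2 (u b) + \<delta>" by (rule \<phi>(4)[OF js])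
      also have "2 * n2 (pd js (dil l K)) * n2 (u b) \<le> 2 * (?L ^ Suc (length js) * I2) * V"
        using ub L2 I0 Lp(1)[of "Suc (length js)"] by (intro mult_mono mult_left_mono mult_nonneg_nonneg) auto
      also have "2 * (?L ^ Suc (length js) * I2) * V + \<delta> \<le> (1 + 2 * I2) * (V * ?L ^ Suc (length js))"
        using d1 by (simp add: algebra_simps del: power_Suc)
      also have "\<dots> \<le> kv * (V * ?L ^ Suc (length js))" using V0 Lp(1)[of "Suc (length js)"] by (intro mult_right_mono kv1 mult_nonneg_nonneg) auto
      finally show ?thesis by (simp add: mult.assoc del: power_Suc)
    qed
    with r1 show "n2 (pd js (\<phi> b)) \<le> kv * V * ?L ^ (0 + length js) \<and> (\<forall>x. \<bar>pd js (\<phi> b) x\<bar> \<le> kv * V * ?L ^ Suc (0 + length js))" by blast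
  qed
  moreover have "pr u \<phi> \<ge> V\<^sup>2 / 2"
  proof -
    have "\<delta> \<le> V\<^sup>2 / 4" unfolding \<delta>_def by (rule min.cobounded1)
    then show ?thesis using \<phi>(5) pr unfolding pr_def V_def[symmetric] by linarith
  qed
  ultimately show ?thesis using that unfolding V_def by blast
qed

lemma core_lower_bound:
  fixes \<alpha> c0 C0 :: real and m :: nat
  assumes n: "CARD('n::finite) \<ge> 2" and pos: "\<alpha> > 0" "c0 > 0" "C0 > 0"
  shows "\<exists>\<Gamma>>0. \<forall>\<mu> \<nu> \<xi> t0 T0 Z. \<mu> > 0 \<and> \<nu> > 0 \<and> \<xi> > 0 \<longrightarrow> (\<exists>T\<ge>0.
    \<forall>(u :: real \<Rightarrow> 'n \<Rightarrow> real^'n \<Rightarrow> real) \<beta>. damped \<mu> \<nu> \<xi> Z u \<beta> \<and>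
      (\<forall>t>T0. nrm (u t) \<le> C0 * Z * t powr (- \<alpha>)) \<and> (\<forall>t>t0. c0 * Z * t powr (- \<alpha>) \<le> nrm (u t)) \<longrightarrow>
      (\<forall>t>T. \<forall>D\<ge>0. (\<forall>b js \<theta>. length js = m \<and> test_fun \<theta> \<longrightarrow> \<bar>\<integral>x. u t b x * pd js \<theta> x \<partial>lborel\<bar> \<le> D * n2 \<theta>) \<longrightarrow>
        \<Gamma> * c0 * \<mu> powr (- real m / 2) * Z * t powr (- \<alpha> - real m / 2) \<le> D))"
proof -
  define d where "d = real CARD('n)"
  define S where "S = molli_radius TYPE('n)"
  \<comment> \<open>At least \<alpha> + 1, as the decay of the microrotation pairings
    demands.\<close>
  define N where "N = nat \<lceil>\<alpha>\<rceil> + 1"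
  define J where "J = 2 * N + 2"
  define K where "K = (kerK m :: real^'n \<Rightarrow> real)"
  define kv where "kv = 1 + (\<Sum>js\<in>{js::'n list. length js \<le> J}. 2 * ((\<integral>x. \<bar>pd js K x\<bar> \<partial>lborel) + n2 (pd js K)))"
  \<comment> \<open>Chosen so that M^\<alpha> \<ge> X bounds the end point term by c0 / (8
    kv).\<close>
  define X where "X = 8 * kv * d * C0 / c0"
  define M where "M = max 2 (X powr (1 / \<alpha>))"
  \<comment> \<open>Bounds the viscous term by c0 / (8 kv); M is already fixed at this
    point.\<close>
  define A where "A = sqrt (8 * kv * M * d\<^sup>2 * C0 * 2 powr \<alpha> / c0)"
  \<comment> \<open>If the m-th derivatives fall below the claimed bound, this value makes the
    smoothing error at scale A sqrt(\<mu> t) at most a quarter of the squared norm of u(t).\<close>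
  define \<Gamma> where "\<Gamma> = 1 / (4 * d * (d * S) ^ m * A ^ m)"
  have d: "d \<ge> 2" using n by (simp add: d_def)
  have S: "S > 0" unfolding S_def by (rule molli_radius(1))
  have kv: "kv \<ge> 1" unfolding kv_def by (simp add: sum_nonneg)
  have X: "X > 0" using d pos kv by (simp add: X_def)
  have M: "M \<ge> 1" "M > 0" "M \<ge> X powr (1 / \<alpha>)" by (auto simp: M_def)
  have A2: "A\<^sup>2 = 8 * kv * M * d\<^sup>2 * C0 * 2 powr \<alpha> / c0" using kv M d pos by (simp add: A_def)
  have A: "A > 0" using kv M d pos by (simp add: A_def)
  have \<Gamma>: "\<Gamma> > 0" using d S A by (simp add: \<Gamma>_def)
  have N1: "N \<ge> 1" by (simp add: N_def)
  have lim: "d * C0 * M powr (- \<alpha>) + (M - 1) * d\<^sup>2 * C0 * 2 powr \<alpha> / A\<^sup>2 < c0 / (2 * kv)"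
  proof -
    have "X = (X powr (1 / \<alpha>)) powr \<alpha>" using X pos by (simp add: powr_powr)
    also have "\<dots> \<le> M powr \<alpha>" using M pos by (intro powr_mono2) auto
    finally have "1 / M powr \<alpha> \<le> 1 / X" using X M by (intro divide_left_mono mult_pos_pos) auto
    then have "d * C0 * M powr (- \<alpha>) \<le> d * C0 * (1 / X)" using d pos by (intro mult_left_mono) (auto simp: powr_minus divide_inverse)
    also have "\<dots> = c0 / (8 * kv)" using d pos kv by (simp add: X_def field_simps)
    finally have 1: "d * C0 * M powr (- \<alpha>) \<le> c0 / (8 * kv)" .
    have "(M - 1) * d\<^sup>2 * C0 * 2 powr \<alpha> / A\<^sup>2 \<le> M * d\<^sup>2 * C0 * 2 powr \<alpha> / A\<^sup>2"
      using pos by (intro divide_right_mono mult_right_mono) auto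
    also have "\<dots> = c0 / (8 * kv)" unfolding A2 using kv M d pos by (simp add: field_simps)
    finally have 2: "(M - 1) * d\<^sup>2 * C0 * 2 powr \<alpha> / A\<^sup>2 \<le> c0 / (8 * kv)" .
    have "c0 / (8 * kv) + c0 / (8 * kv) < c0 / (2 * kv)" using pos kv by (simp add: field_simps)
    with 1 2 show ?thesis by linarith
  qed
  show ?thesis
  proof (rule exI[of _ \<Gamma>], rule conjI[OF \<Gamma>], intro allI impI)
    fix \<mu> \<nu> \<xi> t0 T0 Z :: real
    assume "\<mu> > 0 \<and> \<nu> > 0 \<and> \<xi> > 0"
    then have p3: "\<mu> > 0" "\<nu> > 0" "\<xi> > 0" by auto
    show "\<exists>T\<ge>0. \<forall>(u :: real \<Rightarrow> 'n \<Rightarrow> real^'n \<Rightarrow> real) \<beta>. damped \<mu> \<nu> \<xi> Z u \<beta> \<and>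
      (\<forall>t>T0. nrm (u t) \<le> C0 * Z * t powr (- \<alpha>)) \<and> (\<forall>t>t0. c0 * Z * t powr (- \<alpha>) \<le> nrm (u t)) \<longrightarrow>
      (\<forall>t>T. \<forall>D\<ge>0. (\<forall>b js \<theta>. length js = m \<and> test_fun \<theta> \<longrightarrow> \<bar>\<integral>x. u t b x * pd js \<theta> x \<partial>lborel\<bar> \<le> D * n2 \<theta>) \<longrightarrow>
        \<Gamma> * c0 * \<mu> powr (- real m / 2) * Z * t powr (- \<alpha> - real m / 2) \<le> D)"
    proof (cases "Z \<le> 0")
      \<comment> \<open>For nonpositive Z, in particular for vanishing data, the asserted lower
        bound is nonpositive.\<close>
      case True
      have "\<Gamma> * c0 * \<mu> powr (- real m / 2) * Z * t powr (- \<alpha> - real m / 2) \<le> 0" for t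
        using True \<Gamma> pos by (intro mult_nonpos_nonneg mult_nonneg_nonpos) auto
      then show ?thesis by (intro exI[of _ 0]) (auto intro: order_trans)
    next
      case False
      then have Z: "Z > 0" by simp
      let ?l = "\<lambda>t. A * sqrt (\<mu> * t)" and ?U = "\<lambda>t. C0 * Z * 2 powr \<alpha> * t powr (- \<alpha>)"
      let ?rhs = "\<lambda>t. d * (C0 * Z * (M * t) powr (- \<alpha>)) + rot_bound \<nu> \<xi> Z N d t (?l t) (?U t) N
        + (M - 1) * t * (\<nu> / 2 * rot_bound \<nu> \<xi> Z N d t (?l t) (?U t) (N - 1)
        + \<mu> * (d * (?U t * (d * (1 / ?l t)\<^sup>2))) + 100 * (?U t)\<^sup>2 * (1 / ?l t)\<^sup>2 + 50 * Z * ?U t * (1 / ?l t) ^ 3)"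
      have ev1: "\<forall>\<^sub>F t in at_top. t powr \<alpha> * ?rhs t < Z * (c0 / (2 * kv))"
        by (rule core_threshold[OF pos(1,3) Z p3(1,3) M(1) A N_def lim])
      have ev2: "\<forall>\<^sub>F t in at_top. ?l t \<ge> 1" using A p3 by real_asymp
      \<comment> \<open>The condition t > 2 T0 makes the upper bound for u available from time t / 2
        on. The threshold is obtained here, before u and \<beta> are introduced, so it cannot depend
        on them.\<close>
      have "\<forall>\<^sub>F t in at_top. t powr \<alpha> * ?rhs t < Z * (c0 / (2 * kv)) \<and> ?l t \<ge> 1 \<and> t > 0 \<and> t > t0 \<and> t > 2 * T0"
        using ev1 ev2 eventually_gt_at_top[of 0] eventually_gt_at_top[of t0] eventually_gt_at_top[of "2 * T0"] by eventually_elim blast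
      then obtain T where T: "\<And>t. t \<ge> T \<Longrightarrow> t powr \<alpha> * ?rhs t < Z * (c0 / (2 * kv)) \<and> ?l t \<ge> 1 \<and> t > 0 \<and> t > t0 \<and> t > 2 * T0"
        unfolding eventually_at_top_linorder by blast
      show ?thesis
      proof (intro exI[of _ "max T 0"] conjI allI impI)
        fix u :: "real \<Rightarrow> 'n \<Rightarrow> real^'n \<Rightarrow> real" and \<beta> t D
        assume hyp: "damped \<mu> \<nu> \<xi> Z u \<beta> \<and> (\<forall>t>T0. nrm (u t) \<le> C0 * Z * t powr (- \<alpha>)) \<and> (\<forall>t>t0. c0 * Z * t powr (- \<alpha>) \<le> nrm (u t))"
          and t: "max T 0 < t" and D0: "0 \<le> D"
          and Db: "\<forall>b js \<theta>. length js = m \<and> test_fun \<theta> \<longrightarrow> \<bar>\<integral>x. u t b x * pd js \<theta> x \<partial>lborel\<bar> \<le> D * n2 \<theta>"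
        have dm: "damped \<mu> \<nu> \<xi> Z u \<beta>" and up: "\<And>t. t > T0 \<Longrightarrow> nrm (u t) \<le> C0 * Z * t powr (- \<alpha>)"
          and lo: "\<And>t. t > t0 \<Longrightarrow> c0 * Z * t powr (- \<alpha>) \<le> nrm (u t)" using hyp by auto
        have rhs: "t powr \<alpha> * ?rhs t < Z * (c0 / (2 * kv))" and l1: "?l t \<ge> 1" and tp: "t > 0" "t > t0" "t > 2 * T0"
          using T[of t] t by auto
        define l where "l = ?l t"
        have l: "l \<ge> 1" "l > 0" using l1 by (auto simp: l_def)
        define V where "V = nrm (u t)"
        have V: "c0 * Z * t powr (- \<alpha>) \<le> V" unfolding V_def by (rule lo[OF tp(2)])
        have low0: "c0 * Z * t powr (- \<alpha>) > 0" using pos Z tp by simp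
        have V0: "V > 0" using V low0 by linarith
        note D1 = dm[unfolded damped_def, THEN conjunct1, rule_format, OF less_imp_le[OF tp(1)]]
        have su: "\<And>b. sqint (u t b)" using D1 by blast
        have dv: "\<And>\<psi>. test_fun \<psi> \<Longrightarrow> (\<Sum>j\<in>UNIV. \<integral>x. u t j x * pd [j] \<psi> x \<partial>lborel) = 0" using D1 by blast
        show "\<Gamma> * c0 * \<mu> powr (- real m / 2) * Z * t powr (- \<alpha> - real m / 2) \<le> D"
        proof (rule ccontr)
          assume "\<not> ?thesis"
          then have Dlt: "D < \<Gamma> * c0 * \<mu> powr (- real m / 2) * Z * t powr (- \<alpha> - real m / 2)" by simp
          \<comment> \<open>The powers of \<mu> and t in the claim are those that the scale l
            contributes to the smoothing error.\<close>
          have lm: "l ^ m = A ^ m * \<mu> powr (real m / 2) * t powr (real m / 2)"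
          proof -
            have "sqrt (\<mu> * t) ^ m = (\<mu> * t) powr (real m / 2)"
              using p3 tp by (simp add: powr_half_sqrt[symmetric] powr_realpow[symmetric] powr_powr)
            then show ?thesis using p3 tp by (simp add: l_def power_mult_distrib powr_mult)
          qed
          have lD: "l ^ m * D \<le> A ^ m * \<Gamma> * (c0 * Z * t powr (- \<alpha>))"
          proof -
            have "l ^ m * D \<le> l ^ m * (\<Gamma> * c0 * \<mu> powr (- real m / 2) * Z * t powr (- \<alpha> - real m / 2))"
              using Dlt l by (intro mult_left_mono) auto
            also have "\<dots> = A ^ m * \<Gamma> * (c0 * Z * (t powr (real m / 2) * t powr (- \<alpha> - real m / 2))) * (\<mu> powr (real m / 2) * \<mu> powr (- real m / 2))"
              unfolding lm by (simp add: mult_ac)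
            also have "\<mu> powr (real m / 2) * \<mu> powr (- real m / 2) = 1" using p3 by (simp flip: powr_add)
            also have "t powr (real m / 2) * t powr (- \<alpha> - real m / 2) = t powr (- \<alpha>)" by (simp flip: powr_add)
            finally show ?thesis by simp
          qed
          have err: "d * ((d * S * l) ^ m * D) \<le> V / 4"
          proof -
            have "d * ((d * S * l) ^ m * D) = d * (d * S) ^ m * (l ^ m * D)" by (simp add: power_mult_distrib)
            also have "\<dots> \<le> d * (d * S) ^ m * (A ^ m * \<Gamma> * (c0 * Z * t powr (- \<alpha>)))" using lD d S by (intro mult_left_mono) auto
            also have "\<dots> = (c0 * Z * t powr (- \<alpha>)) / 4" using d S A by (simp add: \<Gamma>_def)
            finally show ?thesis using V by simp
          qed
          have prK: "(\<Sum>b\<in>UNIV. \<integral>x. u t b x * conv (dil l K) (u t b) x \<partial>lborel) \<ge> 3 / 4 * (nrm (u t))\<^sup>2"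
          proof -
            have "(\<Sum>b\<in>UNIV. (n2 (u t b))\<^sup>2 - (d * S * l) ^ m * D * n2 (u t b)) \<le> (\<Sum>b\<in>UNIV. \<integral>x. u t b x * conv (dil l K) (u t b) x \<partial>lborel)"
              unfolding d_def S_def K_def using Db by (intro sum_mono kernel_error su l D0) blast
            moreover have "(\<Sum>b\<in>UNIV. (n2 (u t b))\<^sup>2) = V\<^sup>2" by (simp add: V_def nrm_def sum_nonneg)
            moreover have "(\<Sum>b\<in>UNIV. (d * S * l) ^ m * D * n2 (u t b)) \<le> V / 4 * V"
            proof -
              have "(\<Sum>b\<in>UNIV. (d * S * l) ^ m * D * n2 (u t b)) \<le> (\<Sum>b\<in>(UNIV::'n set). (d * S * l) ^ m * D * V)"
                unfolding V_def using d S l D0 by (intro sum_mono mult_left_mono n2_le_nrm) auto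
              also have "\<dots> = d * ((d * S * l) ^ m * D) * V" by (simp add: d_def)
              also have "\<dots> \<le> V / 4 * V" using err V0 by (intro mult_right_mono) auto
              finally show ?thesis .
            qed
            ultimately show ?thesis unfolding sum_subtractf V_def[symmetric] by (simp add: power2_eq_square)
          qed
          have Kc: "ctest K" unfolding K_def by (rule kerK_ctest)
          obtain \<phi> where \<phi>: "sol \<phi>" "\<And>b. tb J l (kv * nrm (u t)) 0 (\<phi> b)" "pr (u t) \<phi> \<ge> (nrm (u t))\<^sup>2 / 2"
            using scaled_test_field[OF n su Kc l(1) V0[unfolded V_def] dv kv_def prK] by blast
          \<comment> \<open>Monotonicity of the decay rate from t / 2 on produces the factor
            2^\<alpha>.\<close>
          have U: "nrm (u s) \<le> ?U t" if s: "t / 2 \<le> s" for s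
          proof -
            have "nrm (u s) \<le> C0 * Z * s powr (- \<alpha>)" using s tp by (intro up) auto
            also have "s powr (- \<alpha>) \<le> (t / 2) powr (- \<alpha>)" using s tp pos by (intro powr_mono2') auto
            also have "(t / 2) powr (- \<alpha>) = 2 powr \<alpha> * t powr (- \<alpha>)" using tp by (simp add: powr_divide powr_minus field_simps)
            finally show ?thesis using pos Z by (simp add: mult_ac mult_left_mono)
          qed
          have Ue: "nrm (u (M * t)) \<le> C0 * Z * (M * t) powr (- \<alpha>)"
          proof (rule up)
            have "t \<le> M * t" using M tp by simp
            then show "T0 < M * t" using tp by linarith
          qed
          have "\<bar>pr (u t) \<phi>\<bar> \<le> kv * V * ?rhs t"
            unfolding d_def l_def[symmetric]
            by (rule field_pairing_estimate[OF dm \<phi>(1) \<phi>(2)[unfolded J_def V_def[symmetric]] N1 p3 less_imp_le[OF Z] l(2) _ tp(1) M(1) U Ue])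
               (use kv V0 in auto)
          \<comment> \<open>The test field has the size of u(t), so one factor V cancels; the lower
            bound for V then contradicts the threshold inequality, whose right-hand side was set to
            c0 Z / (2 kv) for this purpose.\<close>
          then have "V\<^sup>2 / 2 \<le> kv * V * ?rhs t" using \<phi>(3) unfolding V_def[symmetric] by linarith
          then have "V * (V / 2) \<le> V * (kv * ?rhs t)" by (simp add: power2_eq_square mult_ac)
          then have "V / 2 \<le> kv * ?rhs t" using V0 by (simp only: mult_le_cancel_left_pos)
          then have "c0 * Z * t powr (- \<alpha>) / 2 \<le> kv * ?rhs t" using V by linarith
          then have "t powr \<alpha> * (c0 * Z * t powr (- \<alpha>) / 2) \<le> t powr \<alpha> * (kv * ?rhs t)" by (intro mult_left_mono) auto
          moreover have "t powr \<alpha> * (c0 * Z * t powr (- \<alpha>) / 2) = c0 * Z / 2" using tp by (simp add: powr_minus)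
          moreover have "t powr \<alpha> * (kv * ?rhs t) = kv * (t powr \<alpha> * ?rhs t)" by (rule mult.left_commute)
          moreover have "kv * (t powr \<alpha> * ?rhs t) < kv * (Z * (c0 / (2 * kv)))" using rhs kv by (intro mult_strict_left_mono) auto
          moreover have "kv * (Z * (c0 / (2 * kv))) = c0 * Z / 2" using kv by (simp add: field_simps)
          ultimately show False by linarith
        qed
      qed simp
    qed
  qed
qed

section \<open>From Lebesgue to Borel measurable representatives\<close>

text \<open>Completeness of Lebesgue measure: the two preimages of a Borel set differ by a null
  set.\<close>

lemma lebesgue_measurable_AE:
  fixes f g :: "'a::euclidean_space \<Rightarrow> real"
  assumes g: "g \<in> borel_measurable lebesgue" and ae: "AE x in lebesgue. f x = g x"
  shows "f \<in> borel_measurable lebesgue"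
proof (rule measurableI)
  fix A :: "real set" assume A: "A \<in> sets borel"
  have 1: "g -` A \<inter> space lebesgue \<in> sets lebesgue" by (rule measurable_sets[OF g A])
  have 2: "AE x in lebesgue. (x \<in> g -` A \<inter> space lebesgue) = (x \<in> f -` A \<inter> space lebesgue)"
    using ae by eventually_elim auto
  show "f -` A \<inter> space lebesgue \<in> sets lebesgue"
    by (rule completion.in_sets_AE[OF 2 1]) auto
qed auto

text \<open>A Borel representative; the solutions are only Lebesgue measurable, while products with \<open>lborel\<close> need Borel functions.\<close>
definition bv :: "('a::euclidean_space \<Rightarrow> real) \<Rightarrow> 'a \<Rightarrow> real" where
  "bv f = (SOME g. g \<in> borel_measurable borel \<and> (AE x in lborel. f x = g x))"

lemma bv:
  assumes "f \<in> borel_measurable lebesgue"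
  shows bv_measurable: "bv f \<in> borel_measurable borel" and bv_AE: "AE x in lborel. f x = bv f x"
proof -
  have "\<exists>g. g \<in> borel_measurable borel \<and> (AE x in lborel. f x = g x)"
    using completion_ex_borel_measurable_real[OF assms] by auto
  from someI_ex[OF this] show "bv f \<in> borel_measurable borel" "AE x in lborel. f x = bv f x"
    unfolding bv_def by blast+
qed

lemma lebesgue_integral_AE_borel:
  fixes f g :: "'a::euclidean_space \<Rightarrow> real"
  assumes g: "g \<in> borel_measurable borel" and ae: "AE x in lborel. f x = g x"
  shows "(\<integral>x. f x \<partial>lebesgue) = (\<integral>x. g x \<partial>lborel)"
proof -
  have gl: "g \<in> borel_measurable lebesgue" using g by (intro measurable_completion) simp
  have "(\<integral>x. f x \<partial>lebesgue) = (\<integral>x. g x \<partial>lebesgue)"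
    using AE_completion[OF ae] by (intro integral_cong_AE lebesgue_measurable_AE[OF gl] gl)
  also have "\<dots> = (\<integral>x. g x \<partial>lborel)" by (rule integral_completion) (use g in simp)
  finally show ?thesis .
qed

lemma bv_sqint:
  assumes f: "f \<in> borel_measurable lebesgue" and i: "integrable lebesgue (\<lambda>x. (f x)\<^sup>2)"
  shows "sqint (bv f)" "(n2 (bv f))\<^sup>2 = (\<integral>x. (f x)\<^sup>2 \<partial>lebesgue)"
proof -
  note m[measurable] = bv_measurable[OF f]
  have ae: "AE x in lborel. (f x)\<^sup>2 = (bv f x)\<^sup>2" using bv_AE[OF f] by eventually_elim simp
  have "integrable lebesgue (\<lambda>x. (bv f x)\<^sup>2)"
  proof (rule integrable_cong_AE_imp[OF i])
    show "(\<lambda>x. (bv f x)\<^sup>2) \<in> borel_measurable lebesgue" by (rule measurable_completion) measurable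
    show "AE x in lebesgue. (f x)\<^sup>2 = (bv f x)\<^sup>2" by (rule AE_completion[OF ae])
  qed
  then show "sqint (bv f)" using m by (simp add: sqint_def integrable_completion)
  show "(n2 (bv f))\<^sup>2 = (\<integral>x. (f x)\<^sup>2 \<partial>lebesgue)"
    unfolding n2_sq by (rule lebesgue_integral_AE_borel[symmetric, OF _ ae]) measurable
qed

lemma lebesgue_pairing_bv:
  assumes f: "f \<in> borel_measurable lebesgue" and g: "g \<in> borel_measurable borel"
  shows "(\<integral>x. f x * g x \<partial>lebesgue) = (\<integral>x. bv f x * g x \<partial>lborel)"
proof (rule lebesgue_integral_AE_borel)
  show "(\<lambda>x. bv f x * g x) \<in> borel_measurable borel" using bv_measurable[OF f] g by simp
  show "AE x in lborel. f x * g x = bv f x * g x" using bv_AE[OF f] by eventually_elim simp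
qed

lemma weak_deriv_bv:
  assumes w: "weak_deriv js f g" and \<psi>: "test_fun \<psi>"
  shows "(\<integral>x. bv f x * pd js \<psi> x \<partial>lborel) = (-1) ^ length js * (\<integral>x. bv g x * \<psi> x \<partial>lborel)"
proof -
  have m: "f \<in> borel_measurable lebesgue" "g \<in> borel_measurable lebesgue" using w by (auto simp: weak_deriv_def loc_int_def)
  have "(\<integral>x. f x * pd js \<psi> x \<partial>lebesgue) = (-1) ^ length js * (\<integral>x. g x * \<psi> x \<partial>lebesgue)" using w \<psi> by (simp add: weak_deriv_def)
  then show ?thesis
    unfolding lebesgue_pairing_bv[OF m(1) test_fun_measurable[OF test_fun_pd[OF \<psi>]]] lebesgue_pairing_bv[OF m(2) test_fun_measurable[OF \<psi>]] .
qed

lemma L2_component: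
  fixes v :: "'a::euclidean_space \<Rightarrow> real^'k::finite"
  assumes "L2 v"
  shows "(\<lambda>x. v x $ i) \<in> borel_measurable lebesgue" "integrable lebesgue (\<lambda>x. (v x $ i)\<^sup>2)"
proof -
  have m[measurable]: "v \<in> borel_measurable lebesgue" and int: "integrable lebesgue (\<lambda>x. (norm (v x))\<^sup>2)" using assms by (auto simp: L2_def)
  show mi: "(\<lambda>x. v x $ i) \<in> borel_measurable lebesgue"
    using m by (rule measurable_compose) (intro borel_measurable_continuous_onI continuous_intros)
  show "integrable lebesgue (\<lambda>x. (v x $ i)\<^sup>2)"
  proof (rule Bochner_Integration.integrable_bound[OF int])
    show "(\<lambda>x. (v x $ i)\<^sup>2) \<in> borel_measurable lebesgue" using mi by (rule borel_measurable_power)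
    show "AE x in lebesgue. norm ((v x $ i)\<^sup>2) \<le> norm ((norm (v x))\<^sup>2)"
      using component_le_norm_cart[of "v x" i for x] by (intro AE_I2) (simp add: abs_le_square_iff[symmetric])
  qed
qed

lemma L2norm_components:
  fixes v :: "'a::euclidean_space \<Rightarrow> real^'k::finite"
  assumes "L2 v"
  shows "L2norm v = sqrt (\<Sum>i\<in>UNIV. (n2 (bv (\<lambda>x. v x $ i)))\<^sup>2)"
proof -
  have "(\<integral>x. (norm (v x))\<^sup>2 \<partial>lebesgue) = (\<integral>x. (\<Sum>i\<in>UNIV. (v x $ i)\<^sup>2) \<partial>lebesgue)"
    by (simp add: norm_vec_def L2_set_def sum_nonneg)
  also have "\<dots> = (\<Sum>i\<in>UNIV. \<integral>x. (v x $ i)\<^sup>2 \<partial>lebesgue)"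
    by (rule Bochner_Integration.integral_sum) (rule L2_component(2)[OF assms])
  also have "\<dots> = (\<Sum>i\<in>UNIV. (n2 (bv (\<lambda>x. v x $ i)))\<^sup>2)"
    using bv_sqint(2)[OF L2_component[OF assms]] by simp
  finally show ?thesis by (simp add: L2norm_def)
qed

lemma L2_inner_bv:
  fixes v :: "'a::euclidean_space \<Rightarrow> real^'k::finite"
  assumes v: "L2 v" and p: "\<And>i. sqint (p i)"
  shows "(\<integral>x. v x \<bullet> (\<chi> i. p i x) \<partial>lebesgue) = (\<Sum>i\<in>UNIV. \<integral>x. bv (\<lambda>x. v x $ i) x * p i x \<partial>lborel)"
proof -
  note m = L2_component(1)[OF v] and s = bv_sqint(1)[OF L2_component[OF v]]
  have "AE x in lborel. \<forall>i\<in>UNIV. v x $ i = bv (\<lambda>x. v x $ i) x"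
    by (intro AE_finite_allI bv_AE m) simp
  then have ae: "AE x in lborel. v x \<bullet> (\<chi> i. p i x) = (\<Sum>i\<in>UNIV. bv (\<lambda>x. v x $ i) x * p i x)"
    by eventually_elim (simp add: inner_vec_def)
  have "(\<integral>x. v x \<bullet> (\<chi> i. p i x) \<partial>lebesgue) = (\<integral>x. (\<Sum>i\<in>UNIV. bv (\<lambda>x. v x $ i) x * p i x) \<partial>lborel)"
    by (rule lebesgue_integral_AE_borel[OF _ ae])
       (intro borel_measurable_sum borel_measurable_times sqint_meas s p)
  also have "\<dots> = (\<Sum>i\<in>UNIV. \<integral>x. bv (\<lambda>x. v x $ i) x * p i x \<partial>lborel)"
    by (rule Bochner_Integration.integral_sum) (rule sqint_mult_integrable[OF s p])
  finally show ?thesis .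
qed

section \<open>Time slices of functions on space-time\<close>

lemma AE_sections:
  assumes "AE p in (lborel :: ('a::euclidean_space \<times> 'b::euclidean_space) measure). Q p"
  shows "AE s in lborel. AE x in lborel. Q (x, s)"
proof -
  obtain N where N: "{p \<in> space lborel. \<not> Q p} \<subseteq> N" "N \<in> sets (lborel :: ('a \<times> 'b) measure)" "emeasure lborel N = 0"
    using AE_E[OF assms] by metis
  have Nm: "N \<in> sets (lborel \<Otimes>\<^sub>M lborel)" using N(2) by (simp only: lborel_prod)
  have "AE p in lborel \<Otimes>\<^sub>M lborel. p \<notin> N"
    unfolding lborel_prod using N by (intro AE_not_in) (simp add: null_sets_def)
  then have "AE x in lborel. AE s in lborel. (x, s) \<notin> N" by (rule lborel_pair.AE_pair)
  \<comment> \<open>Exceptional sets have to be sought in time with the space variable inside, the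
    opposite of the order in which the product theorem delivers them.\<close>
  moreover have "(AE x in lborel. AE s in lborel. (x, s) \<notin> N) \<longleftrightarrow> (AE s in lborel. AE x in lborel. (x, s) \<notin> N)"
    by (rule lborel_pair.AE_commute) (use Nm in measurable)
  ultimately have "AE s in lborel. AE x in lborel. (x, s) \<notin> N" by blast
  then show ?thesis
  proof eventually_elim
    case (elim s)
    then show ?case by eventually_elim (use N(1) in auto)
  qed
qed

text \<open>The representatives \<open>bv\<close> are chosen separately for each time and need not
  be measurable in time. For almost every time they agree with the sections of one jointly Borel
  function, which restores measurability in time.\<close>

lemma joint_borel_version:
  fixes f :: "'a::euclidean_space \<Rightarrow> real \<Rightarrow> real"
  assumes "(\<lambda>(x, t). f x t) \<in> borel_measurable lebesgue"
  obtains F where "F \<in> borel_measurable (lborel \<Otimes>\<^sub>M lborel)" "AE p in lborel. (case p of (x, t) \<Rightarrow> f x t) = F p"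
    "AE s in lborel. (\<lambda>x. f x s) \<in> borel_measurable lebesgue \<and> (AE x in lborel. bv (\<lambda>x. f x s) x = F (x, s))"
proof -
  obtain F where F: "F \<in> borel_measurable (lborel :: ('a \<times> real) measure)" and ae: "AE p in lborel. (case p of (x, t) \<Rightarrow> f x t) = F p"
    using completion_ex_borel_measurable_real[OF assms] by auto
  have Fm[measurable]: "F \<in> borel_measurable (lborel \<Otimes>\<^sub>M lborel)" using F by (simp only: lborel_prod)
  have "AE s in lborel. (\<lambda>x. f x s) \<in> borel_measurable lebesgue \<and> (AE x in lborel. bv (\<lambda>x. f x s) x = F (x, s))"
    using AE_sections[OF ae]
  proof eventually_elim
    case (elim s)
    then have e: "AE x in lborel. f x s = F (x, s)" by simp
    have Fs: "(\<lambda>x. F (x, s)) \<in> borel_measurable lebesgue" by (rule measurable_completion) measurable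
    have m: "(\<lambda>x. f x s) \<in> borel_measurable lebesgue" by (rule lebesgue_measurable_AE[OF Fs AE_completion[OF e]])
    have "AE x in lborel. bv (\<lambda>x. f x s) x = F (x, s)" using bv_AE[OF m] e by eventually_elim simp
    with m show ?case by blast
  qed
  then show ?thesis by (rule that[OF Fm ae])
qed

lemma section_product_measurable:
  fixes f g :: "'a::euclidean_space \<Rightarrow> real \<Rightarrow> real"
  assumes f: "(\<lambda>(x, t). f x t) \<in> borel_measurable lebesgue" and g: "(\<lambda>(x, t). g x t) \<in> borel_measurable lebesgue"
    and z[measurable]: "\<zeta> \<in> borel_measurable borel"
  shows "\<exists>G \<in> borel_measurable borel. AE s in lborel. (\<integral>x. bv (\<lambda>x. f x s) x * (bv (\<lambda>x. g x s) x * \<zeta> x) \<partial>lborel) = G s"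
proof -
  obtain F where F[measurable]: "F \<in> borel_measurable (lborel \<Otimes>\<^sub>M lborel)"
    and Fe: "AE s in lborel. (\<lambda>x. f x s) \<in> borel_measurable lebesgue \<and> (AE x in lborel. bv (\<lambda>x. f x s) x = F (x, s))"
    using joint_borel_version[OF f] by blast
  obtain G where G[measurable]: "G \<in> borel_measurable (lborel \<Otimes>\<^sub>M lborel)"
    and Ge: "AE s in lborel. (\<lambda>x. g x s) \<in> borel_measurable lebesgue \<and> (AE x in lborel. bv (\<lambda>x. g x s) x = G (x, s))"
    using joint_borel_version[OF g] by blast
  show ?thesis
  proof (rule bexI[of _ "\<lambda>s. \<integral>x. F (x, s) * (G (x, s) * \<zeta> x) \<partial>lborel"])
    show "(\<lambda>s. \<integral>x. F (x, s) * (G (x, s) * \<zeta> x) \<partial>lborel) \<in> borel_measurable borel"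
      using lborel.borel_measurable_lebesgue_integral[of "\<lambda>s x. F (x, s) * (G (x, s) * \<zeta> x)" "lborel"] by measurable
    show "AE s in lborel. (\<integral>x. bv (\<lambda>x. f x s) x * (bv (\<lambda>x. g x s) x * \<zeta> x) \<partial>lborel) = (\<integral>x. F (x, s) * (G (x, s) * \<zeta> x) \<partial>lborel)"
      using Fe Ge
    proof eventually_elim
      case (elim s)
      note m[measurable] = bv_measurable[OF elim(1)[THEN conjunct1]] bv_measurable[OF elim(2)[THEN conjunct1]]
      show ?case
      proof (rule integral_cong_AE)
        show "AE x in lborel. bv (\<lambda>x. f x s) x * (bv (\<lambda>x. g x s) x * \<zeta> x) = F (x, s) * (G (x, s) * \<zeta> x)"
          using elim(1)[THEN conjunct2] elim(2)[THEN conjunct2] by eventually_elim simp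
      qed measurable
    qed
  qed
qed

text \<open>Tonelli for the joint Borel version: an iterated integral that is finite has finite
  inner integrals at almost every time.\<close>

lemma section_sqint:
  fixes g :: "'a::euclidean_space \<Rightarrow> real \<Rightarrow> real"
  assumes g: "(\<lambda>(x, t). g x t) \<in> borel_measurable lebesgue"
    and i: "set_integrable lebesgue {p :: 'a \<times> real. snd p > 0} (\<lambda>(x, t). (g x t)\<^sup>2)"
  shows "AE s in lborel. s > 0 \<longrightarrow> sqint (bv (\<lambda>x. g x s))"
proof -
  obtain F where F[measurable]: "F \<in> borel_measurable (lborel \<Otimes>\<^sub>M lborel)" and Fe: "AE p in lborel. (case p of (x, t) \<Rightarrow> g x t) = F p"
    and Fs: "AE s in lborel. (\<lambda>x. g x s) \<in> borel_measurable lebesgue \<and> (AE x in lborel. bv (\<lambda>x. g x s) x = F (x, s))"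
    using joint_borel_version[OF g] by blast
  let ?I = "\<lambda>p :: 'a \<times> real. indicator {p. snd p > 0} p * (F p)\<^sup>2 :: real"
  have Im[measurable]: "?I \<in> borel_measurable (lborel \<Otimes>\<^sub>M lborel)" by measurable
  have Iml: "?I \<in> borel_measurable (lborel :: ('a \<times> real) measure)" using Im by (simp only: lborel_prod)
  have "integrable lebesgue ?I"
  proof (rule integrable_cong_AE_imp)
    show "integrable lebesgue (\<lambda>p. indicator {p :: 'a \<times> real. snd p > 0} p *\<^sub>R (\<lambda>(x, t). (g x t)\<^sup>2) p)"
      using i by (simp add: set_integrable_def)
    show "?I \<in> borel_measurable lebesgue" by (rule measurable_completion[OF Iml])
    show "AE p in lebesgue. indicator {p :: 'a \<times> real. snd p > 0} p *\<^sub>R (\<lambda>(x, t). (g x t)\<^sup>2) p = ?I p"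
      using AE_completion[OF Fe] by eventually_elim (auto split: prod.splits)
  qed
  then have "integrable lborel ?I" by (simp add: integrable_completion[OF Iml])
  then have "(\<integral>\<^sup>+p. ennreal (?I p) \<partial>(lborel \<Otimes>\<^sub>M lborel)) < \<infinity>"
    unfolding lborel_prod by (auto simp: integrable_iff_bounded)
  also have "(\<integral>\<^sup>+p. ennreal (?I p) \<partial>(lborel \<Otimes>\<^sub>M lborel)) = (\<integral>\<^sup>+s. \<integral>\<^sup>+x. ennreal (?I (x, s)) \<partial>lborel \<partial>lborel)"
    by (rule lborel_pair.nn_integral_snd[symmetric]) measurable
  finally have "AE s in lborel. (\<integral>\<^sup>+x. ennreal (?I (x, s)) \<partial>lborel) \<noteq> \<infinity>"
    by (intro nn_integral_PInf_AE) (auto intro!: lborel.borel_measurable_nn_integral)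
  then show ?thesis using Fs
  proof eventually_elim
    case (elim s)
    show ?case
    proof
      assume s: "s > 0"
      note m[measurable] = bv_measurable[OF elim(2)[THEN conjunct1]]
      have "(\<integral>\<^sup>+x. ennreal ((bv (\<lambda>x. g x s) x)\<^sup>2) \<partial>lborel) = (\<integral>\<^sup>+x. ennreal (?I (x, s)) \<partial>lborel)"
        using elim(2)[THEN conjunct2] s by (intro nn_integral_cong_AE) (auto elim!: eventually_mono)
      also have "\<dots> < \<infinity>" using elim(1) by (simp add: less_top)
      finally show "sqint (bv (\<lambda>x. g x s))" unfolding sqint_def integrable_iff_bounded using m by simp
    qed
  qed
qed

text \<open>Bridge from the integrated weak formulation to increments. The integrand h is known only
  at almost every positive time, as a continuous part c and a measurable part g; c is kept under an
  ordinary integral and g is estimated.\<close>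

lemma evolution_increment:
  fixes a h c g :: "real \<Rightarrow> real"
  assumes P: "\<And>t. t \<ge> 0 \<Longrightarrow> a t - a0 + set_lebesgue_integral lebesgue {0..t} h = 0"
    and c: "continuous_on {0..} c" and g[measurable]: "g \<in> borel_measurable borel"
    and h: "AE s in lborel. s > 0 \<longrightarrow> h s = - c s - g s"
    and C: "AE s in lborel. s > 0 \<longrightarrow> \<bar>g s\<bar> \<le> C"
    and s12: "0 \<le> s1" "s1 \<le> s2" and E: "AE s in lborel. s > 0 \<longrightarrow> s \<in> {s1..s2} \<longrightarrow> \<bar>g s\<bar> \<le> E"
  shows "\<bar>a s2 - a s1 - integral {s1..s2} c\<bar> \<le> E * (s2 - s1)"
proof -
  \<comment> \<open>Clamping changes g on no more than a null set of positive times and makes it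
    bounded everywhere, hence integrable over bounded intervals.\<close>
  define G where "G = (\<lambda>s. max (- \<bar>C\<bar>) (min \<bar>C\<bar> (g s)))"
  have G[measurable]: "G \<in> borel_measurable borel" unfolding G_def by measurable
  have Gb: "\<bar>G s\<bar> \<le> \<bar>C\<bar>" for s by (auto simp: G_def)
  have n0: "AE s in lborel. s \<noteq> (0::real)" by (rule AE_lborel_singleton)
  have Gg: "AE s in lborel. s > 0 \<longrightarrow> G s = g s" using C by eventually_elim (auto simp: G_def)
  define k where "k = (\<lambda>s. - c s - G s)"
  have Gi: "set_integrable lebesgue {x..y} G" for x y
  proof -
    have "set_integrable lborel {x..y} G" unfolding set_integrable_def
    proof (rule Bochner_Integration.integrable_bound)
      show "integrable lborel (\<lambda>s. \<bar>C\<bar> * indicator {x..y} s :: real)"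
        by (intro integrable_mult_right integrable_real_indicator) (auto simp: emeasure_lborel_Icc_eq)
      show "AE s in lborel. norm (indicat_real {x..y} s *\<^sub>R G s) \<le> norm (\<bar>C\<bar> * indicator {x..y} s :: real)"
        using Gb by (intro AE_I2) (auto simp: indicator_def)
    qed measurable
    then show ?thesis unfolding set_integrable_def by (subst integrable_completion) measurable
  qed
  have ci: "set_integrable lebesgue {x..y} c" if "0 \<le> x" for x y
    by (rule absolutely_integrable_continuous_real) (rule continuous_on_subset[OF c], use that in auto)
  have ki: "set_integrable lebesgue {x..y} k" if "0 \<le> x" for x y
  proof -
    have "set_integrable lebesgue {x..y} (\<lambda>s. (-1) * c s - G s)"
      by (intro set_integral_diff(1) set_integrable_mult_right ci that Gi)
    then show ?thesis by (simp add: k_def)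
  qed
  have hk: "set_lebesgue_integral lebesgue {0..t} h = integral {0..t} k" for t
  proof -
    have ae: "AE s in lebesgue. indicator {0..t} s *\<^sub>R h s = indicator {0..t} s *\<^sub>R k s"
      using AE_completion[OF h] AE_completion[OF Gg] AE_completion[OF n0]
      by eventually_elim (auto simp: k_def indicator_def)
    have km: "(\<lambda>s. indicator {0..t} s *\<^sub>R k s) \<in> borel_measurable lebesgue"
      using ki[of 0 t] by (simp add: set_integrable_def borel_measurable_integrable)
    have "set_lebesgue_integral lebesgue {0..t} h = set_lebesgue_integral lebesgue {0..t} k"
      unfolding set_lebesgue_integral_def by (rule integral_cong_AE[OF lebesgue_measurable_AE[OF km ae] km ae])
    also have "\<dots> = integral {0..t} k" by (rule set_lebesgue_integral_eq_integral(2)[OF ki]) simp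
    finally show ?thesis .
  qed
  have "a s2 - a s1 = integral {0..s1} k - integral {0..s2} k"
    using P[of s1] P[of s2] s12 unfolding hk by simp
  also have "integral {0..s2} k = integral {0..s1} k + integral {s1..s2} k"
    by (rule Henstock_Kurzweil_Integration.integral_combine[symmetric]) (use s12 ki[of 0 s2] in \<open>auto intro: set_lebesgue_integral_eq_integral(1)\<close>)
  also have "integral {s1..s2} k = - integral {s1..s2} c - integral {s1..s2} G"
    unfolding k_def using ci[of s1 s2] Gi[of s1 s2] s12
    by (subst integral_diff) (auto intro!: set_lebesgue_integral_eq_integral(1) integrable_neg)
  finally have "a s2 - a s1 - integral {s1..s2} c = integral {s1..s2} G" by simp
  also have "integral {s1..s2} G = set_lebesgue_integral lebesgue {s1..s2} G"
    by (rule set_lebesgue_integral_eq_integral(2)[symmetric, OF Gi])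
  also have "\<bar>\<dots>\<bar> \<le> (\<integral>s. E * indicator {s1..s2} s \<partial>lebesgue)"
  proof -
    have "\<bar>set_lebesgue_integral lebesgue {s1..s2} G\<bar> \<le> (\<integral>s. \<bar>indicator {s1..s2} s *\<^sub>R G s\<bar> \<partial>lebesgue)"
      unfolding set_lebesgue_integral_def by (rule integral_abs_bound)
    also have "\<dots> \<le> (\<integral>s. E * indicator {s1..s2} s \<partial>lebesgue)"
    proof (rule integral_mono_AE)
      show "integrable lebesgue (\<lambda>s. \<bar>indicator {s1..s2} s *\<^sub>R G s\<bar>)" using Gi[of s1 s2] by (simp add: set_integrable_def)
      show "integrable lebesgue (\<lambda>s. E * indicator {s1..s2} s)"
        by (intro integrable_mult_right integrable_real_indicator) (auto simp: emeasure_lborel_Icc_eq)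
      show "AE s in lebesgue. \<bar>indicator {s1..s2} s *\<^sub>R G s\<bar> \<le> E * indicator {s1..s2} s"
        using AE_completion[OF E] AE_completion[OF Gg] AE_completion[OF n0]
        by eventually_elim (use s12 in \<open>auto simp: indicator_def\<close>)
    qed
    finally show ?thesis .
  qed
  also have "\<dots> = E * (s2 - s1)" using s12 by simp
  finally show ?thesis .
qed

section \<open>The coupled weak formulation\<close>

text \<open>Curl with structure constants \<open>e\<close>, so that dimensions two (\<open>'i = unit\<close>) and three (\<open>'i = 3\<close>) share one proof.\<close>
definition crl :: "('i \<Rightarrow> 'n \<Rightarrow> 'n \<Rightarrow> real) \<Rightarrow> ('n::finite \<Rightarrow> real^'n \<Rightarrow> real) \<Rightarrow> 'i \<Rightarrow> real^'n \<Rightarrow> real" where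
  "crl e \<phi> i x = (\<Sum>j\<in>UNIV. \<Sum>b\<in>UNIV. e i j b * pd [j] (\<phi> b) x)"

lemma pd_crl: assumes "sol \<phi>" shows "pd js (crl e \<phi> i) = (\<lambda>x. \<Sum>j\<in>UNIV. \<Sum>b\<in>UNIV. e i j b * pd (js @ [j]) (\<phi> b) x)"
proof -
  have s: "smooth_fn (pd [j] (\<phi> b))" for j b by (rule smooth_fn_pd[OF test_fun_smooth[OF sol_test[OF assms]]])
  have s1: "smooth_fn (\<lambda>x. e i j b * pd [j] (\<phi> b) x)" for j b by (rule smooth_fn_cmult[OF s])
  have s2: "smooth_fn (\<lambda>x. \<Sum>b\<in>UNIV. e i j b * pd [j] (\<phi> b) x)" for j by (rule smooth_fn_sum[OF s1])
  show ?thesis unfolding crl_def[abs_def] pd_sum[OF s2] pd_sum[OF s1] pd_cmult[OF s] pd_append ..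
qed

lemma crl_test: assumes "sol \<phi>" shows "test_fun (crl e \<phi> i)"
  unfolding crl_def[abs_def] by (intro test_fun_sum test_fun_cmult test_fun_pd sol_test[OF assms])

lemma lap_crl:
  assumes "sol \<phi>" shows "(\<Sum>j\<in>UNIV. pd [j, j] (crl e \<phi> i) x) = crl e (lap \<phi>) i x"
proof -
  have c: "ctest (\<phi> b)" for b using assms by (simp add: sol_def)
  have s: "smooth_fn (pd [j, j] (\<phi> b))" for j b by (rule smooth_fn_pd[OF ctest_smooth[OF c]])
  have l: "pd [k] (lap \<phi> b) = (\<lambda>x. \<Sum>j\<in>UNIV. pd ([j, j] @ [k]) (\<phi> b) x)" for k b
  proof -
    have "pd [k] (lap \<phi> b) = (\<lambda>x. \<Sum>j\<in>UNIV. pd [k] (pd [j, j] (\<phi> b)) x)" unfolding lap_def[abs_def] by (rule pd_sum[OF s])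
    moreover have "pd [k] (pd [j, j] (\<phi> b)) = pd ([j, j] @ [k]) (\<phi> b)" for j unfolding pd_append by (rule ctest_comm[OF c]) simp
    ultimately show ?thesis by (simp only:)
  qed
  have "(\<Sum>j\<in>UNIV. pd [j, j] (crl e \<phi> i) x) = (\<Sum>j\<in>UNIV. \<Sum>k\<in>UNIV. \<Sum>b\<in>UNIV. e i k b * pd ([j, j] @ [k]) (\<phi> b) x)"
    unfolding pd_crl[OF assms] ..
  also have "\<dots> = (\<Sum>k\<in>UNIV. \<Sum>j\<in>UNIV. \<Sum>b\<in>UNIV. e i k b * pd ([j, j] @ [k]) (\<phi> b) x)" by (rule sum.swap)
  also have "\<dots> = (\<Sum>k\<in>UNIV. \<Sum>b\<in>UNIV. \<Sum>j\<in>UNIV. e i k b * pd ([j, j] @ [k]) (\<phi> b) x)" by (intro sum.cong refl sum.swap)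
  also have "\<dots> = crl e (lap \<phi>) i x" unfolding crl_def l sum_distrib_left ..
  finally show ?thesis .
qed

text \<open>The contraction of the structure constants leaves the Laplacian of the b-th component
  minus d_b of the divergence, and the latter vanishes for solenoidal fields. The curl applied
  second carries its indices in transposed position, whence the plus sign before the
  Laplacian.\<close>

lemma curl_curl:
  fixes e :: "'i::finite \<Rightarrow> 'n::finite \<Rightarrow> 'n \<Rightarrow> real"
  assumes \<phi>: "sol \<phi>"
    and eid: "\<And>j b k c. (\<Sum>i\<in>UNIV. e i j b * e i k c) = (if j = k \<and> b = c then 1 else 0) - (if j = c \<and> b = k then 1 else 0)"
  shows "(\<Sum>i\<in>UNIV. \<Sum>j\<in>UNIV. e i j b * pd [j] (crl e \<phi> i) x) = lap \<phi> b x"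
proof -
  have c: "ctest (\<phi> b)" for b using \<phi> by (simp add: sol_def)
  let ?P = "\<lambda>j k c. pd ([j] @ [k]) (\<phi> c) x"
  have "(\<Sum>i\<in>UNIV. \<Sum>j\<in>UNIV. e i j b * pd [j] (crl e \<phi> i) x) = (\<Sum>i\<in>UNIV. \<Sum>j\<in>UNIV. \<Sum>k\<in>UNIV. \<Sum>c\<in>UNIV. (e i j b * e i k c) * ?P j k c)"
    unfolding pd_crl[OF \<phi>] sum_distrib_left mult.assoc ..
  also have "\<dots> = (\<Sum>j\<in>UNIV. \<Sum>k\<in>UNIV. \<Sum>c\<in>UNIV. \<Sum>i\<in>UNIV. (e i j b * e i k c) * ?P j k c)"
    by (subst sum.swap, intro sum.cong refl, subst sum.swap, intro sum.cong refl, rule sum.swap)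
  also have "\<dots> = (\<Sum>j\<in>UNIV. \<Sum>k\<in>UNIV. \<Sum>c\<in>UNIV. (if c = b then (if j = k then ?P j k c else 0) else 0) - (if c = j then (if b = k then ?P j k c else 0) else 0))"
    unfolding sum_distrib_right[symmetric] eid by (intro sum.cong refl) auto
  also have "\<dots> = (\<Sum>j\<in>UNIV. \<Sum>k\<in>UNIV. (if j = k then ?P j k b else 0) - (if b = k then ?P j k j else 0))"
    by (simp only: sum_subtractf sum.delta finite UNIV_I if_True)
  also have "\<dots> = (\<Sum>j\<in>UNIV. ?P j j b) - (\<Sum>j\<in>UNIV. ?P j b j)"
    by (simp only: sum_subtractf sum.delta' finite UNIV_I if_True)
  also have "(\<Sum>j\<in>UNIV. ?P j b j) = 0"
  proof -
    have e1: "?P j b j = pd [b] (pd [j] (\<phi> j)) x" for j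
    proof -
      have "pd ([j] @ [b]) (\<phi> j) = pd ([b] @ [j]) (\<phi> j)" by (rule ctest_comm[OF c]) simp
      then show ?thesis by (simp only: pd_append)
    qed
    have e2: "(\<lambda>x. \<Sum>j\<in>UNIV. pd [b] (pd [j] (\<phi> j)) x) = pd [b] (\<lambda>x. \<Sum>j\<in>UNIV. pd [j] (\<phi> j) x)"
      by (rule pd_sum[symmetric]) (rule smooth_fn_pd[OF ctest_smooth[OF c]])
    have z: "(\<lambda>x. \<Sum>j\<in>UNIV. pd [j] (\<phi> j) x) = (\<lambda>x. 0)" using \<phi> by (auto simp: sol_def)
    have "(\<Sum>j\<in>UNIV. ?P j b j) = (\<Sum>j\<in>UNIV. pd [b] (pd [j] (\<phi> j)) x)" by (simp only: e1)
    also have "\<dots> = 0" using fun_cong[OF e2, of x] unfolding z pd_zero .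
    finally show ?thesis .
  qed
  finally show ?thesis by (simp add: lap_def)
qed

section \<open>Reduction of the weak formulation to a damped system\<close>

lemma convection_bound:
  assumes f: "sqint f" and g: "sqint g" and z: "test_fun \<zeta>" and q: "\<And>x. \<bar>\<zeta> x\<bar> \<le> q"
    and A: "n2 f \<le> A" and B: "n2 g \<le> B"
  shows "\<bar>\<integral>x. f x * (g x * \<zeta> x) \<partial>lborel\<bar> \<le> A * (q * B)"
proof -
  note m = sqint_mult_bounded[OF g test_fun_measurable[OF z] q]
  have q0: "q \<ge> 0" using order_trans[OF abs_ge_zero q] .
  have "\<bar>\<integral>x. f x * (g x * \<zeta> x) \<partial>lborel\<bar> \<le> n2 f * n2 (\<lambda>x. g x * \<zeta> x)" by (rule sqint_cauchy_schwarz[OF f m(1)])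
  also have "\<dots> \<le> A * (q * B)"
    using A order_trans[OF m(2) mult_left_mono[OF B q0]] by (intro mult_mono) (auto intro: order_trans[OF n2_nonneg])
  finally show ?thesis .
qed

lemma double_sum_abs_bound:
  fixes f :: "'i::finite \<Rightarrow> 'n::finite \<Rightarrow> real"
  assumes "CARD('i) \<le> 3" "CARD('n) \<le> 3" "\<And>i j. \<bar>f i j\<bar> \<le> B"
  shows "\<bar>\<Sum>i\<in>UNIV. \<Sum>j\<in>UNIV. f i j\<bar> \<le> 9 * B"
proof -
  have B: "B \<ge> 0" using order_trans[OF abs_ge_zero assms(3)] .
  have "\<bar>\<Sum>i\<in>UNIV. \<Sum>j\<in>UNIV. f i j\<bar> \<le> (\<Sum>i\<in>UNIV. \<Sum>j\<in>UNIV. \<bar>f i j\<bar>)"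
    by (intro order_trans[OF sum_abs] sum_mono) (rule order_refl)
  also have "\<dots> \<le> (\<Sum>i\<in>(UNIV::'i set). \<Sum>j\<in>(UNIV::'n set). B)" by (intro sum_mono assms(3))
  also have "\<dots> = (real CARD('i) * real CARD('n)) * B" by simp
  also have "\<dots> \<le> (3 * 3) * B" using assms(1,2) B by (intro mult_right_mono mult_mono) auto
  finally show ?thesis by simp
qed

text \<open>Integration by parts removes all gradients of u and w, so that only L2 norms of the
  solution and derivatives of the test field remain. The constant 100 is generous: at most nine
  convective terms occur, each curl costs a factor 2, so the momentum, spin and size estimates need
  9, 18 and 6.\<close>

lemma damped_system:
  fixes u :: "real \<Rightarrow> 'n::finite \<Rightarrow> real^'n \<Rightarrow> real" and w :: "real \<Rightarrow> 'i::finite \<Rightarrow> real^'n \<Rightarrow> real"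
    and gu :: "real \<Rightarrow> 'n \<Rightarrow> 'n \<Rightarrow> real^'n \<Rightarrow> real" and gw :: "real \<Rightarrow> 'i \<Rightarrow> 'n \<Rightarrow> real^'n \<Rightarrow> real"
    and e :: "'i \<Rightarrow> 'n \<Rightarrow> 'n \<Rightarrow> real"
  assumes card: "CARD('n) \<le> 3" "CARD('i) \<le> 3"
    and e2: "\<And>i. (\<Sum>j\<in>UNIV. \<Sum>b\<in>UNIV. \<bar>e i j b\<bar>) \<le> 2"
    and eid: "\<And>j b k c. (\<Sum>i\<in>UNIV. e i j b * e i k c) = (if j = k \<and> b = c then 1 else 0) - (if j = c \<and> b = k then 1 else 0)"
    and su: "\<And>s b. s \<ge> 0 \<Longrightarrow> sqint (u s b)" and sw: "\<And>s i. s \<ge> 0 \<Longrightarrow> sqint (w s i)"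
    and uZ: "\<And>s. s \<ge> 0 \<Longrightarrow> nrm (u s) \<le> Z" and wZ: "\<And>s i. s \<ge> 0 \<Longrightarrow> n2 (w s i) \<le> Z"
    and dv: "\<And>s \<psi>. s \<ge> 0 \<Longrightarrow> test_fun \<psi> \<Longrightarrow> (\<Sum>j\<in>UNIV. \<integral>x. u s j x * pd [j] \<psi> x \<partial>lborel) = 0"
    and cu: "\<And>p. (\<And>b. sqint (p b)) \<Longrightarrow> continuous_on {0..} (\<lambda>t. \<Sum>b\<in>UNIV. \<integral>x. u t b x * p b x \<partial>lborel)"
    and cw: "\<And>p. (\<And>i. sqint (p i)) \<Longrightarrow> continuous_on {0..} (\<lambda>t. \<Sum>i\<in>UNIV. \<integral>x. w t i x * p i x \<partial>lborel)"
    and gu: "AE s in lborel. s > 0 \<longrightarrow> (\<forall>b j. sqint (gu s b j) \<and> (\<forall>\<psi>. test_fun \<psi> \<longrightarrow> (\<integral>x. u s b x * pd [j] \<psi> x \<partial>lborel) = - (\<integral>x. gu s b j x * \<psi> x \<partial>lborel)))"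
    and gw: "AE s in lborel. s > 0 \<longrightarrow> (\<forall>i j. sqint (gw s i j) \<and> (\<forall>\<psi>. test_fun \<psi> \<longrightarrow> (\<integral>x. w s i x * pd [j] \<psi> x \<partial>lborel) = - (\<integral>x. gw s i j x * \<psi> x \<partial>lborel)))"
    and mu: "\<And>b j \<zeta>. test_fun \<zeta> \<Longrightarrow> \<exists>G\<in>borel_measurable borel. AE s in lborel. (\<integral>x. u s b x * (u s j x * \<zeta> x) \<partial>lborel) = G s"
    and mw: "\<And>i j \<zeta>. test_fun \<zeta> \<Longrightarrow> \<exists>G\<in>borel_measurable borel. AE s in lborel. (\<integral>x. w s i x * (u s j x * \<zeta> x) \<partial>lborel) = G s"
    and Pu: "\<And>\<phi>. sol \<phi> \<Longrightarrow> \<exists>a0 h. (\<forall>t\<ge>0. pr (u t) \<phi> - a0 + set_lebesgue_integral lebesgue {0..t} h = 0) \<and>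
       (AE s in lborel. s > 0 \<longrightarrow> h s = (\<mu> + \<xi>) * (\<Sum>b\<in>UNIV. \<Sum>j\<in>UNIV. \<integral>x. gu s b j x * pd [j] (\<phi> b) x \<partial>lborel)
          + (\<Sum>b\<in>UNIV. \<Sum>j\<in>UNIV. \<integral>x. gu s b j x * (u s j x * \<phi> b x) \<partial>lborel)
          + 2 * \<xi> * (\<Sum>i\<in>UNIV. \<Sum>j\<in>UNIV. \<Sum>b\<in>UNIV. e i j b * (\<integral>x. gw s i j x * \<phi> b x \<partial>lborel)))"
    and Pw: "\<And>\<phi>. sol \<phi> \<Longrightarrow> \<exists>a0 h. (\<forall>t\<ge>0. (\<Sum>i\<in>UNIV. \<integral>x. w t i x * crl e \<phi> i x \<partial>lborel) - a0 + set_lebesgue_integral lebesgue {0..t} h = 0) \<and>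
       (AE s in lborel. s > 0 \<longrightarrow> h s = \<nu> * (\<Sum>i\<in>UNIV. \<Sum>j\<in>UNIV. \<integral>x. gw s i j x * pd [j] (crl e \<phi> i) x \<partial>lborel)
          + (\<Sum>i\<in>UNIV. \<Sum>j\<in>UNIV. \<integral>x. gw s i j x * (u s j x * crl e \<phi> i x) \<partial>lborel)
          + 4 * \<xi> * (\<Sum>i\<in>UNIV. \<integral>x. w s i x * crl e \<phi> i x \<partial>lborel)
          - 2 * \<xi> * (\<Sum>i\<in>UNIV. \<Sum>j\<in>UNIV. \<Sum>b\<in>UNIV. e i j b * (\<integral>x. gu s b j x * crl e \<phi> i x \<partial>lborel)))"
  shows "damped \<mu> \<nu> \<xi> Z u (\<lambda>\<phi> s. \<Sum>i\<in>UNIV. \<integral>x. w s i x * crl e \<phi> i x \<partial>lborel)"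
proof -
  let ?\<beta> = "\<lambda>\<phi> s. \<Sum>i\<in>UNIV. \<integral>x. w s i x * crl e \<phi> i x \<partial>lborel"
  have Z0: "Z \<ge> 0" using order_trans[OF nrm_nonneg uZ[of 0]] by simp
  have cont_pr: "continuous_on {0..} (\<lambda>t. pr (u t) \<phi>)" if "sol \<phi>" for \<phi>
    unfolding pr_def by (rule cu) (rule test_fun_sqint(1)[OF sol_test[OF that]])
  have cont_\<beta>: "continuous_on {0..} (?\<beta> \<phi>)" if "sol \<phi>" for \<phi>
    by (rule cw) (rule test_fun_sqint(1)[OF crl_test[OF that]])
  have crl_sup: "\<bar>pd js (crl e \<phi> i) x\<bar> \<le> 2 * q" if \<phi>: "sol \<phi>" and q: "\<And>j b x. \<bar>pd (js @ [j]) (\<phi> b) x\<bar> \<le> q" for \<phi> js i x q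
  proof -
    have q0: "q \<ge> 0" using order_trans[OF abs_ge_zero q] .
    have "\<bar>pd js (crl e \<phi> i) x\<bar> \<le> (\<Sum>j\<in>UNIV. \<Sum>b\<in>UNIV. \<bar>e i j b * pd (js @ [j]) (\<phi> b) x\<bar>)"
      unfolding pd_crl[OF \<phi>] by (intro order_trans[OF sum_abs] sum_mono) (rule order_refl)
    also have "\<dots> \<le> (\<Sum>j\<in>UNIV. \<Sum>b\<in>UNIV. \<bar>e i j b\<bar> * q)"
      unfolding abs_mult by (intro sum_mono mult_left_mono q) auto
    also have "\<dots> = (\<Sum>j\<in>UNIV. \<Sum>b\<in>UNIV. \<bar>e i j b\<bar>) * q" by (simp add: sum_distrib_right)
    also have "\<dots> \<le> 2 * q" by (intro mult_right_mono e2 q0)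
    finally show ?thesis .
  qed
  have main_u: "\<bar>pr (u s2) \<phi> - pr (u s1) \<phi> - integral {s1..s2} (\<lambda>s. (\<mu> + \<xi>) * pr (u s) (lap \<phi>) + 2 * \<xi> * ?\<beta> \<phi> s)\<bar> \<le> 100 * U\<^sup>2 * q * (s2 - s1)"
    if \<phi>: "sol \<phi>" and s12: "0 \<le> s1" "s1 \<le> s2" and q: "\<And>j b x. \<bar>pd [j] (\<phi> b) x\<bar> \<le> q" and U: "\<And>s. s \<in> {s1..s2} \<Longrightarrow> nrm (u s) \<le> U"
    for \<phi> s1 s2 q U
  proof -
    have q0: "q \<ge> 0" using order_trans[OF abs_ge_zero q] .
    have U0: "U \<ge> 0" using order_trans[OF nrm_nonneg U[of s1]] s12 by simp
    note t\<phi> = sol_test[OF \<phi>]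
    from Pu[OF \<phi>] obtain a0 h where P0: "\<forall>t\<ge>0. pr (u t) \<phi> - a0 + set_lebesgue_integral lebesgue {0..t} h = 0"
      and h: "AE s in lborel. s > 0 \<longrightarrow> h s = (\<mu> + \<xi>) * (\<Sum>b\<in>UNIV. \<Sum>j\<in>UNIV. \<integral>x. gu s b j x * pd [j] (\<phi> b) x \<partial>lborel)
          + (\<Sum>b\<in>UNIV. \<Sum>j\<in>UNIV. \<integral>x. gu s b j x * (u s j x * \<phi> b x) \<partial>lborel)
          + 2 * \<xi> * (\<Sum>i\<in>UNIV. \<Sum>j\<in>UNIV. \<Sum>b\<in>UNIV. e i j b * (\<integral>x. gw s i j x * \<phi> b x \<partial>lborel))"
      by (elim exE conjE) (rule that)
    note P = P0[rule_format]
    define NL where "NL = (\<lambda>s. \<Sum>b\<in>UNIV. \<Sum>j\<in>UNIV. \<integral>x. u s b x * (u s j x * pd [j] (\<phi> b) x) \<partial>lborel)"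
    \<comment> \<open>Each convective integral is replaced by a Borel function of time that equals
      it almost everywhere, since the evolution lemma needs measurability.\<close>
    define G where "G = (\<lambda>b j. SOME G. G \<in> borel_measurable borel \<and> (AE s in lborel. (\<integral>x. u s b x * (u s j x * pd [j] (\<phi> b) x) \<partial>lborel) = G s))"
    have G: "G b j \<in> borel_measurable borel" "AE s in lborel. (\<integral>x. u s b x * (u s j x * pd [j] (\<phi> b) x) \<partial>lborel) = G b j s" for b j
    proof -
      have "\<exists>G. G \<in> borel_measurable borel \<and> (AE s in lborel. (\<integral>x. u s b x * (u s j x * pd [j] (\<phi> b) x) \<partial>lborel) = G s)"
        by (rule mu[OF test_fun_pd[OF t\<phi>], unfolded Bex_def])
      from someI_ex[OF this] have *: "G b j \<in> borel_measurable borel \<and> (AE s in lborel. (\<integral>x. u s b x * (u s j x * pd [j] (\<phi> b) x) \<partial>lborel) = G b j s)" unfolding G_def .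
      show "G b j \<in> borel_measurable borel" using * by (rule conjunct1)
      show "AE s in lborel. (\<integral>x. u s b x * (u s j x * pd [j] (\<phi> b) x) \<partial>lborel) = G b j s" using * by (rule conjunct2)
    qed
    define g where "g = (\<lambda>s. \<Sum>b\<in>UNIV. \<Sum>j\<in>UNIV. G b j s)"
    have gm: "g \<in> borel_measurable borel" unfolding g_def by (intro borel_measurable_sum G)
    have "AE s in lborel. \<forall>b\<in>UNIV. \<forall>j\<in>UNIV. (\<integral>x. u s b x * (u s j x * pd [j] (\<phi> b) x) \<partial>lborel) = G b j s"
      by (intro AE_finite_allI G) auto
    then have gNL: "AE s in lborel. NL s = g s" unfolding NL_def g_def by eventually_elim simp
    have NLb: "\<bar>NL s\<bar> \<le> 9 * (A * (q * A))" if "s \<ge> 0" "nrm (u s) \<le> A" for s A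
      unfolding NL_def
      by (intro double_sum_abs_bound card convection_bound su that test_fun_pd t\<phi> q order_trans[OF n2_le_nrm that(2)])
    have "\<bar>pr (u s2) \<phi> - pr (u s1) \<phi> - integral {s1..s2} (\<lambda>s. (\<mu> + \<xi>) * pr (u s) (lap \<phi>) + 2 * \<xi> * ?\<beta> \<phi> s)\<bar> \<le> (9 * (U * (q * U))) * (s2 - s1)"
    proof (rule evolution_increment[OF P _ gm _ _ s12])
      show "continuous_on {0..} (\<lambda>s. (\<mu> + \<xi>) * pr (u s) (lap \<phi>) + 2 * \<xi> * ?\<beta> \<phi> s)"
        by (intro continuous_on_add continuous_on_mult continuous_on_const cont_pr cont_\<beta> sol_lap \<phi>)
      show "AE s in lborel. s > 0 \<longrightarrow> h s = - ((\<mu> + \<xi>) * pr (u s) (lap \<phi>) + 2 * \<xi> * ?\<beta> \<phi> s) - g s"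
        using h gu gw gNL
      proof eventually_elim
        case (elim s)
        show ?case
        proof
          assume s: "s > 0"
          then have s0: "s \<ge> 0" by simp
          note gus = elim(2)[rule_format, OF s] and gws = elim(3)[rule_format, OF s]
          have i: "(\<Sum>b\<in>UNIV. \<Sum>j\<in>UNIV. \<integral>x. gu s b j x * pd [j] (\<phi> b) x \<partial>lborel) = - pr (u s) (lap \<phi>)"
          proof -
            have "(\<integral>x. u s b x * lap \<phi> b x \<partial>lborel) = - (\<Sum>j\<in>UNIV. \<integral>x. gu s b j x * pd [j] (\<phi> b) x \<partial>lborel)" for b
            proof -
              have "(\<integral>x. u s b x * lap \<phi> b x \<partial>lborel) = (\<integral>x. (\<Sum>j\<in>UNIV. u s b x * pd [j] (pd [j] (\<phi> b)) x) \<partial>lborel)"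
                unfolding lap_def sum_distrib_left pd_append by simp
              also have "\<dots> = (\<Sum>j\<in>UNIV. \<integral>x. u s b x * pd [j] (pd [j] (\<phi> b)) x \<partial>lborel)"
                by (intro Bochner_Integration.integral_sum sqint_mult_integrable su s0 test_fun_sqint(1) test_fun_pd t\<phi>)
              also have "\<dots> = (\<Sum>j\<in>UNIV. - (\<integral>x. gu s b j x * pd [j] (\<phi> b) x \<partial>lborel))"
                using gus test_fun_pd[OF t\<phi>] by (intro sum.cong refl) blast
              finally show ?thesis by (simp only: sum_negf)
            qed
            then show ?thesis unfolding pr_def by (simp only: sum_negf minus_minus)
          qed
          \<comment> \<open>Moving the derivative to the test field avoids the gradient of u, whose
            norm has no pointwise bound in time.\<close>
          have ii: "(\<Sum>b\<in>UNIV. \<Sum>j\<in>UNIV. \<integral>x. gu s b j x * (u s j x * \<phi> b x) \<partial>lborel) = - NL s"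
          proof -
            have "(\<Sum>j\<in>UNIV. \<integral>x. gu s b j x * (u s j x * \<phi> b x) \<partial>lborel) = - (\<Sum>j\<in>UNIV. \<integral>x. u s b x * (u s j x * pd [j] (\<phi> b) x) \<partial>lborel)" for b
              by (rule transport_by_parts[OF su[OF s0] su[OF s0] _ dv[OF s0] _ t\<phi>]) (use gus in auto)
            then show ?thesis unfolding NL_def by (simp only: sum_negf)
          qed
          have iii: "(\<Sum>i\<in>UNIV. \<Sum>j\<in>UNIV. \<Sum>b\<in>UNIV. e i j b * (\<integral>x. gw s i j x * \<phi> b x \<partial>lborel)) = - ?\<beta> \<phi> s"
          proof -
            have "(\<integral>x. w s i x * crl e \<phi> i x \<partial>lborel) = - (\<Sum>j\<in>UNIV. \<Sum>b\<in>UNIV. e i j b * (\<integral>x. gw s i j x * \<phi> b x \<partial>lborel))" for i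
            proof -
              have int: "integrable lborel (\<lambda>x. e i j b * (w s i x * pd [j] (\<phi> b) x))" for j b
                by (intro integrable_mult_right sqint_mult_integrable sw s0 test_fun_sqint(1) test_fun_pd t\<phi>)
              have "(\<integral>x. w s i x * crl e \<phi> i x \<partial>lborel) = (\<integral>x. (\<Sum>j\<in>UNIV. \<Sum>b\<in>UNIV. e i j b * (w s i x * pd [j] (\<phi> b) x)) \<partial>lborel)"
                unfolding crl_def sum_distrib_left by (simp only: mult.left_commute)
              also have "\<dots> = (\<Sum>j\<in>UNIV. \<Sum>b\<in>UNIV. \<integral>x. e i j b * (w s i x * pd [j] (\<phi> b) x) \<partial>lborel)"
                by (subst Bochner_Integration.integral_sum, intro Bochner_Integration.integrable_sum int, intro sum.cong refl Bochner_Integration.integral_sum int)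
              also have "\<dots> = (\<Sum>j\<in>UNIV. \<Sum>b\<in>UNIV. e i j b * (- (\<integral>x. gw s i j x * \<phi> b x \<partial>lborel)))"
                using gws t\<phi> by (intro sum.cong refl) (simp del: pd.simps)
              finally show ?thesis by (simp only: mult_minus_right sum_negf)
            qed
            then show ?thesis by (simp only: sum_negf minus_minus)
          qed
          show "h s = - ((\<mu> + \<xi>) * pr (u s) (lap \<phi>) + 2 * \<xi> * ?\<beta> \<phi> s) - g s"
            unfolding elim(1)[rule_format, OF s] i ii iii elim(4)[symmetric] by (simp add: algebra_simps)
        qed
      qed
      \<comment> \<open>Two bounds for the same term: the one by Z holds at all positive times and
        only secures integrability; the one by U holds on the interval and gives the
        estimate.\<close>
      have bZ: "\<bar>NL s\<bar> \<le> 9 * (Z * (q * Z))" if "s > 0" for s by (rule NLb) (use that in \<open>auto intro: uZ\<close>)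
      have bU: "\<bar>NL s\<bar> \<le> 9 * (U * (q * U))" if "s > 0" "s \<in> {s1..s2}" for s by (rule NLb) (use that in \<open>auto intro: U\<close>)
      show "AE s in lborel. s > 0 \<longrightarrow> \<bar>g s\<bar> \<le> 9 * (Z * (q * Z))"
        using gNL by eventually_elim (metis bZ)
      show "AE s in lborel. s > 0 \<longrightarrow> s \<in> {s1..s2} \<longrightarrow> \<bar>g s\<bar> \<le> 9 * (U * (q * U))"
        using gNL by eventually_elim (metis bU)
    qed
    also have "\<dots> \<le> 100 * U\<^sup>2 * q * (s2 - s1)"
    proof -
      have "9 * (U * (q * U)) \<le> 100 * U\<^sup>2 * q" using mult_nonneg_nonneg[OF zero_le_power2[of U] q0] by (simp add: power2_eq_square mult_ac)
      then show ?thesis using s12 by (intro mult_right_mono) auto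
    qed
    finally show ?thesis .
  qed
  have main_w: "\<bar>?\<beta> \<phi> s2 - ?\<beta> \<phi> s1 - integral {s1..s2} (\<lambda>s. \<nu> * ?\<beta> (lap \<phi>) s - 4 * \<xi> * ?\<beta> \<phi> s - 2 * \<xi> * pr (u s) (lap \<phi>))\<bar> \<le> 100 * Z * U * q * (s2 - s1)"
    if \<phi>: "sol \<phi>" and s12: "0 \<le> s1" "s1 \<le> s2" and q: "\<And>i j b x. \<bar>pd [i, j] (\<phi> b) x\<bar> \<le> q" and U: "\<And>s. s \<in> {s1..s2} \<Longrightarrow> nrm (u s) \<le> U"
    for \<phi> s1 s2 q U
  proof -
    have q0: "q \<ge> 0" using order_trans[OF abs_ge_zero q] .
    have U0: "U \<ge> 0" using order_trans[OF nrm_nonneg U[of s1]] s12 by simp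
    have tc: "test_fun (crl e \<phi> i)" for i by (rule crl_test[OF \<phi>])
    have q2: "\<bar>pd [j] (crl e \<phi> i) x\<bar> \<le> 2 * q" for i j x by (rule crl_sup[OF \<phi>]) (use q in \<open>simp del: pd.simps\<close>)
    from Pw[OF \<phi>] obtain a0 h where P0: "\<forall>t\<ge>0. ?\<beta> \<phi> t - a0 + set_lebesgue_integral lebesgue {0..t} h = 0"
      and h: "AE s in lborel. s > 0 \<longrightarrow> h s = \<nu> * (\<Sum>i\<in>UNIV. \<Sum>j\<in>UNIV. \<integral>x. gw s i j x * pd [j] (crl e \<phi> i) x \<partial>lborel)
          + (\<Sum>i\<in>UNIV. \<Sum>j\<in>UNIV. \<integral>x. gw s i j x * (u s j x * crl e \<phi> i x) \<partial>lborel)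
          + 4 * \<xi> * ?\<beta> \<phi> s
          - 2 * \<xi> * (\<Sum>i\<in>UNIV. \<Sum>j\<in>UNIV. \<Sum>b\<in>UNIV. e i j b * (\<integral>x. gu s b j x * crl e \<phi> i x \<partial>lborel))"
      by (elim exE conjE) (rule that)
    note P = P0[rule_format]
    define NL where "NL = (\<lambda>s. \<Sum>i\<in>UNIV. \<Sum>j\<in>UNIV. \<integral>x. w s i x * (u s j x * pd [j] (crl e \<phi> i) x) \<partial>lborel)"
    define G where "G = (\<lambda>i j. SOME G. G \<in> borel_measurable borel \<and> (AE s in lborel. (\<integral>x. w s i x * (u s j x * pd [j] (crl e \<phi> i) x) \<partial>lborel) = G s))"
    have G: "G i j \<in> borel_measurable borel" "AE s in lborel. (\<integral>x. w s i x * (u s j x * pd [j] (crl e \<phi> i) x) \<partial>lborel) = G i j s" for i j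
    proof -
      have "\<exists>G. G \<in> borel_measurable borel \<and> (AE s in lborel. (\<integral>x. w s i x * (u s j x * pd [j] (crl e \<phi> i) x) \<partial>lborel) = G s)"
        by (rule mw[OF test_fun_pd[OF tc], unfolded Bex_def])
      from someI_ex[OF this] have *: "G i j \<in> borel_measurable borel \<and> (AE s in lborel. (\<integral>x. w s i x * (u s j x * pd [j] (crl e \<phi> i) x) \<partial>lborel) = G i j s)" unfolding G_def .
      show "G i j \<in> borel_measurable borel" using * by (rule conjunct1)
      show "AE s in lborel. (\<integral>x. w s i x * (u s j x * pd [j] (crl e \<phi> i) x) \<partial>lborel) = G i j s" using * by (rule conjunct2)
    qed
    define g where "g = (\<lambda>s. \<Sum>i\<in>UNIV. \<Sum>j\<in>UNIV. G i j s)"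
    have gm: "g \<in> borel_measurable borel" unfolding g_def by (intro borel_measurable_sum G)
    have "AE s in lborel. \<forall>i\<in>UNIV. \<forall>j\<in>UNIV. (\<integral>x. w s i x * (u s j x * pd [j] (crl e \<phi> i) x) \<partial>lborel) = G i j s"
      by (intro AE_finite_allI G) auto
    then have gNL: "AE s in lborel. NL s = g s" unfolding NL_def g_def by eventually_elim simp
    have NLb: "\<bar>NL s\<bar> \<le> 9 * (Z * ((2 * q) * A))" if "s \<ge> 0" "nrm (u s) \<le> A" for s A
      unfolding NL_def
      by (intro double_sum_abs_bound card convection_bound su sw wZ that test_fun_pd tc q2 order_trans[OF n2_le_nrm that(2)])
    have "\<bar>?\<beta> \<phi> s2 - ?\<beta> \<phi> s1 - integral {s1..s2} (\<lambda>s. \<nu> * ?\<beta> (lap \<phi>) s - 4 * \<xi> * ?\<beta> \<phi> s - 2 * \<xi> * pr (u s) (lap \<phi>))\<bar> \<le> (9 * (Z * ((2 * q) * U))) * (s2 - s1)"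
    proof (rule evolution_increment[OF P _ gm _ _ s12])
      show "continuous_on {0..} (\<lambda>s. \<nu> * ?\<beta> (lap \<phi>) s - 4 * \<xi> * ?\<beta> \<phi> s - 2 * \<xi> * pr (u s) (lap \<phi>))"
        by (intro continuous_on_diff continuous_on_mult continuous_on_const cont_pr cont_\<beta> sol_lap \<phi>)
      show "AE s in lborel. s > 0 \<longrightarrow> h s = - (\<nu> * ?\<beta> (lap \<phi>) s - 4 * \<xi> * ?\<beta> \<phi> s - 2 * \<xi> * pr (u s) (lap \<phi>)) - g s"
        using h gu gw gNL
      proof eventually_elim
        case (elim s)
        show ?case
        proof
          assume s: "s > 0"
          then have s0: "s \<ge> 0" by simp
          note gus = elim(2)[rule_format, OF s] and gws = elim(3)[rule_format, OF s]
          have i: "(\<Sum>i\<in>UNIV. \<Sum>j\<in>UNIV. \<integral>x. gw s i j x * pd [j] (crl e \<phi> i) x \<partial>lborel) = - ?\<beta> (lap \<phi>) s"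
          proof -
            have "(\<integral>x. w s i x * crl e (lap \<phi>) i x \<partial>lborel) = - (\<Sum>j\<in>UNIV. \<integral>x. gw s i j x * pd [j] (crl e \<phi> i) x \<partial>lborel)" for i
            proof -
              have "(\<integral>x. w s i x * crl e (lap \<phi>) i x \<partial>lborel) = (\<integral>x. (\<Sum>j\<in>UNIV. w s i x * pd [j] (pd [j] (crl e \<phi> i)) x) \<partial>lborel)"
                unfolding lap_crl[OF \<phi>, symmetric] sum_distrib_left pd_append by simp
              also have "\<dots> = (\<Sum>j\<in>UNIV. \<integral>x. w s i x * pd [j] (pd [j] (crl e \<phi> i)) x \<partial>lborel)"
                by (intro Bochner_Integration.integral_sum sqint_mult_integrable sw s0 test_fun_sqint(1) test_fun_pd tc)
              also have "\<dots> = (\<Sum>j\<in>UNIV. - (\<integral>x. gw s i j x * pd [j] (crl e \<phi> i) x \<partial>lborel))"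
                using gws test_fun_pd[OF tc] by (intro sum.cong refl) blast
              finally show ?thesis by (simp only: sum_negf)
            qed
            then show ?thesis by (simp only: sum_negf minus_minus)
          qed
          have ii: "(\<Sum>i\<in>UNIV. \<Sum>j\<in>UNIV. \<integral>x. gw s i j x * (u s j x * crl e \<phi> i x) \<partial>lborel) = - NL s"
          proof -
            have "(\<Sum>j\<in>UNIV. \<integral>x. gw s i j x * (u s j x * crl e \<phi> i x) \<partial>lborel) = - (\<Sum>j\<in>UNIV. \<integral>x. w s i x * (u s j x * pd [j] (crl e \<phi> i) x) \<partial>lborel)" for i
              by (rule transport_by_parts[OF su[OF s0] sw[OF s0] _ dv[OF s0] _ tc]) (use gws in auto)
            then show ?thesis unfolding NL_def by (simp only: sum_negf)
          qed
          \<comment> \<open>The curl of u paired with the curl of \<open>\<phi>\<close> becomes u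
            paired with the Laplacian of \<open>\<phi>\<close>, by the double curl identity; this is
            the coupling that later cancels.\<close>
          have iv: "(\<Sum>i\<in>UNIV. \<Sum>j\<in>UNIV. \<Sum>b\<in>UNIV. e i j b * (\<integral>x. gu s b j x * crl e \<phi> i x \<partial>lborel)) = - pr (u s) (lap \<phi>)"
          proof -
            have "(\<integral>x. u s b x * lap \<phi> b x \<partial>lborel) = - (\<Sum>i\<in>UNIV. \<Sum>j\<in>UNIV. e i j b * (\<integral>x. gu s b j x * crl e \<phi> i x \<partial>lborel))" for b
            proof -
              have int: "integrable lborel (\<lambda>x. e i j b * (u s b x * pd [j] (crl e \<phi> i) x))" for i j
                by (intro integrable_mult_right sqint_mult_integrable su s0 test_fun_sqint(1) test_fun_pd tc)
              have "(\<integral>x. u s b x * lap \<phi> b x \<partial>lborel) = (\<integral>x. (\<Sum>i\<in>UNIV. \<Sum>j\<in>UNIV. e i j b * (u s b x * pd [j] (crl e \<phi> i) x)) \<partial>lborel)"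
                unfolding curl_curl[OF \<phi> eid, symmetric] sum_distrib_left by (simp only: mult.left_commute)
              also have "\<dots> = (\<Sum>i\<in>UNIV. \<Sum>j\<in>UNIV. \<integral>x. e i j b * (u s b x * pd [j] (crl e \<phi> i) x) \<partial>lborel)"
                by (subst Bochner_Integration.integral_sum, intro Bochner_Integration.integrable_sum int, intro sum.cong refl Bochner_Integration.integral_sum int)
              also have "\<dots> = (\<Sum>i\<in>UNIV. \<Sum>j\<in>UNIV. e i j b * (- (\<integral>x. gu s b j x * crl e \<phi> i x \<partial>lborel)))"
                using gus tc by (intro sum.cong refl) (simp del: pd.simps)
              finally show ?thesis by (simp only: mult_minus_right sum_negf)
            qed
            then have "- pr (u s) (lap \<phi>) = (\<Sum>b\<in>UNIV. \<Sum>i\<in>UNIV. \<Sum>j\<in>UNIV. e i j b * (\<integral>x. gu s b j x * crl e \<phi> i x \<partial>lborel))"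
              unfolding pr_def by (simp only: sum_negf minus_minus)
            also have "\<dots> = (\<Sum>i\<in>UNIV. \<Sum>b\<in>UNIV. \<Sum>j\<in>UNIV. e i j b * (\<integral>x. gu s b j x * crl e \<phi> i x \<partial>lborel))" by (rule sum.swap)
            also have "\<dots> = (\<Sum>i\<in>UNIV. \<Sum>j\<in>UNIV. \<Sum>b\<in>UNIV. e i j b * (\<integral>x. gu s b j x * crl e \<phi> i x \<partial>lborel))"
              by (intro sum.cong refl sum.swap)
            finally show ?thesis by simp
          qed
          show "h s = - (\<nu> * ?\<beta> (lap \<phi>) s - 4 * \<xi> * ?\<beta> \<phi> s - 2 * \<xi> * pr (u s) (lap \<phi>)) - g s"
            unfolding elim(1)[rule_format, OF s] i ii iv elim(4)[symmetric] by (simp add: algebra_simps)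
        qed
      qed
      have bZ: "\<bar>NL s\<bar> \<le> 9 * (Z * ((2 * q) * Z))" if "s > 0" for s by (rule NLb) (use that in \<open>auto intro: uZ\<close>)
      have bU: "\<bar>NL s\<bar> \<le> 9 * (Z * ((2 * q) * U))" if "s > 0" "s \<in> {s1..s2}" for s by (rule NLb) (use that in \<open>auto intro: U\<close>)
      show "AE s in lborel. s > 0 \<longrightarrow> \<bar>g s\<bar> \<le> 9 * (Z * ((2 * q) * Z))"
        using gNL by eventually_elim (metis bZ)
      show "AE s in lborel. s > 0 \<longrightarrow> s \<in> {s1..s2} \<longrightarrow> \<bar>g s\<bar> \<le> 9 * (Z * ((2 * q) * U))"
        using gNL by eventually_elim (metis bU)
    qed
    also have "\<dots> \<le> 100 * Z * U * q * (s2 - s1)"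
    proof -
      have "9 * (Z * ((2 * q) * U)) \<le> 100 * Z * U * q" using mult_nonneg_nonneg[OF mult_nonneg_nonneg[OF Z0 U0] q0] by (simp add: mult_ac)
      then show ?thesis using s12 by (intro mult_right_mono) auto
    qed
    finally show ?thesis .
  qed
  have main_b: "\<bar>?\<beta> \<phi> s\<bar> \<le> 100 * Z * q" if \<phi>: "sol \<phi>" and s: "s \<ge> 0" and q: "\<And>j b. n2 (pd [j] (\<phi> b)) \<le> q" for \<phi> s q
  proof -
    have q0: "q \<ge> 0" using order_trans[OF n2_nonneg q] .
    have sp: "sqint (\<lambda>x. e i j b * pd [j] (\<phi> b) x)" for i j b by (intro sqint_cmult test_fun_sqint(1) test_fun_pd sol_test[OF \<phi>])
    have n: "n2 (crl e \<phi> i) \<le> 2 * q" for i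
    proof -
      have "n2 (crl e \<phi> i) \<le> (\<Sum>j\<in>UNIV. n2 (\<lambda>x. \<Sum>b\<in>UNIV. e i j b * pd [j] (\<phi> b) x))"
        unfolding crl_def[abs_def] by (rule n2_sum) (rule sqint_sum[OF sp])
      also have "\<dots> \<le> (\<Sum>j\<in>UNIV. \<Sum>b\<in>UNIV. n2 (\<lambda>x. e i j b * pd [j] (\<phi> b) x))" by (intro sum_mono n2_sum sp)
      also have "\<dots> \<le> (\<Sum>j\<in>UNIV. \<Sum>b\<in>UNIV. \<bar>e i j b\<bar> * q)" unfolding n2_cmult by (intro sum_mono mult_left_mono q) auto
      also have "\<dots> = (\<Sum>j\<in>UNIV. \<Sum>b\<in>UNIV. \<bar>e i j b\<bar>) * q" by (simp add: sum_distrib_right)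
      also have "\<dots> \<le> 2 * q" by (intro mult_right_mono e2 q0)
      finally show ?thesis .
    qed
    have "\<bar>?\<beta> \<phi> s\<bar> \<le> (\<Sum>i\<in>(UNIV::'i set). Z * (2 * q))"
    proof (intro order_trans[OF sum_abs] sum_mono)
      fix i
      have "\<bar>\<integral>x. w s i x * crl e \<phi> i x \<partial>lborel\<bar> \<le> n2 (w s i) * n2 (crl e \<phi> i)"
        by (rule sqint_cauchy_schwarz[OF sw[OF s] test_fun_sqint(1)[OF crl_test[OF \<phi>]]])
      also have "\<dots> \<le> Z * (2 * q)" by (intro mult_mono wZ s n Z0 n2_nonneg)
      finally show "\<bar>\<integral>x. w s i x * crl e \<phi> i x \<partial>lborel\<bar> \<le> Z * (2 * q)" .
    qed
    also have "\<dots> = real CARD('i) * (Z * (2 * q))" by simp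
    also have "\<dots> \<le> 3 * (Z * (2 * q))" using card(2) Z0 q0 by (intro mult_right_mono) auto
    also have "\<dots> \<le> 100 * Z * q" using mult_nonneg_nonneg[OF Z0 q0] by simp
    finally show ?thesis .
  qed
  show ?thesis
    unfolding damped_def
  proof (intro conjI allI impI)
    fix s :: real assume "0 \<le> s"
    then show "sqint (u s b)" "nrm (u s) \<le> Z" for b by (auto intro: su uZ)
    show "test_fun \<psi> \<Longrightarrow> (\<Sum>j\<in>UNIV. \<integral>x. u s j x * pd [j] \<psi> x \<partial>lborel) = 0" for \<psi> using \<open>0 \<le> s\<close> by (rule dv)
  qed (use cont_pr cont_\<beta> main_u main_w main_b in auto)
qed

section \<open>Borel slices of the weak formulation\<close>

lemma bv_family_sum:
  assumes "finite I" "\<And>i. i \<in> I \<Longrightarrow> f i \<in> borel_measurable lebesgue"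
  shows "AE x in lborel. \<forall>i\<in>I. f i x = bv (f i) x"
  using assms by (intro AE_finite_allI bv_AE) auto

text \<open>At a fixed time all components are replaced simultaneously by Borel representatives, off
  one null set, and each product is integrable by Cauchy-Schwarz, so the integral may be split term
  by term.\<close>

lemma slice_momentum:
  fixes u :: "'n::finite \<Rightarrow> real^'n \<Rightarrow> real" and g :: "'n \<Rightarrow> 'n \<Rightarrow> real^'n \<Rightarrow> real" and gw :: "'i::finite \<Rightarrow> 'n \<Rightarrow> real^'n \<Rightarrow> real"
  assumes um: "\<And>b. u b \<in> borel_measurable lebesgue" and gm: "\<And>b j. g b j \<in> borel_measurable lebesgue"
    and gwm: "\<And>i j. gw i j \<in> borel_measurable lebesgue"
    and us: "\<And>b. sqint (bv (u b))" and gs: "\<And>b j. sqint (bv (g b j))" and gws: "\<And>i j. sqint (bv (gw i j))"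
    and \<phi>: "\<And>b. test_fun (\<phi> b)"
  shows "(\<integral>x. c * (\<Sum>b\<in>UNIV. \<Sum>j\<in>UNIV. g b j x * pd [j] (\<phi> b) x) + (\<Sum>b\<in>UNIV. \<Sum>j\<in>UNIV. g b j x * (u j x * \<phi> b x))
       + k * (\<Sum>i\<in>UNIV. \<Sum>j\<in>UNIV. \<Sum>b\<in>UNIV. e i j b * (gw i j x * \<phi> b x)) \<partial>lebesgue)
    = c * (\<Sum>b\<in>UNIV. \<Sum>j\<in>UNIV. \<integral>x. bv (g b j) x * pd [j] (\<phi> b) x \<partial>lborel)
       + (\<Sum>b\<in>UNIV. \<Sum>j\<in>UNIV. \<integral>x. bv (g b j) x * (bv (u j) x * \<phi> b x) \<partial>lborel)
       + k * (\<Sum>i\<in>UNIV. \<Sum>j\<in>UNIV. \<Sum>b\<in>UNIV. e i j b * (\<integral>x. bv (gw i j) x * \<phi> b x \<partial>lborel))"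
proof -
  have i1: "integrable lborel (\<lambda>x. bv (g b j) x * pd [j] (\<phi> b) x)" for b j
    by (intro sqint_mult_integrable gs test_fun_sqint(1) test_fun_pd \<phi>)
  have i2: "integrable lborel (\<lambda>x. bv (g b j) x * (bv (u j) x * \<phi> b x))" for b j
    by (intro sqint_mult_integrable gs sqint_mult_test(1) us \<phi>)
  have i3: "integrable lborel (\<lambda>x. e i j b * (bv (gw i j) x * \<phi> b x))" for i j b
    by (intro integrable_mult_right sqint_mult_integrable gws test_fun_sqint(1) \<phi>)
  let ?A = "\<lambda>x. \<Sum>b\<in>UNIV. \<Sum>j\<in>UNIV. bv (g b j) x * pd [j] (\<phi> b) x"
  let ?B = "\<lambda>x. \<Sum>b\<in>UNIV. \<Sum>j\<in>UNIV. bv (g b j) x * (bv (u j) x * \<phi> b x)"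
  let ?C = "\<lambda>x. \<Sum>i\<in>UNIV. \<Sum>j\<in>UNIV. \<Sum>b\<in>UNIV. e i j b * (bv (gw i j) x * \<phi> b x)"
  have I: "integrable lborel ?A" "integrable lborel ?B" "integrable lborel ?C"
    by (intro Bochner_Integration.integrable_sum i1 i2 i3)+
  have "(\<integral>x. c * (\<Sum>b\<in>UNIV. \<Sum>j\<in>UNIV. g b j x * pd [j] (\<phi> b) x) + (\<Sum>b\<in>UNIV. \<Sum>j\<in>UNIV. g b j x * (u j x * \<phi> b x))
       + k * (\<Sum>i\<in>UNIV. \<Sum>j\<in>UNIV. \<Sum>b\<in>UNIV. e i j b * (gw i j x * \<phi> b x)) \<partial>lebesgue) = (\<integral>x. c * ?A x + ?B x + k * ?C x \<partial>lborel)"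
  proof (rule lebesgue_integral_AE_borel)
    show "(\<lambda>x. c * ?A x + ?B x + k * ?C x) \<in> borel_measurable borel"
      using borel_measurable_integrable[OF I(1)] borel_measurable_integrable[OF I(2)] borel_measurable_integrable[OF I(3)] by simp
    have a1: "AE x in lborel. \<forall>b\<in>UNIV. u b x = bv (u b) x" by (rule bv_family_sum[OF finite um])
    have a2: "AE x in lborel. \<forall>b\<in>UNIV. \<forall>j\<in>UNIV. g b j x = bv (g b j) x" by (intro AE_finite_allI bv_AE gm) auto
    have a3: "AE x in lborel. \<forall>i\<in>UNIV. \<forall>j\<in>UNIV. gw i j x = bv (gw i j) x" by (intro AE_finite_allI bv_AE gwm) auto
    show "AE x in lborel. c * (\<Sum>b\<in>UNIV. \<Sum>j\<in>UNIV. g b j x * pd [j] (\<phi> b) x) + (\<Sum>b\<in>UNIV. \<Sum>j\<in>UNIV. g b j x * (u j x * \<phi> b x))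
       + k * (\<Sum>i\<in>UNIV. \<Sum>j\<in>UNIV. \<Sum>b\<in>UNIV. e i j b * (gw i j x * \<phi> b x)) = c * ?A x + ?B x + k * ?C x"
      using a1 a2 a3 by eventually_elim (simp del: pd.simps)
  qed
  also have "\<dots> = c * (\<integral>x. ?A x \<partial>lborel) + (\<integral>x. ?B x \<partial>lborel) + k * (\<integral>x. ?C x \<partial>lborel)"
    using I by simp
  also have "(\<integral>x. ?A x \<partial>lborel) = (\<Sum>b\<in>UNIV. \<Sum>j\<in>UNIV. \<integral>x. bv (g b j) x * pd [j] (\<phi> b) x \<partial>lborel)"
    by (subst Bochner_Integration.integral_sum, intro Bochner_Integration.integrable_sum i1, intro sum.cong refl Bochner_Integration.integral_sum i1)
  also have "(\<integral>x. ?B x \<partial>lborel) = (\<Sum>b\<in>UNIV. \<Sum>j\<in>UNIV. \<integral>x. bv (g b j) x * (bv (u j) x * \<phi> b x) \<partial>lborel)"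
    by (subst Bochner_Integration.integral_sum, intro Bochner_Integration.integrable_sum i2, intro sum.cong refl Bochner_Integration.integral_sum i2)
  also have "(\<integral>x. ?C x \<partial>lborel) = (\<Sum>i\<in>UNIV. \<Sum>j\<in>UNIV. \<Sum>b\<in>UNIV. \<integral>x. e i j b * (bv (gw i j) x * \<phi> b x) \<partial>lborel)"
    by (subst Bochner_Integration.integral_sum, intro Bochner_Integration.integrable_sum i3, intro sum.cong refl,
        subst Bochner_Integration.integral_sum, intro Bochner_Integration.integrable_sum i3, intro sum.cong refl Bochner_Integration.integral_sum i3)
  finally show ?thesis by simp
qed

lemma slice_spin:
  fixes u :: "'n::finite \<Rightarrow> real^'n \<Rightarrow> real" and g :: "'n \<Rightarrow> 'n \<Rightarrow> real^'n \<Rightarrow> real" and w :: "'i::finite \<Rightarrow> real^'n \<Rightarrow> real" and gw :: "'i \<Rightarrow> 'n \<Rightarrow> real^'n \<Rightarrow> real"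
  assumes um: "\<And>b. u b \<in> borel_measurable lebesgue" and gm: "\<And>b j. g b j \<in> borel_measurable lebesgue"
    and wm: "\<And>i. w i \<in> borel_measurable lebesgue" and gwm: "\<And>i j. gw i j \<in> borel_measurable lebesgue"
    and us: "\<And>b. sqint (bv (u b))" and gs: "\<And>b j. sqint (bv (g b j))" and ws: "\<And>i. sqint (bv (w i))" and gws: "\<And>i j. sqint (bv (gw i j))"
    and \<psi>: "\<And>i. test_fun (\<psi> i)"
  shows "(\<integral>x. c * (\<Sum>i\<in>UNIV. \<Sum>j\<in>UNIV. gw i j x * pd [j] (\<psi> i) x) + (\<Sum>i\<in>UNIV. \<Sum>j\<in>UNIV. gw i j x * (u j x * \<psi> i x))
       + l * (\<Sum>i\<in>UNIV. w i x * \<psi> i x) - k * (\<Sum>i\<in>UNIV. \<Sum>j\<in>UNIV. \<Sum>b\<in>UNIV. e i j b * (g b j x * \<psi> i x)) \<partial>lebesgue)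
    = c * (\<Sum>i\<in>UNIV. \<Sum>j\<in>UNIV. \<integral>x. bv (gw i j) x * pd [j] (\<psi> i) x \<partial>lborel)
       + (\<Sum>i\<in>UNIV. \<Sum>j\<in>UNIV. \<integral>x. bv (gw i j) x * (bv (u j) x * \<psi> i x) \<partial>lborel)
       + l * (\<Sum>i\<in>UNIV. \<integral>x. bv (w i) x * \<psi> i x \<partial>lborel)
       - k * (\<Sum>i\<in>UNIV. \<Sum>j\<in>UNIV. \<Sum>b\<in>UNIV. e i j b * (\<integral>x. bv (g b j) x * \<psi> i x \<partial>lborel))"
proof -
  have i1: "integrable lborel (\<lambda>x. bv (gw i j) x * pd [j] (\<psi> i) x)" for i j
    by (intro sqint_mult_integrable gws test_fun_sqint(1) test_fun_pd \<psi>)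
  have i2: "integrable lborel (\<lambda>x. bv (gw i j) x * (bv (u j) x * \<psi> i x))" for i j
    by (intro sqint_mult_integrable gws sqint_mult_test(1) us \<psi>)
  have i4: "integrable lborel (\<lambda>x. bv (w i) x * \<psi> i x)" for i
    by (intro sqint_mult_integrable ws test_fun_sqint(1) \<psi>)
  have i3: "integrable lborel (\<lambda>x. e i j b * (bv (g b j) x * \<psi> i x))" for i j b
    by (intro integrable_mult_right sqint_mult_integrable gs test_fun_sqint(1) \<psi>)
  let ?A = "\<lambda>x. \<Sum>i\<in>UNIV. \<Sum>j\<in>UNIV. bv (gw i j) x * pd [j] (\<psi> i) x"
  let ?B = "\<lambda>x. \<Sum>i\<in>UNIV. \<Sum>j\<in>UNIV. bv (gw i j) x * (bv (u j) x * \<psi> i x)"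
  let ?D = "\<lambda>x. \<Sum>i\<in>UNIV. bv (w i) x * \<psi> i x"
  let ?C = "\<lambda>x. \<Sum>i\<in>UNIV. \<Sum>j\<in>UNIV. \<Sum>b\<in>UNIV. e i j b * (bv (g b j) x * \<psi> i x)"
  have I: "integrable lborel ?A" "integrable lborel ?B" "integrable lborel ?C" "integrable lborel ?D"
    by (intro Bochner_Integration.integrable_sum i1 i2 i3 i4)+
  have "(\<integral>x. c * (\<Sum>i\<in>UNIV. \<Sum>j\<in>UNIV. gw i j x * pd [j] (\<psi> i) x) + (\<Sum>i\<in>UNIV. \<Sum>j\<in>UNIV. gw i j x * (u j x * \<psi> i x))
       + l * (\<Sum>i\<in>UNIV. w i x * \<psi> i x) - k * (\<Sum>i\<in>UNIV. \<Sum>j\<in>UNIV. \<Sum>b\<in>UNIV. e i j b * (g b j x * \<psi> i x)) \<partial>lebesgue) = (\<integral>x. c * ?A x + ?B x + l * ?D x - k * ?C x \<partial>lborel)"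
  proof (rule lebesgue_integral_AE_borel)
    show "(\<lambda>x. c * ?A x + ?B x + l * ?D x - k * ?C x) \<in> borel_measurable borel"
      using borel_measurable_integrable[OF I(1)] borel_measurable_integrable[OF I(2)] borel_measurable_integrable[OF I(3)] borel_measurable_integrable[OF I(4)] by simp
    have a1: "AE x in lborel. \<forall>b\<in>UNIV. u b x = bv (u b) x" by (rule bv_family_sum[OF finite um])
    have a4: "AE x in lborel. \<forall>b\<in>UNIV. w b x = bv (w b) x" by (rule bv_family_sum[OF finite wm])
    have a2: "AE x in lborel. \<forall>b\<in>UNIV. \<forall>j\<in>UNIV. g b j x = bv (g b j) x" by (intro AE_finite_allI bv_AE gm) auto
    have a3: "AE x in lborel. \<forall>i\<in>UNIV. \<forall>j\<in>UNIV. gw i j x = bv (gw i j) x" by (intro AE_finite_allI bv_AE gwm) auto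
    show "AE x in lborel. c * (\<Sum>i\<in>UNIV. \<Sum>j\<in>UNIV. gw i j x * pd [j] (\<psi> i) x) + (\<Sum>i\<in>UNIV. \<Sum>j\<in>UNIV. gw i j x * (u j x * \<psi> i x))
       + l * (\<Sum>i\<in>UNIV. w i x * \<psi> i x) - k * (\<Sum>i\<in>UNIV. \<Sum>j\<in>UNIV. \<Sum>b\<in>UNIV. e i j b * (g b j x * \<psi> i x)) = c * ?A x + ?B x + l * ?D x - k * ?C x"
      using a1 a2 a3 a4 by eventually_elim (simp del: pd.simps)
  qed
  also have "\<dots> = c * (\<integral>x. ?A x \<partial>lborel) + (\<integral>x. ?B x \<partial>lborel) + l * (\<integral>x. ?D x \<partial>lborel) - k * (\<integral>x. ?C x \<partial>lborel)"
    using I by simp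
  also have "(\<integral>x. ?A x \<partial>lborel) = (\<Sum>i\<in>UNIV. \<Sum>j\<in>UNIV. \<integral>x. bv (gw i j) x * pd [j] (\<psi> i) x \<partial>lborel)"
    by (subst Bochner_Integration.integral_sum, intro Bochner_Integration.integrable_sum i1, intro sum.cong refl Bochner_Integration.integral_sum i1)
  also have "(\<integral>x. ?B x \<partial>lborel) = (\<Sum>i\<in>UNIV. \<Sum>j\<in>UNIV. \<integral>x. bv (gw i j) x * (bv (u j) x * \<psi> i x) \<partial>lborel)"
    by (subst Bochner_Integration.integral_sum, intro Bochner_Integration.integrable_sum i2, intro sum.cong refl Bochner_Integration.integral_sum i2)
  also have "(\<integral>x. ?D x \<partial>lborel) = (\<Sum>i\<in>UNIV. \<integral>x. bv (w i) x * \<psi> i x \<partial>lborel)"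
    by (rule Bochner_Integration.integral_sum[OF i4])
  also have "(\<integral>x. ?C x \<partial>lborel) = (\<Sum>i\<in>UNIV. \<Sum>j\<in>UNIV. \<Sum>b\<in>UNIV. \<integral>x. e i j b * (bv (g b j) x * \<psi> i x) \<partial>lborel)"
    by (subst Bochner_Integration.integral_sum, intro Bochner_Integration.integrable_sum i3, intro sum.cong refl,
        subst Bochner_Integration.integral_sum, intro Bochner_Integration.integrable_sum i3, intro sum.cong refl Bochner_Integration.integral_sum i3)
  finally show ?thesis by simp
qed

text \<open>Measurability is assumed both jointly and for the individual slices: the joint version
  provides measurability in time of the convective terms, while the slices of u and w are needed at
  every time, not merely at almost every one.\<close>

lemma leray_damped:
  fixes uf :: "'n::finite \<Rightarrow> real^'n \<Rightarrow> real \<Rightarrow> real" and guf :: "'n \<Rightarrow> 'n \<Rightarrow> real^'n \<Rightarrow> real \<Rightarrow> real"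
    and wf :: "'i::finite \<Rightarrow> real^'n \<Rightarrow> real \<Rightarrow> real" and gwf :: "'i \<Rightarrow> 'n \<Rightarrow> real^'n \<Rightarrow> real \<Rightarrow> real"
  assumes card: "CARD('n) \<le> 3" "CARD('i) \<le> 3"
    and e2: "\<And>i. (\<Sum>j\<in>UNIV. \<Sum>b\<in>UNIV. \<bar>e i j b\<bar>) \<le> 2"
    and eid: "\<And>j b k c. (\<Sum>i\<in>UNIV. e i j b * e i k c) = (if j = k \<and> b = c then 1 else 0) - (if j = c \<and> b = k then 1 else 0)"
    and ju: "\<And>b. (\<lambda>(x, t). uf b x t) \<in> borel_measurable lebesgue" and jw: "\<And>i. (\<lambda>(x, t). wf i x t) \<in> borel_measurable lebesgue"
    and jgu: "\<And>b j. (\<lambda>(x, t). guf b j x t) \<in> borel_measurable lebesgue" and jgw: "\<And>i j. (\<lambda>(x, t). gwf i j x t) \<in> borel_measurable lebesgue"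
    and um: "\<And>b t. t \<ge> 0 \<Longrightarrow> (\<lambda>x. uf b x t) \<in> borel_measurable lebesgue" and ui: "\<And>b t. t \<ge> 0 \<Longrightarrow> integrable lebesgue (\<lambda>x. (uf b x t)\<^sup>2)"
    and wm: "\<And>i t. t \<ge> 0 \<Longrightarrow> (\<lambda>x. wf i x t) \<in> borel_measurable lebesgue" and wi: "\<And>i t. t \<ge> 0 \<Longrightarrow> integrable lebesgue (\<lambda>x. (wf i x t)\<^sup>2)"
    and cu: "\<And>b p. sqint p \<Longrightarrow> continuous_on {0..} (\<lambda>t. \<integral>x. uf b x t * p x \<partial>lebesgue)"
    and cw: "\<And>i p. sqint p \<Longrightarrow> continuous_on {0..} (\<lambda>t. \<integral>x. wf i x t * p x \<partial>lebesgue)"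
    and uZ: "\<And>t. t \<ge> 0 \<Longrightarrow> nrm (\<lambda>b. bv (\<lambda>x. uf b x t)) \<le> Z" and wZ: "\<And>t i. t \<ge> 0 \<Longrightarrow> n2 (bv (\<lambda>x. wf i x t)) \<le> Z"
    and dv: "\<And>t \<psi>. t \<ge> 0 \<Longrightarrow> test_fun \<psi> \<Longrightarrow> (\<Sum>j\<in>UNIV. \<integral>x. bv (\<lambda>x. uf j x t) x * pd [j] \<psi> x \<partial>lborel) = 0"
    and gui: "\<And>b j. set_integrable lebesgue {p :: (real^'n) \<times> real. snd p > 0} (\<lambda>(x, t). (guf b j x t)\<^sup>2)"
    and gwi: "\<And>i j. set_integrable lebesgue {p :: (real^'n) \<times> real. snd p > 0} (\<lambda>(x, t). (gwf i j x t)\<^sup>2)"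
    and du: "AE s in lebesgue. s > 0 \<longrightarrow> (\<forall>b j. weak_deriv [j] (\<lambda>x. uf b x s) (\<lambda>x. guf b j x s))"
    and dw: "AE s in lebesgue. s > 0 \<longrightarrow> (\<forall>i j. weak_deriv [j] (\<lambda>x. wf i x s) (\<lambda>x. gwf i j x s))"
    and Pu: "\<And>\<phi>. sol \<phi> \<Longrightarrow> \<exists>a0. \<forall>t\<ge>0. pr (\<lambda>b. bv (\<lambda>x. uf b x t)) \<phi> - a0 + set_lebesgue_integral lebesgue {0..t} (\<lambda>s. \<integral>x.
        (\<mu> + \<xi>) * (\<Sum>b\<in>UNIV. \<Sum>j\<in>UNIV. guf b j x s * pd [j] (\<phi> b) x) + (\<Sum>b\<in>UNIV. \<Sum>j\<in>UNIV. guf b j x s * (uf j x s * \<phi> b x))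
        + 2 * \<xi> * (\<Sum>i\<in>UNIV. \<Sum>j\<in>UNIV. \<Sum>b\<in>UNIV. e i j b * (gwf i j x s * \<phi> b x)) \<partial>lebesgue) = 0"
    and Pw: "\<And>\<phi>. sol \<phi> \<Longrightarrow> \<exists>a0. \<forall>t\<ge>0. (\<Sum>i\<in>UNIV. \<integral>x. bv (\<lambda>x. wf i x t) x * crl e \<phi> i x \<partial>lborel) - a0 + set_lebesgue_integral lebesgue {0..t} (\<lambda>s. \<integral>x.
        \<nu> * (\<Sum>i\<in>UNIV. \<Sum>j\<in>UNIV. gwf i j x s * pd [j] (crl e \<phi> i) x) + (\<Sum>i\<in>UNIV. \<Sum>j\<in>UNIV. gwf i j x s * (uf j x s * crl e \<phi> i x))
        + 4 * \<xi> * (\<Sum>i\<in>UNIV. wf i x s * crl e \<phi> i x) - 2 * \<xi> * (\<Sum>i\<in>UNIV. \<Sum>j\<in>UNIV. \<Sum>b\<in>UNIV. e i j b * (guf b j x s * crl e \<phi> i x)) \<partial>lebesgue) = 0"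
  shows "damped \<mu> \<nu> \<xi> Z (\<lambda>s b. bv (\<lambda>x. uf b x s)) (\<lambda>\<phi> s. \<Sum>i\<in>UNIV. \<integral>x. bv (\<lambda>x. wf i x s) x * crl e \<phi> i x \<partial>lborel)"
proof -
  let ?u = "\<lambda>s b. bv (\<lambda>x. uf b x s)" and ?w = "\<lambda>s i. bv (\<lambda>x. wf i x s)"
  let ?gu = "\<lambda>s b j. bv (\<lambda>x. guf b j x s)" and ?gw = "\<lambda>s i j. bv (\<lambda>x. gwf i j x s)"
  have su: "sqint (?u s b)" if "s \<ge> 0" for s b by (rule bv_sqint(1)[OF um[OF that] ui[OF that]])
  have sw: "sqint (?w s i)" if "s \<ge> 0" for s i by (rule bv_sqint(1)[OF wm[OF that] wi[OF that]])
  have "AE s in lborel. \<forall>b\<in>UNIV. \<forall>j\<in>UNIV. s > 0 \<longrightarrow> sqint (?gu s b j)" by (intro AE_finite_allI section_sqint jgu gui) auto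
  moreover have du': "AE s in lborel. s > 0 \<longrightarrow> (\<forall>b j. weak_deriv [j] (\<lambda>x. uf b x s) (\<lambda>x. guf b j x s))" using du by (simp add: AE_completion_iff)
  ultimately have GU: "AE s in lborel. s > 0 \<longrightarrow> (\<forall>b j. (\<lambda>x. guf b j x s) \<in> borel_measurable lebesgue \<and> sqint (?gu s b j) \<and> (\<forall>\<psi>. test_fun \<psi> \<longrightarrow> (\<integral>x. ?u s b x * pd [j] \<psi> x \<partial>lborel) = - (\<integral>x. ?gu s b j x * \<psi> x \<partial>lborel)))"
  proof eventually_elim
    case (elim s)
    show ?case
    proof (intro impI allI conjI)
      fix b j assume s: "s > 0"
      note wd = elim(2)[rule_format, OF s, of j b]
      show "(\<lambda>x. guf b j x s) \<in> borel_measurable lebesgue" using wd by (simp add: weak_deriv_def loc_int_def)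
      show "sqint (?gu s b j)" using elim(1) s by blast
      show "test_fun \<psi> \<Longrightarrow> (\<integral>x. ?u s b x * pd [j] \<psi> x \<partial>lborel) = - (\<integral>x. ?gu s b j x * \<psi> x \<partial>lborel)" for \<psi>
        using weak_deriv_bv[OF wd, of \<psi>] by simp
    qed
  qed
  have "AE s in lborel. \<forall>i\<in>UNIV. \<forall>j\<in>UNIV. s > 0 \<longrightarrow> sqint (?gw s i j)" by (intro AE_finite_allI section_sqint jgw gwi) auto
  moreover have dw': "AE s in lborel. s > 0 \<longrightarrow> (\<forall>i j. weak_deriv [j] (\<lambda>x. wf i x s) (\<lambda>x. gwf i j x s))" using dw by (simp add: AE_completion_iff)
  ultimately have GW: "AE s in lborel. s > 0 \<longrightarrow> (\<forall>i j. (\<lambda>x. gwf i j x s) \<in> borel_measurable lebesgue \<and> sqint (?gw s i j) \<and> (\<forall>\<psi>. test_fun \<psi> \<longrightarrow> (\<integral>x. ?w s i x * pd [j] \<psi> x \<partial>lborel) = - (\<integral>x. ?gw s i j x * \<psi> x \<partial>lborel)))"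
  proof eventually_elim
    case (elim s)
    show ?case
    proof (intro impI allI conjI)
      fix i j assume s: "s > 0"
      note wd = elim(2)[rule_format, OF s, of j i]
      show "(\<lambda>x. gwf i j x s) \<in> borel_measurable lebesgue" using wd by (simp add: weak_deriv_def loc_int_def)
      show "sqint (?gw s i j)" using elim(1) s by blast
      show "test_fun \<psi> \<Longrightarrow> (\<integral>x. ?w s i x * pd [j] \<psi> x \<partial>lborel) = - (\<integral>x. ?gw s i j x * \<psi> x \<partial>lborel)" for \<psi>
        using weak_deriv_bv[OF wd, of \<psi>] by simp
    qed
  qed
  show ?thesis
  proof (rule damped_system[where gu = ?gu and gw = ?gw, OF card e2 eid su sw uZ wZ dv])
    show "continuous_on {0..} (\<lambda>t. \<Sum>b\<in>UNIV. \<integral>x. ?u t b x * p b x \<partial>lborel)" if p: "\<And>b. sqint (p b)" for p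
    proof (rule continuous_on_sum)
      fix b
      have "continuous_on {0..} (\<lambda>t. \<integral>x. ?u t b x * p b x \<partial>lborel) \<longleftrightarrow> continuous_on {0..} (\<lambda>t. \<integral>x. uf b x t * p b x \<partial>lebesgue)"
        by (rule continuous_on_cong[OF refl]) (rule lebesgue_pairing_bv[symmetric, OF um sqint_meas[OF p]], simp)
      then show "continuous_on {0..} (\<lambda>t. \<integral>x. ?u t b x * p b x \<partial>lborel)" using cu[OF p] by blast
    qed
    show "continuous_on {0..} (\<lambda>t. \<Sum>i\<in>UNIV. \<integral>x. ?w t i x * p i x \<partial>lborel)" if p: "\<And>i. sqint (p i)" for p
    proof (rule continuous_on_sum)
      fix i
      have "continuous_on {0..} (\<lambda>t. \<integral>x. ?w t i x * p i x \<partial>lborel) \<longleftrightarrow> continuous_on {0..} (\<lambda>t. \<integral>x. wf i x t * p i x \<partial>lebesgue)"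
        by (rule continuous_on_cong[OF refl]) (rule lebesgue_pairing_bv[symmetric, OF wm sqint_meas[OF p]], simp)
      then show "continuous_on {0..} (\<lambda>t. \<integral>x. ?w t i x * p i x \<partial>lborel)" using cw[OF p] by blast
    qed
    show "AE s in lborel. s > 0 \<longrightarrow> (\<forall>b j. sqint (?gu s b j) \<and> (\<forall>\<psi>. test_fun \<psi> \<longrightarrow> (\<integral>x. ?u s b x * pd [j] \<psi> x \<partial>lborel) = - (\<integral>x. ?gu s b j x * \<psi> x \<partial>lborel)))"
      using GU by eventually_elim blast
    show "AE s in lborel. s > 0 \<longrightarrow> (\<forall>i j. sqint (?gw s i j) \<and> (\<forall>\<psi>. test_fun \<psi> \<longrightarrow> (\<integral>x. ?w s i x * pd [j] \<psi> x \<partial>lborel) = - (\<integral>x. ?gw s i j x * \<psi> x \<partial>lborel)))"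
      using GW by eventually_elim blast
    show "\<exists>G\<in>borel_measurable borel. AE s in lborel. (\<integral>x. ?u s b x * (?u s j x * \<zeta> x) \<partial>lborel) = G s" if "test_fun \<zeta>" for b j \<zeta>
      by (rule section_product_measurable[OF ju ju test_fun_measurable[OF that]])
    show "\<exists>G\<in>borel_measurable borel. AE s in lborel. (\<integral>x. ?w s i x * (?u s j x * \<zeta> x) \<partial>lborel) = G s" if "test_fun \<zeta>" for i j \<zeta>
      by (rule section_product_measurable[OF jw ju test_fun_measurable[OF that]])
    fix \<phi> :: "'n \<Rightarrow> real^'n \<Rightarrow> real" assume \<phi>: "sol \<phi>"
    obtain a0 where a0: "\<forall>t\<ge>0. pr (\<lambda>b. bv (\<lambda>x. uf b x t)) \<phi> - a0 + set_lebesgue_integral lebesgue {0..t} (\<lambda>s. \<integral>x.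
        (\<mu> + \<xi>) * (\<Sum>b\<in>UNIV. \<Sum>j\<in>UNIV. guf b j x s * pd [j] (\<phi> b) x) + (\<Sum>b\<in>UNIV. \<Sum>j\<in>UNIV. guf b j x s * (uf j x s * \<phi> b x))
        + 2 * \<xi> * (\<Sum>i\<in>UNIV. \<Sum>j\<in>UNIV. \<Sum>b\<in>UNIV. e i j b * (gwf i j x s * \<phi> b x)) \<partial>lebesgue) = 0"
      using Pu[OF \<phi>] by (elim exE) (rule that)
    show "\<exists>a0 h. (\<forall>t\<ge>0. pr (?u t) \<phi> - a0 + set_lebesgue_integral lebesgue {0..t} h = 0) \<and>
       (AE s in lborel. s > 0 \<longrightarrow> h s = (\<mu> + \<xi>) * (\<Sum>b\<in>UNIV. \<Sum>j\<in>UNIV. \<integral>x. ?gu s b j x * pd [j] (\<phi> b) x \<partial>lborel)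
          + (\<Sum>b\<in>UNIV. \<Sum>j\<in>UNIV. \<integral>x. ?gu s b j x * (?u s j x * \<phi> b x) \<partial>lborel)
          + 2 * \<xi> * (\<Sum>i\<in>UNIV. \<Sum>j\<in>UNIV. \<Sum>b\<in>UNIV. e i j b * (\<integral>x. ?gw s i j x * \<phi> b x \<partial>lborel)))"
    proof (rule exI[of _ a0], rule exI, rule conjI[OF a0])
      show "AE s in lborel. s > 0 \<longrightarrow> (\<integral>x.
        (\<mu> + \<xi>) * (\<Sum>b\<in>UNIV. \<Sum>j\<in>UNIV. guf b j x s * pd [j] (\<phi> b) x) + (\<Sum>b\<in>UNIV. \<Sum>j\<in>UNIV. guf b j x s * (uf j x s * \<phi> b x))
        + 2 * \<xi> * (\<Sum>i\<in>UNIV. \<Sum>j\<in>UNIV. \<Sum>b\<in>UNIV. e i j b * (gwf i j x s * \<phi> b x)) \<partial>lebesgue) = (\<mu> + \<xi>) * (\<Sum>b\<in>UNIV. \<Sum>j\<in>UNIV. \<integral>x. ?gu s b j x * pd [j] (\<phi> b) x \<partial>lborel)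
          + (\<Sum>b\<in>UNIV. \<Sum>j\<in>UNIV. \<integral>x. ?gu s b j x * (?u s j x * \<phi> b x) \<partial>lborel)
          + 2 * \<xi> * (\<Sum>i\<in>UNIV. \<Sum>j\<in>UNIV. \<Sum>b\<in>UNIV. e i j b * (\<integral>x. ?gw s i j x * \<phi> b x \<partial>lborel))"
        using GU GW
      proof eventually_elim
        case (elim s)
        show ?case
        proof
          assume s: "s > 0"
          show "(\<integral>x.
        (\<mu> + \<xi>) * (\<Sum>b\<in>UNIV. \<Sum>j\<in>UNIV. guf b j x s * pd [j] (\<phi> b) x) + (\<Sum>b\<in>UNIV. \<Sum>j\<in>UNIV. guf b j x s * (uf j x s * \<phi> b x))
        + 2 * \<xi> * (\<Sum>i\<in>UNIV. \<Sum>j\<in>UNIV. \<Sum>b\<in>UNIV. e i j b * (gwf i j x s * \<phi> b x)) \<partial>lebesgue) = (\<mu> + \<xi>) * (\<Sum>b\<in>UNIV. \<Sum>j\<in>UNIV. \<integral>x. ?gu s b j x * pd [j] (\<phi> b) x \<partial>lborel)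
          + (\<Sum>b\<in>UNIV. \<Sum>j\<in>UNIV. \<integral>x. ?gu s b j x * (?u s j x * \<phi> b x) \<partial>lborel)
          + 2 * \<xi> * (\<Sum>i\<in>UNIV. \<Sum>j\<in>UNIV. \<Sum>b\<in>UNIV. e i j b * (\<integral>x. ?gw s i j x * \<phi> b x \<partial>lborel))"
            by (rule slice_momentum) (use s elim um su sol_test[OF \<phi>] in auto)
        qed
      qed
    qed
    obtain a1 where a1: "\<forall>t\<ge>0. (\<Sum>i\<in>UNIV. \<integral>x. bv (\<lambda>x. wf i x t) x * crl e \<phi> i x \<partial>lborel) - a1 + set_lebesgue_integral lebesgue {0..t} (\<lambda>s. \<integral>x.
        \<nu> * (\<Sum>i\<in>UNIV. \<Sum>j\<in>UNIV. gwf i j x s * pd [j] (crl e \<phi> i) x) + (\<Sum>i\<in>UNIV. \<Sum>j\<in>UNIV. gwf i j x s * (uf j x s * crl e \<phi> i x))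
        + 4 * \<xi> * (\<Sum>i\<in>UNIV. wf i x s * crl e \<phi> i x) - 2 * \<xi> * (\<Sum>i\<in>UNIV. \<Sum>j\<in>UNIV. \<Sum>b\<in>UNIV. e i j b * (guf b j x s * crl e \<phi> i x)) \<partial>lebesgue) = 0"
      using Pw[OF \<phi>] by (elim exE) (rule that)
    show "\<exists>a0 h. (\<forall>t\<ge>0. (\<Sum>i\<in>UNIV. \<integral>x. ?w t i x * crl e \<phi> i x \<partial>lborel) - a0 + set_lebesgue_integral lebesgue {0..t} h = 0) \<and>
       (AE s in lborel. s > 0 \<longrightarrow> h s = \<nu> * (\<Sum>i\<in>UNIV. \<Sum>j\<in>UNIV. \<integral>x. ?gw s i j x * pd [j] (crl e \<phi> i) x \<partial>lborel)
          + (\<Sum>i\<in>UNIV. \<Sum>j\<in>UNIV. \<integral>x. ?gw s i j x * (?u s j x * crl e \<phi> i x) \<partial>lborel)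
          + 4 * \<xi> * (\<Sum>i\<in>UNIV. \<integral>x. ?w s i x * crl e \<phi> i x \<partial>lborel)
          - 2 * \<xi> * (\<Sum>i\<in>UNIV. \<Sum>j\<in>UNIV. \<Sum>b\<in>UNIV. e i j b * (\<integral>x. ?gu s b j x * crl e \<phi> i x \<partial>lborel)))"
    proof (rule exI[of _ a1], rule exI, rule conjI[OF a1])
      show "AE s in lborel. s > 0 \<longrightarrow> (\<integral>x.
        \<nu> * (\<Sum>i\<in>UNIV. \<Sum>j\<in>UNIV. gwf i j x s * pd [j] (crl e \<phi> i) x) + (\<Sum>i\<in>UNIV. \<Sum>j\<in>UNIV. gwf i j x s * (uf j x s * crl e \<phi> i x))
        + 4 * \<xi> * (\<Sum>i\<in>UNIV. wf i x s * crl e \<phi> i x) - 2 * \<xi> * (\<Sum>i\<in>UNIV. \<Sum>j\<in>UNIV. \<Sum>b\<in>UNIV. e i j b * (guf b j x s * crl e \<phi> i x)) \<partial>lebesgue)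
        = \<nu> * (\<Sum>i\<in>UNIV. \<Sum>j\<in>UNIV. \<integral>x. ?gw s i j x * pd [j] (crl e \<phi> i) x \<partial>lborel)
          + (\<Sum>i\<in>UNIV. \<Sum>j\<in>UNIV. \<integral>x. ?gw s i j x * (?u s j x * crl e \<phi> i x) \<partial>lborel)
          + 4 * \<xi> * (\<Sum>i\<in>UNIV. \<integral>x. ?w s i x * crl e \<phi> i x \<partial>lborel)
          - 2 * \<xi> * (\<Sum>i\<in>UNIV. \<Sum>j\<in>UNIV. \<Sum>b\<in>UNIV. e i j b * (\<integral>x. ?gu s b j x * crl e \<phi> i x \<partial>lborel))"
        using GU GW
      proof eventually_elim
        case (elim s)
        show ?case
        proof
          assume s: "s > 0"
          show "(\<integral>x.
        \<nu> * (\<Sum>i\<in>UNIV. \<Sum>j\<in>UNIV. gwf i j x s * pd [j] (crl e \<phi> i) x) + (\<Sum>i\<in>UNIV. \<Sum>j\<in>UNIV. gwf i j x s * (uf j x s * crl e \<phi> i x))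
        + 4 * \<xi> * (\<Sum>i\<in>UNIV. wf i x s * crl e \<phi> i x) - 2 * \<xi> * (\<Sum>i\<in>UNIV. \<Sum>j\<in>UNIV. \<Sum>b\<in>UNIV. e i j b * (guf b j x s * crl e \<phi> i x)) \<partial>lebesgue)
        = \<nu> * (\<Sum>i\<in>UNIV. \<Sum>j\<in>UNIV. \<integral>x. ?gw s i j x * pd [j] (crl e \<phi> i) x \<partial>lborel)
          + (\<Sum>i\<in>UNIV. \<Sum>j\<in>UNIV. \<integral>x. ?gw s i j x * (?u s j x * crl e \<phi> i x) \<partial>lborel)
          + 4 * \<xi> * (\<Sum>i\<in>UNIV. \<integral>x. ?w s i x * crl e \<phi> i x \<partial>lborel)
          - 2 * \<xi> * (\<Sum>i\<in>UNIV. \<Sum>j\<in>UNIV. \<Sum>b\<in>UNIV. e i j b * (\<integral>x. ?gu s b j x * crl e \<phi> i x \<partial>lborel))"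
            by (rule slice_spin) (use s elim um su wm sw crl_test[OF \<phi>] in auto)
        qed
      qed
    qed
  qed
qed

section \<open>Leray solutions in dimensions two and three\<close>

definition eps3 :: "3 \<Rightarrow> 3 \<Rightarrow> 3 \<Rightarrow> real" where
  "eps3 i j b = (if (i, j, b) \<in> {(1, 2, 3), (2, 3, 1), (3, 1, 2)} then 1
     else if (i, j, b) \<in> {(1, 3, 2), (3, 2, 1), (2, 1, 3)} then - 1 else 0)"

text \<open>The microrotation is scalar in dimension two, so the index of the curl ranges over a
  single value.\<close>

definition eps2 :: "unit \<Rightarrow> 2 \<Rightarrow> 2 \<Rightarrow> real" where
  "eps2 i j b = (if j = 1 \<and> b = 2 then 1 else if j = 2 \<and> b = 1 then - 1 else 0)"

lemma eps3_bound: "(\<Sum>j\<in>UNIV. \<Sum>b\<in>UNIV. \<bar>eps3 i j b\<bar>) \<le> 2"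
proof -
  have "\<forall>i. (\<Sum>j\<in>UNIV. \<Sum>b\<in>UNIV. \<bar>eps3 i j b\<bar>) \<le> 2" by (simp add: forall_3 sum_3 eps3_def)
  then show ?thesis by blast
qed

lemma eps3_contract: "(\<Sum>i\<in>UNIV. eps3 i j b * eps3 i k c) = (if j = k \<and> b = c then 1 else 0) - (if j = c \<and> b = k then 1 else 0)"
proof -
  have "\<forall>j b k c. (\<Sum>i\<in>UNIV. eps3 i j b * eps3 i k c) = (if j = k \<and> b = c then 1 else 0) - (if j = c \<and> b = k then 1 else 0)"
    by (simp add: forall_3 sum_3 eps3_def)
  then show ?thesis by blast
qed

lemma eps2_bound: "(\<Sum>j\<in>UNIV. \<Sum>b\<in>UNIV. \<bar>eps2 i j b\<bar>) \<le> 2"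
  by (simp add: sum_2 eps2_def)

lemma eps2_contract: "(\<Sum>i\<in>UNIV. eps2 i j b * eps2 i k c) = (if j = k \<and> b = c then 1 else 0) - (if j = c \<and> b = k then 1 else 0)"
proof -
  have "\<forall>j b k c. (\<Sum>i\<in>UNIV. eps2 i j b * eps2 i k c) = (if j = k \<and> b = c then 1 else 0) - (if j = c \<and> b = k then 1 else 0)"
    by (simp add: forall_2 UNIV_unit eps2_def)
  then show ?thesis by blast
qed

lemma joint_component:
  fixes v :: "'a::euclidean_space \<Rightarrow> real \<Rightarrow> 'b::euclidean_space" and L :: "'b \<Rightarrow> real"
  assumes "(\<lambda>(x, t). v x t) \<in> borel_measurable lebesgue" "continuous_on UNIV L"
  shows "(\<lambda>(x, t). L (v x t)) \<in> borel_measurable lebesgue"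
  using measurable_compose[OF assms(1) borel_measurable_continuous_onI[OF assms(2)]] by (simp add: case_prod_unfold)

lemma component_set_integrable:
  fixes G :: "'a::euclidean_space \<Rightarrow> real \<Rightarrow> 'g::euclidean_space" and f :: "'a \<Rightarrow> real \<Rightarrow> real"
  assumes G: "set_integrable lebesgue {p :: 'a \<times> real. snd p > 0} (\<lambda>(x, s). (norm (G x s))\<^sup>2)"
    and f: "(\<lambda>(x, s). f x s) \<in> borel_measurable lebesgue" and le: "\<And>x s. \<bar>f x s\<bar> \<le> norm (G x s)"
  shows "set_integrable lebesgue {p :: 'a \<times> real. snd p > 0} (\<lambda>(x, s). (f x s)\<^sup>2)"
  unfolding set_integrable_def
proof (rule Bochner_Integration.integrable_bound[OF G[unfolded set_integrable_def]])
  have "open {p :: 'a \<times> real. snd p > 0}" by (intro open_Collect_less continuous_intros)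
  then have S: "{p :: 'a \<times> real. snd p > 0} \<in> sets lebesgue" by simp
  have "(\<lambda>p. ((\<lambda>(x, s). f x s) p)\<^sup>2) \<in> borel_measurable lebesgue" by (rule borel_measurable_power[OF f])
  then have "(\<lambda>(x, s). (f x s)\<^sup>2) \<in> borel_measurable lebesgue" by (simp add: case_prod_unfold)
  then show "(\<lambda>p. indicat_real {p :: 'a \<times> real. snd p > 0} p *\<^sub>R (case p of (x, s) \<Rightarrow> (f x s)\<^sup>2)) \<in> borel_measurable lebesgue"
    using S by (intro borel_measurable_scaleR borel_measurable_indicator)
  have "(f x s)\<^sup>2 \<le> (norm (G x s))\<^sup>2" for x s using le[of x s] by (simp add: abs_le_square_iff[symmetric])
  then show "AE p in lebesgue. norm (indicat_real {p :: 'a \<times> real. snd p > 0} p *\<^sub>R (case p of (x, s) \<Rightarrow> (f x s)\<^sup>2))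
     \<le> norm (indicat_real {p :: 'a \<times> real. snd p > 0} p *\<^sub>R (case p of (x, s) \<Rightarrow> (norm (G x s))\<^sup>2))"
    by (intro AE_I2) (auto simp: indicator_def)
qed

lemma weakly_continuous_component:
  fixes v :: "real^'n::finite \<Rightarrow> real \<Rightarrow> real^'k::finite"
  assumes c: "\<forall>\<phi>. L2 \<phi> \<longrightarrow> continuous_on {0..} (\<lambda>t. \<integral>x. v x t \<bullet> \<phi> x \<partial>lebesgue)" and p: "sqint p"
  shows "continuous_on {0..} (\<lambda>t. \<integral>x. v x t $ i * p x \<partial>lebesgue)"
proof -
  have "L2 (\<lambda>x. p x *\<^sub>R (axis i 1 :: real^'k))"
    unfolding L2_def
  proof
    show "(\<lambda>x. p x *\<^sub>R (axis i 1 :: real^'k)) \<in> borel_measurable lebesgue"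
      by (rule measurable_completion) (use p in \<open>auto simp: sqint_def\<close>)
    have "(\<lambda>x. (norm (p x *\<^sub>R (axis i 1 :: real^'k)))\<^sup>2) = (\<lambda>x. (p x)\<^sup>2)" by (simp add: norm_axis_1)
    then show "integrable lebesgue (\<lambda>x. (norm (p x *\<^sub>R (axis i 1 :: real^'k)))\<^sup>2)"
      using p by (subst integrable_completion) (auto simp: sqint_def)
  qed
  with c have "continuous_on {0..} (\<lambda>t. \<integral>x. v x t \<bullet> (p x *\<^sub>R axis i 1) \<partial>lebesgue)" by blast
  then show ?thesis by (simp add: inner_axis mult.commute)
qed

text \<open>The energy inequality from time 0, with the nonnegative dissipation dropped; the
  solution at time 0 agrees with the data almost everywhere, and this also settles t = 0.\<close>

lemma energy_bound:
  assumes s: "sol_data u0 w0 u w" and e: "energy_ineq \<mu> \<nu> u w Gu Gw" and pos: "\<mu> > 0" "\<nu> > 0" and t: "t \<ge> 0"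
  shows "L2norm (\<lambda>x. u x t) \<le> znorm u0 w0" "L2norm (\<lambda>x. w x t) \<le> znorm u0 w0"
proof -
  have n0: "0 \<le> L2norm f" for f :: "'x::euclidean_space \<Rightarrow> 'y::euclidean_space" by (simp add: L2norm_def)
  have d: "L2 (\<lambda>x. u x 0)" "L2 (\<lambda>x. w x 0)" "L2 u0" "L2 w0" "AE x in lebesgue. u x 0 = u0 x" "AE x in lebesgue. w x 0 = w0 x"
    using s by (auto simp: sol_data_def)
  have u0: "L2norm (\<lambda>x. u x 0) = L2norm u0"
    unfolding L2norm_def using d by (intro arg_cong[where f=sqrt] integral_cong_AE) (auto simp: L2_def intro!: borel_measurable_integrable)
  have w0: "L2norm (\<lambda>x. w x 0) = L2norm w0"
    unfolding L2norm_def using d by (intro arg_cong[where f=sqrt] integral_cong_AE) (auto simp: L2_def intro!: borel_measurable_integrable)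
  have "(L2norm (\<lambda>x. u x t))\<^sup>2 + (L2norm (\<lambda>x. w x t))\<^sup>2 \<le> (L2norm u0)\<^sup>2 + (L2norm w0)\<^sup>2"
  proof (cases "t = 0")
    case False
    then have "(L2norm (\<lambda>x. u x t))\<^sup>2 + (L2norm (\<lambda>x. w x t))\<^sup>2
        + 2 * set_lebesgue_integral lebesgue {0..t} (\<lambda>\<tau>. \<mu> * (\<integral>x. (norm (Gu x \<tau>))\<^sup>2 \<partial>lebesgue) + \<nu> * (\<integral>x. (norm (Gw x \<tau>))\<^sup>2 \<partial>lebesgue))
        \<le> (L2norm (\<lambda>x. u x 0))\<^sup>2 + (L2norm (\<lambda>x. w x 0))\<^sup>2"
      using e t by (auto simp: energy_ineq_def Let_def)
    moreover have "0 \<le> set_lebesgue_integral lebesgue {0..t} (\<lambda>\<tau>. \<mu> * (\<integral>x. (norm (Gu x \<tau>))\<^sup>2 \<partial>lebesgue) + \<nu> * (\<integral>x. (norm (Gw x \<tau>))\<^sup>2 \<partial>lebesgue))"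
      unfolding set_lebesgue_integral_def using pos
      by (intro Bochner_Integration.integral_nonneg) (auto intro!: mult_nonneg_nonneg add_nonneg_nonneg)
    ultimately show ?thesis unfolding u0 w0 by linarith
  qed (simp add: u0 w0)
  then show "L2norm (\<lambda>x. u x t) \<le> znorm u0 w0" "L2norm (\<lambda>x. w x t) \<le> znorm u0 w0"
    unfolding znorm_def by (auto intro!: real_le_rsqrt) (smt (verit) zero_le_power2)+
qed

lemma div_free_bv:
  assumes v: "L2 v" and d: "div_free v" and \<psi>: "test_fun \<psi>"
  shows "(\<Sum>j\<in>UNIV. \<integral>x. bv (\<lambda>x. v x $ j) x * pd [j] \<psi> x \<partial>lborel) = 0"
proof -
  have sg: "sgrad \<psi> = (\<lambda>x. \<chi> j. pd [j] \<psi> x)" by (simp add: fun_eq_iff sgrad_def)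
  have "(\<integral>x. v x \<bullet> sgrad \<psi> x \<partial>lebesgue) = 0" using d \<psi> by (simp add: div_free_def)
  then have "(\<integral>x. v x \<bullet> (\<chi> j. pd [j] \<psi> x) \<partial>lebesgue) = 0" unfolding sg .
  then show ?thesis using L2_inner_bv[OF v, of "\<lambda>j. pd [j] \<psi>"] test_fun_sqint(1)[OF test_fun_pd[OF \<psi>]] by (simp del: pd.simps)
qed

text \<open>The spin equation is tested with the curl of a solenoidal field. Its divergence vanishes
  by symmetry of second derivatives, which removes the \<kappa>-term.\<close>

lemma leray3_damped:
  assumes l: "leray3 \<mu> \<nu> \<xi> \<kappa> u0 w0 u w" and pos: "\<mu> > 0" "\<nu> > 0"
  shows "damped \<mu> \<nu> \<xi> (znorm u0 w0) (\<lambda>s b. bv (\<lambda>x. u x s $ b)) (\<lambda>\<phi> s. \<Sum>i\<in>UNIV. \<integral>x. bv (\<lambda>x. w x s $ i) x * crl eps3 \<phi> i x \<partial>lborel)"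
proof -
  obtain Gu Gw where sd: "sol_data u0 w0 u w" and go: "grads_ok u Gu Gw"
    and gw: "AE s in lebesgue. s > 0 \<longrightarrow> weak_grad (\<lambda>x. w x s) (\<lambda>x. Gw x s)"
    and Pu: "\<And>\<phi> t. vtest_fun \<phi> \<Longrightarrow> (\<forall>x. vdiv \<phi> x = 0) \<Longrightarrow> t \<ge> 0 \<Longrightarrow>
          (\<integral>x. u x t \<bullet> \<phi> x \<partial>lebesgue) - (\<integral>x. u0 x \<bullet> \<phi> x \<partial>lebesgue)
          + set_lebesgue_integral lebesgue {0..t} (\<lambda>s. \<integral>x.
               (\<mu> + \<xi>) * (Gu x s \<bullet> vgrad \<phi> x) + (Gu x s *v u x s) \<bullet> \<phi> x
               - 2 * \<xi> * (curl3 (Gw x s) \<bullet> \<phi> x) \<partial>lebesgue) = 0"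
    and Pw: "\<And>\<psi> t. vtest_fun \<psi> \<Longrightarrow> t \<ge> 0 \<Longrightarrow>
          (\<integral>x. w x t \<bullet> \<psi> x \<partial>lebesgue) - (\<integral>x. w0 x \<bullet> \<psi> x \<partial>lebesgue)
          + set_lebesgue_integral lebesgue {0..t} (\<lambda>s. \<integral>x.
               \<nu> * (Gw x s \<bullet> vgrad \<psi> x) + \<kappa> * (\<Sum>i\<in>UNIV. Gw x s $ i $ i) * vdiv \<psi> x
               + (Gw x s *v u x s) \<bullet> \<psi> x + 4 * \<xi> * (w x s \<bullet> \<psi> x)
               - 2 * \<xi> * (curl3 (Gu x s) \<bullet> \<psi> x) \<partial>lebesgue) = 0"
    and en: "energy_ineq \<mu> \<nu> u w Gu Gw"
    using l unfolding leray3_def by (elim conjE exE) (rule that, auto)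
  have uL: "L2 (\<lambda>x. u x t)" "div_free (\<lambda>x. u x t)" "L2 (\<lambda>x. w x t)" if "t \<ge> 0" for t using sd that by (auto simp: sol_data_def)
  have ju: "(\<lambda>(x, t). u x t) \<in> borel_measurable lebesgue" and jw: "(\<lambda>(x, t). w x t) \<in> borel_measurable lebesgue" using sd by (auto simp: sol_data_def)
  have cu: "\<forall>\<phi>::real^3 \<Rightarrow> real^3. L2 \<phi> \<longrightarrow> continuous_on {0..} (\<lambda>t. \<integral>x. u x t \<bullet> \<phi> x \<partial>lebesgue)"
    and cw: "\<forall>\<phi>::real^3 \<Rightarrow> real^3. L2 \<phi> \<longrightarrow> continuous_on {0..} (\<lambda>t. \<integral>x. w x t \<bullet> \<phi> x \<partial>lebesgue)" using sd by (auto simp: sol_data_def)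
  have jgu: "(\<lambda>(x, s). Gu x s) \<in> borel_measurable lebesgue" and jgw: "(\<lambda>(x, s). Gw x s) \<in> borel_measurable lebesgue"
    and igu: "set_integrable lebesgue {p :: (real^3) \<times> real. snd p > 0} (\<lambda>(x,s). (norm (Gu x s))\<^sup>2)"
    and igw: "set_integrable lebesgue {p :: (real^3) \<times> real. snd p > 0} (\<lambda>(x,s). (norm (Gw x s))\<^sup>2)"
    and gu: "AE s in lebesgue. s > 0 \<longrightarrow> weak_grad (\<lambda>x. u x s) (\<lambda>x. Gu x s)" using go by (auto simp: grads_ok_def)
  have cc: "\<bar>A $ b $ j\<bar> \<le> norm A" for A :: "real^3^3" and b j
    by (rule order_trans[OF component_le_norm_cart Finite_Cartesian_Product.norm_nth_le])
  have cn: "continuous_on UNIV (\<lambda>A :: real^3. A $ b)" for b by (intro continuous_intros)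
  have cnn: "continuous_on UNIV (\<lambda>A :: real^3^3. A $ b $ j)" for b j by (intro continuous_intros)
  have test: "vtest_fun (\<lambda>x. \<chi> b. \<phi> b x)" if "\<And>b. test_fun (\<phi> b)" for \<phi> :: "3 \<Rightarrow> real^3 \<Rightarrow> real"
    using that by (simp add: vtest_fun_def)
  have dvg: "vdiv (\<lambda>x. \<chi> b. \<phi> b x) x = (\<Sum>j\<in>UNIV. pd [j] (\<phi> j) x)" for \<phi> :: "3 \<Rightarrow> real^3 \<Rightarrow> real" and x
    by (simp add: vdiv_def del: pd.simps)
  have grd: "G \<bullet> vgrad (\<lambda>x. \<chi> b. \<phi> b x) x = (\<Sum>b\<in>UNIV. \<Sum>j\<in>UNIV. G $ b $ j * pd [j] (\<phi> b) x)" for \<phi> :: "3 \<Rightarrow> real^3 \<Rightarrow> real" and x and G :: "real^3^3"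
    by (simp add: inner_vec_def vgrad_def del: pd.simps)
  have cnv: "(G *v a) \<bullet> (\<chi> b. \<phi> b x) = (\<Sum>b\<in>UNIV. \<Sum>j\<in>UNIV. G $ b $ j * (a $ j * \<phi> b x))" for \<phi> :: "3 \<Rightarrow> real^3 \<Rightarrow> real" and x and G :: "real^3^3" and a
    by (simp add: inner_vec_def matrix_vector_mult_def sum_distrib_right mult.assoc)
  \<comment> \<open>The component index of the curl occupies the last place of \<open>eps3\<close>
    here and the first place in the next identity; antisymmetry accounts for the minus sign.\<close>
  have crw: "- (curl3 G \<bullet> (\<chi> b. \<phi> b x)) = (\<Sum>i\<in>UNIV. \<Sum>j\<in>UNIV. \<Sum>b\<in>UNIV. eps3 i j b * (G $ i $ j * \<phi> b x))" for \<phi> :: "3 \<Rightarrow> real^3 \<Rightarrow> real" and x and G :: "real^3^3"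
    by (simp add: inner_vec_def curl3_def vector_3 sum_3 eps3_def algebra_simps)
  have cru: "curl3 G \<bullet> (\<chi> b. \<phi> b x) = (\<Sum>i\<in>UNIV. \<Sum>j\<in>UNIV. \<Sum>b\<in>UNIV. eps3 i j b * (G $ b $ j * \<phi> i x))" for \<phi> :: "3 \<Rightarrow> real^3 \<Rightarrow> real" and x and G :: "real^3^3"
    by (simp add: inner_vec_def curl3_def vector_3 sum_3 eps3_def algebra_simps)
  have dcrl: "vdiv (\<lambda>x. \<chi> i. crl eps3 \<phi> i x) x = 0" if \<phi>: "sol \<phi>" for \<phi> x
  proof -
    have c: "pd [i, j] (\<phi> b) = pd [j, i] (\<phi> b)" for i j b using \<phi> by (intro ctest_comm) (auto simp: sol_def)
    have "vdiv (\<lambda>x. \<chi> i. crl eps3 \<phi> i x) x = (\<Sum>i\<in>UNIV. \<Sum>j\<in>UNIV. \<Sum>b\<in>UNIV. eps3 i j b * pd ([i] @ [j]) (\<phi> b) x)"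
      unfolding dvg pd_crl[OF \<phi>] ..
    also have "\<dots> = 0"
      unfolding append.simps using c[of 1 2] c[of 1 3] c[of 2 3] by (simp add: sum_3 eps3_def del: pd.simps)
    finally show ?thesis .
  qed
  show ?thesis
  proof (rule leray_damped[where uf="\<lambda>b x t. u x t $ b" and wf="\<lambda>i x t. w x t $ i" and guf="\<lambda>b j x s. Gu x s $ b $ j" and gwf="\<lambda>i j x s. Gw x s $ i $ j" and e=eps3])
    show "(\<lambda>(x, t). u x t $ b) \<in> borel_measurable lebesgue" for b by (rule joint_component[OF ju cn])
    show "(\<lambda>(x, t). w x t $ b) \<in> borel_measurable lebesgue" for b by (rule joint_component[OF jw cn])
    show mgu: "(\<lambda>(x, t). Gu x t $ b $ j) \<in> borel_measurable lebesgue" for b j by (rule joint_component[OF jgu cnn])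
    show mgw: "(\<lambda>(x, t). Gw x t $ b $ j) \<in> borel_measurable lebesgue" for b j by (rule joint_component[OF jgw cnn])
    show "(\<lambda>x. u x t $ b) \<in> borel_measurable lebesgue" "integrable lebesgue (\<lambda>x. (u x t $ b)\<^sup>2)" if "t \<ge> 0" for b t by (rule L2_component[OF uL(1)[OF that]])+
    show "(\<lambda>x. w x t $ b) \<in> borel_measurable lebesgue" "integrable lebesgue (\<lambda>x. (w x t $ b)\<^sup>2)" if "t \<ge> 0" for b t by (rule L2_component[OF uL(3)[OF that]])+
    show "continuous_on {0..} (\<lambda>t. \<integral>x. u x t $ b * p x \<partial>lebesgue)" if "sqint p" for b p by (rule weakly_continuous_component[OF cu that])
    show "continuous_on {0..} (\<lambda>t. \<integral>x. w x t $ b * p x \<partial>lebesgue)" if "sqint p" for b p by (rule weakly_continuous_component[OF cw that])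
    show "nrm (\<lambda>b. bv (\<lambda>x. u x t $ b)) \<le> znorm u0 w0" if "t \<ge> 0" for t
      using energy_bound(1)[OF sd en pos that] L2norm_components[OF uL(1)[OF that]] by (simp add: nrm_def)
    show "n2 (bv (\<lambda>x. w x t $ i)) \<le> znorm u0 w0" if "t \<ge> 0" for t i
      using energy_bound(2)[OF sd en pos that] L2norm_components[OF uL(3)[OF that]] n2_le_nrm[of "\<lambda>i. bv (\<lambda>x. w x t $ i)" i] by (simp add: nrm_def)
    show "(\<Sum>j\<in>UNIV. \<integral>x. bv (\<lambda>x. u x t $ j) x * pd [j] \<psi> x \<partial>lborel) = 0" if "t \<ge> 0" "test_fun \<psi>" for t \<psi>
      by (rule div_free_bv[OF uL(1,2)[OF that(1)] that(2)])
    show "set_integrable lebesgue {p :: (real^3) \<times> real. snd p > 0} (\<lambda>(x, t). (Gu x t $ b $ j)\<^sup>2)" for b j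
      by (rule component_set_integrable[OF igu mgu cc])
    show "set_integrable lebesgue {p :: (real^3) \<times> real. snd p > 0} (\<lambda>(x, t). (Gw x t $ b $ j)\<^sup>2)" for b j
      by (rule component_set_integrable[OF igw mgw cc])
    show "AE s in lebesgue. s > 0 \<longrightarrow> (\<forall>b j. weak_deriv [j] (\<lambda>x. u x s $ b) (\<lambda>x. Gu x s $ b $ j))" using gu by (simp add: weak_grad_def)
    show "AE s in lebesgue. s > 0 \<longrightarrow> (\<forall>b j. weak_deriv [j] (\<lambda>x. w x s $ b) (\<lambda>x. Gw x s $ b $ j))" using gw by (simp add: weak_grad_def)
    fix \<phi> :: "3 \<Rightarrow> real^3 \<Rightarrow> real" assume \<phi>: "sol \<phi>"
    let ?\<Phi> = "\<lambda>x. \<chi> b. \<phi> b x" and ?\<Psi> = "\<lambda>x. \<chi> i. crl eps3 \<phi> i x"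
    have t\<phi>: "test_fun (\<phi> b)" for b by (rule sol_test[OF \<phi>])
    have tc: "test_fun (crl eps3 \<phi> i)" for i by (rule crl_test[OF \<phi>])
    have t\<Psi>: "vtest_fun ?\<Psi>" by (rule test) (rule tc)
    have d0: "\<forall>x. vdiv ?\<Phi> x = 0" using \<phi> unfolding dvg by (simp add: sol_def)
    have id1: "(\<mu> + \<xi>) * (Gu x s \<bullet> vgrad ?\<Phi> x) + (Gu x s *v u x s) \<bullet> ?\<Phi> x - 2 * \<xi> * (curl3 (Gw x s) \<bullet> ?\<Phi> x)
       = (\<mu> + \<xi>) * (\<Sum>b\<in>UNIV. \<Sum>j\<in>UNIV. Gu x s $ b $ j * pd [j] (\<phi> b) x) + (\<Sum>b\<in>UNIV. \<Sum>j\<in>UNIV. Gu x s $ b $ j * (u x s $ j * \<phi> b x))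
        + 2 * \<xi> * (\<Sum>i\<in>UNIV. \<Sum>j\<in>UNIV. \<Sum>b\<in>UNIV. eps3 i j b * (Gw x s $ i $ j * \<phi> b x))" for x s
      unfolding grd cnv crw[symmetric] by simp
    have id2: "\<nu> * (Gw x s \<bullet> vgrad ?\<Psi> x) + \<kappa> * (\<Sum>i\<in>UNIV. Gw x s $ i $ i) * vdiv ?\<Psi> x
               + (Gw x s *v u x s) \<bullet> ?\<Psi> x + 4 * \<xi> * (w x s \<bullet> ?\<Psi> x) - 2 * \<xi> * (curl3 (Gu x s) \<bullet> ?\<Psi> x)
       = \<nu> * (\<Sum>i\<in>UNIV. \<Sum>j\<in>UNIV. Gw x s $ i $ j * pd [j] (crl eps3 \<phi> i) x) + (\<Sum>i\<in>UNIV. \<Sum>j\<in>UNIV. Gw x s $ i $ j * (u x s $ j * crl eps3 \<phi> i x))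
        + 4 * \<xi> * (\<Sum>i\<in>UNIV. w x s $ i * crl eps3 \<phi> i x) - 2 * \<xi> * (\<Sum>i\<in>UNIV. \<Sum>j\<in>UNIV. \<Sum>b\<in>UNIV. eps3 i j b * (Gu x s $ b $ j * crl eps3 \<phi> i x))" for x s
      unfolding grd cnv cru dcrl[OF \<phi>] by (simp add: inner_vec_def del: pd.simps)
    show "\<exists>a0. \<forall>t\<ge>0. pr (\<lambda>b. bv (\<lambda>x. u x t $ b)) \<phi> - a0 + set_lebesgue_integral lebesgue {0..t} (\<lambda>s. \<integral>x.
        (\<mu> + \<xi>) * (\<Sum>b\<in>UNIV. \<Sum>j\<in>UNIV. Gu x s $ b $ j * pd [j] (\<phi> b) x) + (\<Sum>b\<in>UNIV. \<Sum>j\<in>UNIV. Gu x s $ b $ j * (u x s $ j * \<phi> b x))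
        + 2 * \<xi> * (\<Sum>i\<in>UNIV. \<Sum>j\<in>UNIV. \<Sum>b\<in>UNIV. eps3 i j b * (Gw x s $ i $ j * \<phi> b x)) \<partial>lebesgue) = 0"
    proof (rule exI, intro allI impI)
      fix t :: real assume t: "t \<ge> 0"
      show "pr (\<lambda>b. bv (\<lambda>x. u x t $ b)) \<phi> - (\<integral>x. u0 x \<bullet> ?\<Phi> x \<partial>lebesgue) + set_lebesgue_integral lebesgue {0..t} (\<lambda>s. \<integral>x.
        (\<mu> + \<xi>) * (\<Sum>b\<in>UNIV. \<Sum>j\<in>UNIV. Gu x s $ b $ j * pd [j] (\<phi> b) x) + (\<Sum>b\<in>UNIV. \<Sum>j\<in>UNIV. Gu x s $ b $ j * (u x s $ j * \<phi> b x))
        + 2 * \<xi> * (\<Sum>i\<in>UNIV. \<Sum>j\<in>UNIV. \<Sum>b\<in>UNIV. eps3 i j b * (Gw x s $ i $ j * \<phi> b x)) \<partial>lebesgue) = 0"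
        using Pu[OF test[OF t\<phi>] d0 t] unfolding id1 pr_def L2_inner_bv[OF uL(1)[OF t] test_fun_sqint(1)[OF t\<phi>]] .
    qed
    show "\<exists>a0. \<forall>t\<ge>0. (\<Sum>i\<in>UNIV. \<integral>x. bv (\<lambda>x. w x t $ i) x * crl eps3 \<phi> i x \<partial>lborel) - a0 + set_lebesgue_integral lebesgue {0..t} (\<lambda>s. \<integral>x.
        \<nu> * (\<Sum>i\<in>UNIV. \<Sum>j\<in>UNIV. Gw x s $ i $ j * pd [j] (crl eps3 \<phi> i) x) + (\<Sum>i\<in>UNIV. \<Sum>j\<in>UNIV. Gw x s $ i $ j * (u x s $ j * crl eps3 \<phi> i x))
        + 4 * \<xi> * (\<Sum>i\<in>UNIV. w x s $ i * crl eps3 \<phi> i x) - 2 * \<xi> * (\<Sum>i\<in>UNIV. \<Sum>j\<in>UNIV. \<Sum>b\<in>UNIV. eps3 i j b * (Gu x s $ b $ j * crl eps3 \<phi> i x)) \<partial>lebesgue) = 0"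
    proof (rule exI, intro allI impI)
      fix t :: real assume t: "t \<ge> 0"
      show "(\<Sum>i\<in>UNIV. \<integral>x. bv (\<lambda>x. w x t $ i) x * crl eps3 \<phi> i x \<partial>lborel) - (\<integral>x. w0 x \<bullet> ?\<Psi> x \<partial>lebesgue) + set_lebesgue_integral lebesgue {0..t} (\<lambda>s. \<integral>x.
        \<nu> * (\<Sum>i\<in>UNIV. \<Sum>j\<in>UNIV. Gw x s $ i $ j * pd [j] (crl eps3 \<phi> i) x) + (\<Sum>i\<in>UNIV. \<Sum>j\<in>UNIV. Gw x s $ i $ j * (u x s $ j * crl eps3 \<phi> i x))
        + 4 * \<xi> * (\<Sum>i\<in>UNIV. w x s $ i * crl eps3 \<phi> i x) - 2 * \<xi> * (\<Sum>i\<in>UNIV. \<Sum>j\<in>UNIV. \<Sum>b\<in>UNIV. eps3 i j b * (Gu x s $ b $ j * crl eps3 \<phi> i x)) \<partial>lebesgue) = 0"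
        using Pw[OF t\<Psi> t] unfolding id2 L2_inner_bv[where p="crl eps3 \<phi>", OF uL(3)[OF t] test_fun_sqint(1)[OF tc]] .
    qed
  qed (simp_all add: eps3_bound eps3_contract)
qed

text \<open>As in dimension three, with w viewed as a family over the one-element index type and the
  scalar curl of \<open>\<phi>\<close> as test function for the spin equation.\<close>

lemma leray2_damped:
  assumes l: "leray2 \<mu> \<nu> \<xi> u0 w0 u w" and pos: "\<mu> > 0" "\<nu> > 0"
  shows "damped \<mu> \<nu> \<xi> (znorm u0 w0) (\<lambda>s b. bv (\<lambda>x. u x s $ b)) (\<lambda>\<phi> s. \<Sum>i\<in>UNIV. \<integral>x. bv (\<lambda>x. w x s) x * crl eps2 \<phi> i x \<partial>lborel)"
proof -
  obtain Gu Gw where sd: "sol_data u0 w0 u w" and go: "grads_ok u Gu Gw"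
    and gw: "AE s in lebesgue. s > 0 \<longrightarrow> weak_grad_s (\<lambda>x. w x s) (\<lambda>x. Gw x s)"
    and Pu: "\<And>\<phi> t. vtest_fun \<phi> \<Longrightarrow> (\<forall>x. vdiv \<phi> x = 0) \<Longrightarrow> t \<ge> 0 \<Longrightarrow>
          (\<integral>x. u x t \<bullet> \<phi> x \<partial>lebesgue) - (\<integral>x. u0 x \<bullet> \<phi> x \<partial>lebesgue)
          + set_lebesgue_integral lebesgue {0..t} (\<lambda>s. \<integral>x.
               (\<mu> + \<xi>) * (Gu x s \<bullet> vgrad \<phi> x) + (Gu x s *v u x s) \<bullet> \<phi> x
               - 2 * \<xi> * (curl2s (Gw x s) \<bullet> \<phi> x) \<partial>lebesgue) = 0"
    and Pw: "\<And>\<psi> t. test_fun \<psi> \<Longrightarrow> t \<ge> 0 \<Longrightarrow>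
          (\<integral>x. w x t * \<psi> x \<partial>lebesgue) - (\<integral>x. w0 x * \<psi> x \<partial>lebesgue)
          + set_lebesgue_integral lebesgue {0..t} (\<lambda>s. \<integral>x.
               \<nu> * (Gw x s \<bullet> sgrad \<psi> x) + (Gw x s \<bullet> u x s) * \<psi> x + 4 * \<xi> * (w x s * \<psi> x)
               - 2 * \<xi> * (curl2v (Gu x s) * \<psi> x) \<partial>lebesgue) = 0"
    and en: "energy_ineq \<mu> \<nu> u w Gu Gw"
    using l unfolding leray2_def by (elim conjE exE) (rule that, auto)
  have uL: "L2 (\<lambda>x. u x t)" "div_free (\<lambda>x. u x t)" "L2 (\<lambda>x. w x t)" if "t \<ge> 0" for t using sd that by (auto simp: sol_data_def)
  have ju: "(\<lambda>(x, t). u x t) \<in> borel_measurable lebesgue" and jw: "(\<lambda>(x, t). w x t) \<in> borel_measurable lebesgue" using sd by (auto simp: sol_data_def)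
  have cu: "\<forall>\<phi>::real^2 \<Rightarrow> real^2. L2 \<phi> \<longrightarrow> continuous_on {0..} (\<lambda>t. \<integral>x. u x t \<bullet> \<phi> x \<partial>lebesgue)"
    and cw: "\<forall>\<phi>::real^2 \<Rightarrow> real. L2 \<phi> \<longrightarrow> continuous_on {0..} (\<lambda>t. \<integral>x. w x t \<bullet> \<phi> x \<partial>lebesgue)" using sd by (auto simp: sol_data_def)
  have jgu: "(\<lambda>(x, s). Gu x s) \<in> borel_measurable lebesgue" and jgw: "(\<lambda>(x, s). Gw x s) \<in> borel_measurable lebesgue"
    and igu: "set_integrable lebesgue {p :: (real^2) \<times> real. snd p > 0} (\<lambda>(x,s). (norm (Gu x s))\<^sup>2)"
    and igw: "set_integrable lebesgue {p :: (real^2) \<times> real. snd p > 0} (\<lambda>(x,s). (norm (Gw x s))\<^sup>2)"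
    and gu: "AE s in lebesgue. s > 0 \<longrightarrow> weak_grad (\<lambda>x. u x s) (\<lambda>x. Gu x s)" using go by (auto simp: grads_ok_def)
  have wm: "(\<lambda>x. w x t) \<in> borel_measurable lebesgue" "integrable lebesgue (\<lambda>x. (w x t)\<^sup>2)" if "t \<ge> 0" for t
    using uL(3)[OF that] by (auto simp: L2_def)
  have cc: "\<bar>A $ b $ j\<bar> \<le> norm A" for A :: "real^2^2" and b j
    by (rule order_trans[OF component_le_norm_cart Finite_Cartesian_Product.norm_nth_le])
  have cn: "continuous_on UNIV (\<lambda>A :: real^2. A $ b)" for b by (intro continuous_intros)
  have cnn: "continuous_on UNIV (\<lambda>A :: real^2^2. A $ b $ j)" for b j by (intro continuous_intros)
  have test: "vtest_fun (\<lambda>x. \<chi> b. \<phi> b x)" if "\<And>b. test_fun (\<phi> b)" for \<phi> :: "2 \<Rightarrow> real^2 \<Rightarrow> real"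
    using that by (simp add: vtest_fun_def)
  have dvg: "vdiv (\<lambda>x. \<chi> b. \<phi> b x) x = (\<Sum>j\<in>UNIV. pd [j] (\<phi> j) x)" for \<phi> :: "2 \<Rightarrow> real^2 \<Rightarrow> real" and x
    by (simp add: vdiv_def del: pd.simps)
  have grd: "G \<bullet> vgrad (\<lambda>x. \<chi> b. \<phi> b x) x = (\<Sum>b\<in>UNIV. \<Sum>j\<in>UNIV. G $ b $ j * pd [j] (\<phi> b) x)" for \<phi> :: "2 \<Rightarrow> real^2 \<Rightarrow> real" and x and G :: "real^2^2"
    by (simp add: inner_vec_def vgrad_def del: pd.simps)
  have cnv: "(G *v a) \<bullet> (\<chi> b. \<phi> b x) = (\<Sum>b\<in>UNIV. \<Sum>j\<in>UNIV. G $ b $ j * (a $ j * \<phi> b x))" for \<phi> :: "2 \<Rightarrow> real^2 \<Rightarrow> real" and x and G :: "real^2^2" and a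
    by (simp add: inner_vec_def matrix_vector_mult_def sum_distrib_right mult.assoc)
  have crw: "- (curl2s g \<bullet> (\<chi> b. \<phi> b x)) = (\<Sum>i\<in>UNIV. \<Sum>j\<in>UNIV. \<Sum>b\<in>UNIV. eps2 i j b * (g $ j * \<phi> b x))" for \<phi> :: "2 \<Rightarrow> real^2 \<Rightarrow> real" and x and g :: "real^2"
    by (simp add: inner_vec_def curl2s_def vector_2 sum_2 UNIV_unit eps2_def algebra_simps)
  have cru: "curl2v G * (\<psi> :: unit \<Rightarrow> real) () = (\<Sum>i\<in>UNIV. \<Sum>j\<in>UNIV. \<Sum>b\<in>UNIV. eps2 i j b * (G $ b $ j * \<psi> i))" for \<psi> and G :: "real^2^2"
    by (simp add: curl2v_def sum_2 UNIV_unit eps2_def algebra_simps)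
  show ?thesis
  proof (rule leray_damped[where uf="\<lambda>b x t. u x t $ b" and wf="\<lambda>i x t. w x t" and guf="\<lambda>b j x s. Gu x s $ b $ j" and gwf="\<lambda>i j x s. Gw x s $ j" and e=eps2])
    show "(\<lambda>(x, t). u x t $ b) \<in> borel_measurable lebesgue" for b by (rule joint_component[OF ju cn])
    show "(\<lambda>(x, t). w x t) \<in> borel_measurable lebesgue" by (rule jw)
    show mgu: "(\<lambda>(x, t). Gu x t $ b $ j) \<in> borel_measurable lebesgue" for b j by (rule joint_component[OF jgu cnn])
    show mgw: "(\<lambda>(x, t). Gw x t $ j) \<in> borel_measurable lebesgue" for j by (rule joint_component[OF jgw cn])
    show "(\<lambda>x. u x t $ b) \<in> borel_measurable lebesgue" "integrable lebesgue (\<lambda>x. (u x t $ b)\<^sup>2)" if "t \<ge> 0" for b t by (rule L2_component[OF uL(1)[OF that]])+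
    show "(\<lambda>x. w x t) \<in> borel_measurable lebesgue" "integrable lebesgue (\<lambda>x. (w x t)\<^sup>2)" if "t \<ge> 0" for t by (rule wm[OF that])+
    show "continuous_on {0..} (\<lambda>t. \<integral>x. u x t $ b * p x \<partial>lebesgue)" if "sqint p" for b p by (rule weakly_continuous_component[OF cu that])
    show "continuous_on {0..} (\<lambda>t. \<integral>x. w x t * p x \<partial>lebesgue)" if p: "sqint p" for p
    proof -
      have "integrable lebesgue (\<lambda>x. (p x)\<^sup>2)" using p by (subst integrable_completion) (auto simp: sqint_def)
      moreover have "p \<in> borel_measurable lebesgue" by (rule measurable_completion) (use p in \<open>simp add: sqint_def\<close>)
      ultimately have "L2 p" by (simp add: L2_def)
      with cw show ?thesis by (simp add: inner_real_def)
    qed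
    show "nrm (\<lambda>b. bv (\<lambda>x. u x t $ b)) \<le> znorm u0 w0" if "t \<ge> 0" for t
      using energy_bound(1)[OF sd en pos that] L2norm_components[OF uL(1)[OF that]] by (simp add: nrm_def)
    show "n2 (bv (\<lambda>x. w x t)) \<le> znorm u0 w0" if "t \<ge> 0" for t
    proof -
      have "n2 (bv (\<lambda>x. w x t)) = L2norm (\<lambda>x. w x t)"
        using bv_sqint(2)[OF wm[OF that]] by (simp add: L2norm_def real_sqrt_unique)
      then show ?thesis using energy_bound(2)[OF sd en pos that] by simp
    qed
    show "(\<Sum>j\<in>UNIV. \<integral>x. bv (\<lambda>x. u x t $ j) x * pd [j] \<psi> x \<partial>lborel) = 0" if "t \<ge> 0" "test_fun \<psi>" for t \<psi>
      by (rule div_free_bv[OF uL(1,2)[OF that(1)] that(2)])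
    show "set_integrable lebesgue {p :: (real^2) \<times> real. snd p > 0} (\<lambda>(x, t). (Gu x t $ b $ j)\<^sup>2)" for b j
      by (rule component_set_integrable[OF igu mgu cc])
    show "set_integrable lebesgue {p :: (real^2) \<times> real. snd p > 0} (\<lambda>(x, t). (Gw x t $ j)\<^sup>2)" for j
      by (rule component_set_integrable[OF igw mgw component_le_norm_cart])
    show "AE s in lebesgue. s > 0 \<longrightarrow> (\<forall>b j. weak_deriv [j] (\<lambda>x. u x s $ b) (\<lambda>x. Gu x s $ b $ j))" using gu by (simp add: weak_grad_def)
    show "AE s in lebesgue. s > 0 \<longrightarrow> (\<forall>(i::unit) j. weak_deriv [j] (\<lambda>x. w x s) (\<lambda>x. Gw x s $ j))" using gw by (simp add: weak_grad_s_def)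
    fix \<phi> :: "2 \<Rightarrow> real^2 \<Rightarrow> real" assume \<phi>: "sol \<phi>"
    let ?\<Phi> = "\<lambda>x. \<chi> b. \<phi> b x" and ?\<psi> = "crl eps2 \<phi> ()"
    have t\<phi>: "test_fun (\<phi> b)" for b by (rule sol_test[OF \<phi>])
    have tc: "test_fun (crl eps2 \<phi> i)" for i by (rule crl_test[OF \<phi>])
    have d0: "\<forall>x. vdiv ?\<Phi> x = 0" using \<phi> unfolding dvg by (simp add: sol_def)
    have id1: "(\<mu> + \<xi>) * (Gu x s \<bullet> vgrad ?\<Phi> x) + (Gu x s *v u x s) \<bullet> ?\<Phi> x - 2 * \<xi> * (curl2s (Gw x s) \<bullet> ?\<Phi> x)
       = (\<mu> + \<xi>) * (\<Sum>b\<in>UNIV. \<Sum>j\<in>UNIV. Gu x s $ b $ j * pd [j] (\<phi> b) x) + (\<Sum>b\<in>UNIV. \<Sum>j\<in>UNIV. Gu x s $ b $ j * (u x s $ j * \<phi> b x))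
        + 2 * \<xi> * (\<Sum>i\<in>UNIV. \<Sum>j\<in>UNIV. \<Sum>b\<in>UNIV. eps2 i j b * (Gw x s $ j * \<phi> b x))" for x s
      unfolding grd cnv crw[symmetric] by simp
    have id2: "\<nu> * (Gw x s \<bullet> sgrad ?\<psi> x) + (Gw x s \<bullet> u x s) * ?\<psi> x + 4 * \<xi> * (w x s * ?\<psi> x) - 2 * \<xi> * (curl2v (Gu x s) * ?\<psi> x)
       = \<nu> * (\<Sum>i\<in>UNIV. \<Sum>j\<in>UNIV. Gw x s $ j * pd [j] (crl eps2 \<phi> i) x) + (\<Sum>i\<in>(UNIV::unit set). \<Sum>j\<in>UNIV. Gw x s $ j * (u x s $ j * crl eps2 \<phi> i x))
        + 4 * \<xi> * (\<Sum>i\<in>UNIV. w x s * crl eps2 \<phi> i x) - 2 * \<xi> * (\<Sum>i\<in>UNIV. \<Sum>j\<in>UNIV. \<Sum>b\<in>UNIV. eps2 i j b * (Gu x s $ b $ j * crl eps2 \<phi> i x))" for x s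
      unfolding cru[of _ "\<lambda>i. crl eps2 \<phi> i x"] by (simp add: inner_vec_def sgrad_def UNIV_unit sum_distrib_right mult.assoc del: pd.simps)
    show "\<exists>a0. \<forall>t\<ge>0. pr (\<lambda>b. bv (\<lambda>x. u x t $ b)) \<phi> - a0 + set_lebesgue_integral lebesgue {0..t} (\<lambda>s. \<integral>x.
        (\<mu> + \<xi>) * (\<Sum>b\<in>UNIV. \<Sum>j\<in>UNIV. Gu x s $ b $ j * pd [j] (\<phi> b) x) + (\<Sum>b\<in>UNIV. \<Sum>j\<in>UNIV. Gu x s $ b $ j * (u x s $ j * \<phi> b x))
        + 2 * \<xi> * (\<Sum>i\<in>UNIV. \<Sum>j\<in>UNIV. \<Sum>b\<in>UNIV. eps2 i j b * (Gw x s $ j * \<phi> b x)) \<partial>lebesgue) = 0"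
    proof (rule exI, intro allI impI)
      fix t :: real assume t: "t \<ge> 0"
      show "pr (\<lambda>b. bv (\<lambda>x. u x t $ b)) \<phi> - (\<integral>x. u0 x \<bullet> ?\<Phi> x \<partial>lebesgue) + set_lebesgue_integral lebesgue {0..t} (\<lambda>s. \<integral>x.
        (\<mu> + \<xi>) * (\<Sum>b\<in>UNIV. \<Sum>j\<in>UNIV. Gu x s $ b $ j * pd [j] (\<phi> b) x) + (\<Sum>b\<in>UNIV. \<Sum>j\<in>UNIV. Gu x s $ b $ j * (u x s $ j * \<phi> b x))
        + 2 * \<xi> * (\<Sum>i\<in>UNIV. \<Sum>j\<in>UNIV. \<Sum>b\<in>UNIV. eps2 i j b * (Gw x s $ j * \<phi> b x)) \<partial>lebesgue) = 0"
        using Pu[OF test[OF t\<phi>] d0 t] unfolding id1 pr_def L2_inner_bv[OF uL(1)[OF t] test_fun_sqint(1)[OF t\<phi>]] .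
    qed
    show "\<exists>a0. \<forall>t\<ge>0. (\<Sum>i\<in>UNIV. \<integral>x. bv (\<lambda>x. w x t) x * crl eps2 \<phi> i x \<partial>lborel) - a0 + set_lebesgue_integral lebesgue {0..t} (\<lambda>s. \<integral>x.
        \<nu> * (\<Sum>i\<in>UNIV. \<Sum>j\<in>UNIV. Gw x s $ j * pd [j] (crl eps2 \<phi> i) x) + (\<Sum>i\<in>(UNIV::unit set). \<Sum>j\<in>UNIV. Gw x s $ j * (u x s $ j * crl eps2 \<phi> i x))
        + 4 * \<xi> * (\<Sum>i\<in>UNIV. w x s * crl eps2 \<phi> i x) - 2 * \<xi> * (\<Sum>i\<in>UNIV. \<Sum>j\<in>UNIV. \<Sum>b\<in>UNIV. eps2 i j b * (Gu x s $ b $ j * crl eps2 \<phi> i x)) \<partial>lebesgue) = 0"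
    proof (rule exI, intro allI impI)
      fix t :: real assume t: "t \<ge> 0"
      have pw: "(\<Sum>i\<in>UNIV. \<integral>x. bv (\<lambda>x. w x t) x * crl eps2 \<phi> i x \<partial>lborel) = (\<integral>x. w x t * ?\<psi> x \<partial>lebesgue)"
        using lebesgue_pairing_bv[OF wm(1)[OF t] test_fun_measurable[OF tc[of "()"]]] by (simp add: UNIV_unit)
      show "(\<Sum>i\<in>UNIV. \<integral>x. bv (\<lambda>x. w x t) x * crl eps2 \<phi> i x \<partial>lborel) - (\<integral>x. w0 x * ?\<psi> x \<partial>lebesgue) + set_lebesgue_integral lebesgue {0..t} (\<lambda>s. \<integral>x.
        \<nu> * (\<Sum>i\<in>UNIV. \<Sum>j\<in>UNIV. Gw x s $ j * pd [j] (crl eps2 \<phi> i) x) + (\<Sum>i\<in>(UNIV::unit set). \<Sum>j\<in>UNIV. Gw x s $ j * (u x s $ j * crl eps2 \<phi> i x))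
        + 4 * \<xi> * (\<Sum>i\<in>UNIV. w x s * crl eps2 \<phi> i x) - 2 * \<xi> * (\<Sum>i\<in>UNIV. \<Sum>j\<in>UNIV. \<Sum>b\<in>UNIV. eps2 i j b * (Gu x s $ b $ j * crl eps2 \<phi> i x)) \<partial>lebesgue) = 0"
        using Pw[OF tc[of "()"] t] unfolding id2 pw .
    qed
  qed (simp_all add: eps2_bound eps2_contract)
qed

section \<open>Lower bounds by duality and the final statement\<close>

lemma Dm_norm_lower_bound:
  fixes v :: "real^'n::finite \<Rightarrow> real^'k::finite"
  assumes X: "\<And>D. D \<ge> 0 \<Longrightarrow> (\<And>b js \<theta>. length js = m \<Longrightarrow> test_fun \<theta> \<Longrightarrow> \<bar>\<integral>x. bv (\<lambda>x. v x $ b) x * pd js \<theta> x \<partial>lborel\<bar> \<le> D * n2 \<theta>) \<Longrightarrow> X \<le> D"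
  shows "ereal X \<le> Dm_norm m v"
proof (cases "Dm_sq m v = \<infinity>")
  case True
  then show ?thesis by (simp add: Dm_norm_def)
next
  case False
  let ?g = "\<lambda>b js. SOME g. weak_deriv js (\<lambda>x. v x $ b) g"
  have ex: "\<forall>i (js::'n list). length js = m \<longrightarrow> (\<exists>g. weak_deriv js (\<lambda>x. v x $ i) g)"
    using False unfolding Dm_sq_def by presburger
  then have sq: "Dm_sq m v = (\<Sum>i\<in>UNIV. \<Sum>js\<in>{js::'n list. length js = m}. \<integral>\<^sup>+x. ennreal ((?g i js x)\<^sup>2) \<partial>lebesgue)"
    unfolding Dm_sq_def by (rule if_P)
  define D where "D = sqrt (enn2real (Dm_sq m v))"
  have D0: "D \<ge> 0" by (simp add: D_def)
  have DD: "Dm_sq m v = ennreal (D\<^sup>2)" using False by (simp add: D_def less_top)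
  have fin: "finite {js::'n list. length js = m}" using finite_lists_length_eq[of "UNIV::'n set" m] by simp
  have "\<bar>\<integral>x. bv (\<lambda>x. v x $ b) x * pd js \<theta> x \<partial>lborel\<bar> \<le> D * n2 \<theta>" if js: "length js = m" and \<theta>: "test_fun \<theta>" for b js \<theta>
  proof -
    \<comment> \<open>Every weak derivative selected in \<open>Dm_sq\<close> has L2 norm at most D,
      so Cauchy-Schwarz bounds all pairings with m-th derivatives by D, which is the hypothesis on D
      in the dual formulation. An infinite \<open>Dm_sq\<close> needs no argument.\<close>
    have wd: "weak_deriv js (\<lambda>x. v x $ b) (?g b js)" by (rule someI_ex[of "weak_deriv js (\<lambda>x. v x $ b)"]) (use ex js in blast)
    have "weak_deriv js f g \<Longrightarrow> g \<in> borel_measurable lebesgue" for f g by (simp add: weak_deriv_def loc_int_def)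
    then have gm: "?g b js \<in> borel_measurable lebesgue" using wd .
    have "(\<integral>\<^sup>+x. ennreal ((?g b js x)\<^sup>2) \<partial>lebesgue) \<le> (\<Sum>js\<in>{js::'n list. length js = m}. \<integral>\<^sup>+x. ennreal ((?g b js x)\<^sup>2) \<partial>lebesgue)"
      by (rule member_le_sum) (use js fin in auto)
    also have "\<dots> \<le> Dm_sq m v" unfolding sq
      by (rule member_le_sum[of b UNIV "\<lambda>b. \<Sum>js\<in>{js::'n list. length js = m}. \<integral>\<^sup>+x. ennreal ((?g b js x)\<^sup>2) \<partial>lebesgue"]) auto
    finally have nn: "(\<integral>\<^sup>+x. ennreal ((?g b js x)\<^sup>2) \<partial>lebesgue) \<le> ennreal (D\<^sup>2)" unfolding DD .
    have int: "integrable lebesgue (\<lambda>x. (?g b js x)\<^sup>2)"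
      unfolding integrable_iff_bounded using nn gm by (auto intro: order.strict_trans1)
    have "ennreal (\<integral>x. (?g b js x)\<^sup>2 \<partial>lebesgue) \<le> ennreal (D\<^sup>2)" using nn int by (simp add: nn_integral_eq_integral)
    then have "(n2 (bv (?g b js)))\<^sup>2 \<le> D\<^sup>2" unfolding bv_sqint(2)[OF gm int] by simp
    then have nD: "n2 (bv (?g b js)) \<le> D" by (rule power2_le_imp_le[OF _ D0])
    have "\<bar>\<integral>x. bv (\<lambda>x. v x $ b) x * pd js \<theta> x \<partial>lborel\<bar> = \<bar>\<integral>x. bv (?g b js) x * \<theta> x \<partial>lborel\<bar>"
      unfolding weak_deriv_bv[OF wd \<theta>] by (simp add: abs_mult power_abs)
    also have "\<dots> \<le> n2 (bv (?g b js)) * n2 \<theta>" by (rule sqint_cauchy_schwarz[OF bv_sqint(1)[OF gm int] test_fun_sqint(1)[OF \<theta>]])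
    also have "\<dots> \<le> D * n2 \<theta>" using nD by (intro mult_right_mono) auto
    finally show ?thesis .
  qed
  then have "X \<le> D" by (rule X[OF D0])
  then show ?thesis using False by (simp add: Dm_norm_def D_def)
qed

text \<open>The existence statements are turned into functions by choice, first
  \<open>\<Gamma>\<close> and then \<open>T\<close> with \<open>\<Gamma>\<close> inserted; their
  argument lists record the admissible dependence. The solution enters only as a damped system, so
  the lemma serves both dimensions.\<close>

lemma uniform_lower_bound:
  assumes n: "CARD('n::finite) \<ge> 2"
  shows "\<exists>(\<Gamma> :: nat \<Rightarrow> real \<Rightarrow> real \<Rightarrow> real \<Rightarrow> real)
      (T :: nat \<Rightarrow> real \<Rightarrow> real \<Rightarrow> real \<Rightarrow> real \<Rightarrow> real \<Rightarrow> real \<Rightarrow> real \<Rightarrow> real \<Rightarrow> real \<Rightarrow> real).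
     \<forall>m \<alpha> c0 C0. \<alpha> > 0 \<and> c0 > 0 \<and> C0 > 0 \<longrightarrow> \<Gamma> m \<alpha> c0 C0 > 0 \<and>
       (\<forall>\<mu> \<nu> \<xi> t0 T0 Z (u :: real^'n \<Rightarrow> real \<Rightarrow> real^'n) \<beta>.
          \<mu> > 0 \<and> \<nu> > 0 \<and> \<xi> > 0 \<and> t0 \<ge> 0 \<and> T0 \<ge> 0 \<and> (\<forall>t\<ge>0. L2 (\<lambda>x. u x t)) \<and>
          damped \<mu> \<nu> \<xi> Z (\<lambda>s b. bv (\<lambda>x. u x s $ b)) \<beta> \<and>
          (\<forall>t > T0. L2norm (\<lambda>x. u x t) \<le> C0 * Z * t powr (-\<alpha>)) \<and>
          (\<forall>t > t0. L2norm (\<lambda>x. u x t) \<ge> c0 * Z * t powr (-\<alpha>))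
          \<longrightarrow> (\<forall>t > T m \<alpha> \<mu> \<nu> \<xi> c0 C0 t0 T0 Z.
                 ereal (\<Gamma> m \<alpha> c0 C0 * c0 * \<mu> powr (- real m / 2) * Z * t powr (-\<alpha> - real m / 2))
                 \<le> Dm_norm m (\<lambda>x. u x t)))"
proof -
  define Q where "Q = (\<lambda>(m::nat) \<alpha> c0 C0 \<Gamma> \<mu> \<nu> \<xi> t0 T0 Z (T::real). T \<ge> 0 \<and>
    (\<forall>(u :: real \<Rightarrow> 'n \<Rightarrow> real^'n \<Rightarrow> real) \<beta>. damped \<mu> \<nu> \<xi> Z u \<beta> \<and>
      (\<forall>t>T0. nrm (u t) \<le> C0 * Z * t powr (- \<alpha>)) \<and> (\<forall>t>t0. c0 * Z * t powr (- \<alpha>) \<le> nrm (u t)) \<longrightarrow>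
      (\<forall>t>T. \<forall>D\<ge>0. (\<forall>b js \<theta>. length js = m \<and> test_fun \<theta> \<longrightarrow> \<bar>\<integral>x. u t b x * pd js \<theta> x \<partial>lborel\<bar> \<le> D * n2 \<theta>) \<longrightarrow>
        \<Gamma> * c0 * \<mu> powr (- real m / 2) * Z * t powr (- \<alpha> - real m / 2) \<le> D)))"
  define \<Gamma> where "\<Gamma> = (\<lambda>m \<alpha> c0 C0. SOME \<Gamma>. \<Gamma> > 0 \<and> (\<forall>\<mu> \<nu> \<xi> t0 T0 Z. \<mu> > 0 \<and> \<nu> > 0 \<and> \<xi> > 0 \<longrightarrow> (\<exists>T. Q m \<alpha> c0 C0 \<Gamma> \<mu> \<nu> \<xi> t0 T0 Z T)))"
  define T where "T = (\<lambda>m \<alpha> \<mu> \<nu> \<xi> c0 C0 t0 T0 Z. SOME T. Q m \<alpha> c0 C0 (\<Gamma> m \<alpha> c0 C0) \<mu> \<nu> \<xi> t0 T0 Z T)"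
  have \<Gamma>: "\<Gamma> m \<alpha> c0 C0 > 0 \<and> (\<forall>\<mu> \<nu> \<xi> t0 T0 Z. \<mu> > 0 \<and> \<nu> > 0 \<and> \<xi> > 0 \<longrightarrow> (\<exists>T. Q m \<alpha> c0 C0 (\<Gamma> m \<alpha> c0 C0) \<mu> \<nu> \<xi> t0 T0 Z T))"
    if "\<alpha> > 0" "c0 > 0" "C0 > 0" for m \<alpha> c0 C0
  proof -
    have "\<exists>\<Gamma>>0. \<forall>\<mu> \<nu> \<xi> t0 T0 Z. \<mu> > 0 \<and> \<nu> > 0 \<and> \<xi> > 0 \<longrightarrow> (\<exists>T. Q m \<alpha> c0 C0 \<Gamma> \<mu> \<nu> \<xi> t0 T0 Z T)"
      using core_lower_bound[OF n that, of m] unfolding Q_def .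
    from someI_ex[OF this] show ?thesis unfolding \<Gamma>_def .
  qed
  have T: "Q m \<alpha> c0 C0 (\<Gamma> m \<alpha> c0 C0) \<mu> \<nu> \<xi> t0 T0 Z (T m \<alpha> \<mu> \<nu> \<xi> c0 C0 t0 T0 Z)"
    if "\<alpha> > 0" "c0 > 0" "C0 > 0" "\<mu> > 0" "\<nu> > 0" "\<xi> > 0" for m \<alpha> c0 C0 \<mu> \<nu> \<xi> t0 T0 Z
    unfolding T_def by (rule someI_ex) (use \<Gamma>[OF that(1-3)] that(4-6) in blast)
  show ?thesis
  proof (rule exI[of _ \<Gamma>], rule exI[of _ T], intro allI impI conjI; elim conjE)
    show "\<Gamma> m \<alpha> c0 C0 > 0" if "\<alpha> > 0" "c0 > 0" "C0 > 0" for m \<alpha> c0 C0 using \<Gamma>[OF that] by blast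
    fix m \<alpha> c0 C0 \<mu> \<nu> \<xi> t0 T0 Z and u :: "real^'n \<Rightarrow> real \<Rightarrow> real^'n" and \<beta> t
    assume p: "\<alpha> > 0" "c0 > 0" "C0 > 0" "\<mu> > 0" "\<nu> > 0" "\<xi> > 0" and t0: "t0 \<ge> 0" "T0 \<ge> 0"
      and u2: "\<forall>t\<ge>0. L2 (\<lambda>x. u x t)" and d: "damped \<mu> \<nu> \<xi> Z (\<lambda>s b. bv (\<lambda>x. u x s $ b)) \<beta>"
      and up: "\<forall>t > T0. L2norm (\<lambda>x. u x t) \<le> C0 * Z * t powr (-\<alpha>)"
      and lo: "\<forall>t > t0. L2norm (\<lambda>x. u x t) \<ge> c0 * Z * t powr (-\<alpha>)"
      and t: "t > T m \<alpha> \<mu> \<nu> \<xi> c0 C0 t0 T0 Z"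
    have nr: "nrm (\<lambda>b. bv (\<lambda>x. u x s $ b)) = L2norm (\<lambda>x. u x s)" if "s \<ge> 0" for s
      using L2norm_components[of "\<lambda>x. u x s"] u2 that by (simp add: nrm_def)
    have up': "\<forall>t>T0. nrm (\<lambda>b. bv (\<lambda>x. u x t $ b)) \<le> C0 * Z * t powr (- \<alpha>)" using up t0 nr by simp
    have lo': "\<forall>t>t0. c0 * Z * t powr (- \<alpha>) \<le> nrm (\<lambda>b. bv (\<lambda>x. u x t $ b))" using lo t0 nr by simp
    note main = T[OF p, of m t0 T0 Z, unfolded Q_def, THEN conjunct2, rule_format, OF conjI[OF d conjI[OF up' lo']] t]
    show "ereal (\<Gamma> m \<alpha> c0 C0 * c0 * \<mu> powr (- real m / 2) * Z * t powr (-\<alpha> - real m / 2)) \<le> Dm_norm m (\<lambda>x. u x t)"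
    proof (rule Dm_norm_lower_bound)
      fix D :: real
      assume D: "D \<ge> 0" "\<And>b js \<theta>. length js = m \<Longrightarrow> test_fun \<theta> \<Longrightarrow> \<bar>\<integral>x. bv (\<lambda>x. u x t $ b) x * pd js \<theta> x \<partial>lborel\<bar> \<le> D * n2 \<theta>"
      show "\<Gamma> m \<alpha> c0 C0 * c0 * \<mu> powr (- real m / 2) * Z * t powr (-\<alpha> - real m / 2) \<le> D"
        by (rule main[OF D(1)]) (use D(2) in blast)
    qed
  qed
qed

text \<open>Both halves instantiate \<open>uniform_lower_bound\<close> with Z the norm of the data;
  what is particular to a dimension is confined to the proof that a Leray solution gives a damped
  system.\<close>

theorem theoremC:
  shows
  "(\<exists>(\<Gamma> :: nat \<Rightarrow> real \<Rightarrow> real \<Rightarrow> real \<Rightarrow> real)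
      (T :: nat \<Rightarrow> real \<Rightarrow> real \<Rightarrow> real \<Rightarrow> real \<Rightarrow> real \<Rightarrow> real \<Rightarrow> real \<Rightarrow> real \<Rightarrow> real \<Rightarrow> real).
     \<forall>m \<alpha> c0 C0. m \<ge> 1 \<and> \<alpha> > 0 \<and> c0 > 0 \<and> C0 > 0 \<longrightarrow>
       \<Gamma> m \<alpha> c0 C0 > 0 \<and>
       (\<forall>\<mu> \<nu> chi t0 T0 (u0 :: real^2 \<Rightarrow> real^2) (w0 :: real^2 \<Rightarrow> real)
           (u :: real^2 \<Rightarrow> real \<Rightarrow> real^2) (w :: real^2 \<Rightarrow> real \<Rightarrow> real).
          \<mu> > 0 \<and> \<nu> > 0 \<and> chi > 0 \<and> t0 \<ge> 0 \<and> T0 \<ge> 0 \<and>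
          leray2 \<mu> \<nu> chi u0 w0 u w \<and>
          (\<forall>t > T0. L2norm (\<lambda>x. u x t) \<le> C0 * znorm u0 w0 * t powr (-\<alpha>)) \<and>
          (\<forall>t > t0. L2norm (\<lambda>x. u x t) \<ge> c0 * znorm u0 w0 * t powr (-\<alpha>))
          \<longrightarrow> (\<forall>t > T m \<alpha> \<mu> \<nu> chi c0 C0 t0 T0 (znorm u0 w0).
                 ereal (\<Gamma> m \<alpha> c0 C0 * c0 * \<mu> powr (- real m / 2) * znorm u0 w0
                        * t powr (-\<alpha> - real m / 2))
                 \<le> Dm_norm m (\<lambda>x. u x t))))
   \<and>
   (\<exists>(\<Gamma> :: nat \<Rightarrow> real \<Rightarrow> real \<Rightarrow> real \<Rightarrow> real)
      (T :: nat \<Rightarrow> real \<Rightarrow> real \<Rightarrow> real \<Rightarrow> real \<Rightarrow> real \<Rightarrow> real \<Rightarrow> real \<Rightarrow> real \<Rightarrow> real \<Rightarrow> real).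
     \<forall>m \<alpha> c0 C0. m \<ge> 1 \<and> \<alpha> > 0 \<and> c0 > 0 \<and> C0 > 0 \<longrightarrow>
       \<Gamma> m \<alpha> c0 C0 > 0 \<and>
       (\<forall>\<mu> \<nu> chi \<kappa> t0 T0 (u0 :: real^3 \<Rightarrow> real^3) (w0 :: real^3 \<Rightarrow> real^3)
           (u :: real^3 \<Rightarrow> real \<Rightarrow> real^3) (w :: real^3 \<Rightarrow> real \<Rightarrow> real^3).
          \<mu> > 0 \<and> \<nu> > 0 \<and> chi > 0 \<and> \<kappa> \<ge> 0 \<and> t0 \<ge> 0 \<and> T0 \<ge> 0 \<and>
          leray3 \<mu> \<nu> chi \<kappa> u0 w0 u w \<and>
          (\<forall>t > T0. L2norm (\<lambda>x. u x t) \<le> C0 * znorm u0 w0 * t powr (-\<alpha>)) \<and>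
          (\<forall>t > t0. L2norm (\<lambda>x. u x t) \<ge> c0 * znorm u0 w0 * t powr (-\<alpha>))
          \<longrightarrow> (\<forall>t > T m \<alpha> \<mu> \<nu> chi c0 C0 t0 T0 (znorm u0 w0).
                 ereal (\<Gamma> m \<alpha> c0 C0 * c0 * \<mu> powr (- real m / 2) * znorm u0 w0
                        * t powr (-\<alpha> - real m / 2))
                 \<le> Dm_norm m (\<lambda>x. u x t))))"
proof (rule conjI, goal_cases)
  case 1
  have "CARD(2) \<ge> 2"
    by simp
  from uniform_lower_bound[OF this] show ?case
  proof (elim ex_forward, goal_cases)
    case (1 \<Gamma> T)
    note bound = 1[rule_format]
    show ?case
    proof (intro allI impI, rule conjI, goal_cases)
      case (1 m \<alpha> c0 C0)
      then have p: "\<alpha> > 0 \<and> c0 > 0 \<and> C0 > 0"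
        by (elim conjE) (intro conjI)
      show ?case
        using bound[OF p] by (rule conjunct1)
    next
      case (2 m \<alpha> c0 C0)
      then have p: "\<alpha> > 0 \<and> c0 > 0 \<and> C0 > 0"
        by (elim conjE) (intro conjI)
      show ?case
      proof (intro allI impI, elim conjE, goal_cases)
        case (1 \<mu> \<nu> chi t0 T0 u0 w0 u w t)
        note l = 1(7) and pos = 1(2,3)
        have "\<forall>t\<ge>0. L2 (\<lambda>x. u x t)"
          using l by (simp add: leray2_def sol_data_def)
        note this leray2_damped[OF l pos]
        with 1 show ?case
          by (intro bound[OF p, THEN conjunct2, rule_format, of \<mu> \<nu> chi t0 T0 u "znorm u0 w0"]) (intro conjI, assumption+)
      qed
    qed
  qed
next
  case 2
  have "CARD(3) \<ge> 2"
    by simp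
  from uniform_lower_bound[OF this] show ?case
  proof (elim ex_forward, goal_cases)
    case (1 \<Gamma> T)
    note bound = 1[rule_format]
    show ?case
    proof (intro allI impI, rule conjI, goal_cases)
      case (1 m \<alpha> c0 C0)
      then have p: "\<alpha> > 0 \<and> c0 > 0 \<and> C0 > 0"
        by (elim conjE) (intro conjI)
      show ?case
        using bound[OF p] by (rule conjunct1)
    next
      case (2 m \<alpha> c0 C0)
      then have p: "\<alpha> > 0 \<and> c0 > 0 \<and> C0 > 0"
        by (elim conjE) (intro conjI)
      show ?case
      proof (intro allI impI, elim conjE, goal_cases)
        case (1 \<mu> \<nu> chi \<kappa> t0 T0 u0 w0 u w t)
        note l = 1(8) and pos = 1(2,3)
        have "\<forall>t\<ge>0. L2 (\<lambda>x. u x t)"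
          using l by (simp add: leray3_def sol_data_def)
        note this leray3_damped[OF l pos]
        with 1 show ?case
          by (intro bound[OF p, THEN conjunct2, rule_format, of \<mu> \<nu> chi t0 T0 u "znorm u0 w0"]) (intro conjI, assumption+)
      qed
    qed
  qed
qed

end
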